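(* Let $D\subset\mathbb{R}^3$ be a bounded domain with $C^2$ boundary, $k>0$, $n\in L^\infty(D)$ with $\mathrm{Re}\,n>0$, $\mathrm{Im}\,n\ge0$, and $\lambda=1$. Let $z\in\mathbb{R}^3\setminus\overline D$, $\vec a\in\mathbb{R}^3$ fixed, and let $(u,v)$ be the solution of the acoustic transmission scattering problem corresponding to the incident field $u^i(x)=\nabla_x\Phi(x,z)\cdot\vec a$, where $\Phi(x,z)=\frac{e^{ik|x-z|}}{4\pi|x-z|}$. Then for every $p$ with $6/5\le p<2$ one has $v\in L^p(D)$, $v-u^i\in H^1(D)$, and $$\|v\|_{L^p(D)}+\|v-u^i\|_{H^1(D)}\le C\,\|\nabla_x\Phi(\cdot,z)\cdot\vec a\|_{L^p(D)},$$ where $C>0$ depends on $p,D,n,k$ but not on $z$.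
   Context: Acoustic transmission scattering problem with $\lambda=1$: find $u=u^i+u^s$ in $\mathbb{R}^3\setminus\overline D$ and $v$ in $D$ with $\Delta u+k^2u=0$ in $\mathbb{R}^3\setminus(\overline D\cup\{z\})$, $\Delta v+k^2nv=0$ in $D$, $u=v$ and $\partial u/\partial\nu=\partial v/\partial\nu$ on $\partial D$, and $u^s$ satisfying the Sommerfeld radiation condition. This problem is assumed uniquely solvable. *)

theory Defs
  imports "HOL-Analysis.Analysis"
begin

type_synonym R3 = "real ^ 3"

fun Ck_on :: "nat \<Rightarrow> 'a::real_normed_vector set \<Rightarrow> ('a \<Rightarrow> 'b::real_normed_vector) \<Rightarrow> bool" where
  "Ck_on 0 S f = continuous_on S f"
| "Ck_on (Suc k) S f =
     (\<exists>f'. (\<forall>x\<in>S. (f has_derivative f' x) (at x)) \<and> (\<forall>v. Ck_on k S (\<lambda>x. f' x v)))"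

definition smooth_on :: "'a::real_normed_vector set \<Rightarrow> ('a \<Rightarrow> 'b::real_normed_vector) \<Rightarrow> bool" where
  "smooth_on S f \<longleftrightarrow> (\<forall>k. Ck_on k S f)"

definition pderiv3 :: "3 \<Rightarrow> (R3 \<Rightarrow> 'b::real_normed_vector) \<Rightarrow> R3 \<Rightarrow> 'b" where
  "pderiv3 i f x = frechet_derivative f (at x) (axis i 1)"

definition laplacian3 :: "(R3 \<Rightarrow> complex) \<Rightarrow> R3 \<Rightarrow> complex" where
  "laplacian3 f x = (\<Sum>i\<in>UNIV. pderiv3 i (pderiv3 i f) x)"

definition C2_boundary :: "R3 set \<Rightarrow> bool" where
  "C2_boundary D \<longleftrightarrow>
     (\<forall>x0\<in>frontier D. \<exists>r>0. \<exists>R h.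
        orthogonal_transformation (R :: R3 \<Rightarrow> R3) \<and> Ck_on 2 (UNIV :: (real^2) set) (h :: real^2 \<Rightarrow> real) \<and>
        D \<inter> ball x0 r =
          {x \<in> ball x0 r. (R (x - x0)) $ 3 < h (vector [(R (x - x0)) $ 1, (R (x - x0)) $ 2])})"

definition bounded_C2_domain :: "R3 set \<Rightarrow> bool" where
  "bounded_C2_domain D \<longleftrightarrow> open D \<and> connected D \<and> D \<noteq> {} \<and> bounded D \<and> C2_boundary D"

definition Lp_on :: "real \<Rightarrow> R3 set \<Rightarrow> (R3 \<Rightarrow> complex) \<Rightarrow> bool" where
  "Lp_on p D f \<longleftrightarrow> f \<in> borel_measurable (lebesgue_on D) \<and>
                    integrable (lebesgue_on D) (\<lambda>x. norm (f x) powr p)"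

definition Lp_norm :: "real \<Rightarrow> R3 set \<Rightarrow> (R3 \<Rightarrow> complex) \<Rightarrow> real" where
  "Lp_norm p D f = (\<integral>x. norm (f x) powr p \<partial>(lebesgue_on D)) powr (1 / p)"

definition Linfty_on :: "R3 set \<Rightarrow> (R3 \<Rightarrow> complex) \<Rightarrow> bool" where
  "Linfty_on D f \<longleftrightarrow> f \<in> borel_measurable (lebesgue_on D) \<and>
                     (\<exists>M. AE x in lebesgue_on D. norm (f x) \<le> M)"

definition test_fun :: "R3 set \<Rightarrow> (R3 \<Rightarrow> real) \<Rightarrow> bool" where
  "test_fun \<Omega> \<phi> \<longleftrightarrow> smooth_on UNIV \<phi> \<and> compact (closure {x. \<phi> x \<noteq> 0}) \<and>
                       closure {x. \<phi> x \<noteq> 0} \<subseteq> \<Omega>"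

definition loc_integrable :: "R3 set \<Rightarrow> (R3 \<Rightarrow> complex) \<Rightarrow> bool" where
  "loc_integrable \<Omega> f \<longleftrightarrow> (\<forall>K. compact K \<and> K \<subseteq> \<Omega> \<longrightarrow> set_integrable lebesgue K f)"

definition weak_grad :: "R3 set \<Rightarrow> (R3 \<Rightarrow> complex) \<Rightarrow> (3 \<Rightarrow> R3 \<Rightarrow> complex) \<Rightarrow> bool" where
  "weak_grad \<Omega> f g \<longleftrightarrow> loc_integrable \<Omega> f \<and> (\<forall>i. loc_integrable \<Omega> (g i)) \<and>
     (\<forall>i \<phi>. test_fun \<Omega> \<phi> \<longrightarrow>
        (LINT x:\<Omega>|lebesgue. f x * of_real (pderiv3 i \<phi> x)) =
        - (LINT x:\<Omega>|lebesgue. g i x * of_real (\<phi> x)))"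

definition H1_on :: "R3 set \<Rightarrow> (R3 \<Rightarrow> complex) \<Rightarrow> bool" where
  "H1_on D f \<longleftrightarrow> Lp_on 2 D f \<and> (\<exists>g. weak_grad D f g \<and> (\<forall>i. Lp_on 2 D (g i)))"

definition H1_norm :: "R3 set \<Rightarrow> (R3 \<Rightarrow> complex) \<Rightarrow> real" where
  "H1_norm D f =
     (let g = (SOME g. weak_grad D f g \<and> (\<forall>i. Lp_on 2 D (g i)))
      in sqrt ((Lp_norm 2 D f)\<^sup>2 + (\<Sum>i\<in>UNIV. (Lp_norm 2 D (g i))\<^sup>2)))"

definition H1loc_grad :: "R3 set \<Rightarrow> (R3 \<Rightarrow> complex) \<Rightarrow> (3 \<Rightarrow> R3 \<Rightarrow> complex) \<Rightarrow> bool" where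
  "H1loc_grad \<Omega> f g \<longleftrightarrow> weak_grad \<Omega> f g \<and>
     (\<forall>K. compact K \<and> K \<subseteq> \<Omega> \<longrightarrow> Lp_on 2 K f \<and> (\<forall>i. Lp_on 2 K (g i)))"

definition Phi :: "real \<Rightarrow> R3 \<Rightarrow> R3 \<Rightarrow> complex" where
  "Phi k x z = exp (\<i> * of_real k * of_real (dist x z)) / of_real (4 * pi * dist x z)"

definition dipole_inc :: "real \<Rightarrow> R3 \<Rightarrow> R3 \<Rightarrow> R3 \<Rightarrow> complex" where
  "dipole_inc k z a x = frechet_derivative (\<lambda>y. Phi k y z) (at x) a"

definition radiating :: "real \<Rightarrow> (R3 \<Rightarrow> complex) \<Rightarrow> bool" where
  "radiating k us \<longleftrightarrow>
     ((\<lambda>x. of_real (norm x) *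
            (frechet_derivative us (at x) (x /\<^sub>R norm x) - \<i> * of_real k * us x))
        \<longlongrightarrow> 0) at_infinity"

text \<open>(u^s, v) solves the transmission problem with incident field ui, singular at z.
  The total field is u = ui + us outside closure D. The transmission conditions
  u = v, du/dnu = dv/dnu on the boundary are imposed in the standard weak sense:
  the glued field U (= v in D, = u outside closure D) lies in H^1_loc(R^3 - {z}) and
  satisfies div grad U + k^2 n~ U = 0 weakly in R^3 - {z}, where n~ = n in D, 1 outside.\<close>
definition transmission_solution ::
  "R3 set \<Rightarrow> (R3 \<Rightarrow> complex) \<Rightarrow> real \<Rightarrow> R3 \<Rightarrow> (R3 \<Rightarrow> complex) \<Rightarrow>
   (R3 \<Rightarrow> complex) \<Rightarrow> (R3 \<Rightarrow> complex) \<Rightarrow> bool" where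
  "transmission_solution D n k z ui us v \<longleftrightarrow>
     Ck_on 2 (- closure D) us \<and>
     (\<forall>x \<in> - closure D. laplacian3 us x + (of_real k)\<^sup>2 * us x = 0) \<and>
     radiating k us \<and>
     (let U = (\<lambda>x. if x \<in> D then v x else ui x + us x);
          nt = (\<lambda>x. if x \<in> D then n x else 1)
      in \<exists>g. H1loc_grad (- {z}) U g \<and>
             (\<forall>\<phi>. test_fun (- {z}) \<phi> \<longrightarrow>
                (LINT x|lebesgue. (\<Sum>i\<in>UNIV. g i x * of_real (pderiv3 i \<phi> x))
                                  - (of_real k)\<^sup>2 * nt x * U x * of_real (\<phi> x)) = 0))"

end

theory Submission
  imports Defs "HOL-Complex_Analysis.Great_Picard"
begin

text \<open>
  With \<open>w = v - u\<^sup>i\<close> in \<open>D\<close> and \<open>w = u\<^sup>s\<close> outside, the transmission problem amounts to the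
  Lippmann--Schwinger equation \<open>w = k\<^sup>2 \<integral>\<^sub>D \<Phi>(\<cdot>, y) (n - 1) (u\<^sup>i + w) dy\<close>. Only one direction is
  needed, namely that solutions of the integral equation solve the transmission problem: the
  assumed uniqueness then makes the integral operator injective, hence, by compactness, boundedly
  invertible, so a solution exists, and uniqueness once more identifies it with the given one. This
  avoids Green's representation, Rellich's lemma and any regularity of the boundary.

  To bound the solution, split \<open>w = w\<^sub>1 + w\<^sub>2\<close> with \<open>w\<^sub>1\<close> the potential of \<open>u\<^sup>i\<close>. The kernel
  \<open>|x - y|\<^sup>-\<^sup>1\<close> is square integrable, so the potential of \<open>w\<^sub>1\<close>, and with it \<open>w\<^sub>2\<close>, is bounded by the
  \<open>L\<^sup>2\<close> norm of \<open>w\<^sub>1\<close>. At the endpoint \<open>p = 6/5\<close> the gradient estimate would require the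
  Hardy--Littlewood--Sobolev inequality; it is bypassed by a reverse Hoelder inequality for dipole
  fields, \<open>|u\<^sup>i(y)| \<le> C \<parallel>u\<^sup>i\<parallel>\<^sub>p (1 + |y - z|\<^sup>-\<^sup>2)\<close> on \<open>D\<close> uniformly in \<open>z\<close>, whose right-hand side lies
  in \<open>L\<^sup>q(D)\<close> for all \<open>q < 3/2\<close>.
\<close>

text \<open>The hypothesis \<open>unique\<close> speaks only of dipole incident fields, but the zero
  moment a = 0 is among them, so it contains uniqueness for the homogeneous problem. The obstacle is
  uniformity in z: the potential of |y - z|^-2 has a logarithmic singularity at z, so the dipole
  weight yields no sup bound for w1, while compactness is obtained in the sup norm, through
  Arzela-Ascoli. Hence the operator is inverted only for w2, whose right-hand side is the potential
  of w1. The L^2 bounds are Young's inequality with exponents 4/3, 4/3 and 2: one has 3/4 + 3/4 = 1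
  + 1/2, and |x|^(-8/3) is locally integrable in dimension three. The fundamental solution is
  reached through the regularised radius sqrt(|x|^2 + eps^2), which turns surface integrals over
  small spheres into one scaling argument. Finally, \<open>H1_norm\<close> selects a weak gradient
  by Hilbert choice; its value can be estimated only once weak gradients are known to be unique,
  hence the bump functions and the du Bois-Reymond lemma.\<close>

section \<open>Riesz theory for compact perturbations of the identity\<close>

definition sequentially_compact_op :: "('a::real_normed_vector \<Rightarrow> 'b::real_normed_vector) \<Rightarrow> bool" where
  "sequentially_compact_op K \<longleftrightarrow>
     (\<forall>X :: nat \<Rightarrow> 'a. bounded (range X) \<longrightarrow> (\<exists>r l. strict_mono r \<and> (\<lambda>n. K (X (r n))) \<longlonglongrightarrow> l))"

text \<open>Otherwise there are unit vectors y with y - K y tending to 0. Compactness lets K y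
  converge along a subsequence, hence y as well, and the limit is a fixed point of norm 1.\<close>

lemma compact_perturbation_bounded_below:
  fixes K :: "'a::real_normed_vector \<Rightarrow> 'a"
  assumes K: "bounded_linear K" and cpt: "sequentially_compact_op K"
    and inj: "\<And>x. x = K x \<Longrightarrow> x = 0"
  shows "\<exists>c>0. \<forall>x. c * norm x \<le> norm (x - K x)"
proof (rule ccontr)
  interpret bounded_linear K by (rule K)
  assume neg: "\<not> ?thesis"
  have "\<exists>y. norm y = 1 \<and> norm (y - K y) < inverse (real (Suc n))" for n
  proof -
    have "0 < inverse (real (Suc n))" by simp
    with neg obtain x where x: "norm (x - K x) < inverse (real (Suc n)) * norm x"
      by (meson not_le)
    then have nz: "norm x > 0" by (metis mult_zero_right norm_ge_zero norm_zero not_le zero_less_norm_iff)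
    define y where "y = x /\<^sub>R norm x"
    have "y - K y = (x - K x) /\<^sub>R norm x" by (simp add: y_def scaleR algebra_simps)
    then have "norm (y - K y) = norm (x - K x) / norm x" by (simp add: divide_inverse mult.commute)
    with x nz have "norm (y - K y) < inverse (real (Suc n))" by (simp add: pos_divide_less_eq)
    moreover have "norm y = 1" using nz by (simp add: y_def)
    ultimately show ?thesis by blast
  qed
  then obtain y where y1: "\<And>n. norm (y n) = 1" and y: "\<And>n. norm (y n - K (y n)) < inverse (real (Suc n))"
    by metis
  have "bounded (range y)" by (rule boundedI[of _ 1]) (auto simp: y1)
  then obtain r l where r: "strict_mono r" and l: "(\<lambda>n. K (y (r n))) \<longlonglongrightarrow> l"
    using cpt unfolding sequentially_compact_op_def by blast
  have "(\<lambda>n. y n - K (y n)) \<longlonglongrightarrow> 0"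
    by (rule Lim_null_comparison[OF _ LIMSEQ_inverse_real_of_nat]) (use y in \<open>auto intro: always_eventually less_imp_le\<close>)
  then have "(\<lambda>n. y (r n) - K (y (r n))) \<longlonglongrightarrow> 0"
    using LIMSEQ_subseq_LIMSEQ[OF _ r] by (force simp: o_def)
  from tendsto_add[OF this l] have yl: "(\<lambda>n. y (r n)) \<longlonglongrightarrow> l" by simp
  then have "(\<lambda>n. K (y (r n))) \<longlonglongrightarrow> K l" by (rule tendsto)
  with l have "l = K l" using LIMSEQ_unique by blast
  with inj have "l = 0" by blast
  moreover have "norm l = 1" using tendsto_norm[OF yl] y1 by (simp add: LIMSEQ_const_iff)
  ultimately show False by simp
qed

text \<open>Riesz's argument. With T = I - K injective, a vector b outside the range makes the
  ranges of the powers of T strictly decreasing, as \<open>(T ^^ n) b\<close> never lies in the next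
  one. Unit vectors almost orthogonal to the next range then have images under K that stay 1/2
  apart.\<close>

lemma compact_perturbation_surj:
  fixes K :: "'a::{real_normed_vector, complete_space} \<Rightarrow> 'a"
  assumes K: "bounded_linear K" and cpt: "sequentially_compact_op K"
    and inj: "\<And>x. x = K x \<Longrightarrow> x = 0"
  shows "\<exists>x. x - K x = b"
proof (rule ccontr)
  interpret K: bounded_linear K by (rule K)
  assume nob: "\<nexists>x. x - K x = b"
  define T where "T = (\<lambda>x. x - K x)"
  have T: "bounded_linear T" unfolding T_def
    by (intro bounded_linear_sub bounded_linear_ident K)
  interpret T: bounded_linear T by (rule T)
  obtain c where c: "c > 0" and cT: "\<And>x. c * norm x \<le> norm (T x)"
    using compact_perturbation_bounded_below[OF assms] unfolding T_def by blast
  have Tn: "bounded_linear (T ^^ n)" for n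
  proof (induction n)
    case 0 show ?case by (simp add: bounded_linear_ident id_def)
  next
    case (Suc n) show ?case using bounded_linear_compose[OF T Suc] by (simp add: o_def)
  qed
  have cTn: "c ^ n * norm x \<le> norm ((T ^^ n) x)" for n x
  proof (induction n)
    case (Suc n)
    have "c ^ Suc n * norm x = c * (c ^ n * norm x)" by simp
    also have "\<dots> \<le> c * norm ((T ^^ n) x)" using Suc c by simp
    also have "\<dots> \<le> norm ((T ^^ Suc n) x)" using cT by simp
    finally show ?case .
  qed simp
  define R where "R n = range (T ^^ n)" for n
  \<comment> \<open>The power of T is bounded below by c^n, so a Cauchy sequence of images comes
    from a Cauchy sequence of preimages.\<close>
  have closedR: "closed (R n)" for n
  proof -
    have "complete (range (T ^^ n))"
    proof (rule completeI)
      fix f assume f: "\<forall>m. f m \<in> range (T ^^ n)" and "Cauchy f"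
      then have "\<forall>m. \<exists>x. f m = (T ^^ n) x" by blast
      then obtain x where x: "\<And>m. f m = (T ^^ n) (x m)" by (auto dest: choice)
      have "Cauchy x"
      proof (rule metric_CauchyI)
        fix e :: real assume "e > 0"
        then have "e * c ^ n > 0" using c by simp
        then obtain M where M: "\<And>i j. i \<ge> M \<Longrightarrow> j \<ge> M \<Longrightarrow> dist (f i) (f j) < e * c ^ n"
          using \<open>Cauchy f\<close> unfolding Cauchy_def by blast
        have "dist (x i) (x j) < e" if "i \<ge> M" "j \<ge> M" for i j
        proof -
          interpret Tn: bounded_linear "T ^^ n" by (rule Tn)
          have "c ^ n * norm (x i - x j) \<le> dist (f i) (f j)"
            using cTn[of n "x i - x j"] by (simp add: x dist_norm Tn.diff)
          also have "\<dots> < e * c ^ n" using M that by blast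
          finally show ?thesis using c by (simp add: dist_norm mult.commute)
        qed
        then show "\<exists>M. \<forall>i\<ge>M. \<forall>j\<ge>M. dist (x i) (x j) < e" by blast
      qed
      then obtain l where "x \<longlonglongrightarrow> l" using Cauchy_convergent convergentD by blast
      then have "(\<lambda>m. (T ^^ n) (x m)) \<longlonglongrightarrow> (T ^^ n) l" by (rule bounded_linear.tendsto[OF Tn])
      moreover have "f = (\<lambda>m. (T ^^ n) (x m))" using x by blast
      ultimately show "\<exists>l\<in>range (T ^^ n). f \<longlonglongrightarrow> l" by auto
    qed
    then show ?thesis unfolding R_def by (rule complete_imp_closed)
  qed
  have subR: "subspace (R n)" for n
    unfolding R_def using Tn[of n]
    by (metis bounded_linear.linear linear_subspace_image subspace_UNIV)
  have mono: "R m \<subseteq> R n" if "n \<le> m" for n m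
  proof -
    have "T ^^ m = (T ^^ n) \<circ> (T ^^ (m - n))" using that by (metis funpow_add le_add_diff_inverse)
    then show ?thesis unfolding R_def by (metis image_comp image_mono subset_UNIV)
  qed
  have TR: "T x \<in> R (Suc n)" if "x \<in> R n" for x n
    using that unfolding R_def by force
  have "\<exists>x\<in>R n. norm x = 1 \<and> (\<forall>y\<in>R (Suc n). norm (x - y) \<ge> 1/2)" for n
  proof -
    define u where "u = (T ^^ n) b"
    have uR: "u \<in> R n" unfolding u_def R_def by simp
    have "u \<notin> R (Suc n)"
    proof
      assume "u \<in> R (Suc n)"
      then obtain y where "u = (T ^^ n) (T y)" unfolding R_def by (auto simp: funpow_swap1)
      then have "(T ^^ n) (b - T y) = 0" unfolding u_def
        using bounded_linear.linear[OF Tn[of n]] linear_diff by fastforce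
      then have "c ^ n * norm (b - T y) \<le> 0" using cTn[of n "b - T y"] by simp
      then have "b - T y = 0" using c by (simp add: mult_le_0_iff power_le_zero_eq not_le)
      then show False using nob unfolding T_def by (metis right_minus_eq)
    qed
    moreover have ne: "R (Suc n) \<noteq> {}" unfolding R_def by simp
    ultimately have d: "infdist u (R (Suc n)) > 0"
      using in_closed_iff_infdist_zero[OF closedR ne] infdist_nonneg[of u "R (Suc n)"] by force
    \<comment> \<open>Riesz's lemma with factor 2: normalising u - y0 divides distances to the next
      range by less than twice the infimal distance, which leaves at least 1/2.\<close>
    then obtain y0 where y0: "y0 \<in> R (Suc n)" "dist u y0 < 2 * infdist u (R (Suc n))"
      using infdist_notempty[OF ne] cINF_less_iff[of "R (Suc n)" "dist u"] ne
      by (smt (verit) bdd_below_image_dist)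
    have un: "norm (u - y0) > 0"
      using d infdist_le[OF y0(1), of u] unfolding dist_norm by linarith
    define x where "x = (u - y0) /\<^sub>R norm (u - y0)"
    have "x \<in> R n" unfolding x_def
      using uR y0(1) mono[of n "Suc n"] subR by (auto intro!: subspace_scale subspace_diff)
    moreover have "norm x = 1" using un by (simp add: x_def)
    moreover have "norm (x - y) \<ge> 1/2" if y: "y \<in> R (Suc n)" for y
    proof -
      have "y0 + norm (u - y0) *\<^sub>R y \<in> R (Suc n)"
        using y y0(1) subR by (auto intro!: subspace_add subspace_scale)
      then have "infdist u (R (Suc n)) \<le> norm (u - (y0 + norm (u - y0) *\<^sub>R y))"
        using infdist_le by (metis dist_norm)
      moreover have "u - (y0 + norm (u - y0) *\<^sub>R y) = norm (u - y0) *\<^sub>R (x - y)"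
        using un by (simp add: x_def scaleR_diff_right)
      ultimately have "infdist u (R (Suc n)) \<le> norm (u - y0) * norm (x - y)" by simp
      moreover have "norm (u - y0) < 2 * infdist u (R (Suc n))" using y0 by (simp add: dist_norm)
      ultimately have "norm (u - y0) * 1 < norm (u - y0) * (2 * norm (x - y))" by (simp add: algebra_simps)
      then show ?thesis using un by (simp only: mult_less_cancel_left_pos)
    qed
    ultimately show ?thesis by blast
  qed
  then obtain x where xR: "\<And>n. x n \<in> R n" and x1: "\<And>n. norm (x n) = 1"
    and xd: "\<And>n y. y \<in> R (Suc n) \<Longrightarrow> norm (x n - y) \<ge> 1/2" by metis
  have sep: "norm (K (x n) - K (x m)) \<ge> 1/2" if "n < m" for n m
  proof -
    \<comment> \<open>Since K = I - T, the difference K (x n) - K (x m) equals x n minus this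
      vector, so the separation property of x n applies.\<close>
    have "T (x n) + x m - T (x m) \<in> R (Suc n)"
    proof (intro subspace_diff subspace_add subR)
      show "T (x n) \<in> R (Suc n)" by (rule TR[OF xR])
      show "x m \<in> R (Suc n)" using xR mono[of "Suc n" m] that by (meson Suc_leI subsetD)
      show "T (x m) \<in> R (Suc n)" using TR[OF xR] mono[of "Suc n" "Suc m"] that by (meson Suc_le_mono less_imp_le subsetD)
    qed
    from xd[OF this] show ?thesis by (simp add: T_def algebra_simps)
  qed
  have "bounded (range x)" by (rule boundedI[of _ 1]) (auto simp: x1)
  then obtain r l where r: "strict_mono r" and l: "(\<lambda>n. K (x (r n))) \<longlonglongrightarrow> l"
    using cpt unfolding sequentially_compact_op_def by blast
  from LIMSEQ_imp_Cauchy[OF l] obtain M where "\<And>i j. i \<ge> M \<Longrightarrow> j \<ge> M \<Longrightarrow> dist (K (x (r i))) (K (x (r j))) < 1/2"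
    unfolding Cauchy_def by (metis half_gt_zero_iff zero_less_one)
  then have "dist (K (x (r M))) (K (x (r (Suc M)))) < 1/2" by simp
  moreover have "r M < r (Suc M)" using r by (simp add: strict_mono_Suc_iff)
  ultimately show False using sep[of "r M" "r (Suc M)"] by (simp add: dist_norm)
qed

section \<open>Integrals of weakly singular kernels\<close>

lemma nn_integral_lborel_affine:
  fixes f :: "'a::euclidean_space \<Rightarrow> ennreal" and c :: real
  assumes [measurable]: "f \<in> borel_measurable borel" and c: "c \<noteq> 0"
  shows "(\<integral>\<^sup>+x. f x \<partial>lborel) = ennreal (\<bar>c\<bar> ^ DIM('a)) * (\<integral>\<^sup>+x. f (t + c *\<^sub>R x) \<partial>lborel)"
  by (subst lborel_affine[OF c, of t])
     (simp add: nn_integral_density nn_integral_distr nn_integral_cmult)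

lemma integrable_lborel_affine:
  fixes f :: "'a::euclidean_space \<Rightarrow> 'b::{banach, second_countable_topology}"
  assumes f: "integrable lborel f" and c: "c \<noteq> 0"
  shows "integrable lborel (\<lambda>x. f (t + c *\<^sub>R x))"
proof -
  have [measurable]: "f \<in> borel_measurable borel" using f[THEN borel_measurable_integrable] by simp
  have "(\<integral>\<^sup>+x. norm (f x) \<partial>lborel) < \<infinity>" using f by (simp add: integrable_iff_bounded)
  then have "ennreal (\<bar>c\<bar> ^ DIM('a)) * (\<integral>\<^sup>+x. norm (f (t + c *\<^sub>R x)) \<partial>lborel) < \<infinity>"
    by (subst (asm) nn_integral_lborel_affine[where c=c and t=t]) (use c in auto)
  then have "(\<integral>\<^sup>+x. norm (f (t + c *\<^sub>R x)) \<partial>lborel) < \<infinity>"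
    using c by (auto simp: ennreal_mult_less_top)
  then show ?thesis by (intro integrableI_bounded) auto
qed

lemma integral_lborel_affine:
  fixes f :: "'a::euclidean_space \<Rightarrow> 'b::{banach, second_countable_topology}"
  assumes c: "c \<noteq> 0"
  shows "(\<integral>x. f x \<partial>lborel) = (\<bar>c\<bar> ^ DIM('a)) *\<^sub>R (\<integral>x. f (t + c *\<^sub>R x) \<partial>lborel)"
proof cases
  assume f[measurable]: "integrable lborel f"
  have [measurable]: "f \<in> borel_measurable borel" using f[THEN borel_measurable_integrable] by simp
  have fc: "integrable lborel (\<lambda>x. f (t + c *\<^sub>R x))" by (rule integrable_lborel_affine[OF f c])
  show ?thesis
    by (subst lborel_affine[OF c, of t])
       (use fc in \<open>simp add: integral_density integral_distr\<close>)
next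
  \<comment> \<open>Integrability of the two integrands is equivalent, so here both integrals take
    the default value 0.\<close>
  assume nf: "\<not> integrable lborel f"
  moreover have "\<not> integrable lborel (\<lambda>x. f (t + c *\<^sub>R x))"
  proof
    assume "integrable lborel (\<lambda>x. f (t + c *\<^sub>R x))"
    from integrable_lborel_affine[OF this, of "1/c" "- (1/c) *\<^sub>R t"] nf c
    show False by (simp add: algebra_simps)
  qed
  ultimately show ?thesis by (simp add: not_integrable_integral_eq)
qed

lemma nn_integral_lborel_reflect:
  fixes f :: "'a::euclidean_space \<Rightarrow> ennreal"
  assumes [measurable]: "f \<in> borel_measurable borel"
  shows "(\<integral>\<^sup>+y. f (x - y) \<partial>lborel) = (\<integral>\<^sup>+y. f y \<partial>lborel)"
  using nn_integral_lborel_affine[of f "-1" x] by simp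

text \<open>A substitute for polar coordinates: h is dominated off the origin by the sum of a_j
  times the indicator of the ball of radius r_j, whose integral is a multiple of the sum of a_j
  r_j^3. It serves both for singularities at 0 and for decay at infinity.\<close>

lemma nn_integral_dyadic_le:
  fixes h :: "R3 \<Rightarrow> ennreal" and a r :: "nat \<Rightarrow> real"
  assumes a: "\<And>j. a j \<ge> 0" and r: "\<And>j. r j \<ge> 0"
    and s: "summable (\<lambda>j. a j * r j ^ 3)"
    and dom: "\<And>x. h x \<noteq> 0 \<Longrightarrow> x \<noteq> 0 \<Longrightarrow> \<exists>j. h x \<le> ennreal (a j) \<and> norm x < r j"
  shows "(\<integral>\<^sup>+x. h x \<partial>lborel) < \<infinity>"
proof -
  have "(\<integral>\<^sup>+x. h x \<partial>lborel) \<le> (\<integral>\<^sup>+x. (\<Sum>j. ennreal (a j) * indicator (ball 0 (r j)) (x::R3)) \<partial>lborel)"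
  proof (rule nn_integral_mono_AE)
    have "AE x in lborel. x \<noteq> (0::R3)" using AE_lborel_singleton by blast
    then show "AE x in lborel. h x \<le> (\<Sum>j. ennreal (a j) * indicator (ball 0 (r j)) x)"
    proof eventually_elim
      case (elim x)
      show ?case
      proof (cases "h x = 0")
        case False
        from dom[OF this elim] obtain j where j: "h x \<le> ennreal (a j)" "norm x < r j" by blast
        define F where "F i = ennreal (a i) * indicator (ball 0 (r i)) x" for i
        have "h x \<le> F j" using j by (simp add: F_def)
        also have "\<dots> = sum F {j}" by simp
        also have "\<dots> \<le> (\<Sum>i. F i)" by (rule sum_le_suminf) auto
        also have "\<dots> = (\<Sum>j. ennreal (a j) * indicator (ball 0 (r j)) x)" by (simp only: F_def)
        finally show ?thesis .
      qed simp
    qed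
  qed
  also have "\<dots> = (\<Sum>j. ennreal (a j) * emeasure lborel (ball (0::R3) (r j)))"
  proof -
    have [measurable]: "(\<lambda>x::R3. ennreal (a j) * indicator (ball 0 (r j)) x) \<in> borel_measurable lborel" for j
      by (intro borel_measurable_times_ennreal borel_measurable_indicator) auto
    have "(\<integral>\<^sup>+x. ennreal (a j) * indicator (ball 0 (r j)) (x::R3) \<partial>lborel) = ennreal (a j) * emeasure lborel (ball (0::R3) (r j))" for j
      by (subst nn_integral_cmult_indicator) auto
    then show ?thesis by (subst nn_integral_suminf) auto
  qed
  also have "\<dots> = (\<Sum>j. ennreal (unit_ball_vol 3 * (a j * r j ^ 3)))"
    using r a by (intro suminf_cong) (simp add: emeasure_ball ennreal_mult'[symmetric] ac_simps power3_eq_cube)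
  also have "\<dots> < \<infinity>"
  proof -
    have "(\<Sum>j. ennreal (unit_ball_vol 3 * (a j * r j ^ 3))) \<noteq> top"
      by (rule ennreal_suminf_neq_top[OF summable_mult[OF s]]) (use a r in auto)
    then show ?thesis by (metis infinity_ennreal_def top.not_eq_extremum)
  qed
  finally show ?thesis .
qed

text \<open>On the shell 2^-(j+1) \<le> |x| < 2^-j the integrand is at most 2^(\<beta> (j+1)), while
  the ball volume is of order 2^(-3j); the series is geometric with ratio 2^(\<beta> - 3) <
  1.\<close>

lemma nn_integral_norm_powr_finite:
  assumes b: "0 \<le> \<beta>" "\<beta> < 3"
  shows "(\<integral>\<^sup>+x\<in>ball (0::R3) 1. ennreal (norm x powr - \<beta>) \<partial>lborel) < \<infinity>"
proof (rule nn_integral_dyadic_le)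
  define a where "a j = 2 powr (\<beta> * (real j + 1))" for j :: nat
  define r where "r j = (1/2::real) ^ j" for j :: nat
  show "a j \<ge> 0" "r j \<ge> 0" for j by (auto simp: a_def r_def)
  have "a j * r j ^ 3 = 2 powr \<beta> * (2 powr (\<beta> - 3)) ^ j" for j
  proof -
    have "(r j) ^ 3 = 2 powr (- 3 * real j)"
      by (simp add: r_def powr_minus power_divide powr_realpow[symmetric] powr_powr power_mult[symmetric] field_simps)
    then have "a j * r j ^ 3 = 2 powr (\<beta> * (real j + 1) + - 3 * real j)" by (simp only: a_def powr_add)
    also have "\<dots> = 2 powr (\<beta> + (\<beta> - 3) * real j)" by (simp add: algebra_simps)
    also have "\<dots> = 2 powr \<beta> * (2 powr (\<beta> - 3)) ^ j" by (simp add: powr_add powr_powr[symmetric] powr_realpow)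
    finally show ?thesis .
  qed
  moreover have "2 powr (\<beta> - 3) < (1::real)" using b by (simp add: powr_less_one)
  ultimately show "summable (\<lambda>j. a j * r j ^ 3)" by (auto intro!: summable_mult summable_geometric)
  fix x :: R3
  assume nz: "ennreal (norm x powr - \<beta>) * indicator (ball 0 1) x \<noteq> 0" and x0: "x \<noteq> 0"
  then have x1: "norm x < 1" by (auto simp: indicator_def split: if_splits)
  obtain n where n: "(1/2::real) ^ n < norm x"
    using real_arch_pow_inv[of "norm x" "1/2"] x0 by auto
  \<comment> \<open>The first dyadic radius not exceeding |x|. It is not the zeroth one because |x|
    < 1, so its predecessor j indexes the shell of x.\<close>
  define m where "m = (LEAST n. (1/2::real) ^ n \<le> norm x)"
  have m: "(1/2) ^ m \<le> norm x" unfolding m_def by (rule LeastI[of _ n]) (use n in simp)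
  then have "m \<noteq> 0" using x1 by (intro notI) simp
  then obtain j where j: "m = Suc j" using not0_implies_Suc by blast
  have "norm x < r j" using not_less_Least[of j "\<lambda>n. (1/2::real) ^ n \<le> norm x"] j
    unfolding r_def m_def[symmetric] by (simp add: m_def[symmetric])
  moreover have "norm x powr - \<beta> \<le> a j"
  proof -
    have "norm x powr - \<beta> \<le> ((1/2) ^ Suc j) powr - \<beta>" using m b by (intro powr_mono2') (auto simp: j)
    also have "(1/2::real) ^ Suc j = 2 powr (- (real j + 1))"
    proof -
      have "2 powr (- real (Suc j)) = inverse ((2::real) ^ Suc j)"
        by (simp only: powr_minus powr_realpow[OF zero_less_numeral])
      moreover have "- (real j + 1) = - real (Suc j)" by simp
      moreover have "(1/2::real) ^ Suc j = inverse (2 ^ Suc j)"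
        by (simp only: power_one_over inverse_eq_divide)
      ultimately show ?thesis by (simp only:)
    qed
    also have "(2 powr (- (real j + 1))) powr - \<beta> = a j" unfolding a_def powr_powr by (simp add: algebra_simps)
    finally show ?thesis .
  qed
  ultimately show "\<exists>j. ennreal (norm x powr - \<beta>) * indicator (ball 0 1) x \<le> ennreal (a j) \<and> norm x < r j"
    using x1 by (intro exI[of _ j]) (simp add: ennreal_leI)
qed

definition riesz_const :: "real \<Rightarrow> ennreal" where
  "riesz_const \<beta> = (\<integral>\<^sup>+x\<in>ball (0::R3) 1. ennreal (norm x powr - \<beta>) \<partial>lborel)"

text \<open>Splitting at distance 1 from x: the near part is a translate of
  \<open>riesz_const\<close>, the far part has integrand at most 1. The bound is therefore uniform
  in x.\<close>

lemma nn_integral_riesz_kernel_le: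
  fixes x :: R3
  assumes b: "0 \<le> \<beta>" and S[measurable]: "S \<in> sets borel"
  shows "(\<integral>\<^sup>+y\<in>S. ennreal (norm (x - y) powr - \<beta>) \<partial>lborel) \<le> riesz_const \<beta> + emeasure lborel S"
proof -
  have k[measurable]: "(\<lambda>y. ennreal (norm y powr - \<beta>) * indicator (ball 0 1) y) \<in> borel_measurable (borel :: R3 measure)"
    by (intro borel_measurable_times_ennreal borel_measurable_indicator) auto
  have [measurable]: "(\<lambda>y. ennreal (norm (x - y) powr - \<beta>) * indicator (ball 0 1) (x - y)) \<in> borel_measurable (borel :: R3 measure)"
    by (rule measurable_compose[OF _ k]) simp
  have "(\<integral>\<^sup>+y\<in>S. ennreal (norm (x - y) powr - \<beta>) \<partial>lborel)
      \<le> (\<integral>\<^sup>+y. ennreal (norm (x - y) powr - \<beta>) * indicator (ball 0 1) (x - y) + indicator S y \<partial>lborel)"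
  proof (rule nn_integral_mono)
    fix y
    have "norm (x - y) powr - \<beta> \<le> 1" if "norm (x - y) \<ge> 1"
      using that b powr_mono2'[of "-\<beta>" 1 "norm (x - y)"] by simp
    then show "ennreal (norm (x - y) powr - \<beta>) * indicator S y
        \<le> ennreal (norm (x - y) powr - \<beta>) * indicator (ball 0 1) (x - y) + indicator S y"
      by (auto simp: indicator_def intro: order_trans[OF _ add_increasing2])
  qed
  also have "\<dots> = (\<integral>\<^sup>+y. ennreal (norm (x - y) powr - \<beta>) * indicator (ball 0 1) (x - y) \<partial>lborel)
      + emeasure lborel S"
    by (subst nn_integral_add) auto
  also have "(\<integral>\<^sup>+y. ennreal (norm (x - y) powr - \<beta>) * indicator (ball 0 1) (x - y) \<partial>lborel) = riesz_const \<beta>"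
    unfolding riesz_const_def
    by (rule nn_integral_lborel_reflect[of "\<lambda>y. ennreal (norm y powr - \<beta>) * indicator (ball 0 1) y"]) (rule k)
  finally show ?thesis .
qed

lemma riesz_kernel_uniform_bound:
  assumes b: "0 \<le> \<beta>" "\<beta> < 3" and S: "S \<in> sets borel" "bounded S"
  obtains C :: real where "C > 0"
    "\<And>x::R3. (\<integral>\<^sup>+y\<in>S. ennreal (norm (x - y) powr - \<beta>) \<partial>lborel) \<le> ennreal C"
proof -
  have "emeasure lborel S < \<infinity>" using S emeasure_bounded_finite by blast
  moreover have "riesz_const \<beta> < \<infinity>" unfolding riesz_const_def by (rule nn_integral_norm_powr_finite[OF b])
  ultimately have fin: "riesz_const \<beta> + emeasure lborel S < \<infinity>" by simp
  define C where "C = enn2real (riesz_const \<beta> + emeasure lborel S) + 1"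
  have "riesz_const \<beta> + emeasure lborel S \<le> ennreal C"
    using fin unfolding C_def by (metis ennreal_enn2real_if enn2real_nonneg ennreal_leI infinity_ennreal_def less_add_one less_imp_le order_less_irrefl)
  moreover have "C > 0" unfolding C_def by (simp add: add_nonneg_pos)
  ultimately show ?thesis
    using that[of C] nn_integral_riesz_kernel_le[OF b(1) S(1)] by (meson order_trans)
qed

lemma nn_integral_japanese_bracket_finite:
  "(\<integral>\<^sup>+x. ennreal (1 / (sqrt (1 + (norm (x::R3))\<^sup>2)) ^ 5) \<partial>lborel) < \<infinity>"
proof (rule nn_integral_dyadic_le)
  \<comment> \<open>The shells are indexed by m = j + 1 with 2^j \<le> s < 2^m; the factor 32 = 2^5
    compensates this shift.\<close>
  define a where "a j = 32 * (1/32::real) ^ j" for j :: nat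
  define r where "r j = (2::real) ^ j" for j :: nat
  show "a j \<ge> 0" "r j \<ge> 0" for j by (auto simp: a_def r_def)
  have "a j * r j ^ 3 = 32 * (1/4) ^ j" for j
    by (simp add: a_def r_def power_mult[symmetric] mult.commute[of j] power_mult[of _ 3 j] power_mult_distrib[symmetric])
  then show "summable (\<lambda>j. a j * r j ^ 3)" by (simp add: summable_mult summable_geometric)
  fix x :: R3
  define s where "s = sqrt (1 + (norm x)\<^sup>2)"
  have s1: "s \<ge> 1" unfolding s_def by simp
  have sx: "norm x < s" unfolding s_def by (rule real_less_rsqrt) simp
  obtain n where n: "s < (2::real) ^ n" using real_arch_pow[of 2 s] by auto
  define m where "m = (LEAST n. s < (2::real) ^ n)"
  have m: "s < 2 ^ m" unfolding m_def by (rule LeastI[of _ n]) (use n in simp)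
  then have "m \<noteq> 0" using s1 by (intro notI) simp
  then obtain j where j: "m = Suc j" using not0_implies_Suc by blast
  have sj: "2 ^ j \<le> s" using not_less_Least[of j "\<lambda>n. s < (2::real) ^ n"] j
    by (simp add: m_def[symmetric])
  have "1 / s ^ 5 \<le> 1 / (2 ^ j) ^ 5" using sj by (intro divide_left_mono power_mono) (use s1 in auto)
  also have "\<dots> = a m" by (simp add: a_def j power_mult[symmetric] mult.commute[of j] power_mult[of _ 5 j] power_divide)
  finally have "1 / s ^ 5 \<le> a m" .
  moreover have "norm x < r m" using sx m by (simp add: r_def)
  ultimately show "\<exists>j. ennreal (1 / (sqrt (1 + (norm x)\<^sup>2)) ^ 5) \<le> ennreal (a j) \<and> norm x < r j"
    unfolding s_def[symmetric] by (intro exI[of _ m]) (simp add: ennreal_leI)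
qed

section \<open>The Helmholtz kernel and its derivatives\<close>

text \<open>A regularised radius: smooth on the whole space for \<epsilon> \<noteq> 0 and the true
  radius for \<epsilon> = 0, so that one set of derivative formulas serves both the regularised and
  the singular kernels.\<close>

definition rho :: "real \<Rightarrow> R3 \<Rightarrow> real" where
  "rho \<epsilon> x = sqrt ((norm x)\<^sup>2 + \<epsilon>\<^sup>2)"

lemma rho_pos: "x \<noteq> 0 \<or> \<epsilon> \<noteq> 0 \<Longrightarrow> rho \<epsilon> x > 0"
  unfolding rho_def by (auto simp: add_pos_nonneg add_nonneg_pos)

lemma rho_0 [simp]: "rho 0 x = norm x"
  by (simp add: rho_def)

lemma norm_le_rho: "norm x \<le> rho \<epsilon> x"
  unfolding rho_def by (rule real_le_rsqrt) simp

lemma rho_square: "(rho \<epsilon> x)\<^sup>2 = (norm x)\<^sup>2 + \<epsilon>\<^sup>2"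
  by (simp add: rho_def)

lemma eps_le_rho: "\<epsilon> \<le> rho \<epsilon> x"
  unfolding rho_def by (rule real_le_rsqrt) simp

lemma has_derivative_rho:
  assumes "x \<noteq> 0 \<or> \<epsilon> \<noteq> 0"
  shows "(rho \<epsilon> has_derivative (\<lambda>v. (x \<bullet> v) / rho \<epsilon> x)) (at x)"
proof -
  have pos: "x \<bullet> x + \<epsilon>\<^sup>2 > 0" using assms by (auto simp: add_pos_nonneg add_nonneg_pos)
  have eq: "rho \<epsilon> = (\<lambda>x. sqrt (x \<bullet> x + \<epsilon>\<^sup>2))" by (simp add: rho_def dot_square_norm fun_eq_iff)
  show ?thesis unfolding eq using pos
    by (auto intro!: derivative_eq_intros simp: inner_commute field_simps)
qed

lemma borel_measurable_rho [measurable]: "rho \<epsilon> \<in> borel_measurable borel"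
  unfolding rho_def by measurable

text \<open>The gradient of the radius is x / \<open>rho\<close>. Writing the radial derivative as
  \<open>rho\<close> times f' cancels the denominator, which is why the functions below are radial
  derivatives divided by the radius.\<close>

lemma has_derivative_radial:
  fixes f :: "real \<Rightarrow> complex"
  assumes f: "(f has_vector_derivative rho \<epsilon> x *\<^sub>R f') (at (rho \<epsilon> x))" and x: "x \<noteq> 0 \<or> \<epsilon> \<noteq> 0"
  shows "((\<lambda>x. f (rho \<epsilon> x)) has_derivative (\<lambda>v. of_real (x \<bullet> v) * f')) (at x)"
proof -
  have "(f \<circ> rho \<epsilon> has_derivative (\<lambda>h. h *\<^sub>R (rho \<epsilon> x *\<^sub>R f')) \<circ> (\<lambda>v. (x \<bullet> v) / rho \<epsilon> x)) (at x)"
    by (rule diff_chain_at[OF has_derivative_rho[OF x]]) (use f in \<open>simp add: has_vector_derivative_def\<close>)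
  moreover have "(\<lambda>h. h *\<^sub>R (rho \<epsilon> x *\<^sub>R f')) \<circ> (\<lambda>v. (x \<bullet> v) / rho \<epsilon> x) = (\<lambda>v. of_real (x \<bullet> v) * f')"
    using rho_pos[OF x] by (auto simp: fun_eq_iff scaleR_conv_of_real)
  ultimately show ?thesis by (simp add: o_def)
qed

text \<open>Each of these is the radial derivative, divided by the radius, of its predecessor.\<close>

definition fE :: "real \<Rightarrow> real \<Rightarrow> complex" where
  "fE k t = exp (\<i> * of_real k * of_real t) / of_real t"
definition fA :: "real \<Rightarrow> real \<Rightarrow> complex" where
  "fA k t = exp (\<i> * of_real k * of_real t) * (\<i> * of_real k / of_real t ^ 2 - 1 / of_real t ^ 3)"
definition fB :: "real \<Rightarrow> real \<Rightarrow> complex" where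
  "fB k t = exp (\<i> * of_real k * of_real t) *
     (- (of_real k)\<^sup>2 / of_real t ^ 3 - 3 * \<i> * of_real k / of_real t ^ 4 + 3 / of_real t ^ 5)"
definition fC :: "real \<Rightarrow> real \<Rightarrow> complex" where
  "fC k t = exp (\<i> * of_real k * of_real t) *
     (- \<i> * of_real k ^ 3 / of_real t ^ 4 + 6 * of_real k ^ 2 / of_real t ^ 5
      + 15 * \<i> * of_real k / of_real t ^ 6 - 15 / of_real t ^ 7)"

lemma
  shows borel_measurable_fE [measurable]: "fE k \<in> borel_measurable borel"
    and borel_measurable_fA [measurable]: "fA k \<in> borel_measurable borel"
    and borel_measurable_fB [measurable]: "fB k \<in> borel_measurable borel"
  unfolding fE_def fA_def fB_def by measurable

lemma has_field_derivative_exp_ikt: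
  "((\<lambda>t. exp (\<i> * of_real k * t)) has_field_derivative \<i> * of_real k * exp (\<i> * of_real k * t)) (at (t::complex))"
  by (auto intro!: derivative_eq_intros)

section \<open>Radial derivatives and Helmholtz identities\<close>

lemma fE_deriv:
  assumes "t \<noteq> 0" shows "(fE k has_vector_derivative t *\<^sub>R fA k t) (at t)"
proof -
  have "((\<lambda>z. exp (\<i> * of_real k * z) / z) has_field_derivative of_real t * fA k t) (at (complex_of_real t))"
    unfolding fA_def using assms
    by (auto intro!: derivative_eq_intros simp: field_simps power2_eq_square power3_eq_cube)
  from has_field_derivative_imp_has_derivative[OF this] show ?thesis
    using has_vector_derivative_real_field[OF \<open>(_ has_field_derivative _) _\<close>] unfolding fE_def scaleR_conv_of_real by simp
qed

lemma fA_deriv: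
  assumes "t \<noteq> 0" shows "(fA k has_vector_derivative t *\<^sub>R fB k t) (at t)"
proof -
  have "((\<lambda>z. exp (\<i> * of_real k * z) * (\<i> * of_real k / z ^ 2 - 1 / z ^ 3)) has_field_derivative of_real t * fB k t) (at (complex_of_real t))"
    unfolding fB_def using assms
    by (auto intro!: derivative_eq_intros simp: field_simps eval_nat_numeral)
  then show ?thesis
    using has_vector_derivative_real_field[OF \<open>(_ has_field_derivative _) _\<close>] unfolding fA_def scaleR_conv_of_real by simp
qed

lemma fB_deriv:
  assumes "t \<noteq> 0" shows "(fB k has_vector_derivative t *\<^sub>R fC k t) (at t)"
proof -
  have "((\<lambda>z. exp (\<i> * of_real k * z) *
     (- (of_real k)\<^sup>2 / z ^ 3 - 3 * \<i> * of_real k / z ^ 4 + 3 / z ^ 5)) has_field_derivative of_real t * fC k t) (at (complex_of_real t))"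
    unfolding fC_def using assms
    by (auto intro!: derivative_eq_intros simp: field_simps eval_nat_numeral)
  then show ?thesis
    using has_vector_derivative_real_field[OF \<open>(_ has_field_derivative _) _\<close>] unfolding fB_def scaleR_conv_of_real by simp
qed

text \<open>The gradient of \<open>fE\<close> at the radius r is x \<open>fA\<close>, whose
  divergence is 3 \<open>fA\<close> + r^2 \<open>fB\<close>; this is the Helmholtz equation for
  e^(ikr) / r in radial form.\<close>

lemma fE_laplace: "t \<noteq> 0 \<Longrightarrow> 3 * fA k t + of_real t ^ 2 * fB k t = - (of_real k)\<^sup>2 * fE k t"
  unfolding fE_def fA_def fB_def by (simp add: field_simps eval_nat_numeral)

text \<open>The Laplacian of (x . a) \<open>fA\<close> is (x . a) (5 \<open>fB\<close> + r^2
  \<open>fC\<close>): the two extra copies of \<open>fB\<close> come from the cross term between the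
  linear factor and the radial one. This is the Helmholtz equation of the dipole.\<close>

lemma fA_laplace: "t \<noteq> 0 \<Longrightarrow> 5 * fB k t + of_real t ^ 2 * fC k t = - (of_real k)\<^sup>2 * fA k t"
  unfolding fA_def fB_def fC_def by (simp add: field_simps eval_nat_numeral)

lemma norm_exp_ikt [simp]: "norm (exp (\<i> * of_real k * of_real t)) = 1"
  by (metis mult.assoc norm_exp_i_times of_real_mult)

lemma norm_fE: "t > 0 \<Longrightarrow> norm (fE k t) = 1 / t"
  unfolding fE_def by (simp add: norm_divide)

lemma norm_fA: "t > 0 \<Longrightarrow> k \<ge> 0 \<Longrightarrow> norm (fA k t) \<le> k / t\<^sup>2 + 1 / t ^ 3"
  unfolding fA_def norm_mult norm_exp_ikt
  by (rule order_trans[OF _ order_trans[OF norm_triangle_ineq4]]) (auto simp: norm_divide norm_mult norm_power)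

text \<open>The exact modulus, as opposed to an upper bound, makes monotonicity and scaling in t
  visible; the reverse Hoelder inequality needs lower bounds for the field.\<close>

lemma norm_fA_eq: "t > 0 \<Longrightarrow> norm (fA k t) = sqrt (k\<^sup>2 / t\<^sup>2 + 1 / t ^ 4) / t"
proof -
  assume t: "t > 0"
  have "\<i> * of_real k / of_real t ^ 2 - 1 / of_real t ^ 3 = (Complex (- 1 / t\<^sup>2) (k / t)) / of_real t"
    using t by (simp add: complex_eq_iff Re_divide Im_divide field_simps eval_nat_numeral)
  moreover have "norm (Complex (- 1 / t\<^sup>2) (k / t)) = sqrt (k\<^sup>2 / t\<^sup>2 + 1 / t ^ 4)"
    by (simp add: cmod_def power_divide add.commute power_mult[symmetric])
  ultimately have "norm (\<i> * of_real k / of_real t ^ 2 - 1 / of_real t ^ 3) = sqrt (k\<^sup>2 / t\<^sup>2 + 1 / t ^ 4) / t"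
    using t by (simp only: norm_divide norm_of_real)
  then show ?thesis unfolding fA_def norm_mult norm_exp_ikt by simp
qed

text \<open>The algebra generated by linear forms, 1 / \<open>rho\<close> and exp(ik
  \<open>rho\<close>) is closed under directional derivatives. One derivative lemma for the
  generators thus gives smoothness of every kernel and of all its derivatives.\<close>

inductive kern :: "real \<Rightarrow> real \<Rightarrow> (R3 \<Rightarrow> complex) \<Rightarrow> bool" for k \<epsilon> where
  kern_const: "kern k \<epsilon> (\<lambda>x. c)"
| kern_inner: "kern k \<epsilon> (\<lambda>x. of_real (x \<bullet> v))"
| kern_inverse: "kern k \<epsilon> (\<lambda>x. 1 / of_real (rho \<epsilon> x))"
| kern_exp: "kern k \<epsilon> (\<lambda>x. exp (\<i> * of_real k * of_real (rho \<epsilon> x)))"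
| kern_add: "kern k \<epsilon> F \<Longrightarrow> kern k \<epsilon> G \<Longrightarrow> kern k \<epsilon> (\<lambda>x. F x + G x)"
| kern_mult: "kern k \<epsilon> F \<Longrightarrow> kern k \<epsilon> G \<Longrightarrow> kern k \<epsilon> (\<lambda>x. F x * G x)"

lemma kern_power: "kern k \<epsilon> F \<Longrightarrow> kern k \<epsilon> (\<lambda>x. F x ^ n)"
  by (induction n) (auto intro: kern.intros)

lemma kern_inverse_power: "kern k \<epsilon> (\<lambda>x. c / of_real (rho \<epsilon> x) ^ n)"
  using kern_mult[OF kern_const[of k \<epsilon> c] kern_power[OF kern_inverse[of k \<epsilon>], of n]]
  by (simp add: power_one_over divide_inverse power_inverse)

lemma kern_diff: "kern k \<epsilon> F \<Longrightarrow> kern k \<epsilon> G \<Longrightarrow> kern k \<epsilon> (\<lambda>x. F x - G x)"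
  using kern_add[of k \<epsilon> F "\<lambda>x. (-1) * G x"] kern_mult[OF kern_const[of k \<epsilon> "-1"], of G] by simp

lemma kern_fE: "kern k \<epsilon> (\<lambda>x. fE k (rho \<epsilon> x))"
  using kern_mult[OF kern_exp kern_inverse, of k \<epsilon>] unfolding fE_def by simp

lemma kern_fA: "kern k \<epsilon> (\<lambda>x. fA k (rho \<epsilon> x))"
  unfolding fA_def by (intro kern_mult kern_exp kern_diff kern_inverse_power)

lemma kern_fB: "kern k \<epsilon> (\<lambda>x. fB k (rho \<epsilon> x))"
  unfolding fB_def by (intro kern_mult kern_exp kern_diff kern_add kern_inverse_power)

lemma kern_derivative:
  assumes "kern k \<epsilon> F"
  shows "\<exists>F'. (\<forall>x. x \<noteq> 0 \<or> \<epsilon> \<noteq> 0 \<longrightarrow> (F has_derivative F' x) (at x)) \<and> (\<forall>v. kern k \<epsilon> (\<lambda>x. F' x v))"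
  using assms
proof induction
  case (kern_const c)
  then show ?case by (intro exI[of _ "\<lambda>x v. 0"]) (auto intro: kern.intros)
next
  case (kern_inner w)
  show ?case
    by (intro exI[of _ "\<lambda>x v. of_real (v \<bullet> w)"])
       (auto intro: kern.intros intro!: derivative_eq_intros)
next
  case kern_inverse
  have "((\<lambda>x. 1 / of_real (rho \<epsilon> x) :: complex) has_derivative (\<lambda>v. of_real (x \<bullet> v) * (- 1 / of_real (rho \<epsilon> x) ^ 3))) (at x)"
    if x: "x \<noteq> 0 \<or> \<epsilon> \<noteq> 0" for x
  proof -
    have "((\<lambda>z. 1 / z) has_field_derivative of_real (rho \<epsilon> x) * (- 1 / of_real (rho \<epsilon> x) ^ 3)) (at (complex_of_real (rho \<epsilon> x)))"
      using rho_pos[OF x] by (auto intro!: derivative_eq_intros simp: field_simps eval_nat_numeral)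
    from has_vector_derivative_real_field[OF this] show ?thesis
      by (intro has_derivative_radial[where f="\<lambda>t. 1 / of_real t", OF _ x]) (simp add: scaleR_conv_of_real)
  qed
  then show ?case
    by (intro exI[of _ "\<lambda>x v. of_real (x \<bullet> v) * (- 1 / of_real (rho \<epsilon> x) ^ 3)"] conjI allI impI
        kern.kern_mult kern.kern_inner kern_inverse_power)
next
  case kern_exp
  have "((\<lambda>x. exp (\<i> * of_real k * of_real (rho \<epsilon> x))) has_derivative
      (\<lambda>v. of_real (x \<bullet> v) * (\<i> * of_real k * exp (\<i> * of_real k * of_real (rho \<epsilon> x)) / of_real (rho \<epsilon> x)))) (at x)"
    if x: "x \<noteq> 0 \<or> \<epsilon> \<noteq> 0" for x
    using has_vector_derivative_real_field[OF has_field_derivative_exp_ikt[of k "of_real (rho \<epsilon> x)"]] rho_pos[OF x]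
    by (intro has_derivative_radial[where f="\<lambda>t. exp (\<i> * of_real k * of_real t)", OF _ x]) (simp add: scaleR_conv_of_real)
  moreover have "kern k \<epsilon> (\<lambda>x. of_real (x \<bullet> v) * (\<i> * of_real k * exp (\<i> * of_real k * of_real (rho \<epsilon> x)) / of_real (rho \<epsilon> x)))" for v
    using kern.kern_mult[OF kern.kern_inner[of k \<epsilon> v] kern.kern_mult[OF kern.kern_mult[OF kern.kern_const[of k \<epsilon> "\<i> * of_real k"] kern.kern_exp] kern.kern_inverse]]
    by simp
  ultimately show ?case
    by (intro exI[of _ "\<lambda>x v. of_real (x \<bullet> v) * (\<i> * of_real k * exp (\<i> * of_real k * of_real (rho \<epsilon> x)) / of_real (rho \<epsilon> x))"]) auto
next
  case (kern_add F G)
  then obtain F' G' where "\<forall>x. x \<noteq> 0 \<or> \<epsilon> \<noteq> 0 \<longrightarrow> (F has_derivative F' x) (at x)" "\<forall>v. kern k \<epsilon> (\<lambda>x. F' x v)"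
    "\<forall>x. x \<noteq> 0 \<or> \<epsilon> \<noteq> 0 \<longrightarrow> (G has_derivative G' x) (at x)" "\<forall>v. kern k \<epsilon> (\<lambda>x. G' x v)" by blast
  then show ?case
    by (intro exI[of _ "\<lambda>x v. F' x v + G' x v"]) (auto intro: kern.kern_add has_derivative_add)
next
  case (kern_mult F G)
  then obtain F' G' where *: "\<forall>x. x \<noteq> 0 \<or> \<epsilon> \<noteq> 0 \<longrightarrow> (F has_derivative F' x) (at x)" "\<forall>v. kern k \<epsilon> (\<lambda>x. F' x v)"
    "\<forall>x. x \<noteq> 0 \<or> \<epsilon> \<noteq> 0 \<longrightarrow> (G has_derivative G' x) (at x)" "\<forall>v. kern k \<epsilon> (\<lambda>x. G' x v)" by blast
  show ?case
    by (intro exI[of _ "\<lambda>x v. F x * G' x v + F' x v * G x"])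
       (use * kern_mult.hyps in \<open>auto intro!: kern.kern_add kern.kern_mult has_derivative_mult\<close>)
qed

lemma kern_isCont: "kern k \<epsilon> F \<Longrightarrow> x \<noteq> 0 \<or> \<epsilon> \<noteq> 0 \<Longrightarrow> isCont F x"
  using kern_derivative has_derivative_continuous by blast

lemma kern_measurable: "kern k \<epsilon> F \<Longrightarrow> F \<in> borel_measurable borel"
  by (induction rule: kern.induct) auto

text \<open>\<open>Ck_on\<close> recurses through directional derivatives, so an induction on the
  order never leaves a class that is closed under them.\<close>

lemma Ck_on_closed_class:
  assumes "\<And>F. P F \<Longrightarrow> \<exists>F'. (\<forall>x\<in>S. (F has_derivative F' x) (at x)) \<and> (\<forall>v. P (\<lambda>x. F' x v))"
  shows "P F \<Longrightarrow> Ck_on m S F"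
proof (induction m arbitrary: F)
  case 0
  with assms[of F] show ?case
    by (auto intro!: continuous_at_imp_continuous_on dest: has_derivative_continuous)
next
  case (Suc m)
  with assms[of F] show ?case by auto
qed

section \<open>Integration by parts against test functions\<close>

lemma has_derivative_zero_off_closed:
  fixes f :: "'a::real_normed_vector \<Rightarrow> 'b::real_normed_vector"
  assumes "closed K" "x \<notin> K" "\<And>x. x \<notin> K \<Longrightarrow> f x = 0"
  shows "(f has_derivative (\<lambda>h. 0)) (at x)"
proof (rule has_derivative_transform_within_open[OF has_derivative_const[of 0]])
  show "open (- K)" using assms(1) by (simp add: open_Compl)
  show "x \<in> - K" using assms(2) by simp
  show "0 = f y" if "y \<in> - K" for y using that assms(3)[of y] by simp
qed

lemma integrable_bounded_compact_support:
  fixes f :: "'a::euclidean_space \<Rightarrow> 'b::{banach, second_countable_topology}"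
  assumes "f \<in> borel_measurable borel" "\<And>x. norm (f x) \<le> B" "\<And>x. x \<notin> K \<Longrightarrow> f x = 0" "bounded K"
  shows "integrable lborel f"
proof -
  obtain c r where K: "K \<subseteq> cball c r" using assms(4) bounded_subset_cball by blast
  have "integrable lborel (\<lambda>x. B * indicator (cball c r) x)"
    using emeasure_bounded_finite[of "cball c r"] by simp
  then show ?thesis
  proof (rule Bochner_Integration.integrable_bound)
    show "AE x in lborel. norm (f x) \<le> norm (B * indicator (cball c r) x)"
    proof (rule AE_I2)
      fix x
      have "B \<ge> 0" using assms(2)[of x] norm_ge_zero order_trans by blast
      moreover have "f x = 0" if "x \<notin> cball c r" using that K assms(3) by blast
      ultimately show "norm (f x) \<le> norm (B * indicator (cball c r) x)"
        using assms(2)[of x] by (cases "x \<in> cball c r") auto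
    qed
  qed (use assms(1) in simp)
qed

lemma continuous_compact_support_bounded:
  fixes f :: "'a::euclidean_space \<Rightarrow> 'b::real_normed_vector"
  assumes "continuous_on UNIV f" "\<And>x. x \<notin> K \<Longrightarrow> f x = 0" "compact K"
  shows "\<exists>B\<ge>0. \<forall>x. norm (f x) \<le> B"
proof -
  have "compact (f ` K)" using assms compact_continuous_image continuous_on_subset by blast
  then obtain B where B: "\<forall>x\<in>K. norm (f x) \<le> B" using compact_imp_bounded bounded_iff by (metis imageI)
  then have "\<forall>x. norm (f x) \<le> max B 0" using assms(2) by (metis max.cobounded2 max.coboundedI1 norm_zero)
  then show ?thesis by (intro exI[of _ "max B 0"]) auto
qed

text \<open>Differentiate the translation-invariant quantity \<open>\<integral> \<psi> (x + h e) dx\<close> in \<open>h\<close>.\<close>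

lemma integral_directional_derivative_zero:
  fixes \<psi> :: "'a::euclidean_space \<Rightarrow> complex"
  assumes d: "\<And>x. (\<psi> has_derivative \<psi>' x) (at x)"
    and c: "continuous_on UNIV (\<lambda>x. \<psi>' x e)"
    and K: "compact K" "\<And>x. x \<notin> K \<Longrightarrow> \<psi> x = 0"
  shows "(\<integral>x. \<psi>' x e \<partial>lborel) = 0"
proof -
  have z: "\<psi>' x e = 0" if "x \<notin> K" for x
  proof -
    have "(\<psi> has_derivative (\<lambda>h. 0)) (at x)"
      by (rule has_derivative_zero_off_closed[OF compact_imp_closed[OF K(1)] that K(2)])
    then have "\<psi>' x = (\<lambda>h. 0)" using d has_derivative_unique by blast
    then show ?thesis by simp
  qed
  obtain B where B0: "B \<ge> 0" and B: "\<And>x. norm (\<psi>' x e) \<le> B"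
    using continuous_compact_support_bounded[OF c z K(1)] by blast
  \<comment> \<open>Difference quotients with step 1 / (n + 1); each has integral 0 by translation
    invariance.\<close>
  define q where "q n x = (\<psi> (x + inverse (real (Suc n)) *\<^sub>R e) - \<psi> x) /\<^sub>R inverse (real (Suc n))" for n x
  have c\<psi>: "continuous_on UNIV \<psi>"
    using d by (auto intro!: continuous_at_imp_continuous_on has_derivative_continuous)
  have i\<psi>: "integrable lborel \<psi>"
  proof -
    obtain B' where "\<And>x. norm (\<psi> x) \<le> B'" using continuous_compact_support_bounded[OF c\<psi> K(2,1)] by blast
    then show ?thesis
      by (intro integrable_bounded_compact_support[OF _ _ K(2)])
         (use c\<psi> K compact_imp_bounded borel_measurable_continuous_onI in auto)
  qed
  have q0: "(\<integral>x. q n x \<partial>lborel) = 0" for n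
  proof -
    have *: "(\<integral>x. \<psi> (x + inverse (real (Suc n)) *\<^sub>R e) \<partial>lborel) = (\<integral>x. \<psi> x \<partial>lborel)"
      using integral_lborel_affine[of 1 \<psi> "inverse (real (Suc n)) *\<^sub>R e"] by (simp add: add.commute)
    have "integrable lborel (\<lambda>x. \<psi> (x + inverse (real (Suc n)) *\<^sub>R e))"
      using integrable_lborel_affine[OF i\<psi>, of 1 "inverse (real (Suc n)) *\<^sub>R e"] by (simp add: add.commute)
    then show ?thesis unfolding q_def using * i\<psi> by simp
  qed
  have qlim: "(\<lambda>n. q n x) \<longlonglongrightarrow> \<psi>' x e" for x
  proof -
    have "((\<lambda>s::real. x + s *\<^sub>R e) has_derivative (\<lambda>s. s *\<^sub>R e)) (at 0)"
      by (auto intro!: derivative_eq_intros)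
    then have "((\<lambda>s::real. \<psi> (x + s *\<^sub>R e)) has_derivative (\<lambda>s. \<psi>' x (s *\<^sub>R e))) (at 0)"
      by (rule has_derivative_compose) (simp add: d)
    then have "((\<lambda>s. \<psi> (x + s *\<^sub>R e)) has_vector_derivative \<psi>' x e) (at 0)"
      unfolding has_vector_derivative_def using linear_cmul[OF has_derivative_linear[OF d]] by simp
    then have *: "((\<lambda>s. norm (\<psi> (x + s *\<^sub>R e) - \<psi> x - s *\<^sub>R \<psi>' x e) / norm s) \<longlongrightarrow> 0) (at 0)"
      unfolding has_vector_derivative_def has_derivative_at by simp
    have "((\<lambda>s. (\<psi> (x + s *\<^sub>R e) - \<psi> x) /\<^sub>R s - \<psi>' x e) \<longlongrightarrow> 0) (at 0)"
    proof (rule Lim_null_comparison[OF _ *])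
      have "norm ((\<psi> (x + s *\<^sub>R e) - \<psi> x) /\<^sub>R s - \<psi>' x e) \<le> norm (\<psi> (x + s *\<^sub>R e) - \<psi> x - s *\<^sub>R \<psi>' x e) / norm s"
        if "s \<noteq> 0" for s
      proof -
        have "(\<psi> (x + s *\<^sub>R e) - \<psi> x) /\<^sub>R s - \<psi>' x e = (\<psi> (x + s *\<^sub>R e) - \<psi> x - s *\<^sub>R \<psi>' x e) /\<^sub>R s"
          using that by (simp add: scaleR_diff_right)
        then show ?thesis by (simp add: divide_inverse mult.commute)
      qed
      then show "\<forall>\<^sub>F s in at 0. norm ((\<psi> (x + s *\<^sub>R e) - \<psi> x) /\<^sub>R s - \<psi>' x e) \<le> norm (\<psi> (x + s *\<^sub>R e) - \<psi> x - s *\<^sub>R \<psi>' x e) / norm s"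
        by (simp add: eventually_at_filter)
    qed
    then have "((\<lambda>s. (\<psi> (x + s *\<^sub>R e) - \<psi> x) /\<^sub>R s) \<longlongrightarrow> \<psi>' x e) (at 0)"
      by (simp only: LIM_zero_iff)
    from this[unfolded tendsto_at_iff_sequentially, THEN spec, THEN mp, THEN mp, OF _ LIMSEQ_inverse_real_of_nat]
    show ?thesis unfolding q_def o_def by simp
  qed
  \<comment> \<open>The mean value inequality along the segment bounds all quotients by the sup of
    the directional derivative, which yields the dominating function.\<close>
  have qB: "norm (q n x) \<le> B" for n x
  proof -
    define h where "h = inverse (real (Suc n))"
    have h: "h > 0" by (simp add: h_def)
    have "norm (\<psi> (x + h *\<^sub>R e) - \<psi> (x + 0 *\<^sub>R e)) \<le> B * norm (h - 0)"
    proof (rule differentiable_bound[where S = UNIV and f = "\<lambda>s. \<psi> (x + s *\<^sub>R e)" and f' = "\<lambda>s r. r *\<^sub>R \<psi>' (x + s *\<^sub>R e) e"])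
      fix s :: real
      have "((\<lambda>s::real. x + s *\<^sub>R e) has_derivative (\<lambda>s. s *\<^sub>R e)) (at s)"
        by (auto intro!: derivative_eq_intros)
      then have "((\<lambda>s::real. \<psi> (x + s *\<^sub>R e)) has_derivative (\<lambda>r. \<psi>' (x + s *\<^sub>R e) (r *\<^sub>R e))) (at s)"
        by (rule has_derivative_compose) (simp add: d)
      then show "((\<lambda>s. \<psi> (x + s *\<^sub>R e)) has_derivative (\<lambda>r. r *\<^sub>R \<psi>' (x + s *\<^sub>R e) e)) (at s within UNIV)"
        using linear_cmul[OF has_derivative_linear[OF d]] by simp
      show "onorm (\<lambda>r::real. r *\<^sub>R \<psi>' (x + s *\<^sub>R e) e) \<le> B"
        by (rule onorm_le) (use mult_right_mono[OF B[of "x + s *\<^sub>R e"] abs_ge_zero] in \<open>simp add: mult.commute\<close>)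
    qed auto
    then have "norm (\<psi> (x + h *\<^sub>R e) - \<psi> x) \<le> B * h" using h by simp
    then show ?thesis unfolding q_def h_def[symmetric] using h by (simp add: divide_inverse[symmetric] pos_divide_le_eq mult.commute[of "inverse h"])
  qed
  obtain c0 r where cr: "K \<subseteq> cball c0 r" using K(1) compact_imp_bounded bounded_subset_cball by blast
  \<comment> \<open>The steps are at most 1, so enlarging the radius by \<open>norm e\<close> covers
    the supports of all quotients at once.\<close>
  have qsupp: "q n x = 0" if "x \<notin> cball c0 (r + norm e)" for n x
  proof -
    have "x + inverse (real (Suc n)) *\<^sub>R e \<notin> cball c0 r"
    proof
      assume "x + inverse (real (Suc n)) *\<^sub>R e \<in> cball c0 r"
      moreover have "dist c0 x \<le> dist c0 (x + inverse (real (Suc n)) *\<^sub>R e) + norm (inverse (real (Suc n)) *\<^sub>R e)"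
        by (metis dist_triangle2 dist_commute dist_norm add_diff_cancel_left')
      moreover have "norm (inverse (real (Suc n)) *\<^sub>R e) \<le> norm e"
      proof -
        have "\<bar>inverse (real (Suc n))\<bar> \<le> 1" by (simp add: inverse_le_1_iff)
        from mult_right_mono[OF this norm_ge_zero[of e]] show ?thesis by (simp only: norm_scaleR mult_1_left)
      qed
      ultimately show False using that by simp
    qed
    moreover have "x \<notin> cball c0 r" using that norm_ge_zero[of e] unfolding mem_cball by linarith
    ultimately have "x + inverse (real (Suc n)) *\<^sub>R e \<notin> K" "x \<notin> K" using cr by blast+
    then show ?thesis unfolding q_def using K(2) by simp
  qed
  have "(\<lambda>n. \<integral>x. q n x \<partial>lborel) \<longlonglongrightarrow> (\<integral>x. \<psi>' x e \<partial>lborel)"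
  proof (rule integral_dominated_convergence[where w = "\<lambda>x. B * indicator (cball c0 (r + norm e)) x"])
    show "(\<lambda>x. \<psi>' x e) \<in> borel_measurable lborel" using borel_measurable_continuous_onI[OF c] by simp
    have "\<psi> \<in> borel_measurable borel" using borel_measurable_continuous_onI[OF c\<psi>] by simp
    then show "q n \<in> borel_measurable lborel" for n unfolding q_def by measurable
    show "integrable lborel (\<lambda>x. B * indicator (cball c0 (r + norm e)) x)"
      using emeasure_bounded_finite[of "cball c0 (r + norm e)"] by simp
    show "AE x in lborel. norm (q n x) \<le> B * indicator (cball c0 (r + norm e)) x" for n
      using qB qsupp by (intro AE_I2) (auto simp: indicator_def)
  qed (use qlim in auto)
  then show ?thesis using q0 LIMSEQ_unique by (metis (lifting) tendsto_const ext)
qed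

lemma test_funD:
  assumes "test_fun \<Omega> \<phi>"
  shows "\<And>x. (\<phi> has_derivative frechet_derivative \<phi> (at x)) (at x)"
    and "\<And>i. continuous_on UNIV (pderiv3 i \<phi>)"
    and "continuous_on UNIV \<phi>"
    and "compact (closure {x. \<phi> x \<noteq> 0})" "closure {x. \<phi> x \<noteq> 0} \<subseteq> \<Omega>"
    and "\<And>x. x \<notin> closure {x. \<phi> x \<noteq> 0} \<Longrightarrow> \<phi> x = 0"
    and "\<And>i x. x \<notin> closure {x. \<phi> x \<noteq> 0} \<Longrightarrow> pderiv3 i \<phi> x = 0"
proof -
  have "Ck_on (Suc 0) UNIV \<phi>" using assms unfolding test_fun_def smooth_on_def by blast
  then obtain f' where f': "\<And>x. (\<phi> has_derivative f' x) (at x)" "\<And>v. continuous_on UNIV (\<lambda>x. f' x v)" by auto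
  have eq: "frechet_derivative \<phi> (at x) = f' x" for x using f'(1) frechet_derivative_at by metis
  show d: "\<And>x. (\<phi> has_derivative frechet_derivative \<phi> (at x)) (at x)" using f'(1) eq by simp
  show "\<And>i. continuous_on UNIV (pderiv3 i \<phi>)" using f'(2) by (simp add: pderiv3_def[abs_def] eq)
  show "continuous_on UNIV \<phi>" using d by (auto intro!: continuous_at_imp_continuous_on has_derivative_continuous)
  show "compact (closure {x. \<phi> x \<noteq> 0})" "closure {x. \<phi> x \<noteq> 0} \<subseteq> \<Omega>"
    using assms unfolding test_fun_def by auto
  show z: "\<And>x. x \<notin> closure {x. \<phi> x \<noteq> 0} \<Longrightarrow> \<phi> x = 0"
    using closure_subset[of "{x. \<phi> x \<noteq> 0}"] by (metis (mono_tags) mem_Collect_eq subsetD)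
  show "\<And>i x. x \<notin> closure {x. \<phi> x \<noteq> 0} \<Longrightarrow> pderiv3 i \<phi> x = 0"
  proof -
    fix i x assume x: "x \<notin> closure {x. \<phi> x \<noteq> 0}"
    have "(\<phi> has_derivative (\<lambda>h. 0)) (at x)"
      by (rule has_derivative_zero_off_closed[OF closed_closure x z])
    then have "frechet_derivative \<phi> (at x) = (\<lambda>h. 0)" using d has_derivative_unique by blast
    then show "pderiv3 i \<phi> x = 0" by (simp add: pderiv3_def)
  qed
qed

lemma test_fun_bounds:
  assumes "test_fun \<Omega> \<phi>"
  obtains B K where "B \<ge> 0" "compact K" "K \<subseteq> \<Omega>" "\<And>x. x \<notin> K \<Longrightarrow> \<phi> x = 0" "\<And>i x. x \<notin> K \<Longrightarrow> pderiv3 i \<phi> x = 0"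
    "\<And>x. \<bar>\<phi> x\<bar> \<le> B" "\<And>i x. \<bar>pderiv3 i \<phi> x\<bar> \<le> B"
proof -
  note T = test_funD[OF assms]
  have "\<exists>B\<ge>0. \<forall>x. norm (pderiv3 i \<phi> x) \<le> B" for i
    by (rule continuous_compact_support_bounded[OF T(2) T(7) T(4)])
  then obtain b where b: "\<And>i. b i \<ge> 0" "\<And>i x. norm (pderiv3 i \<phi> x) \<le> b i" by metis
  obtain b0 where b0: "b0 \<ge> 0" "\<And>x. norm (\<phi> x) \<le> b0"
    using continuous_compact_support_bounded[OF T(3) T(6) T(4)] by blast
  have le: "b i \<le> b0 + sum b UNIV" for i
  proof -
    have "b i \<le> sum b UNIV" by (rule member_le_sum) (auto simp: b)
    with b0(1) show ?thesis by linarith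
  qed
  show ?thesis
  proof (rule that[of "b0 + sum b UNIV" "closure {x. \<phi> x \<noteq> 0}"])
    show "\<bar>\<phi> x\<bar> \<le> b0 + sum b UNIV" for x
      using b0(2)[of x] sum_nonneg[of UNIV b] b(1) by simp
    show "\<bar>pderiv3 i \<phi> x\<bar> \<le> b0 + sum b UNIV" for i x
      using b(2)[of i x] le[of i] by simp
    show "0 \<le> b0 + sum b UNIV" using b(1) b0(1) by (simp add: sum_nonneg)
  qed (rule T | assumption)+
qed

text \<open>F may behave arbitrarily outside \<Omega>. The product is continuous on \<Omega> and
  vanishes on the complement of K, and these two open sets cover the space.\<close>

lemma continuous_on_mult_compact_support:
  fixes F :: "'a::euclidean_space \<Rightarrow> complex"
  assumes "continuous_on \<Omega> F" "open \<Omega>" "continuous_on UNIV p" "\<And>x. x \<notin> K \<Longrightarrow> p x = 0" "compact K" "K \<subseteq> \<Omega>"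
  shows "continuous_on UNIV (\<lambda>x. F x * of_real (p x))"
proof -
  have "continuous_on \<Omega> (\<lambda>x. F x * of_real (p x))"
    by (intro continuous_on_mult assms(1) continuous_on_of_real continuous_on_subset[OF assms(3)]) simp
  moreover have "continuous_on (- K) (\<lambda>x. F x * of_real (p x))"
    by (rule continuous_on_eq[OF continuous_on_const[of _ 0]]) (use assms in auto)
  ultimately have "continuous_on (\<Omega> \<union> - K) (\<lambda>x. F x * of_real (p x))"
    using assms compact_imp_closed by (intro continuous_on_open_Un) auto
  moreover have "\<Omega> \<union> - K = UNIV" using assms(6) by blast
  ultimately show ?thesis by simp
qed

lemma integrable_mult_test:
  fixes F :: "R3 \<Rightarrow> complex"
  assumes "continuous_on \<Omega> F" "open \<Omega>" and \<phi>: "test_fun \<Omega> \<phi>"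
  shows "integrable lborel (\<lambda>x. F x * of_real (\<phi> x))"
    and "integrable lborel (\<lambda>x. F x * of_real (pderiv3 i \<phi> x))"
proof -
  note T = test_funD[OF \<phi>]
  let ?K = "closure {x. \<phi> x \<noteq> 0}"
  have *: "integrable lborel (\<lambda>x. F x * of_real (p x))"
    if "continuous_on UNIV p" "\<And>x. x \<notin> ?K \<Longrightarrow> p x = 0" for p :: "R3 \<Rightarrow> real"
  proof -
    have c: "continuous_on UNIV (\<lambda>x. F x * of_real (p x))"
      by (rule continuous_on_mult_compact_support[OF assms(1,2) that(1,2) T(4,5)])
    have z: "F x * of_real (p x) = 0" if "x \<notin> ?K" for x using that \<open>\<And>x. x \<notin> ?K \<Longrightarrow> p x = 0\<close> by simp
    obtain B where B: "\<And>x. norm (F x * of_real (p x)) \<le> B"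
      using continuous_compact_support_bounded[OF c z T(4)] by blast
    show ?thesis
      by (rule integrable_bounded_compact_support[OF borel_measurable_continuous_onI[OF c] B z compact_imp_bounded[OF T(4)]])
  qed
  show "integrable lborel (\<lambda>x. F x * of_real (\<phi> x))" by (rule *[OF T(3) T(6)])
  show "integrable lborel (\<lambda>x. F x * of_real (pderiv3 i \<phi> x))" by (rule *[OF T(2) T(7)])
qed

lemma integral_by_parts_test:
  fixes F :: "R3 \<Rightarrow> complex"
  assumes op: "open \<Omega>" and \<phi>: "test_fun \<Omega> \<phi>"
    and d: "\<And>x. x \<in> \<Omega> \<Longrightarrow> (F has_derivative F' x) (at x)"
    and c: "continuous_on \<Omega> (\<lambda>x. F' x (axis i 1))"
  shows "(\<integral>x. F x * of_real (pderiv3 i \<phi> x) \<partial>lborel) = - (\<integral>x. F' x (axis i 1) * of_real (\<phi> x) \<partial>lborel)"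
proof -
  note T = test_funD[OF \<phi>]
  let ?K = "closure {x. \<phi> x \<noteq> 0}"
  have cF: "continuous_on \<Omega> F" using d by (auto intro!: continuous_at_imp_continuous_on has_derivative_continuous)
  have z: "F x * of_real (\<phi> x) = 0" if "x \<notin> ?K" for x using T(6)[OF that] by simp
  \<comment> \<open>Outside \<Omega> the value F' is arbitrary and need not be a derivative; there
    the product vanishes in a neighbourhood, so 0 is the right value.\<close>
  define P where "P x v = (if x \<in> \<Omega> then F x * of_real (frechet_derivative \<phi> (at x) v) + F' x v * of_real (\<phi> x) else 0)" for x v
  have P: "P x (axis i 1) = F x * of_real (pderiv3 i \<phi> x) + F' x (axis i 1) * of_real (\<phi> x)" for x
  proof (cases "x \<in> \<Omega>")
    case False
    then have "x \<notin> ?K" using T(5) by blast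
    with False T(6)[of x] T(7)[of x i] show ?thesis unfolding P_def by simp
  qed (simp add: P_def pderiv3_def)
  have "(\<integral>x. P x (axis i 1) \<partial>lborel) = 0"
  proof (rule integral_directional_derivative_zero[OF _ _ T(4)])
    show "((\<lambda>x. F x * of_real (\<phi> x)) has_derivative P x) (at x)" for x
    proof (cases "x \<in> \<Omega>")
      case True
      have "((\<lambda>x. of_real (\<phi> x) :: complex) has_derivative (\<lambda>v. of_real (frechet_derivative \<phi> (at x) v))) (at x)"
        using T(1) by (rule has_derivative_of_real)
      from has_derivative_mult[OF d[OF True] this] show ?thesis using True by (simp add: P_def[abs_def])
    next
      case False
      then have "x \<notin> ?K" using T(5) by blast
      then have "((\<lambda>x. F x * of_real (\<phi> x)) has_derivative (\<lambda>v. 0)) (at x)"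
        by (rule has_derivative_zero_off_closed[OF closed_closure _ z])
      then show ?thesis using False by (simp add: P_def[abs_def])
    qed
    show "continuous_on UNIV (\<lambda>x. P x (axis i 1))" unfolding P
      by (intro continuous_on_add continuous_on_mult_compact_support[OF cF op T(2) T(7) T(4) T(5)]
          continuous_on_mult_compact_support[OF c op T(3) T(6) T(4) T(5)])
    show "F x * of_real (\<phi> x) = 0" if "x \<notin> ?K" for x by (rule z[OF that])
  qed
  then show ?thesis unfolding P
    using integrable_mult_test(2)[OF cF op \<phi>, of i] integrable_mult_test(1)[OF c op \<phi>]
    by (simp add: eq_neg_iff_add_eq_0)
qed

section \<open>The fundamental solution\<close>

lemma integrable_singular_kernel:
  fixes x :: R3
  assumes "0 \<le> \<beta>" "\<beta> < 3" "S \<in> sets borel" "bounded S"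
  shows "integrable lborel (\<lambda>y. norm (x - y) powr - \<beta> * indicator S y)"
proof (rule integrableI_bounded)
  show "(\<lambda>y. norm (x - y) powr - \<beta> * indicator S y) \<in> borel_measurable lborel"
    using assms(3) by measurable
  obtain C where "(\<integral>\<^sup>+y\<in>S. ennreal (norm (x - y) powr - \<beta>) \<partial>lborel) \<le> ennreal C"
    using riesz_kernel_uniform_bound[OF assms] by metis
  moreover have "(\<integral>\<^sup>+y. ennreal (norm (norm (x - y) powr - \<beta> * indicator S y)) \<partial>lborel)
      = (\<integral>\<^sup>+y\<in>S. ennreal (norm (x - y) powr - \<beta>) \<partial>lborel)"
    by (rule nn_integral_cong) (auto simp: indicator_def)
  ultimately have "(\<integral>\<^sup>+y. ennreal (norm (norm (x - y) powr - \<beta> * indicator S y)) \<partial>lborel) \<le> ennreal C"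
    by simp
  also have "\<dots> < \<infinity>" by simp
  finally show "(\<integral>\<^sup>+y. ennreal (norm (norm (x - y) powr - \<beta> * indicator S y)) \<partial>lborel) < \<infinity>" .
qed

lemma norm_powr_minus_1: "norm x powr - 1 = 1 / norm x"
  by (simp add: powr_minus_divide)

lemma norm_powr_minus_2: "norm x powr - 2 = 1 / (norm x)\<^sup>2"
  by (cases "norm x = 0") (simp_all add: powr_minus_divide)

lemma norm_fE_le: "x \<noteq> 0 \<Longrightarrow> norm (fE k (rho \<epsilon> x)) \<le> norm x powr - 1"
  using norm_fE[OF rho_pos[of x \<epsilon>], of k] norm_le_rho[of x \<epsilon>]
  by (simp add: norm_powr_minus_1 frac_le)

lemma norm_fA_le:
  assumes "x \<noteq> 0" "k \<ge> 0"
  shows "norm x * norm (fA k (rho \<epsilon> x)) \<le> k * norm x powr - 1 + norm x powr - 2"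
proof -
  let ?r = "rho \<epsilon> x"
  have r: "?r > 0" "norm x > 0" "norm x \<le> ?r" using rho_pos norm_le_rho assms by auto
  have "norm x * norm (fA k ?r) \<le> ?r * (k / ?r\<^sup>2 + 1 / ?r ^ 3)"
    using r assms norm_fA[OF r(1) assms(2)] less_imp_le[OF r(1)] by (intro mult_mono) auto
  also have "\<dots> = k * (1 / ?r) + 1 / ?r\<^sup>2" using r by (simp add: field_simps eval_nat_numeral)
  also have "\<dots> \<le> k * (1 / norm x) + 1 / (norm x)\<^sup>2"
    using r assms by (intro add_mono mult_left_mono frac_le power_mono) auto
  finally show ?thesis unfolding norm_powr_minus_1 norm_powr_minus_2 .
qed

lemma norm_component_fA_le:
  assumes "x \<noteq> 0" "k \<ge> 0"
  shows "norm (of_real (x $ i) * fA k (rho \<epsilon> x)) \<le> k * norm x powr - 1 + norm x powr - 2"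
proof -
  have "norm (of_real (x $ i) * fA k (rho \<epsilon> x)) \<le> norm x * norm (fA k (rho \<epsilon> x))"
    by (simp add: norm_mult mult_right_mono component_le_norm_cart)
  then show ?thesis by (rule order_trans) (rule norm_fA_le[OF assms])
qed

lemma has_derivative_fE_shift:
  assumes "x \<noteq> y \<or> \<epsilon> \<noteq> 0"
  shows "((\<lambda>x. fE k (rho \<epsilon> (x - y))) has_derivative (\<lambda>v. of_real ((x - y) \<bullet> v) * fA k (rho \<epsilon> (x - y)))) (at x)"
proof -
  have x: "x - y \<noteq> 0 \<or> \<epsilon> \<noteq> 0" using assms by simp
  have "((\<lambda>x. x - y) has_derivative (\<lambda>v. v)) (at x)" by (auto intro!: derivative_eq_intros)
  moreover have "((\<lambda>x. fE k (rho \<epsilon> x)) has_derivative (\<lambda>v. of_real ((x - y) \<bullet> v) * fA k (rho \<epsilon> (x - y)))) (at (x - y))"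
    using rho_pos[OF x] by (intro has_derivative_radial fE_deriv x) simp
  ultimately show ?thesis by (rule has_derivative_compose)
qed

lemma has_derivative_fA_shift:
  assumes "x \<noteq> y \<or> \<epsilon> \<noteq> 0"
  shows "((\<lambda>x. fA k (rho \<epsilon> (x - y))) has_derivative (\<lambda>v. of_real ((x - y) \<bullet> v) * fB k (rho \<epsilon> (x - y)))) (at x)"
proof -
  have x: "x - y \<noteq> 0 \<or> \<epsilon> \<noteq> 0" using assms by simp
  have "((\<lambda>x. x - y) has_derivative (\<lambda>v. v)) (at x)" by (auto intro!: derivative_eq_intros)
  moreover have "((\<lambda>x. fA k (rho \<epsilon> x)) has_derivative (\<lambda>v. of_real ((x - y) \<bullet> v) * fB k (rho \<epsilon> (x - y)))) (at (x - y))"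
    using rho_pos[OF x] by (intro has_derivative_radial fA_deriv x) simp
  ultimately show ?thesis by (rule has_derivative_compose)
qed

lemma has_derivative_component_shift:
  "((\<lambda>x::R3. of_real ((x - y) $ i) :: complex) has_derivative (\<lambda>v. of_real (v $ i))) (at x)"
  by (auto intro!: derivative_eq_intros bounded_linear_imp_has_derivative bounded_linear_vec_nth)

lemma has_derivative_gradE_shift:
  assumes "x \<noteq> y \<or> \<epsilon> \<noteq> 0"
  shows "((\<lambda>x. of_real ((x - y) $ i) * fA k (rho \<epsilon> (x - y))) has_derivative
    (\<lambda>v. of_real ((x - y) $ i) * (of_real ((x - y) \<bullet> v) * fB k (rho \<epsilon> (x - y))) + of_real (v $ i) * fA k (rho \<epsilon> (x - y)))) (at x)"
  by (rule has_derivative_mult[OF has_derivative_component_shift has_derivative_fA_shift[OF assms]])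

lemma kern_shift_continuous_on:
  assumes "kern k \<epsilon> F" "\<epsilon> \<noteq> 0 \<or> y \<notin> S"
  shows "continuous_on S (\<lambda>x. F (x - y))"
proof (rule continuous_at_imp_continuous_on, rule ballI)
  fix x assume "x \<in> S"
  with assms(2) have "x - y \<noteq> 0 \<or> \<epsilon> \<noteq> 0" by auto
  note nz = this
  have "isCont (\<lambda>x. x - y) x" by (intro continuous_intros)
  then show "isCont (\<lambda>x. F (x - y)) x"
    by (rule isCont_o2) (rule kern_isCont[OF assms(1) nz])
qed

lemma kern_component: "kern k \<epsilon> (\<lambda>x. of_real (x $ i))"
  using kern_inner[of k \<epsilon> "axis i 1"] by (simp add: inner_axis)

text \<open>The Laplacian of (|x|^2 + \<epsilon>^2)^(-1/2) is -3 \<epsilon>^2 (|x|^2 +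
  \<epsilon>^2)^(-5/2). This is the total mass of its negative at \<epsilon> = 1, which by scaling
  is the mass for every \<epsilon> > 0.\<close>

definition kappa :: real where
  "kappa = (\<integral>x. 3 / (sqrt (1 + (norm (x::R3))\<^sup>2)) ^ 5 \<partial>lborel)"

lemma integrable_bracket: "integrable lborel (\<lambda>x::R3. 3 / (sqrt (1 + (norm x)\<^sup>2)) ^ 5)"
proof -
  have "integrable lborel (\<lambda>x::R3. 1 / (sqrt (1 + (norm x)\<^sup>2)) ^ 5)"
  proof (rule integrableI_bounded)
    show "(\<integral>\<^sup>+x. ennreal (norm (1 / (sqrt (1 + (norm (x::R3))\<^sup>2)) ^ 5)) \<partial>lborel) < \<infinity>"
      using nn_integral_japanese_bracket_finite by (simp add: abs_of_nonneg)
  qed simp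
  from integrable_mult_right[OF this, of 3] show ?thesis by simp
qed

lemma kappa_pos: "kappa > 0"
proof -
  have "kappa \<noteq> 0"
  proof
    assume "kappa = 0"
    then have "AE x::R3 in lborel. 3 / (sqrt (1 + (norm x)\<^sup>2)) ^ 5 = 0"
      unfolding kappa_def using integral_nonneg_eq_0_iff_AE[OF integrable_bracket] by simp
    moreover have "3 / (sqrt (1 + (norm x)\<^sup>2)) ^ 5 \<noteq> 0" for x :: R3
      by (simp add: add_nonneg_eq_0_iff)
    ultimately have "AE x::R3 in lborel. False" by simp
    then have "emeasure lborel (UNIV :: R3 set) = 0" unfolding eventually_False ae_filter_eq_bot_iff by simp
    then show False by simp
  qed
  moreover have "kappa \<ge> 0" unfolding kappa_def by (rule integral_nonneg_AE) simp
  ultimately show ?thesis by simp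
qed

lemma sum_component_squares: "(\<Sum>i\<in>UNIV. of_real ((v $ i)\<^sup>2) :: complex) = of_real (norm v) ^ 2" for v :: R3
proof -
  have "(\<Sum>i\<in>UNIV. (v $ i)\<^sup>2) = (norm v)\<^sup>2" by (simp add: norm_vec_def L2_set_def sum_nonneg)
  then show ?thesis by (simp flip: of_real_sum of_real_power)
qed

text \<open>The divergence of x \<open>fA\<close> is 3 \<open>fA\<close> + |x|^2 \<open>fB\<close>
  with |x|^2 = \<open>rho\<close>^2 - \<epsilon>^2. The radial Helmholtz identity absorbs the part
  with \<open>rho\<close>^2 and leaves the defect \<epsilon>^2 \<open>fB\<close>. As the kernels are
  smooth everywhere, no boundary terms arise.\<close>

lemma regularised_helmholtz:
  assumes e: "\<epsilon> > 0" and \<phi>: "test_fun UNIV \<phi>"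
  shows "(\<integral>x. fE k (rho \<epsilon> (x - y)) * of_real (pderiv3 i \<phi> x) \<partial>lborel)
      = - (\<integral>x. of_real ((x - y) $ i) * fA k (rho \<epsilon> (x - y)) * of_real (\<phi> x) \<partial>lborel)"
    and "(\<integral>x. (\<Sum>i\<in>UNIV. of_real ((x - y) $ i) * fA k (rho \<epsilon> (x - y)) * of_real (pderiv3 i \<phi> x))
           - (of_real k)\<^sup>2 * fE k (rho \<epsilon> (x - y)) * of_real (\<phi> x) \<partial>lborel)
      = (\<integral>x. of_real (\<epsilon>\<^sup>2) * fB k (rho \<epsilon> (x - y)) * of_real (\<phi> x) \<partial>lborel)"
proof -
  define E where "E x = fE k (rho \<epsilon> (x - y))" for x
  define A where "A x = fA k (rho \<epsilon> (x - y))" for x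
  define B where "B x = fB k (rho \<epsilon> (x - y))" for x
  have cE: "continuous_on UNIV E" unfolding E_def using e by (intro kern_shift_continuous_on[OF kern_fE]) auto
  have cA: "continuous_on UNIV A" unfolding A_def using e by (intro kern_shift_continuous_on[OF kern_fA]) auto
  have cB: "continuous_on UNIV B" unfolding B_def using e by (intro kern_shift_continuous_on[OF kern_fB]) auto
  have ax: "v \<bullet> axis i 1 = v $ i" for v :: R3 and i by (simp add: inner_axis)
  show "(\<integral>x. fE k (rho \<epsilon> (x - y)) * of_real (pderiv3 i \<phi> x) \<partial>lborel)
      = - (\<integral>x. of_real ((x - y) $ i) * fA k (rho \<epsilon> (x - y)) * of_real (\<phi> x) \<partial>lborel)"
    unfolding ax[symmetric]
  proof (rule integral_by_parts_test[OF open_UNIV \<phi>])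
    show "((\<lambda>x. fE k (rho \<epsilon> (x - y))) has_derivative (\<lambda>v. of_real ((x - y) \<bullet> v) * fA k (rho \<epsilon> (x - y)))) (at x)" for x
      by (rule has_derivative_fE_shift) (use e in simp)
    show "continuous_on UNIV (\<lambda>x. of_real ((x - y) \<bullet> axis i 1) * fA k (rho \<epsilon> (x - y)))"
      using cA unfolding A_def by (intro continuous_intros)
  qed
  have parts: "(\<integral>x. of_real ((x - y) $ i) * A x * of_real (pderiv3 i \<phi> x) \<partial>lborel)
      = - (\<integral>x. (of_real (((x - y) $ i)\<^sup>2) * B x + A x) * of_real (\<phi> x) \<partial>lborel)" for i
  proof -
    have "(\<integral>x. of_real ((x - y) $ i) * A x * of_real (pderiv3 i \<phi> x) \<partial>lborel)
      = - (\<integral>x. (of_real ((x - y) $ i) * (of_real ((x - y) \<bullet> axis i 1) * B x) + of_real (axis i 1 $ i) * A x) * of_real (\<phi> x) \<partial>lborel)"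
      unfolding A_def B_def
    proof (rule integral_by_parts_test[OF open_UNIV \<phi>])
      show "((\<lambda>x. of_real ((x - y) $ i) * fA k (rho \<epsilon> (x - y))) has_derivative
        (\<lambda>v. of_real ((x - y) $ i) * (of_real ((x - y) \<bullet> v) * fB k (rho \<epsilon> (x - y))) + of_real (v $ i) * fA k (rho \<epsilon> (x - y)))) (at x)" for x
        by (rule has_derivative_gradE_shift) (use e in simp)
      show "continuous_on UNIV (\<lambda>x. of_real ((x - y) $ i) * (of_real ((x - y) \<bullet> axis i 1) * fB k (rho \<epsilon> (x - y))) + of_real (axis i 1 $ i) * fA k (rho \<epsilon> (x - y)))"
        using cA cB unfolding A_def B_def by (intro continuous_intros)
    qed
    then show ?thesis unfolding ax by (simp add: power2_eq_square mult.assoc axis_def)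
  qed
  have int1: "integrable lborel (\<lambda>x. of_real ((x - y) $ i) * A x * of_real (pderiv3 i \<phi> x))" for i
    by (intro integrable_mult_test(2)[OF _ open_UNIV \<phi>] continuous_intros cA)
  have int2: "integrable lborel (\<lambda>x. (of_real (((x - y) $ i)\<^sup>2) * B x + A x) * of_real (\<phi> x))" for i
    by (intro integrable_mult_test(1)[OF _ open_UNIV \<phi>] continuous_intros cA cB)
  have int3: "integrable lborel (\<lambda>x. (of_real k)\<^sup>2 * E x * of_real (\<phi> x))"
    by (intro integrable_mult_test(1)[OF _ open_UNIV \<phi>] continuous_intros cE)
  have "(\<integral>x. (\<Sum>i\<in>UNIV. of_real ((x - y) $ i) * A x * of_real (pderiv3 i \<phi> x)) - (of_real k)\<^sup>2 * E x * of_real (\<phi> x) \<partial>lborel)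
    = (\<Sum>i\<in>UNIV. \<integral>x. of_real ((x - y) $ i) * A x * of_real (pderiv3 i \<phi> x) \<partial>lborel)
      - (\<integral>x. (of_real k)\<^sup>2 * E x * of_real (\<phi> x) \<partial>lborel)"
    using int1 int3 by simp
  also have "\<dots> = (\<Sum>i\<in>UNIV. - (\<integral>x. (of_real (((x - y) $ i)\<^sup>2) * B x + A x) * of_real (\<phi> x) \<partial>lborel))
      - (\<integral>x. (of_real k)\<^sup>2 * E x * of_real (\<phi> x) \<partial>lborel)"
    by (simp only: parts)
  also have "\<dots> = (\<integral>x. - (\<Sum>i\<in>UNIV. (of_real (((x - y) $ i)\<^sup>2) * B x + A x) * of_real (\<phi> x)) - (of_real k)\<^sup>2 * E x * of_real (\<phi> x) \<partial>lborel)"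
    using int2 int3 by (simp add: sum_negf)
  also have "\<dots> = (\<integral>x. of_real (\<epsilon>\<^sup>2) * B x * of_real (\<phi> x) \<partial>lborel)"
  proof (rule Bochner_Integration.integral_cong[OF refl])
    fix x
    have r: "rho \<epsilon> (x - y) \<noteq> 0" using rho_pos[of "x - y" \<epsilon>] e by simp
    have S: "(\<Sum>i\<in>UNIV. of_real (((x - y) $ i)\<^sup>2) :: complex) = of_real ((rho \<epsilon> (x - y))\<^sup>2) - of_real (\<epsilon>\<^sup>2)"
      unfolding sum_component_squares by (simp add: rho_square)
    have "(\<Sum>i\<in>UNIV. (of_real (((x - y) $ i)\<^sup>2) * B x + A x) * of_real (\<phi> x))
      = ((\<Sum>i\<in>UNIV. of_real (((x - y) $ i)\<^sup>2)) * B x + 3 * A x) * of_real (\<phi> x)"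
      by (simp add: sum_distrib_right[symmetric] sum.distrib)
    also have "\<dots> = (3 * A x + of_real (rho \<epsilon> (x - y)) ^ 2 * B x - of_real (\<epsilon>\<^sup>2) * B x) * of_real (\<phi> x)"
      unfolding S by (simp add: algebra_simps)
    also have "3 * A x + of_real (rho \<epsilon> (x - y)) ^ 2 * B x = - (of_real k)\<^sup>2 * E x"
      unfolding A_def B_def E_def by (rule fE_laplace[OF r])
    finally have S2: "(\<Sum>i\<in>UNIV. (of_real (((x - y) $ i)\<^sup>2) * B x + A x) * of_real (\<phi> x))
        = (- (of_real k)\<^sup>2 * E x - of_real (\<epsilon>\<^sup>2) * B x) * of_real (\<phi> x)" .
    show "- (\<Sum>i\<in>UNIV. (of_real (((x - y) $ i)\<^sup>2) * B x + A x) * of_real (\<phi> x)) - (of_real k)\<^sup>2 * E x * of_real (\<phi> x)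
        = of_real (\<epsilon>\<^sup>2) * B x * of_real (\<phi> x)"
      unfolding S2 by (simp add: algebra_simps)
  qed
  finally show "(\<integral>x. (\<Sum>i\<in>UNIV. of_real ((x - y) $ i) * fA k (rho \<epsilon> (x - y)) * of_real (pderiv3 i \<phi> x))
           - (of_real k)\<^sup>2 * fE k (rho \<epsilon> (x - y)) * of_real (\<phi> x) \<partial>lborel)
      = (\<integral>x. of_real (\<epsilon>\<^sup>2) * fB k (rho \<epsilon> (x - y)) * of_real (\<phi> x) \<partial>lborel)"
    unfolding A_def B_def E_def .
qed

text \<open>In dimension three |\<xi>|^-1 and |\<xi>|^-2 are locally integrable, so they dominate on
  the compact support of p; the singular point is a null set. A constant sequence H gives plain
  integrability.\<close>

lemma singular_kernel_dct:
  fixes H :: "nat \<Rightarrow> R3 \<Rightarrow> complex" and p :: "R3 \<Rightarrow> complex"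
  assumes [measurable]: "\<And>n. H n \<in> borel_measurable borel" "H0 \<in> borel_measurable borel"
    and bd: "\<And>n \<xi>. \<xi> \<noteq> 0 \<Longrightarrow> norm (H n \<xi>) \<le> c1 * norm \<xi> powr - 1 + c2 * norm \<xi> powr - 2"
    and lim: "\<And>\<xi>. \<xi> \<noteq> 0 \<Longrightarrow> (\<lambda>n. H n \<xi>) \<longlonglongrightarrow> H0 \<xi>"
    and p[measurable]: "p \<in> borel_measurable borel"
    and pB: "\<And>x. norm (p x) \<le> B" and pK: "\<And>x. x \<notin> K \<Longrightarrow> p x = 0" and K: "compact K"
  shows "(\<lambda>n. \<integral>x. H n (x - y) * p x \<partial>lborel) \<longlonglongrightarrow> (\<integral>x. H0 (x - y) * p x \<partial>lborel)"
    and "integrable lborel (\<lambda>x. H0 (x - y) * p x)"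
    and "integrable lborel (\<lambda>x. H n (x - y) * p x)"
proof -
  define w where "w x = (c1 * (norm (y - x) powr - 1 * indicator K x) + c2 * (norm (y - x) powr - 2 * indicator K x)) * B" for x
  have K': "K \<in> sets borel" "bounded K" using K by (auto intro: compact_imp_bounded borel_compact)
  have w: "integrable lborel w" unfolding w_def
    by (intro integrable_mult_left Bochner_Integration.integrable_add integrable_mult_right integrable_singular_kernel K') auto
  have neq: "AE x in lborel. x \<noteq> y" using AE_lborel_singleton[of y] by simp
  have B: "B \<ge> 0" using pB[of y] norm_ge_zero order_trans by blast
  have dom: "AE x in lborel. norm (H n (x - y) * p x) \<le> w x" for n
    using neq
  proof eventually_elim
    case (elim x)
    show ?case
    proof (cases "x \<in> K")
      case True
      have "norm (H n (x - y) * p x) \<le> (c1 * norm (x - y) powr - 1 + c2 * norm (x - y) powr - 2) * B"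
      proof -
        have nz: "x - y \<noteq> 0" using elim by simp
        show ?thesis unfolding norm_mult
          by (intro mult_mono bd[OF nz] pB norm_ge_zero order_trans[OF norm_ge_zero bd[OF nz, of n]])
      qed
      then show ?thesis using True by (simp add: w_def norm_minus_commute)
    qed (simp add: pK w_def)
  qed
  have lim': "AE x in lborel. (\<lambda>n. H n (x - y) * p x) \<longlonglongrightarrow> H0 (x - y) * p x"
    using neq by eventually_elim (auto intro!: tendsto_mult_right lim)
  show "(\<lambda>n. \<integral>x. H n (x - y) * p x \<partial>lborel) \<longlonglongrightarrow> (\<integral>x. H0 (x - y) * p x \<partial>lborel)"
    by (rule integral_dominated_convergence[OF _ _ w lim' dom]) measurable
  show "integrable lborel (\<lambda>x. H0 (x - y) * p x)"
    by (rule integrable_dominated_convergence[OF _ _ w lim' dom]) measurable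
  show "integrable lborel (\<lambda>x. H n (x - y) * p x)"
    by (rule integrable_dominated_convergence2[OF _ _ w lim' dom]) measurable
qed

lemma rho_tendsto_norm: "(\<lambda>n. rho (inverse (real (Suc n))) x) \<longlonglongrightarrow> norm x"
proof -
  have "(\<lambda>n. sqrt ((norm x)\<^sup>2 + (inverse (real (Suc n)))\<^sup>2)) \<longlonglongrightarrow> sqrt ((norm x)\<^sup>2 + 0\<^sup>2)"
    by (intro tendsto_intros LIMSEQ_inverse_real_of_nat)
  then show ?thesis by (simp add: rho_def)
qed

lemma fE_rho_tendsto:
  assumes "x \<noteq> 0" shows "(\<lambda>n. fE k (rho (inverse (real (Suc n))) x)) \<longlonglongrightarrow> fE k (norm x)"
  by (rule isCont_tendsto_compose[OF has_vector_derivative_continuous[OF fE_deriv] rho_tendsto_norm])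
     (use assms in simp)

lemma fA_rho_tendsto:
  assumes "x \<noteq> 0" shows "(\<lambda>n. fA k (rho (inverse (real (Suc n))) x)) \<longlonglongrightarrow> fA k (norm x)"
  by (rule isCont_tendsto_compose[OF has_vector_derivative_continuous[OF fA_deriv] rho_tendsto_norm])
     (use assms in simp)

lemma test_fun_measurable:
  assumes "test_fun \<Omega> \<phi>"
  shows "\<phi> \<in> borel_measurable borel" "pderiv3 i \<phi> \<in> borel_measurable borel"
  using test_funD(2,3)[OF assms] borel_measurable_continuous_onI by auto

text \<open>The regularised kernels satisfy the Helmholtz equation up to \<open>\<epsilon>\<^sup>2 fB\<close>, whose leading part
  is an approximate multiple of a point mass; after rescaling by \<open>\<epsilon>\<close> it becomes the integrand of
  \<^term>\<open>kappa\<close>. The value \<open>kappa = 4 \<pi>\<close> is never needed.\<close>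

lemma approximate_point_mass:
  fixes \<phi> :: "R3 \<Rightarrow> real"
  assumes k: "k \<ge> 0" and \<phi>: "test_fun UNIV \<phi>"
  shows "(\<lambda>n. \<integral>x. of_real ((inverse (real (Suc n)))\<^sup>2) * fB k (rho (inverse (real (Suc n))) (x - y)) * of_real (\<phi> x) \<partial>lborel)
    \<longlonglongrightarrow> of_real (kappa * \<phi> y)"
proof -
  define \<epsilon> where "\<epsilon> n = inverse (real (Suc n))" for n
  have e: "\<epsilon> n > 0" "\<epsilon> n \<le> 1" for n unfolding \<epsilon>_def by (auto simp: inverse_le_1_iff)
  have e0: "\<epsilon> \<longlonglongrightarrow> 0" unfolding \<epsilon>_def by (rule LIMSEQ_inverse_real_of_nat)
  obtain Bd K where BK: "Bd \<ge> 0" "compact K" "\<And>x. x \<notin> K \<Longrightarrow> \<phi> x = 0" "\<And>x. \<bar>\<phi> x\<bar> \<le> Bd"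
    using test_fun_bounds[OF \<phi>] by metis
  have [measurable]: "\<phi> \<in> borel_measurable borel" by (rule test_fun_measurable[OF \<phi>])
  have c\<phi>: "isCont \<phi> x" for x using test_funD(3)[OF \<phi>] by (simp add: continuous_on_eq_continuous_at)
  define M where "M \<epsilon> \<xi> = of_real (\<epsilon>\<^sup>2) * (exp (\<i> * of_real k * of_real (rho \<epsilon> \<xi>)) * (3 / of_real (rho \<epsilon> \<xi>) ^ 5))" for \<epsilon> \<xi>
  \<comment> \<open>Off the leading part, \<open>fB\<close> is of order \<open>rho\<close>^-3 and
    \<open>rho\<close>^-4. Because \<epsilon> \<le> \<open>rho\<close>, the factor \<epsilon>^2
    lowers both orders by two, which gives an integrable majorant and pointwise limit 0.\<close>
  define H where "H n \<xi> = of_real ((\<epsilon> n)\<^sup>2) * fB k (rho (\<epsilon> n) \<xi>) - M (\<epsilon> n) \<xi>" for n \<xi>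
  have Hb: "norm (H n \<xi>) \<le> (\<epsilon> n)\<^sup>2 * (k\<^sup>2 / rho (\<epsilon> n) \<xi> ^ 3 + 3 * k / rho (\<epsilon> n) \<xi> ^ 4)" if "\<xi> \<noteq> 0" for n \<xi>
  proof -
    have r: "rho (\<epsilon> n) \<xi> > 0" using that rho_pos by simp
    have "H n \<xi> = of_real ((\<epsilon> n)\<^sup>2) * (exp (\<i> * of_real k * of_real (rho (\<epsilon> n) \<xi>)) *
        (- ((of_real k)\<^sup>2 / of_real (rho (\<epsilon> n) \<xi>) ^ 3) - 3 * \<i> * of_real k / of_real (rho (\<epsilon> n) \<xi>) ^ 4))"
      unfolding H_def fB_def M_def by (simp add: algebra_simps)
    then have "norm (H n \<xi>) = (\<epsilon> n)\<^sup>2 * norm (- ((complex_of_real k)\<^sup>2 / of_real (rho (\<epsilon> n) \<xi>) ^ 3) - 3 * \<i> * of_real k / of_real (rho (\<epsilon> n) \<xi>) ^ 4)"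
      by (simp add: norm_mult norm_power)
    also have "\<dots> \<le> (\<epsilon> n)\<^sup>2 * (k\<^sup>2 / rho (\<epsilon> n) \<xi> ^ 3 + 3 * k / rho (\<epsilon> n) \<xi> ^ 4)"
      using r k by (intro mult_left_mono order_trans[OF norm_triangle_ineq4]) (auto simp: norm_divide norm_mult norm_power)
    finally show ?thesis .
  qed
  have "(\<lambda>n. \<integral>x. H n (x - y) * of_real (\<phi> x) \<partial>lborel) \<longlonglongrightarrow> (\<integral>x. 0 * of_real (\<phi> x) \<partial>lborel)"
  proof (rule singular_kernel_dct(1)[where ?c1.0 = "k\<^sup>2" and ?c2.0 = "3 * k" and K = K and B = Bd and ?H0.0 = "\<lambda>x. 0"])
    show "H n \<in> borel_measurable borel" for n unfolding H_def M_def by measurable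
    show "norm (H n \<xi>) \<le> k\<^sup>2 * norm \<xi> powr - 1 + 3 * k * norm \<xi> powr - 2" if "\<xi> \<noteq> 0" for n \<xi>
    proof -
      let ?r = "rho (\<epsilon> n) \<xi>"
      have r: "?r > 0" "norm \<xi> \<le> ?r" "norm \<xi> > 0" "\<epsilon> n \<le> ?r" using that rho_pos norm_le_rho eps_le_rho by auto
      have "(\<epsilon> n)\<^sup>2 * (k\<^sup>2 / ?r ^ 3 + 3 * k / ?r ^ 4) \<le> ?r\<^sup>2 * (k\<^sup>2 / ?r ^ 3 + 3 * k / ?r ^ 4)"
        using r k e[of n] by (intro mult_right_mono power_mono) auto
      also have "\<dots> = k\<^sup>2 * (1 / ?r) + 3 * k * (1 / ?r\<^sup>2)" using r by (simp add: field_simps eval_nat_numeral)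
      also have "\<dots> \<le> k\<^sup>2 * (1 / norm \<xi>) + 3 * k * (1 / (norm \<xi>)\<^sup>2)"
        using r k by (intro add_mono mult_left_mono frac_le power_mono) auto
      finally show ?thesis using Hb[OF that, of n] unfolding norm_powr_minus_1 norm_powr_minus_2 by linarith
    qed
    show "(\<lambda>n. H n \<xi>) \<longlonglongrightarrow> 0" if "\<xi> \<noteq> 0" for \<xi>
    proof (rule Lim_null_comparison)
      show "\<forall>\<^sub>F n in sequentially. norm (H n \<xi>) \<le> (\<epsilon> n)\<^sup>2 * (k\<^sup>2 / rho (\<epsilon> n) \<xi> ^ 3 + 3 * k / rho (\<epsilon> n) \<xi> ^ 4)"
        using Hb[OF that] by simp
      have "(\<lambda>n. (\<epsilon> n)\<^sup>2 * (k\<^sup>2 / rho (\<epsilon> n) \<xi> ^ 3 + 3 * k / rho (\<epsilon> n) \<xi> ^ 4)) \<longlonglongrightarrow> 0\<^sup>2 * (k\<^sup>2 / norm \<xi> ^ 3 + 3 * k / norm \<xi> ^ 4)"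
        unfolding \<epsilon>_def using that by (intro tendsto_intros rho_tendsto_norm LIMSEQ_inverse_real_of_nat) auto
      then show "(\<lambda>n. (\<epsilon> n)\<^sup>2 * (k\<^sup>2 / rho (\<epsilon> n) \<xi> ^ 3 + 3 * k / rho (\<epsilon> n) \<xi> ^ 4)) \<longlonglongrightarrow> 0" by simp
    qed
  qed (use BK in auto)
  then have lim1: "(\<lambda>n. \<integral>x. H n (x - y) * of_real (\<phi> x) \<partial>lborel) \<longlonglongrightarrow> 0" by simp
  define s where "s t = sqrt (1 + (norm (t::R3))\<^sup>2)" for t
  have s1: "s t \<ge> 1" for t unfolding s_def by simp
  have [measurable]: "s \<in> borel_measurable borel" unfolding s_def by measurable
  have ks: "integrable lborel (\<lambda>t. 3 / s t ^ 5)" unfolding s_def by (rule integrable_bracket)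
  define G where "G n t = exp (\<i> * of_real k * of_real (\<epsilon> n * s t)) * of_real (3 / s t ^ 5) * of_real (\<phi> (y + \<epsilon> n *\<^sub>R t))" for n t
  \<comment> \<open>The substitution x = y + \<epsilon> t gives \<open>rho\<close> = \<epsilon>
    s(t). The factor \<epsilon>^2, the Jacobian \<epsilon>^3 and \<epsilon>^-5 from the kernel
    cancel, so \<epsilon> survives only in the phase and in the argument of \<phi>.\<close>
  have scale: "(\<integral>x. M (\<epsilon> n) (x - y) * of_real (\<phi> x) \<partial>lborel) = (\<integral>t. G n t \<partial>lborel)" for n
  proof -
    have rs: "rho (\<epsilon> n) (\<epsilon> n *\<^sub>R t) = \<epsilon> n * s t" for t
    proof -
      have "(norm (\<epsilon> n *\<^sub>R t))\<^sup>2 + (\<epsilon> n)\<^sup>2 = (\<epsilon> n)\<^sup>2 * (1 + (norm t)\<^sup>2)" by (simp add: power_mult_distrib algebra_simps)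
      then show ?thesis using e[of n] unfolding rho_def s_def by (simp add: real_sqrt_mult)
    qed
    have "(\<integral>x. M (\<epsilon> n) (x - y) * of_real (\<phi> x) \<partial>lborel)
      = (\<epsilon> n) ^ 3 *\<^sub>R (\<integral>t. M (\<epsilon> n) ((y + \<epsilon> n *\<^sub>R t) - y) * of_real (\<phi> (y + \<epsilon> n *\<^sub>R t)) \<partial>lborel)"
      using e[of n] by (subst integral_lborel_affine[of "\<epsilon> n" _ y]) auto
    also have "\<dots> = (\<integral>t. (\<epsilon> n) ^ 3 *\<^sub>R (M (\<epsilon> n) ((y + \<epsilon> n *\<^sub>R t) - y) * of_real (\<phi> (y + \<epsilon> n *\<^sub>R t))) \<partial>lborel)"
      by simp
    also have "\<dots> = (\<integral>t. G n t \<partial>lborel)"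
    proof (rule Bochner_Integration.integral_cong[OF refl])
      fix t
      have nz: "\<epsilon> n \<noteq> 0" "s t \<noteq> 0" using e[of n] s1[of t] by auto
      show "(\<epsilon> n) ^ 3 *\<^sub>R (M (\<epsilon> n) ((y + \<epsilon> n *\<^sub>R t) - y) * of_real (\<phi> (y + \<epsilon> n *\<^sub>R t))) = G n t"
      proof -
        obtain P where P: "\<phi> (y + \<epsilon> n *\<^sub>R t) = P" by blast
        show ?thesis unfolding M_def G_def add_diff_cancel_left' rs P
          using nz by (simp add: scaleR_conv_of_real field_simps eval_nat_numeral)
      qed
    qed
    finally show ?thesis .
  qed
  have "(\<lambda>n. \<integral>t. G n t \<partial>lborel) \<longlonglongrightarrow> (\<integral>t. of_real (3 / s t ^ 5 * \<phi> y) \<partial>lborel)"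
  proof (rule integral_dominated_convergence[where w = "\<lambda>t. 3 / s t ^ 5 * Bd"])
    show "integrable lborel (\<lambda>t. 3 / s t ^ 5 * Bd)" using ks by (rule integrable_mult_left)
    show "G n \<in> borel_measurable lborel" for n unfolding G_def by measurable
    show "AE t in lborel. norm (G n t) \<le> 3 / s t ^ 5 * Bd" for n
    proof (rule AE_I2)
      fix t
      have "norm (G n t) = 3 / s t ^ 5 * \<bar>\<phi> (y + \<epsilon> n *\<^sub>R t)\<bar>"
        unfolding G_def norm_mult norm_exp_ikt norm_of_real using s1[of t] by simp
      then show "norm (G n t) \<le> 3 / s t ^ 5 * Bd" using s1[of t] BK(4) by (simp add: divide_right_mono)
    qed
    show "AE t in lborel. (\<lambda>n. G n t) \<longlonglongrightarrow> of_real (3 / s t ^ 5 * \<phi> y)"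
    proof (rule AE_I2)
      fix t
      have "(\<lambda>n. y + \<epsilon> n *\<^sub>R t) \<longlonglongrightarrow> y + 0 *\<^sub>R t" by (intro tendsto_intros e0)
      then have "(\<lambda>n. \<phi> (y + \<epsilon> n *\<^sub>R t)) \<longlonglongrightarrow> \<phi> y" by (intro isCont_tendsto_compose[OF c\<phi>]) simp
      then have "(\<lambda>n. G n t) \<longlonglongrightarrow> exp (\<i> * of_real k * of_real (0 * s t)) * of_real (3 / s t ^ 5) * of_real (\<phi> y)"
        unfolding G_def by (intro tendsto_intros e0)
      then show "(\<lambda>n. G n t) \<longlonglongrightarrow> of_real (3 / s t ^ 5 * \<phi> y)" by simp
    qed
  qed measurable
  also have "(\<integral>t. of_real (3 / s t ^ 5 * \<phi> y) \<partial>lborel) = complex_of_real (kappa * \<phi> y)"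
  proof -
    have "(\<integral>t. 3 / s t ^ 5 * \<phi> y \<partial>lborel) = kappa * \<phi> y"
      unfolding kappa_def s_def by (rule Bochner_Integration.integral_mult_left_zero)
    then show ?thesis by (simp only: integral_complex_of_real)
  qed
  finally have lim2: "(\<lambda>n. \<integral>x. M (\<epsilon> n) (x - y) * of_real (\<phi> x) \<partial>lborel) \<longlonglongrightarrow> of_real (kappa * \<phi> y)"
    unfolding scale .
  have split: "(\<integral>x. of_real ((\<epsilon> n)\<^sup>2) * fB k (rho (\<epsilon> n) (x - y)) * of_real (\<phi> x) \<partial>lborel)
      = (\<integral>x. H n (x - y) * of_real (\<phi> x) \<partial>lborel) + (\<integral>x. M (\<epsilon> n) (x - y) * of_real (\<phi> x) \<partial>lborel)" for n
  proof -
    have kM: "kern k (\<epsilon> n) (M (\<epsilon> n))" unfolding M_def by (intro kern_mult kern_const kern_exp kern_inverse_power)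
    have "continuous_on UNIV (\<lambda>x. M (\<epsilon> n) (x - y))"
      using e[of n] by (intro kern_shift_continuous_on[OF kM]) auto
    then have iM: "integrable lborel (\<lambda>x. M (\<epsilon> n) (x - y) * of_real (\<phi> x))"
      by (rule integrable_mult_test(1)[OF _ open_UNIV \<phi>])
    have "kern k (\<epsilon> n) (H n)" unfolding H_def by (intro kern_diff kM kern_mult kern_const kern_fB)
    then have "continuous_on UNIV (\<lambda>x. H n (x - y))"
      using e[of n] by (intro kern_shift_continuous_on) auto
    then have iH: "integrable lborel (\<lambda>x. H n (x - y) * of_real (\<phi> x))"
      by (rule integrable_mult_test(1)[OF _ open_UNIV \<phi>])
    show ?thesis
      by (subst Bochner_Integration.integral_add[OF iH iM, symmetric]) (simp add: H_def algebra_simps)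
  qed
  show ?thesis unfolding \<epsilon>_def[symmetric] split using tendsto_add[OF lim1 lim2] by simp
qed

text \<open>Both regularised identities pass to the limit \<epsilon> = 1 / (n + 1) -> 0: E and its
  gradient are dominated by |x - y|^-1 and |x - y|^-2, and the defect tends to a point mass at y.
  The second identity is the distributional Helmholtz equation of e^(ikr) / r.\<close>

lemma
  assumes k: "k \<ge> 0" and \<phi>: "test_fun UNIV \<phi>"
  shows fundamental_solution_gradient:
      "(\<integral>x. fE k (norm (x - y)) * of_real (pderiv3 i \<phi> x) \<partial>lborel)
        = - (\<integral>x. of_real ((x - y) $ i) * fA k (norm (x - y)) * of_real (\<phi> x) \<partial>lborel)"
    and fundamental_solution_helmholtz:
      "(\<integral>x. (\<Sum>i\<in>UNIV. of_real ((x - y) $ i) * fA k (norm (x - y)) * of_real (pderiv3 i \<phi> x))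
           - (of_real k)\<^sup>2 * fE k (norm (x - y)) * of_real (\<phi> x) \<partial>lborel) = of_real (kappa * \<phi> y)"
proof -
  define \<epsilon> where "\<epsilon> n = inverse (real (Suc n))" for n
  have e: "\<epsilon> n > 0" for n unfolding \<epsilon>_def by simp
  obtain Bd K where BK: "Bd \<ge> 0" "compact K" "\<And>x. x \<notin> K \<Longrightarrow> \<phi> x = 0" "\<And>i x. x \<notin> K \<Longrightarrow> pderiv3 i \<phi> x = 0"
      "\<And>x. \<bar>\<phi> x\<bar> \<le> Bd" "\<And>i x. \<bar>pderiv3 i \<phi> x\<bar> \<le> Bd"
    using test_fun_bounds[OF \<phi>] by metis
  note [measurable] = test_fun_measurable[OF \<phi>]
  have bE: "norm (fE k (rho (\<epsilon> n) \<xi>)) \<le> 1 * norm \<xi> powr - 1 + 0 * norm \<xi> powr - 2" if "\<xi> \<noteq> 0" for n \<xi>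
    using norm_fE_le[OF that] by simp
  have bA: "norm (of_real (\<xi> $ i) * fA k (rho (\<epsilon> n) \<xi>)) \<le> k * norm \<xi> powr - 1 + 1 * norm \<xi> powr - 2" if "\<xi> \<noteq> 0" for n \<xi> i
    using norm_component_fA_le[OF that k] by simp
  have lE: "(\<lambda>n. fE k (rho (\<epsilon> n) \<xi>)) \<longlonglongrightarrow> fE k (norm \<xi>)" if "\<xi> \<noteq> 0" for \<xi>
    unfolding \<epsilon>_def by (rule fE_rho_tendsto[OF that])
  have lA: "(\<lambda>n. of_real (\<xi> $ i) * fA k (rho (\<epsilon> n) \<xi>)) \<longlonglongrightarrow> of_real (\<xi> $ i) * fA k (norm \<xi>)" if "\<xi> \<noteq> 0" for \<xi> i
    unfolding \<epsilon>_def by (intro tendsto_mult_left fA_rho_tendsto[OF that])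
  have E: "(\<lambda>n. \<integral>x. fE k (rho (\<epsilon> n) (x - y)) * of_real (p x) \<partial>lborel) \<longlonglongrightarrow> (\<integral>x. fE k (norm (x - y)) * of_real (p x) \<partial>lborel)"
      "integrable lborel (\<lambda>x. fE k (norm (x - y)) * of_real (p x))"
      "\<And>n. integrable lborel (\<lambda>x. fE k (rho (\<epsilon> n) (x - y)) * of_real (p x))"
    if [measurable]: "p \<in> borel_measurable borel" and p: "\<And>x. \<bar>p x\<bar> \<le> Bd" "\<And>x. x \<notin> K \<Longrightarrow> p x = 0" for p
  proof -
    have m: "(\<lambda>\<xi>. fE k (rho (\<epsilon> n) \<xi>)) \<in> borel_measurable borel" "(\<lambda>\<xi>. fE k (norm \<xi>)) \<in> borel_measurable borel" for n by measurable
    have P: "(\<lambda>x. complex_of_real (p x)) \<in> borel_measurable borel" "norm (complex_of_real (p x)) \<le> Bd"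
      "x \<notin> K \<Longrightarrow> complex_of_real (p x) = 0" for x using p by auto
    note D = singular_kernel_dct[OF m bE lE P BK(2)]
    show "(\<lambda>n. \<integral>x. fE k (rho (\<epsilon> n) (x - y)) * of_real (p x) \<partial>lborel) \<longlonglongrightarrow> (\<integral>x. fE k (norm (x - y)) * of_real (p x) \<partial>lborel)" by (rule D(1))
    show "integrable lborel (\<lambda>x. fE k (norm (x - y)) * of_real (p x))" by (rule D(2))
    show "\<And>n. integrable lborel (\<lambda>x. fE k (rho (\<epsilon> n) (x - y)) * of_real (p x))" by (rule D(3))
  qed
  have A: "(\<lambda>n. \<integral>x. of_real ((x - y) $ i) * fA k (rho (\<epsilon> n) (x - y)) * of_real (p x) \<partial>lborel) \<longlonglongrightarrow> (\<integral>x. of_real ((x - y) $ i) * fA k (norm (x - y)) * of_real (p x) \<partial>lborel)"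
      "integrable lborel (\<lambda>x. of_real ((x - y) $ i) * fA k (norm (x - y)) * of_real (p x))"
      "\<And>n. integrable lborel (\<lambda>x. of_real ((x - y) $ i) * fA k (rho (\<epsilon> n) (x - y)) * of_real (p x))"
    if [measurable]: "p \<in> borel_measurable borel" and p: "\<And>x. \<bar>p x\<bar> \<le> Bd" "\<And>x. x \<notin> K \<Longrightarrow> p x = 0" for p i
  proof -
    have m: "(\<lambda>\<xi>. of_real (\<xi> $ i) * fA k (rho (\<epsilon> n) \<xi>)) \<in> borel_measurable borel" "(\<lambda>\<xi>. of_real (\<xi> $ i) * fA k (norm \<xi>)) \<in> borel_measurable borel" for n by measurable
    have P: "(\<lambda>x. complex_of_real (p x)) \<in> borel_measurable borel" "norm (complex_of_real (p x)) \<le> Bd"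
      "x \<notin> K \<Longrightarrow> complex_of_real (p x) = 0" for x using p by auto
    note D = singular_kernel_dct[OF m bA lA P BK(2)]
    show "(\<lambda>n. \<integral>x. of_real ((x - y) $ i) * fA k (rho (\<epsilon> n) (x - y)) * of_real (p x) \<partial>lborel) \<longlonglongrightarrow> (\<integral>x. of_real ((x - y) $ i) * fA k (norm (x - y)) * of_real (p x) \<partial>lborel)" by (rule D(1))
    show "integrable lborel (\<lambda>x. of_real ((x - y) $ i) * fA k (norm (x - y)) * of_real (p x))" by (rule D(2))
    show "\<And>n. integrable lborel (\<lambda>x. of_real ((x - y) $ i) * fA k (rho (\<epsilon> n) (x - y)) * of_real (p x))" by (rule D(3))
  qed
  show "(\<integral>x. fE k (norm (x - y)) * of_real (pderiv3 i \<phi> x) \<partial>lborel)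
        = - (\<integral>x. of_real ((x - y) $ i) * fA k (norm (x - y)) * of_real (\<phi> x) \<partial>lborel)"
  proof (rule LIMSEQ_unique)
    show "(\<lambda>n. \<integral>x. fE k (rho (\<epsilon> n) (x - y)) * of_real (pderiv3 i \<phi> x) \<partial>lborel) \<longlonglongrightarrow> (\<integral>x. fE k (norm (x - y)) * of_real (pderiv3 i \<phi> x) \<partial>lborel)"
      by (rule E(1)) (simp_all add: BK test_fun_measurable[OF \<phi>])
    show "(\<lambda>n. \<integral>x. fE k (rho (\<epsilon> n) (x - y)) * of_real (pderiv3 i \<phi> x) \<partial>lborel) \<longlonglongrightarrow> - (\<integral>x. of_real ((x - y) $ i) * fA k (norm (x - y)) * of_real (\<phi> x) \<partial>lborel)"
      unfolding regularised_helmholtz(1)[OF e \<phi>]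
      by (intro tendsto_minus A(1)) (simp_all add: BK test_fun_measurable[OF \<phi>])
  qed
  show "(\<integral>x. (\<Sum>i\<in>UNIV. of_real ((x - y) $ i) * fA k (norm (x - y)) * of_real (pderiv3 i \<phi> x))
           - (of_real k)\<^sup>2 * fE k (norm (x - y)) * of_real (\<phi> x) \<partial>lborel) = of_real (kappa * \<phi> y)"
  proof (rule LIMSEQ_unique)
    have iA: "integrable lborel (\<lambda>x. of_real ((x - y) $ i) * fA k (rho (\<epsilon> n) (x - y)) * of_real (pderiv3 i \<phi> x))" for n i
      by (rule A(3)) (simp_all add: BK test_fun_measurable[OF \<phi>])
    have iA0: "integrable lborel (\<lambda>x. of_real ((x - y) $ i) * fA k (norm (x - y)) * of_real (pderiv3 i \<phi> x))" for i
      by (rule A(2)) (simp_all add: BK test_fun_measurable[OF \<phi>])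
    have iE: "integrable lborel (\<lambda>x. fE k (rho (\<epsilon> n) (x - y)) * of_real (\<phi> x))" for n
      by (rule E(3)) (simp_all add: BK test_fun_measurable[OF \<phi>])
    have iE0: "integrable lborel (\<lambda>x. fE k (norm (x - y)) * of_real (\<phi> x))"
      by (rule E(2)) (simp_all add: BK test_fun_measurable[OF \<phi>])
    have eq: "(\<integral>x. (\<Sum>i\<in>UNIV. of_real ((x - y) $ i) * fA k (rho (\<epsilon> n) (x - y)) * of_real (pderiv3 i \<phi> x))
           - (of_real k)\<^sup>2 * fE k (rho (\<epsilon> n) (x - y)) * of_real (\<phi> x) \<partial>lborel)
      = (\<Sum>i\<in>UNIV. \<integral>x. of_real ((x - y) $ i) * fA k (rho (\<epsilon> n) (x - y)) * of_real (pderiv3 i \<phi> x) \<partial>lborel)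
        - (of_real k)\<^sup>2 * (\<integral>x. fE k (rho (\<epsilon> n) (x - y)) * of_real (\<phi> x) \<partial>lborel)" for n
      using iA iE by (simp add: mult.assoc)
    have eq0: "(\<integral>x. (\<Sum>i\<in>UNIV. of_real ((x - y) $ i) * fA k (norm (x - y)) * of_real (pderiv3 i \<phi> x))
           - (of_real k)\<^sup>2 * fE k (norm (x - y)) * of_real (\<phi> x) \<partial>lborel)
      = (\<Sum>i\<in>UNIV. \<integral>x. of_real ((x - y) $ i) * fA k (norm (x - y)) * of_real (pderiv3 i \<phi> x) \<partial>lborel)
        - (of_real k)\<^sup>2 * (\<integral>x. fE k (norm (x - y)) * of_real (\<phi> x) \<partial>lborel)"
      using iA0 iE0 by (simp add: mult.assoc)
    show "(\<lambda>n. \<integral>x. (\<Sum>i\<in>UNIV. of_real ((x - y) $ i) * fA k (rho (\<epsilon> n) (x - y)) * of_real (pderiv3 i \<phi> x))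
           - (of_real k)\<^sup>2 * fE k (rho (\<epsilon> n) (x - y)) * of_real (\<phi> x) \<partial>lborel)
      \<longlonglongrightarrow> (\<integral>x. (\<Sum>i\<in>UNIV. of_real ((x - y) $ i) * fA k (norm (x - y)) * of_real (pderiv3 i \<phi> x))
           - (of_real k)\<^sup>2 * fE k (norm (x - y)) * of_real (\<phi> x) \<partial>lborel)"
      unfolding eq eq0
      by (intro tendsto_diff tendsto_sum tendsto_mult_left A(1) E(1)) (simp_all add: BK test_fun_measurable[OF \<phi>])
    show "(\<lambda>n. \<integral>x. (\<Sum>i\<in>UNIV. of_real ((x - y) $ i) * fA k (rho (\<epsilon> n) (x - y)) * of_real (pderiv3 i \<phi> x))
           - (of_real k)\<^sup>2 * fE k (rho (\<epsilon> n) (x - y)) * of_real (\<phi> x) \<partial>lborel) \<longlonglongrightarrow> of_real (kappa * \<phi> y)"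
      unfolding regularised_helmholtz(2)[OF e \<phi>] unfolding \<epsilon>_def by (rule approximate_point_mass[OF k \<phi>])
  qed
qed

section \<open>Volume potentials\<close>

text \<open>The kernel is a parameter, so that derivatives of potentials are again potentials, with
  the differentiated kernel.\<close>

definition potential :: "(R3 \<Rightarrow> complex) \<Rightarrow> (R3 \<Rightarrow> complex) \<Rightarrow> R3 \<Rightarrow> complex" where
  "potential H f x = (\<integral>y. H (x - y) * f y \<partial>lborel)"

abbreviation kerE :: "real \<Rightarrow> R3 \<Rightarrow> complex" where
  "kerE k \<equiv> (\<lambda>\<xi>. fE k (norm \<xi>))"

abbreviation kerG :: "real \<Rightarrow> 3 \<Rightarrow> R3 \<Rightarrow> complex" where
  "kerG k i \<equiv> (\<lambda>\<xi>. of_real (\<xi> $ i) * fA k (norm \<xi>))"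

definition weakly_singular :: "(R3 \<Rightarrow> complex) \<Rightarrow> bool" where
  "weakly_singular H \<longleftrightarrow> H \<in> borel_measurable borel \<and>
     (\<exists>c1\<ge>0. \<exists>c2\<ge>0. \<forall>\<xi>. \<xi> \<noteq> 0 \<longrightarrow> norm (H \<xi>) \<le> c1 * norm \<xi> powr - 1 + c2 * norm \<xi> powr - 2)"

lemma weakly_singular_measurable: "weakly_singular H \<Longrightarrow> H \<in> borel_measurable borel"
  unfolding weakly_singular_def by simp

lemma weakly_singularI:
  assumes "H \<in> borel_measurable borel" "c1 \<ge> 0" "c2 \<ge> 0"
    "\<And>\<xi>. \<xi> \<noteq> 0 \<Longrightarrow> norm (H \<xi>) \<le> c1 * norm \<xi> powr - 1 + c2 * norm \<xi> powr - 2"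
  shows "weakly_singular H"
  using assms unfolding weakly_singular_def by blast

lemma weakly_singular_kerE: "weakly_singular (kerE k)"
proof (rule weakly_singularI)
  show "norm (kerE k \<xi>) \<le> 1 * norm \<xi> powr - 1 + 0 * norm \<xi> powr - 2" if "\<xi> \<noteq> 0" for \<xi> :: R3
    using norm_fE_le[OF that, of k 0] by simp
qed auto

lemma weakly_singular_kerG:
  assumes "k \<ge> 0" shows "weakly_singular (kerG k i)"
proof (rule weakly_singularI)
  show "norm (kerG k i \<xi>) \<le> k * norm \<xi> powr - 1 + 1 * norm \<xi> powr - 2" if "\<xi> \<noteq> 0" for \<xi> :: R3
    using norm_component_fA_le[OF that assms, of i 0] by simp
qed (use assms in auto)

lemma weakly_singular_nn_bound:
  assumes H: "weakly_singular H" and S: "S \<in> sets borel" "bounded S"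
  obtains C :: real where "C > 0" "\<And>x. (\<integral>\<^sup>+y\<in>S. ennreal (norm (H (x - y))) \<partial>lborel) \<le> ennreal C"
    "\<And>y. (\<integral>\<^sup>+x\<in>S. ennreal (norm (H (x - y))) \<partial>lborel) \<le> ennreal C"
proof -
  note [measurable] = weakly_singular_measurable[OF H] S(1)
  obtain c1 c2 where c: "c1 \<ge> 0" "c2 \<ge> 0"
    and bd: "\<And>\<xi>. \<xi> \<noteq> 0 \<Longrightarrow> norm (H \<xi>) \<le> c1 * norm \<xi> powr - 1 + c2 * norm \<xi> powr - 2"
    using H unfolding weakly_singular_def by blast
  obtain C1 where C1: "C1 > 0" "\<And>x::R3. (\<integral>\<^sup>+y\<in>S. ennreal (norm (x - y) powr - 1) \<partial>lborel) \<le> ennreal C1"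
    using riesz_kernel_uniform_bound[of 1 S] S by auto
  obtain C2 where C2: "C2 > 0" "\<And>x::R3. (\<integral>\<^sup>+y\<in>S. ennreal (norm (x - y) powr - 2) \<partial>lborel) \<le> ennreal C2"
    using riesz_kernel_uniform_bound[of 2 S] S by auto
  have *: "(\<integral>\<^sup>+y\<in>S. ennreal (c1 * norm (x - y) powr - 1 + c2 * norm (x - y) powr - 2) \<partial>lborel) \<le> ennreal (c1 * C1 + c2 * C2 + 1)" for x :: R3
  proof -
    have "(\<integral>\<^sup>+y\<in>S. ennreal (c1 * norm (x - y) powr - 1 + c2 * norm (x - y) powr - 2) \<partial>lborel)
      = (\<integral>\<^sup>+y. ennreal c1 * (ennreal (norm (x - y) powr - 1) * indicator S y) + ennreal c2 * (ennreal (norm (x - y) powr - 2) * indicator S y) \<partial>lborel)"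
    proof (rule nn_integral_cong)
      have "ennreal (c1 * a + c2 * b) * t = ennreal c1 * (ennreal a * t) + ennreal c2 * (ennreal b * t)" if "a \<ge> 0" "b \<ge> 0" for a b t
        using that c by (simp add: ennreal_mult' ennreal_plus distrib_right mult.assoc)
      then show "ennreal (c1 * norm (x - y) powr - 1 + c2 * norm (x - y) powr - 2) * indicator S y
        = ennreal c1 * (ennreal (norm (x - y) powr - 1) * indicator S y) + ennreal c2 * (ennreal (norm (x - y) powr - 2) * indicator S y)" for y
        by (simp only: powr_ge_zero)
    qed
    also have "\<dots> = ennreal c1 * (\<integral>\<^sup>+y\<in>S. ennreal (norm (x - y) powr - 1) \<partial>lborel) + ennreal c2 * (\<integral>\<^sup>+y\<in>S. ennreal (norm (x - y) powr - 2) \<partial>lborel)"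
      by (subst nn_integral_add; (subst nn_integral_cmult)?; (subst nn_integral_cmult)?) (auto simp del: norm_powr_minus_1 norm_powr_minus_2)
    also have "\<dots> \<le> ennreal c1 * ennreal C1 + ennreal c2 * ennreal C2"
      by (intro add_mono mult_left_mono C1 C2) auto
    also have "\<dots> = ennreal (c1 * C1 + c2 * C2)" using c C1 C2 by (simp add: ennreal_mult' ennreal_plus)
    also have "\<dots> \<le> ennreal (c1 * C1 + c2 * C2 + 1)" by (rule ennreal_leI) simp
    finally show ?thesis .
  qed
  have 1: "(\<integral>\<^sup>+y\<in>S. ennreal (norm (H (x - y))) \<partial>lborel) \<le> ennreal (c1 * C1 + c2 * C2 + 1)" for x
  proof (rule order_trans[OF nn_integral_mono_AE *])
    have "AE y in lborel. y \<noteq> x" using AE_lborel_singleton[of x] by simp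
    then show "AE y in lborel. ennreal (norm (H (x - y))) * indicator S y \<le> ennreal (c1 * norm (x - y) powr - 1 + c2 * norm (x - y) powr - 2) * indicator S y"
      by eventually_elim (intro mult_right_mono ennreal_leI bd, auto)
  qed
  have 2: "(\<integral>\<^sup>+x\<in>S. ennreal (norm (H (x - y))) \<partial>lborel) \<le> ennreal (c1 * C1 + c2 * C2 + 1)" for y
  proof (rule order_trans[OF nn_integral_mono_AE *[of y]])
    have "AE x in lborel. x \<noteq> y" using AE_lborel_singleton[of y] by simp
    then show "AE x in lborel. ennreal (norm (H (x - y))) * indicator S x \<le> ennreal (c1 * norm (y - x) powr - 1 + c2 * norm (y - x) powr - 2) * indicator S x"
      unfolding norm_minus_commute[of y]
      by eventually_elim (intro mult_right_mono ennreal_leI bd, auto)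
  qed
  have "c1 * C1 + c2 * C2 + 1 > 0" using c C1 C2 by (simp add: add_nonneg_pos)
  with 1 2 that show ?thesis by blast
qed

text \<open>The typical density is the contrast times the total field in D, which is bounded because
  z stays away from the closure of D. For such densities M depends on z and only secures
  integrability.\<close>

locale bounded_density =
  fixes f :: "R3 \<Rightarrow> complex" and S :: "R3 set" and M :: real
  assumes f_meas [measurable]: "f \<in> borel_measurable borel"
    and f_bound: "\<And>y. norm (f y) \<le> M"
    and f_supp: "\<And>y. y \<notin> S \<Longrightarrow> f y = 0"
    and S_meas [measurable]: "S \<in> sets borel" and S_bounded: "bounded S"
begin

lemma M_nonneg: "M \<ge> 0"
  using f_bound[of 0] norm_ge_zero order_trans by blast

lemma f_le_indicator: "norm (f y) \<le> M * indicator S y"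
  using f_bound[of y] f_supp[of y] by (cases "y \<in> S") auto

lemma nn_integral_potential_le:
  assumes H[measurable]: "H \<in> borel_measurable borel"
  shows "(\<integral>\<^sup>+y. ennreal (norm (H (x - y) * f y)) \<partial>lborel) \<le> ennreal M * (\<integral>\<^sup>+y\<in>S. ennreal (norm (H (x - y))) \<partial>lborel)"
proof -
  have "(\<integral>\<^sup>+y. ennreal (norm (H (x - y) * f y)) \<partial>lborel) \<le> (\<integral>\<^sup>+y. ennreal M * (ennreal (norm (H (x - y))) * indicator S y) \<partial>lborel)"
  proof (rule nn_integral_mono)
    fix y
    have "norm (H (x - y) * f y) \<le> norm (H (x - y)) * (M * indicator S y)"
      unfolding norm_mult by (intro mult_left_mono f_le_indicator) simp
    then have "ennreal (norm (H (x - y) * f y)) \<le> ennreal (norm (H (x - y)) * (M * indicator S y))" by (rule ennreal_leI)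
    also have "\<dots> = ennreal M * (ennreal (norm (H (x - y))) * indicator S y)"
      using M_nonneg by (auto simp: indicator_def ennreal_mult' mult.commute)
    finally show "ennreal (norm (H (x - y) * f y)) \<le> ennreal M * (ennreal (norm (H (x - y))) * indicator S y)" .
  qed
  also have "\<dots> = ennreal M * (\<integral>\<^sup>+y\<in>S. ennreal (norm (H (x - y))) \<partial>lborel)"
    by (rule nn_integral_cmult) measurable
  finally show ?thesis .
qed

lemma integrable_potential:
  assumes H: "weakly_singular H"
  shows "integrable lborel (\<lambda>y. H (x - y) * f y)"
proof (rule integrableI_bounded)
  note [measurable] = weakly_singular_measurable[OF H]
  show "(\<lambda>y. H (x - y) * f y) \<in> borel_measurable lborel" by measurable
  obtain C where C: "(\<integral>\<^sup>+y\<in>S. ennreal (norm (H (x - y))) \<partial>lborel) \<le> ennreal C"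
    using weakly_singular_nn_bound[OF H S_meas S_bounded] by metis
  have "(\<integral>\<^sup>+y. ennreal (norm (H (x - y) * f y)) \<partial>lborel) \<le> ennreal M * ennreal C"
    by (rule order_trans[OF nn_integral_potential_le]) (auto intro: mult_left_mono C)
  also have "\<dots> < \<infinity>" by (simp add: ennreal_mult_less_top)
  finally show "(\<integral>\<^sup>+y. ennreal (norm (H (x - y) * f y)) \<partial>lborel) < \<infinity>" .
qed

lemma norm_potential_le:
  assumes C: "(\<integral>\<^sup>+y\<in>S. ennreal (norm (H (x - y))) \<partial>lborel) \<le> ennreal C" "C \<ge> 0" and H: "weakly_singular H"
  shows "norm (potential H f x) \<le> M * C"
proof -
  have "ennreal (norm (potential H f x)) \<le> (\<integral>\<^sup>+y. ennreal (norm (H (x - y) * f y)) \<partial>lborel)"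
    unfolding potential_def by (rule integral_norm_bound_ennreal[OF integrable_potential[OF H]])
  also have "\<dots> \<le> ennreal M * ennreal C"
    by (rule order_trans[OF nn_integral_potential_le]) (auto intro: mult_left_mono C weakly_singular_measurable[OF H])
  also have "\<dots> = ennreal (M * C)" using M_nonneg C by (simp add: ennreal_mult')
  finally show ?thesis using M_nonneg C by (simp add: ennreal_le_iff)
qed

lemma potential_measurable [measurable]:
  assumes H: "weakly_singular H"
  shows "potential H f \<in> borel_measurable borel"
proof -
  note [measurable] = weakly_singular_measurable[OF H]
  have "(\<lambda>x. \<integral>y. H (x - y) * f y \<partial>lborel) \<in> borel_measurable borel" by measurable
  then show ?thesis by (simp add: potential_def[abs_def])
qed

text \<open>Moving the kernel from the density to the test function lets identities for the
  fundamental solution at a fixed y carry over to potentials. Absolute integrability on the product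
  comes from the kernel bound being uniform in x.\<close>

lemma potential_fubini:
  fixes p :: "R3 \<Rightarrow> complex"
  assumes H: "weakly_singular H" and p[measurable]: "p \<in> borel_measurable borel"
    and pB: "\<And>x. norm (p x) \<le> B" and pK: "\<And>x. x \<notin> K \<Longrightarrow> p x = 0" and K: "compact K"
  shows "integrable lborel (\<lambda>x. potential H f x * p x)"
    and "(\<integral>x. potential H f x * p x \<partial>lborel) = (\<integral>y. f y * (\<integral>x. H (x - y) * p x \<partial>lborel) \<partial>lborel)"
    and "integrable lborel (\<lambda>y. f y * (\<integral>x. H (x - y) * p x \<partial>lborel))"
proof -
  note [measurable] = weakly_singular_measurable[OF H]
  obtain C where C: "C > 0" "\<And>x. (\<integral>\<^sup>+y\<in>S. ennreal (norm (H (x - y))) \<partial>lborel) \<le> ennreal C"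
    using weakly_singular_nn_bound[OF H S_meas S_bounded] by metis
  have B: "B \<ge> 0" using pB[of 0] norm_ge_zero order_trans by blast
  have int: "integrable (lborel \<Otimes>\<^sub>M lborel) (\<lambda>(x, y). H (x - y) * f y * p x)"
  proof (rule integrableI_bounded)
    show "(\<lambda>(x, y). H (x - y) * f y * p x) \<in> borel_measurable (lborel \<Otimes>\<^sub>M lborel)" by measurable
    have "(\<integral>\<^sup>+z. ennreal (norm (case z of (x, y) \<Rightarrow> H (x - y) * f y * p x)) \<partial>(lborel \<Otimes>\<^sub>M lborel))
      = (\<integral>\<^sup>+x. \<integral>\<^sup>+y. ennreal (norm (H (x - y) * f y * p x)) \<partial>lborel \<partial>lborel)"
      by (subst lborel.nn_integral_fst[symmetric]) auto
    also have "\<dots> \<le> (\<integral>\<^sup>+x. ennreal (B * (M * C)) * indicator K x \<partial>lborel)"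
    proof (rule nn_integral_mono)
      fix x
      show "(\<integral>\<^sup>+y. ennreal (norm (H (x - y) * f y * p x)) \<partial>lborel) \<le> ennreal (B * (M * C)) * indicator K x"
      proof (cases "x \<in> K")
        case True
        have "(\<integral>\<^sup>+y. ennreal (norm (H (x - y) * f y * p x)) \<partial>lborel) = (\<integral>\<^sup>+y. ennreal (norm (p x)) * ennreal (norm (H (x - y) * f y)) \<partial>lborel)"
          by (intro nn_integral_cong) (simp add: norm_mult ennreal_mult'[symmetric] mult.commute)
        also have "\<dots> = ennreal (norm (p x)) * (\<integral>\<^sup>+y. ennreal (norm (H (x - y) * f y)) \<partial>lborel)"
          by (rule nn_integral_cmult) measurable
        also have "\<dots> \<le> ennreal B * (ennreal M * ennreal C)"
          by (intro mult_mono ennreal_leI pB order_trans[OF nn_integral_potential_le] C order_refl) auto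
        also have "\<dots> = ennreal (B * (M * C))" using B M_nonneg C(1) by (simp add: ennreal_mult')
        finally show ?thesis using True by simp
      qed (simp add: pK)
    qed
    also have "\<dots> = ennreal (B * (M * C)) * emeasure lborel K"
      using K by (intro nn_integral_cmult_indicator) (simp add: borel_compact)
    also have "\<dots> < \<infinity>" using emeasure_bounded_finite[OF compact_imp_bounded[OF K]] by (simp add: ennreal_mult_less_top)
    finally show "(\<integral>\<^sup>+z. ennreal (norm (case z of (x, y) \<Rightarrow> H (x - y) * f y * p x)) \<partial>(lborel \<Otimes>\<^sub>M lborel)) < \<infinity>" .
  qed
  have l: "potential H f x * p x = (\<integral>y. H (x - y) * f y * p x \<partial>lborel)" for x
    unfolding potential_def by simp
  have r: "f y * (\<integral>x. H (x - y) * p x \<partial>lborel) = (\<integral>x. H (x - y) * f y * p x \<partial>lborel)" for y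
    by (simp add: integral_mult_right_zero[symmetric] mult.assoc mult.left_commute del: integral_mult_right_zero)
  show "integrable lborel (\<lambda>x. potential H f x * p x)" unfolding l
    using lborel_pair.integrable_fst'[OF int] by simp
  show "integrable lborel (\<lambda>y. f y * (\<integral>x. H (x - y) * p x \<partial>lborel))" unfolding r
    using lborel_pair.integrable_snd[OF int] by simp
  show "(\<integral>x. potential H f x * p x \<partial>lborel) = (\<integral>y. f y * (\<integral>x. H (x - y) * p x \<partial>lborel) \<partial>lborel)"
    unfolding l r using lborel_pair.Fubini_integral[OF int] by simp
qed

text \<open>After Fubini the inner integral is that of the fundamental solution with pole y, so
  integration against f replaces \<phi>(y) by the integral of f \<phi>.\<close>

lemma
  assumes k: "k \<ge> 0" and \<phi>: "test_fun UNIV \<phi>"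
  shows potential_weak_gradient:
      "(\<integral>x. potential (kerE k) f x * of_real (pderiv3 i \<phi> x) \<partial>lborel)
        = - (\<integral>x. potential (kerG k i) f x * of_real (\<phi> x) \<partial>lborel)"
    and potential_weak_helmholtz:
      "(\<integral>x. (\<Sum>i\<in>UNIV. potential (kerG k i) f x * of_real (pderiv3 i \<phi> x))
           - (of_real k)\<^sup>2 * potential (kerE k) f x * of_real (\<phi> x) \<partial>lborel) = of_real kappa * (\<integral>y. f y * of_real (\<phi> y) \<partial>lborel)"
    and integrable_potential_test:
      "weakly_singular H \<Longrightarrow> integrable lborel (\<lambda>x. potential H f x * of_real (\<phi> x))"
      "weakly_singular H \<Longrightarrow> integrable lborel (\<lambda>x. potential H f x * of_real (pderiv3 i \<phi> x))"
proof -
  obtain Bd K where BK: "Bd \<ge> 0" "compact K" "\<And>x. x \<notin> K \<Longrightarrow> \<phi> x = 0" "\<And>i x. x \<notin> K \<Longrightarrow> pderiv3 i \<phi> x = 0"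
      "\<And>x. \<bar>\<phi> x\<bar> \<le> Bd" "\<And>i x. \<bar>pderiv3 i \<phi> x\<bar> \<le> Bd"
    using test_fun_bounds[OF \<phi>] by metis
  note [measurable] = test_fun_measurable[OF \<phi>]
  have p1: "(\<lambda>x. complex_of_real (\<phi> x)) \<in> borel_measurable borel" "norm (complex_of_real (\<phi> x)) \<le> Bd"
    "x \<notin> K \<Longrightarrow> complex_of_real (\<phi> x) = 0" for x using BK by auto
  have p2: "(\<lambda>x. complex_of_real (pderiv3 i \<phi> x)) \<in> borel_measurable borel" "norm (complex_of_real (pderiv3 i \<phi> x)) \<le> Bd"
    "x \<notin> K \<Longrightarrow> complex_of_real (pderiv3 i \<phi> x) = 0" for x i using BK by auto
  note F1 = potential_fubini[OF _ p1 BK(2)] and F2 = potential_fubini[OF _ p2 BK(2)]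
  note E = weakly_singular_kerE[of k] and G = weakly_singular_kerG[OF k]
  show "weakly_singular H \<Longrightarrow> integrable lborel (\<lambda>x. potential H f x * of_real (\<phi> x))" by (rule F1(1))
  show "weakly_singular H \<Longrightarrow> integrable lborel (\<lambda>x. potential H f x * of_real (pderiv3 i \<phi> x))" by (rule F2(1))
  show "(\<integral>x. potential (kerE k) f x * of_real (pderiv3 i \<phi> x) \<partial>lborel)
        = - (\<integral>x. potential (kerG k i) f x * of_real (\<phi> x) \<partial>lborel)"
  proof -
    have "(\<integral>x. potential (kerE k) f x * of_real (pderiv3 i \<phi> x) \<partial>lborel)
      = (\<integral>y. f y * (\<integral>x. kerE k (x - y) * of_real (pderiv3 i \<phi> x) \<partial>lborel) \<partial>lborel)"
      by (rule F2(2)[OF E])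
    also have "\<dots> = (\<integral>y. f y * - (\<integral>x. kerG k i (x - y) * of_real (\<phi> x) \<partial>lborel) \<partial>lborel)"
      by (simp only: fundamental_solution_gradient[OF k \<phi>])
    also have "\<dots> = - (\<integral>y. f y * (\<integral>x. kerG k i (x - y) * of_real (\<phi> x) \<partial>lborel) \<partial>lborel)"
      by (simp only: mult_minus_right Bochner_Integration.integral_minus)
    also have "(\<integral>y. f y * (\<integral>x. kerG k i (x - y) * of_real (\<phi> x) \<partial>lborel) \<partial>lborel) = (\<integral>x. potential (kerG k i) f x * of_real (\<phi> x) \<partial>lborel)"
      by (rule F1(2)[OF G, symmetric])
    finally show ?thesis .
  qed
  have inner: "(\<Sum>i\<in>UNIV. \<integral>x. kerG k i (x - y) * of_real (pderiv3 i \<phi> x) \<partial>lborel)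
     - (of_real k)\<^sup>2 * (\<integral>x. kerE k (x - y) * of_real (\<phi> x) \<partial>lborel) = of_real (kappa * \<phi> y)" for y
  proof -
    have ws_int: "integrable lborel (\<lambda>x. H (x - y) * p x)" if H: "weakly_singular H" and p: "p \<in> borel_measurable borel"
      "\<And>x. norm (p x) \<le> Bd" "\<And>x. x \<notin> K \<Longrightarrow> p x = 0" for H and p :: "R3 \<Rightarrow> complex"
    proof -
      obtain c1 c2 where bd: "\<And>\<xi>. \<xi> \<noteq> 0 \<Longrightarrow> norm (H \<xi>) \<le> c1 * norm \<xi> powr - 1 + c2 * norm \<xi> powr - 2"
        using H unfolding weakly_singular_def by blast
      show ?thesis
        using singular_kernel_dct(2)[of "\<lambda>n. H" H c1 c2 p Bd K y] weakly_singular_measurable[OF H] bd p BK(2) by simp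
    qed
    have i1: "integrable lborel (\<lambda>x. kerG k i (x - y) * of_real (pderiv3 i \<phi> x))" for i by (rule ws_int[OF G p2])
    have i2: "integrable lborel (\<lambda>x. kerE k (x - y) * of_real (\<phi> x))" by (rule ws_int[OF E p1])
    have "(\<Sum>i\<in>UNIV. \<integral>x. kerG k i (x - y) * of_real (pderiv3 i \<phi> x) \<partial>lborel)
     - (of_real k)\<^sup>2 * (\<integral>x. kerE k (x - y) * of_real (\<phi> x) \<partial>lborel)
     = (\<integral>x. (\<Sum>i\<in>UNIV. kerG k i (x - y) * of_real (pderiv3 i \<phi> x)) - (of_real k)\<^sup>2 * kerE k (x - y) * of_real (\<phi> x) \<partial>lborel)"
      using i1 i2 by (simp add: mult.assoc)
    then show ?thesis using fundamental_solution_helmholtz[OF k \<phi>, of y] by simp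
  qed
  have "(\<integral>x. (\<Sum>i\<in>UNIV. potential (kerG k i) f x * of_real (pderiv3 i \<phi> x))
           - (of_real k)\<^sup>2 * potential (kerE k) f x * of_real (\<phi> x) \<partial>lborel)
    = (\<Sum>i\<in>UNIV. \<integral>x. potential (kerG k i) f x * of_real (pderiv3 i \<phi> x) \<partial>lborel)
      - (of_real k)\<^sup>2 * (\<integral>x. potential (kerE k) f x * of_real (\<phi> x) \<partial>lborel)"
    using F1(1)[OF E] F2(1)[OF G] by (simp add: mult.assoc)
  also have "\<dots> = (\<integral>y. (\<Sum>i\<in>UNIV. f y * (\<integral>x. kerG k i (x - y) * of_real (pderiv3 i \<phi> x) \<partial>lborel))
      - (of_real k)\<^sup>2 * (f y * (\<integral>x. kerE k (x - y) * of_real (\<phi> x) \<partial>lborel)) \<partial>lborel)"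
  proof -
    have e1: "(\<integral>x. potential (kerE k) f x * of_real (\<phi> x) \<partial>lborel) = (\<integral>y. f y * (\<integral>x. kerE k (x - y) * of_real (\<phi> x) \<partial>lborel) \<partial>lborel)"
      by (rule F1(2)[OF E])
    have e2: "(\<integral>x. potential (kerG k i) f x * of_real (pderiv3 i \<phi> x) \<partial>lborel)
      = (\<integral>y. f y * (\<integral>x. kerG k i (x - y) * of_real (pderiv3 i \<phi> x) \<partial>lborel) \<partial>lborel)" for i
      by (rule F2(2)[OF G])
    have i1: "integrable lborel (\<lambda>y. f y * (\<integral>x. kerE k (x - y) * of_real (\<phi> x) \<partial>lborel))" by (rule F1(3)[OF E])
    have i2: "integrable lborel (\<lambda>y. f y * (\<integral>x. kerG k i (x - y) * of_real (pderiv3 i \<phi> x) \<partial>lborel))" for i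
      by (rule F2(3)[OF G])
    show ?thesis unfolding e1 e2
      by (subst Bochner_Integration.integral_diff)
         (intro Bochner_Integration.integrable_sum integrable_mult_right i1 i2 |
          subst Bochner_Integration.integral_sum[OF i2] | simp)+
  qed
  also have "\<dots> = (\<integral>y. of_real kappa * (f y * of_real (\<phi> y)) \<partial>lborel)"
  proof (rule Bochner_Integration.integral_cong[OF refl])
    fix y
    have "(\<Sum>i\<in>UNIV. f y * (\<integral>x. kerG k i (x - y) * of_real (pderiv3 i \<phi> x) \<partial>lborel))
      - (of_real k)\<^sup>2 * (f y * (\<integral>x. kerE k (x - y) * of_real (\<phi> x) \<partial>lborel))
      = f y * ((\<Sum>i\<in>UNIV. \<integral>x. kerG k i (x - y) * of_real (pderiv3 i \<phi> x) \<partial>lborel)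
     - (of_real k)\<^sup>2 * (\<integral>x. kerE k (x - y) * of_real (\<phi> x) \<partial>lborel))"
      by (simp only: sum_distrib_left right_diff_distrib mult.left_commute)
    then show "(\<Sum>i\<in>UNIV. f y * (\<integral>x. kerG k i (x - y) * of_real (pderiv3 i \<phi> x) \<partial>lborel))
      - (of_real k)\<^sup>2 * (f y * (\<integral>x. kerE k (x - y) * of_real (\<phi> x) \<partial>lborel)) = of_real kappa * (f y * of_real (\<phi> y))"
      unfolding inner by (simp add: mult.left_commute)
  qed
  also have "\<dots> = of_real kappa * (\<integral>y. f y * of_real (\<phi> y) \<partial>lborel)" by simp
  finally show "(\<integral>x. (\<Sum>i\<in>UNIV. potential (kerG k i) f x * of_real (pderiv3 i \<phi> x))
           - (of_real k)\<^sup>2 * potential (kerE k) f x * of_real (\<phi> x) \<partial>lborel) = of_real kappa * (\<integral>y. f y * of_real (\<phi> y) \<partial>lborel)" .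
qed

end

section \<open>Smoothness and radiation of potentials\<close>

lemma kern_bounded_annulus:
  assumes "kern k 0 F" "0 < a"
  shows "\<exists>B\<ge>0. \<forall>\<xi>. a \<le> norm \<xi> \<and> norm \<xi> \<le> b \<longrightarrow> norm (F \<xi>) \<le> B"
proof -
  let ?A = "cball 0 b \<inter> - ball (0::R3) a"
  have "compact ?A" by (intro compact_Int_closed) (auto simp: closed_Compl)
  moreover have "continuous_on ?A F"
  proof (rule continuous_at_imp_continuous_on, rule ballI)
    fix x assume "x \<in> ?A"
    then have "x \<noteq> 0" using assms(2) by auto
    then show "isCont F x" using kern_isCont[OF assms(1)] by simp
  qed
  ultimately have "bounded (F ` ?A)" using compact_continuous_image compact_imp_bounded by blast
  then obtain B where "\<forall>x\<in>F ` ?A. norm x \<le> B" using bounded_iff by blast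
  then have "\<forall>\<xi>. a \<le> norm \<xi> \<and> norm \<xi> \<le> b \<longrightarrow> norm (F \<xi>) \<le> max B 0" by (auto simp: le_max_iff_disj)
  then show ?thesis by (intro exI[of _ "max B 0"]) auto
qed

text \<open>Membership in \<open>kern\<close> is known one direction at a time; the three axes turn
  this into a bound for the whole derivative.\<close>

lemma linear_norm_le_axis:
  fixes L :: "R3 \<Rightarrow> complex"
  assumes "linear L"
  shows "norm (L v) \<le> (\<Sum>i\<in>UNIV. norm (L (axis i 1))) * norm v"
proof -
  have "v = (\<Sum>i\<in>UNIV. v $ i *\<^sub>R axis i 1)"
    by (simp add: vec_eq_iff axis_def if_distrib cong: if_cong)
  then have "L v = (\<Sum>i\<in>UNIV. v $ i *\<^sub>R L (axis i 1))"
    using assms by (metis (no_types, lifting) linear_sum linear_scale sum.cong)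
  then have "norm (L v) \<le> (\<Sum>i\<in>UNIV. \<bar>v $ i\<bar> * norm (L (axis i 1)))"
    by (metis (no_types, lifting) norm_scaleR norm_sum sum.cong)
  also have "\<dots> \<le> (\<Sum>i\<in>UNIV. norm v * norm (L (axis i 1)))"
    by (intro sum_mono mult_right_mono component_le_norm_cart) auto
  finally show ?thesis by (simp add: sum_distrib_left[symmetric] mult.commute)
qed

context bounded_density
begin

lemma integrable_density_mult:
  assumes [measurable]: "g \<in> borel_measurable borel" and "\<And>y. y \<in> S \<Longrightarrow> norm (g y) \<le> B"
  shows "integrable lborel (\<lambda>y. g y * f y)"
proof (rule Bochner_Integration.integrable_bound)
  show "integrable lborel (\<lambda>y. \<bar>B\<bar> * M * indicator S y)"
    using emeasure_bounded_finite[OF S_bounded] by simp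
  show "AE y in lborel. norm (g y * f y) \<le> norm (\<bar>B\<bar> * M * indicator S y)"
  proof (rule AE_I2)
    fix y show "norm (g y * f y) \<le> norm (\<bar>B\<bar> * M * indicator S y)"
    proof (cases "y \<in> S")
      case True
      have "norm (g y * f y) \<le> \<bar>B\<bar> * M" unfolding norm_mult
        using assms(2)[OF True] f_bound[of y] M_nonneg by (intro mult_mono) auto
      then show ?thesis using True M_nonneg by simp
    qed (simp add: f_supp)
  qed
qed simp

text \<open>Differentiation under the integral sign off the closure of S. Near x the kernel is
  evaluated only on an annulus away from its singularity, so the mean value inequality dominates the
  difference quotients.\<close>

lemma potential_has_derivative:
  assumes kF: "kern k 0 F" and F': "\<And>\<xi>. \<xi> \<noteq> 0 \<Longrightarrow> (F has_derivative F' \<xi>) (at \<xi>)" and kF': "\<And>v. kern k 0 (\<lambda>\<xi>. F' \<xi> v)"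
    and x: "x \<notin> closure S"
  shows "(potential F f has_derivative (\<lambda>v. potential (\<lambda>\<xi>. F' \<xi> v) f x)) (at x)"
proof -
  have [measurable]: "F \<in> borel_measurable borel" "\<And>v. (\<lambda>\<xi>. F' \<xi> v) \<in> borel_measurable borel"
    by (auto intro: kern_measurable kF kF')
  have "open (- closure S)" by (simp add: open_Compl)
  \<comment> \<open>A margin of 2d around x leaves every point of the ball of radius d at distance
    at least d from S.\<close>
  then obtain d where d: "d > 0" "ball x (2 * d) \<subseteq> - closure S"
    using x unfolding open_contains_ball by (metis ComplI mult_pos_pos zero_less_numeral[where 'a=real] field_sum_of_halves mult_2 half_gt_zero mult_2_right)
  obtain R where R: "\<And>y. y \<in> S \<Longrightarrow> norm y \<le> R" using S_bounded bounded_iff by blast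
  have far: "d \<le> norm (x' - y) \<and> norm (x' - y) \<le> norm x + d + R" if "x' \<in> ball x d" "y \<in> S" for x' y
  proof -
    have "y \<in> closure S" using that closure_subset by blast
    then have "\<not> dist x y < 2 * d" using d(2) by auto
    moreover have "dist x x' < d" using that by simp
    moreover have "dist x y \<le> dist x x' + dist x' y" by (rule dist_triangle)
    ultimately have "d \<le> norm (x' - y)" unfolding dist_norm by linarith
    moreover have "norm (x' - y) \<le> norm x' + norm y" by (rule norm_triangle_ineq4)
    moreover have "norm x' \<le> norm x + norm (x' - x)" using norm_triangle_sub by blast
    ultimately show ?thesis using R[OF that(2)] \<open>dist x x' < d\<close> by (simp add: dist_norm norm_minus_commute)
  qed
  have "\<exists>B\<ge>0. \<forall>\<xi>. d \<le> norm \<xi> \<and> norm \<xi> \<le> norm x + d + R \<longrightarrow> norm (F' \<xi> (axis i 1)) \<le> B" for i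
    by (rule kern_bounded_annulus[OF kF' d(1)])
  then obtain b where b: "\<And>i. b i \<ge> 0" "\<And>i \<xi>. d \<le> norm \<xi> \<Longrightarrow> norm \<xi> \<le> norm x + d + R \<Longrightarrow> norm (F' \<xi> (axis i 1)) \<le> b i"
    by metis
  define B where "B = sum b UNIV"
  have linF': "linear (F' \<xi>)" if "\<xi> \<noteq> 0" for \<xi> using has_derivative_linear[OF F'[OF that]] .
  have FB: "norm (F' \<xi> v) \<le> B * norm v" if "d \<le> norm \<xi>" "norm \<xi> \<le> norm x + d + R" for \<xi> v
  proof -
    have "norm (F' \<xi> v) \<le> (\<Sum>i\<in>UNIV. norm (F' \<xi> (axis i 1))) * norm v"
      using d(1) that by (intro linear_norm_le_axis linF') auto
    also have "\<dots> \<le> B * norm v" unfolding B_def using b(2)[OF that] by (intro mult_right_mono sum_mono) auto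
    finally show ?thesis .
  qed
  obtain B0 where B0: "\<And>\<xi>. d \<le> norm \<xi> \<Longrightarrow> norm \<xi> \<le> norm x + d + R \<Longrightarrow> norm (F \<xi>) \<le> B0"
    using kern_bounded_annulus[OF kF d(1)] by metis
  have xb: "x \<in> ball x d" using d by simp
  have nz: "x' - y \<noteq> 0" if "x' \<in> ball x d" "y \<in> S" for x' y using far[OF that] d(1) by auto
  have iF: "integrable lborel (\<lambda>y. F (x' - y) * f y)" if "x' \<in> ball x d" for x'
    by (rule integrable_density_mult[of _ B0]) (use far[OF that] B0 in auto)
  have iF': "integrable lborel (\<lambda>y. F' (x - y) v * f y)" for v
    by (rule integrable_density_mult[of _ "B * norm v"]) (use far[OF xb] FB in auto)
  have lip: "norm (F (x' - y) - F (x - y)) \<le> B * norm (x' - x)" if "x' \<in> ball x d" "y \<in> S" for x' y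
  proof -
    have "norm ((\<lambda>z. F (z - y)) x' - (\<lambda>z. F (z - y)) x) \<le> B * norm (x' - x)"
    proof (rule differentiable_bound[where S = "ball x d" and f' = "\<lambda>z. F' (z - y)"])
      fix z assume z: "z \<in> ball x d"
      have "((\<lambda>z. z - y) has_derivative (\<lambda>v. v)) (at z)" by (auto intro!: derivative_eq_intros)
      from has_derivative_compose[OF this F'[OF nz[OF z that(2)]]]
      show "((\<lambda>z. F (z - y)) has_derivative F' (z - y)) (at z within ball x d)"
        by (rule has_derivative_at_withinI)
      show "onorm (F' (z - y)) \<le> B" using FB far[OF z that(2)] by (intro onorm_le) auto
    qed (use that d in auto)
    then show ?thesis by simp
  qed
  have lin: "linear (\<lambda>v. potential (\<lambda>\<xi>. F' \<xi> v) f x)"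
  proof (rule linearI)
    fix u v
    have "F' (x - y) (u + v) * f y = F' (x - y) u * f y + F' (x - y) v * f y" for y
      using linear_add[OF linF'[OF nz[OF xb]]] f_supp[of y] by (cases "y \<in> S") (auto simp: distrib_right)
    then show "potential (\<lambda>\<xi>. F' \<xi> (u + v)) f x = potential (\<lambda>\<xi>. F' \<xi> u) f x + potential (\<lambda>\<xi>. F' \<xi> v) f x"
      unfolding potential_def using iF' by simp
  next
    fix r v
    have "F' (x - y) (r *\<^sub>R v) * f y = r *\<^sub>R (F' (x - y) v * f y)" for y
      using linear_scale[OF linF'[OF nz[OF xb]]] f_supp[of y] by (cases "y \<in> S") auto
    then show "potential (\<lambda>\<xi>. F' \<xi> (r *\<^sub>R v)) f x = r *\<^sub>R potential (\<lambda>\<xi>. F' \<xi> v) f x"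
      unfolding potential_def by simp
  qed
  have "(potential F f has_derivative (\<lambda>v. potential (\<lambda>\<xi>. F' \<xi> v) f x)) (at x within ball x d)"
    unfolding has_derivative_within
  proof (intro conjI)
    show "bounded_linear (\<lambda>v. potential (\<lambda>\<xi>. F' \<xi> v) f x)" using lin by (simp add: linear_linear)
    show "((\<lambda>y. (1 / norm (y - x)) *\<^sub>R (potential F f y - (potential F f x + potential (\<lambda>\<xi>. F' \<xi> (y - x)) f x))) \<longlongrightarrow> 0) (at x within ball x d)"
      unfolding tendsto_at_iff_sequentially
    proof (intro allI impI)
      fix X :: "nat \<Rightarrow> R3" assume X: "\<forall>i. X i \<in> ball x d - {x}" and Xl: "X \<longlonglongrightarrow> x"
      define q where "q n y = (1 / norm (X n - x)) *\<^sub>R (F (X n - y) - (F (x - y) + F' (x - y) (X n - x))) * f y" for n y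
      have qeq: "(1 / norm (X n - x)) *\<^sub>R (potential F f (X n) - (potential F f x + potential (\<lambda>\<xi>. F' \<xi> (X n - x)) f x))
          = (\<integral>y. q n y \<partial>lborel)" for n
      proof -
        have "X n \<in> ball x d" using X by simp
        note i = iF[OF this] iF[OF xb] iF'[of "X n - x"]
        have "(\<integral>y. q n y \<partial>lborel) = (\<integral>y. (1 / norm (X n - x)) *\<^sub>R (F (X n - y) * f y - (F (x - y) * f y + F' (x - y) (X n - x) * f y)) \<partial>lborel)"
          by (intro Bochner_Integration.integral_cong refl) (simp add: q_def algebra_simps)
        also have "\<dots> = (1 / norm (X n - x)) *\<^sub>R (\<integral>y. F (X n - y) * f y - (F (x - y) * f y + F' (x - y) (X n - x) * f y) \<partial>lborel)"
          by (rule integral_scaleR_right)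
        also have "(\<integral>y. F (X n - y) * f y - (F (x - y) * f y + F' (x - y) (X n - x) * f y) \<partial>lborel)
          = potential F f (X n) - (potential F f x + potential (\<lambda>\<xi>. F' \<xi> (X n - x)) f x)"
          unfolding potential_def using i by simp
        finally show ?thesis by simp
      qed
      have "(\<lambda>n. \<integral>y. q n y \<partial>lborel) \<longlonglongrightarrow> (\<integral>y. 0 \<partial>(lborel :: R3 measure))"
      proof (rule integral_dominated_convergence[where w = "\<lambda>y. 2 * B * M * indicator S y"])
        show "integrable lborel (\<lambda>y. 2 * B * M * indicator S y)" using emeasure_bounded_finite[OF S_bounded] by simp
        show "q n \<in> borel_measurable lborel" for n unfolding q_def by measurable
        show "AE y in lborel. norm (q n y) \<le> 2 * B * M * indicator S y" for n
        proof (rule AE_I2)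
          fix y show "norm (q n y) \<le> 2 * B * M * indicator S y"
          proof (cases "y \<in> S")
            case True
            have Xn: "X n \<in> ball x d" "X n \<noteq> x" using X by auto
            have "norm (F (X n - y) - (F (x - y) + F' (x - y) (X n - x))) \<le> norm (F (X n - y) - F (x - y)) + norm (F' (x - y) (X n - x))"
              by (metis diff_diff_eq norm_triangle_ineq4)
            also have "\<dots> \<le> B * norm (X n - x) + B * norm (X n - x)"
              using far[OF xb True] by (intro add_mono lip Xn True FB) auto
            finally have "norm (F (X n - y) - (F (x - y) + F' (x - y) (X n - x))) / norm (X n - x) \<le> 2 * B"
              using Xn(2) by (simp add: pos_divide_le_eq)
            then have "norm (F (X n - y) - (F (x - y) + F' (x - y) (X n - x))) / norm (X n - x) * norm (f y) \<le> 2 * B * M"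
              using f_bound[of y] b(1) by (intro mult_mono) (auto simp: B_def sum_nonneg)
            then show ?thesis using True by (simp add: q_def norm_mult)
          qed (simp add: q_def f_supp)
        qed
        show "AE y in lborel. (\<lambda>n. q n y) \<longlonglongrightarrow> 0"
        proof (rule AE_I2)
          fix y show "(\<lambda>n. q n y) \<longlonglongrightarrow> 0"
          proof (cases "y \<in> S")
            case True
            have "((\<lambda>z. z - y) has_derivative (\<lambda>v. v)) (at x)" by (auto intro!: derivative_eq_intros)
            from has_derivative_compose[OF this F'[OF nz[OF xb True]]]
            have "((\<lambda>z. F (z - y)) has_derivative F' (x - y)) (at x within ball x d)"
              by (rule has_derivative_at_withinI)
            then have "((\<lambda>z. (1 / norm (z - x)) *\<^sub>R (F (z - y) - (F (x - y) + F' (x - y) (z - x)))) \<longlongrightarrow> 0) (at x within ball x d)"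
              unfolding has_derivative_within by blast
            then have "(\<lambda>n. (1 / norm (X n - x)) *\<^sub>R (F (X n - y) - (F (x - y) + F' (x - y) (X n - x)))) \<longlonglongrightarrow> 0"
              unfolding tendsto_at_iff_sequentially o_def using X Xl by blast
            from tendsto_mult_left_zero[OF this, of "f y"] show ?thesis by (simp add: q_def)
          qed (simp add: q_def f_supp)
        qed
      qed simp
      then show "((\<lambda>y. (1 / norm (y - x)) *\<^sub>R (potential F f y - (potential F f x + potential (\<lambda>\<xi>. F' \<xi> (y - x)) f x))) \<circ> X) \<longlonglongrightarrow> 0"
        unfolding o_def qeq by simp
    qed
  qed
  then show ?thesis using d(1) by (simp add: at_within_open[OF _ open_ball])
qed

text \<open>Potentials with kernels in \<open>kern\<close> form a class closed under directional
  derivatives, since differentiation acts on the kernel and stays in the algebra.\<close>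

lemma potential_Ck_on:
  assumes "kern k 0 F"
  shows "Ck_on m (- closure S) (potential F f)"
proof (rule Ck_on_closed_class[where P = "\<lambda>G. \<exists>F. kern k 0 F \<and> G = potential F f"])
  show "\<exists>G'. (\<forall>x\<in>- closure S. (G has_derivative G' x) (at x)) \<and> (\<forall>v. \<exists>F. kern k 0 F \<and> (\<lambda>x. G' x v) = potential F f)"
    if "\<exists>F. kern k 0 F \<and> G = potential F f" for G
  proof -
    from that obtain F where F: "kern k 0 F" "G = potential F f" by (elim exE conjE)
    obtain F' where F': "\<And>\<xi>. \<xi> \<noteq> 0 \<Longrightarrow> (F has_derivative F' \<xi>) (at \<xi>)" "\<And>v. kern k 0 (\<lambda>\<xi>. F' \<xi> v)"
      using kern_derivative[OF F(1)] by auto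
    show ?thesis
      by (rule exI[of _ "\<lambda>x v. potential (\<lambda>\<xi>. F' \<xi> v) f x"])
         (use potential_has_derivative[OF F(1) F'] F'(2) F(2) in auto)
  qed
qed (use assms in auto)

lemma potential_kerE_has_derivative:
  assumes "x \<notin> closure S"
  shows "(potential (kerE k) f has_derivative (\<lambda>v. potential (\<lambda>\<xi>. of_real (\<xi> \<bullet> v) * fA k (norm \<xi>)) f x)) (at x)"
proof (rule potential_has_derivative[OF _ _ _ assms])
  show "kern k 0 (kerE k)" using kern_fE[of k 0] by simp
  show "(kerE k has_derivative (\<lambda>v. of_real (\<xi> \<bullet> v) * fA k (norm \<xi>))) (at \<xi>)" if "\<xi> \<noteq> 0" for \<xi> :: R3
    using has_derivative_fE_shift[of \<xi> 0 0 k] that by simp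
  show "kern k 0 (\<lambda>\<xi>. of_real (\<xi> \<bullet> v) * fA k (norm \<xi>))" for v
    using kern_mult[OF kern_inner kern_fA, of k 0 v] by simp
qed

lemma potential_kerG_has_derivative:
  assumes "x \<notin> closure S"
  shows "(potential (kerG k i) f has_derivative
     (\<lambda>v. potential (\<lambda>\<xi>. of_real (\<xi> $ i) * (of_real (\<xi> \<bullet> v) * fB k (norm \<xi>)) + of_real (v $ i) * fA k (norm \<xi>)) f x)) (at x)"
proof (rule potential_has_derivative[OF _ _ _ assms])
  show "kern k 0 (kerG k i)" using kern_mult[OF kern_component kern_fA, of k 0 i] by simp
  show "(kerG k i has_derivative (\<lambda>v. of_real (\<xi> $ i) * (of_real (\<xi> \<bullet> v) * fB k (norm \<xi>)) + of_real (v $ i) * fA k (norm \<xi>))) (at \<xi>)" if "\<xi> \<noteq> 0" for \<xi> :: R3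
    using has_derivative_gradE_shift[of \<xi> 0 0 i k] that by simp
  show "kern k 0 (\<lambda>\<xi>. of_real (\<xi> $ i) * (of_real (\<xi> \<bullet> v) * fB k (norm \<xi>)) + of_real (v $ i) * fA k (norm \<xi>))" for v
    using kern_fA[of k 0] kern_fB[of k 0] by (intro kern_add kern_mult kern_component kern_inner kern_const) simp_all
qed

lemma integrable_kern_potential:
  assumes "kern k 0 F" and x: "x \<notin> closure S"
  shows "integrable lborel (\<lambda>y. F (x - y) * f y)"
proof -
  have [measurable]: "F \<in> borel_measurable borel" by (rule kern_measurable[OF assms(1)])
  have "open (- closure S)" by (simp add: open_Compl)
  then obtain d where d: "d > 0" "ball x d \<subseteq> - closure S"
    using x unfolding open_contains_ball by blast
  obtain R where R: "\<And>y. y \<in> S \<Longrightarrow> norm y \<le> R" using S_bounded bounded_iff by blast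
  obtain B where B: "\<And>\<xi>. d \<le> norm \<xi> \<Longrightarrow> norm \<xi> \<le> norm x + R \<Longrightarrow> norm (F \<xi>) \<le> B"
    using kern_bounded_annulus[OF assms(1) d(1)] by metis
  show ?thesis
  proof (rule integrable_density_mult)
    fix y assume y: "y \<in> S"
    then have "y \<in> closure S" using closure_subset by blast
    then have "\<not> dist x y < d" using d(2) by auto
    moreover have "norm (x - y) \<le> norm x + norm y" by (rule norm_triangle_ineq4)
    ultimately show "norm (F (x - y)) \<le> B" using R[OF y] by (intro B) (auto simp: dist_norm)
  qed measurable
qed

lemma potential_helmholtz_outside:
  assumes x: "x \<notin> closure S"
  shows "laplacian3 (potential (kerE k) f) x + (of_real k)\<^sup>2 * potential (kerE k) f x = 0"
proof -
  let ?H = "\<lambda>i \<xi>. of_real (\<xi> $ i) * (of_real (\<xi> $ i) * fB k (norm \<xi>)) + fA k (norm \<xi>)"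
  have ax: "v \<bullet> axis i 1 = v $ i" for v :: R3 and i by (simp add: inner_axis)
  \<comment> \<open>Needed on the whole open complement, not just at x, because the first derivative
    is differentiated once more.\<close>
  have first: "pderiv3 i (potential (kerE k) f) z = potential (kerG k i) f z" if "z \<notin> closure S" for i z
    unfolding pderiv3_def frechet_derivative_at[OF potential_kerE_has_derivative[OF that], symmetric] ax ..
  have op: "open (- closure S)" by (simp add: open_Compl)
  have second: "pderiv3 i (pderiv3 i (potential (kerE k) f)) x = potential (?H i) f x" for i
  proof -
    have "(pderiv3 i (potential (kerE k) f) has_derivative
     (\<lambda>v. potential (\<lambda>\<xi>. of_real (\<xi> $ i) * (of_real (\<xi> \<bullet> v) * fB k (norm \<xi>)) + of_real (v $ i) * fA k (norm \<xi>)) f x)) (at x)"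
      by (rule has_derivative_transform_within_open[OF potential_kerG_has_derivative[OF x] op]) (use x first in auto)
    from frechet_derivative_at[OF this, symmetric] show ?thesis
      unfolding pderiv3_def[of i "pderiv3 i _"] by (simp add: ax)
  qed
  have iH: "integrable lborel (\<lambda>y. ?H i (x - y) * f y)" for i
    using kern_fA[of k 0] kern_fB[of k 0]
    by (intro integrable_kern_potential[OF _ x] kern_add kern_mult kern_component) simp_all
  have iE: "integrable lborel (\<lambda>y. kerE k (x - y) * f y)"
    by (rule integrable_potential[OF weakly_singular_kerE])
  have "laplacian3 (potential (kerE k) f) x = (\<Sum>i\<in>UNIV. \<integral>y. ?H i (x - y) * f y \<partial>lborel)"
    unfolding laplacian3_def second potential_def ..
  also have "\<dots> = (\<integral>y. (\<Sum>i\<in>UNIV. ?H i (x - y) * f y) \<partial>lborel)"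
    using iH by (intro Bochner_Integration.integral_sum[symmetric])
  also have "\<dots> = (\<integral>y. - (of_real k)\<^sup>2 * (kerE k (x - y) * f y) \<partial>lborel)"
  proof (rule Bochner_Integration.integral_cong[OF refl])
    fix y
    show "(\<Sum>i\<in>UNIV. ?H i (x - y) * f y) = - (of_real k)\<^sup>2 * (kerE k (x - y) * f y)"
    proof (cases "y \<in> S")
      case True
      then have "x \<noteq> y" using x closure_subset by blast
      then have r: "norm (x - y) \<noteq> 0" by simp
      define B where "B = fB k (norm (x - y))"
      define A where "A = fA k (norm (x - y))"
      have "(\<Sum>i\<in>UNIV. ?H i (x - y) * f y) = (\<Sum>i\<in>UNIV. (of_real (((x - y) $ i)\<^sup>2) * B + A) * f y)"
        unfolding A_def B_def by (intro sum.cong refl) (simp add: power2_eq_square mult.assoc)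
      also have "\<dots> = ((\<Sum>i\<in>UNIV. of_real (((x - y) $ i)\<^sup>2)) * B + 3 * A) * f y"
        by (simp add: sum_distrib_right[symmetric] sum.distrib)
      also have "\<dots> = (3 * A + of_real (norm (x - y)) ^ 2 * B) * f y" unfolding sum_component_squares by (simp add: add.commute)
      also have "\<dots> = - (of_real k)\<^sup>2 * (kerE k (x - y) * f y)"
        unfolding A_def B_def fE_laplace[OF r] by simp
      finally show ?thesis .
    qed (simp add: f_supp)
  qed
  also have "\<dots> = - (of_real k)\<^sup>2 * potential (kerE k) f x" unfolding potential_def by simp
  finally show ?thesis by simp
qed

text \<open>The leading terms of the radial derivative and of ik times the potential cancel: each is
  of order 1 / |x|, their difference of order 1 / |x|^2. For |x| \<ge> 2R the distance to any source
  point is at least |x| / 2, whence the factor 4.\<close>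

lemma potential_radiating:
  assumes k: "k \<ge> 0"
  shows "radiating k (potential (kerE k) f)"
proof -
  obtain R where R: "R > 0" "\<And>y. y \<in> closure S \<Longrightarrow> norm y \<le> R"
    using bounded_closure[OF S_bounded] bounded_pos by metis
  define C where "C = 4 * (2 * k * R + 1) * M * measure lborel S"
  have key: "norm (of_real (norm x) * (frechet_derivative (potential (kerE k) f) (at x) (x /\<^sub>R norm x) - \<i> * of_real k * potential (kerE k) f x))
      \<le> C * inverse (norm x)" if x: "norm x \<ge> 2 * R" for x
  proof -
    have x0: "norm x > 0" using x R by linarith
    have xS: "x \<notin> closure S" using R(2)[of x] R(1) x by auto
    define e where "e = x /\<^sub>R norm x"
    have ee: "norm e = 1" using x0 by (simp add: e_def)
    have xe: "x \<bullet> e = norm x" using x0 by (simp add: e_def dot_square_norm power2_eq_square)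
    define h where "h y = of_real ((x - y) \<bullet> e) * fA k (norm (x - y)) - \<i> * of_real k * fE k (norm (x - y))" for y
    have hb: "norm (h y) \<le> 4 * (2 * k * R + 1) / (norm x)\<^sup>2" if y: "y \<in> S" for y
    proof -
      define r where "r = norm (x - y)"
      have yR: "norm y \<le> R" using y R(2) closure_subset by blast
      have rx: "r \<ge> norm x / 2" using norm_triangle_ineq2[of x y] yR x unfolding r_def by linarith
      then have r0: "r > 0" using x0 by linarith
      have inner: "(x - y) \<bullet> e = norm x - y \<bullet> e" by (simp add: inner_diff_left xe)
      have ye: "\<bar>y \<bullet> e\<bar> \<le> R" using Cauchy_Schwarz_ineq2[of y e] ee yR by simp
      have d1: "\<bar>(x - y) \<bullet> e - r\<bar> \<le> 2 * R"
      proof -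
        have "\<bar>norm x - r\<bar> \<le> norm y" unfolding r_def using norm_triangle_ineq3[of x "x - y"] by simp
        then show ?thesis unfolding inner using ye yR by linarith
      qed
      have d2: "\<bar>(x - y) \<bullet> e\<bar> \<le> r" using Cauchy_Schwarz_ineq2[of "x - y" e] ee by (simp add: r_def)
      \<comment> \<open>The cancellation: the first numerator contains (x - y) . e - r, which is
        bounded by 2R because e is the direction of x and |y| \<le> R.\<close>
      have "h y = exp (\<i> * of_real k * of_real r) *
          (\<i> * of_real k * of_real ((x - y) \<bullet> e - r) / of_real r ^ 2 - of_real ((x - y) \<bullet> e) / of_real r ^ 3)"
        unfolding h_def r_def[symmetric] fA_def fE_def using r0 by (simp add: field_simps eval_nat_numeral)
      then have "norm (h y) = norm (\<i> * of_real k * of_real ((x - y) \<bullet> e - r) / of_real r ^ 2 - of_real ((x - y) \<bullet> e) / of_real r ^ 3)"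
        by (simp add: norm_mult)
      also have "\<dots> \<le> norm (\<i> * complex_of_real k * of_real ((x - y) \<bullet> e - r) / of_real r ^ 2) + norm (complex_of_real ((x - y) \<bullet> e) / of_real r ^ 3)"
        by (rule norm_triangle_ineq4)
      also have "\<dots> = k * \<bar>(x - y) \<bullet> e - r\<bar> / r\<^sup>2 + \<bar>(x - y) \<bullet> e\<bar> / r ^ 3"
        unfolding norm_divide norm_mult norm_power norm_of_real using k r0 by simp
      also have "\<dots> \<le> k * (2 * R) / r\<^sup>2 + r / r ^ 3"
        using d1 d2 k r0 by (intro add_mono divide_right_mono mult_left_mono) auto
      also have "\<dots> = (2 * k * R + 1) / r\<^sup>2" using r0 by (simp add: field_simps eval_nat_numeral)
      also have "\<dots> \<le> (2 * k * R + 1) / (norm x / 2)\<^sup>2"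
        using rx x0 k R r0 by (intro divide_left_mono power_mono mult_pos_pos) auto
      also have "\<dots> = 4 * (2 * k * R + 1) / (norm x)\<^sup>2" by (simp add: power_divide)
      finally show ?thesis .
    qed
    have iA: "integrable lborel (\<lambda>y. of_real ((x - y) \<bullet> e) * fA k (norm (x - y)) * f y)"
      using integrable_kern_potential[OF kern_mult[OF kern_inner kern_fA, of k 0 e] xS] by simp
    have iE: "integrable lborel (\<lambda>y. fE k (norm (x - y)) * f y)"
      using integrable_potential[OF weakly_singular_kerE] by simp
    have "frechet_derivative (potential (kerE k) f) (at x) e - \<i> * of_real k * potential (kerE k) f x
      = (\<integral>y. h y * f y \<partial>lborel)"
      unfolding frechet_derivative_at[OF potential_kerE_has_derivative[OF xS], symmetric] potential_def h_def
      using iA iE by (simp add: left_diff_distrib mult.assoc)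
    also have "norm \<dots> \<le> (\<integral>y. norm (h y * f y) \<partial>lborel)" by (rule integral_norm_bound)
    also have "\<dots> \<le> (\<integral>y. 4 * (2 * k * R + 1) / (norm x)\<^sup>2 * M * indicator S y \<partial>lborel)"
    proof (rule integral_mono)
      have "integrable lborel (\<lambda>y. h y * f y)" unfolding h_def using iA iE by (simp add: left_diff_distrib mult.assoc)
      then show "integrable lborel (\<lambda>y. norm (h y * f y))" by (rule integrable_norm)
      show "integrable lborel (\<lambda>y. 4 * (2 * k * R + 1) / (norm x)\<^sup>2 * M * indicator S y)"
        using emeasure_bounded_finite[OF S_bounded] by simp
      show "norm (h y * f y) \<le> 4 * (2 * k * R + 1) / (norm x)\<^sup>2 * M * indicator S y" for y
      proof (cases "y \<in> S")
        case True
        have "norm (h y) * norm (f y) \<le> 4 * (2 * k * R + 1) / (norm x)\<^sup>2 * M"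
          using k R by (intro mult_mono hb[OF True] f_bound) auto
        then show ?thesis using True by (simp add: norm_mult)
      qed (simp add: f_supp)
    qed
    also have "\<dots> = C / (norm x)\<^sup>2" unfolding C_def by simp
    finally have "norm (frechet_derivative (potential (kerE k) f) (at x) e - \<i> * of_real k * potential (kerE k) f x) \<le> C / (norm x)\<^sup>2" .
    then have "norm x * norm (frechet_derivative (potential (kerE k) f) (at x) e - \<i> * of_real k * potential (kerE k) f x) \<le> norm x * (C / (norm x)\<^sup>2)"
      by (intro mult_left_mono) auto
    also have "norm x * (C / (norm x)\<^sup>2) = C * inverse (norm x)" using x0 by (simp add: power2_eq_square field_simps)
    finally show ?thesis unfolding e_def norm_mult norm_of_real by simp
  qed
  show ?thesis unfolding radiating_def
  proof (rule Lim_null_comparison)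
    show "\<forall>\<^sub>F x in at_infinity. norm (of_real (norm x) * (frechet_derivative (potential (kerE k) f) (at x) (x /\<^sub>R norm x) - \<i> * of_real k * potential (kerE k) f x))
      \<le> C * inverse (norm x)"
      unfolding eventually_at_infinity using key by blast
    have "((\<lambda>x::R3. inverse (norm x)) \<longlongrightarrow> 0) at_infinity"
      by (rule tendsto_inverse_0_at_top[OF filterlim_at_infinity_imp_norm_at_top[OF filterlim_ident]])
    from tendsto_mult_right_zero[OF this, of C] show "((\<lambda>x::R3. C * inverse (norm x)) \<longlongrightarrow> 0) at_infinity" .
  qed
qed

end

lemma mult_le_sum_squares:
  fixes a b :: real
  assumes "a \<ge> 0" "b \<ge> 0" shows "a * b \<le> a\<^sup>2 + b\<^sup>2"
  using sum_squares_bound[of a b] mult_nonneg_nonneg[OF assms] by (simp add: mult.assoc)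

text \<open>The difference splits into a phase part, bounded by k |a - b| / |a|, and an amplitude
  part, where 1 / (st) \<le> 1 / s^2 + 1 / t^2 separates the two arguments. All singularities remain
  locally integrable, so potentials of bounded densities are Lipschitz.\<close>

lemma kerE_lipschitz:
  fixes a b :: R3
  assumes "a \<noteq> 0" "b \<noteq> 0" "k \<ge> 0"
  shows "norm (kerE k a - kerE k b) \<le> norm (a - b) * (k * norm a powr - 1 + norm a powr - 2 + norm b powr - 2)"
proof -
  define s t where "s = norm a" and "t = norm b"
  have st: "s > 0" "t > 0" "\<bar>s - t\<bar> \<le> norm (a - b)" using assms norm_triangle_ineq3 unfolding s_def t_def by auto
  define X where "X = (exp (\<i> * of_real k * of_real s) - exp (\<i> * of_real k * of_real t)) / complex_of_real s"
  define Y where "Y = exp (\<i> * of_real k * of_real t) * (1 / of_real s - 1 / complex_of_real t)"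
  have "kerE k a - kerE k b = X + Y"
    unfolding fE_def X_def Y_def s_def[symmetric] t_def[symmetric] by (simp add: diff_divide_distrib right_diff_distrib)
  then have "norm (kerE k a - kerE k b) \<le> norm X + norm Y" using norm_triangle_ineq by metis
  also have "norm X \<le> k * norm (a - b) / s"
  proof -
    have "exp (\<i> * of_real k * of_real s) - exp (\<i> * of_real k * of_real t)
      = exp (\<i> * of_real k * of_real t) * (exp (\<i> * of_real (k * (s - t))) - 1)"
      by (simp add: right_diff_distrib exp_add[symmetric] algebra_simps)
    then have "norm (exp (\<i> * of_real k * of_real s) - exp (\<i> * of_real k * of_real t)) = norm (exp (\<i> * of_real (k * (s - t))) - 1)"
      by (simp add: norm_mult)
    also have "\<dots> = 2 * \<bar>sin (k * (s - t) / 2)\<bar>" by (rule dist_exp_i_1)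
    also have "\<dots> \<le> \<bar>k * (s - t)\<bar>" using abs_sin_x_le_abs_x[of "k * (s - t) / 2"] by simp
    also have "\<dots> \<le> k * norm (a - b)" using st assms by (simp add: abs_mult mult_left_mono)
    finally show ?thesis unfolding X_def norm_divide norm_of_real using st by (simp add: divide_right_mono)
  qed
  also have "norm Y \<le> norm (a - b) * (1 / s\<^sup>2 + 1 / t\<^sup>2)"
  proof -
    have "1 / of_real s - 1 / complex_of_real t = of_real (1 / s - 1 / t)" by simp
    then have "norm Y = \<bar>1 / s - 1 / t\<bar>"
      unfolding Y_def norm_mult norm_exp_ikt by (metis mult_1 norm_of_real)
    also have "1 / s - 1 / t = (t - s) * (1 / s * (1 / t))" using st by (simp add: field_simps)
    also have "\<bar>(t - s) * (1 / s * (1 / t))\<bar> = \<bar>s - t\<bar> * (1 / s * (1 / t))" using st by (simp add: abs_mult abs_minus_commute)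
    also have "\<dots> \<le> norm (a - b) * (1 / s\<^sup>2 + 1 / t\<^sup>2)"
    proof (intro mult_mono)
      have "1 / s * (1 / t) \<le> (1 / s)\<^sup>2 + (1 / t)\<^sup>2" by (rule mult_le_sum_squares) (use st in auto)
      then show "1 / s * (1 / t) \<le> 1 / s\<^sup>2 + 1 / t\<^sup>2" by (simp add: power_divide)
    qed (use st in auto)
    finally show ?thesis .
  qed
  finally have "norm (kerE k a - kerE k b) \<le> norm (a - b) * (k * (1 / s) + 1 / s\<^sup>2 + 1 / t\<^sup>2)"
    by (simp add: distrib_left mult.commute[of k])
  then show ?thesis unfolding norm_powr_minus_1 norm_powr_minus_2 s_def t_def .
qed

section \<open>Dipole fields\<close>

lemma has_derivative_divide_const:
  fixes f :: "'a::real_normed_vector \<Rightarrow> complex"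
  assumes "(f has_derivative f') F"
  shows "((\<lambda>x. f x / c) has_derivative (\<lambda>v. f' v / c)) F"
  using bounded_linear.has_derivative[OF bounded_linear_divide assms] by simp

text \<open>The explicit form of \<open>dipole_inc\<close> off z. There \<open>dipole_inc\<close> is
  a true derivative, whereas at z its value is unspecified; this version is Borel on the whole space
  and equals 0 at z.\<close>

definition dipole_field :: "real \<Rightarrow> R3 \<Rightarrow> R3 \<Rightarrow> R3 \<Rightarrow> complex" where
  "dipole_field k z a x = of_real ((x - z) \<bullet> a) * fA k (norm (x - z)) / of_real (4 * pi)"

definition dipole_grad :: "real \<Rightarrow> R3 \<Rightarrow> R3 \<Rightarrow> 3 \<Rightarrow> R3 \<Rightarrow> complex" where
  "dipole_grad k z a i x = (of_real ((x - z) \<bullet> a) * (of_real ((x - z) $ i) * fB k (norm (x - z)))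
     + of_real (a $ i) * fA k (norm (x - z))) / of_real (4 * pi)"

lemma dipole_inc_eq:
  assumes "x \<noteq> z"
  shows "dipole_inc k z a x = dipole_field k z a x"
proof -
  have "((\<lambda>y. Phi k y z) has_derivative (\<lambda>v. of_real ((x - z) \<bullet> v) * fA k (norm (x - z)) / of_real (4 * pi))) (at x)"
  proof -
    have "Phi k y z = fE k (rho 0 (y - z)) / of_real (4 * pi)" for y
      unfolding Phi_def fE_def by (simp add: dist_norm)
    moreover have "((\<lambda>y. fE k (rho 0 (y - z)) / of_real (4 * pi)) has_derivative
        (\<lambda>v. of_real ((x - z) \<bullet> v) * fA k (rho 0 (x - z)) / of_real (4 * pi))) (at x)"
      by (rule has_derivative_divide_const[OF has_derivative_fE_shift]) (use assms in simp)
    ultimately show ?thesis by simp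
  qed
  from frechet_derivative_at[OF this, symmetric] show ?thesis
    unfolding dipole_inc_def dipole_field_def by simp
qed

lemma dipole_field_measurable [measurable]: "dipole_field k z a \<in> borel_measurable borel"
  unfolding dipole_field_def[abs_def] by measurable

lemma dipole_grad_measurable [measurable]: "dipole_grad k z a i \<in> borel_measurable borel"
  unfolding dipole_grad_def[abs_def] vector_minus_component by measurable

lemma has_derivative_fB_shift:
  assumes "x \<noteq> y \<or> \<epsilon> \<noteq> 0"
  shows "((\<lambda>x. fB k (rho \<epsilon> (x - y))) has_derivative (\<lambda>v. of_real ((x - y) \<bullet> v) * fC k (rho \<epsilon> (x - y)))) (at x)"
proof -
  have x: "x - y \<noteq> 0 \<or> \<epsilon> \<noteq> 0" using assms by simp
  have "((\<lambda>x. x - y) has_derivative (\<lambda>v. v)) (at x)" by (auto intro!: derivative_eq_intros)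
  moreover have "((\<lambda>x. fB k (rho \<epsilon> x)) has_derivative (\<lambda>v. of_real ((x - y) \<bullet> v) * fC k (rho \<epsilon> (x - y)))) (at (x - y))"
    using rho_pos[OF x] by (intro has_derivative_radial fB_deriv x) simp
  ultimately show ?thesis by (rule has_derivative_compose)
qed

lemma kern_fC: "kern k \<epsilon> (\<lambda>x. fC k (rho \<epsilon> x))"
  unfolding fC_def by (intro kern_mult kern_exp kern_diff kern_add kern_inverse_power)

lemma has_derivative_inner_shift:
  "((\<lambda>x::R3. of_real ((x - z) \<bullet> a) :: complex) has_derivative (\<lambda>v. of_real (v \<bullet> a))) (at x)"
  by (auto intro!: derivative_eq_intros)

lemma dipole_field_has_derivative:
  assumes "x \<noteq> z"
  shows "(dipole_field k z a has_derivative (\<lambda>v. (of_real ((x - z) \<bullet> a) * (of_real ((x - z) \<bullet> v) * fB k (norm (x - z)))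
     + of_real (v \<bullet> a) * fA k (norm (x - z))) / of_real (4 * pi))) (at x)"
  using has_derivative_mult[OF has_derivative_inner_shift has_derivative_fA_shift[of x z 0], of z a k] assms
  unfolding dipole_field_def[abs_def] by (intro has_derivative_divide_const) simp

lemma dipole_grad_has_derivative:
  assumes "x \<noteq> z"
  shows "(dipole_grad k z a i has_derivative (\<lambda>v.
     (of_real ((x - z) \<bullet> a) * (of_real ((x - z) $ i) * (of_real ((x - z) \<bullet> v) * fC k (norm (x - z))) + of_real (v $ i) * fB k (norm (x - z)))
      + of_real (v \<bullet> a) * (of_real ((x - z) $ i) * fB k (norm (x - z)))
      + of_real (a $ i) * (of_real ((x - z) \<bullet> v) * fB k (norm (x - z)))) / of_real (4 * pi))) (at x)"
proof -
  have x: "x \<noteq> z \<or> (0::real) \<noteq> 0" using assms by simp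
  note d = has_derivative_mult[OF has_derivative_inner_shift[of z a x] has_derivative_mult[OF has_derivative_component_shift[of z i x] has_derivative_fB_shift[OF x, of k]]]
  have "((\<lambda>x. of_real (a $ i) * fA k (rho 0 (x - z))) has_derivative (\<lambda>v. of_real (a $ i) * (of_real ((x - z) \<bullet> v) * fB k (rho 0 (x - z))))) (at x)"
    by (rule has_derivative_mult_right[OF has_derivative_fA_shift[OF x]])
  from has_derivative_add[OF d this] show ?thesis
    unfolding dipole_grad_def[abs_def] by (intro has_derivative_divide_const) simp
qed

lemma
  shows dipole_field_continuous_on: "continuous_on (- {z}) (dipole_field k z a)"
    and dipole_grad_continuous_on: "continuous_on (- {z}) (dipole_grad k z a i)"
proof -
  have cA: "continuous_on (- {z}) (\<lambda>x. fA k (norm (x - z)))" using kern_shift_continuous_on[OF kern_fA, of 0 z "- {z}" k] by simp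
  have cB: "continuous_on (- {z}) (\<lambda>x. fB k (norm (x - z)))" using kern_shift_continuous_on[OF kern_fB, of 0 z "- {z}" k] by simp
  show "continuous_on (- {z}) (dipole_field k z a)"
    unfolding dipole_field_def[abs_def] by (intro continuous_intros cA) simp
  show "continuous_on (- {z}) (dipole_grad k z a i)"
    unfolding dipole_grad_def[abs_def] by (intro continuous_intros cA cB) simp
qed

text \<open>Test functions here vanish near z, so integration by parts applies twice to a field that
  is smooth off z, and no singular contribution at the source appears.\<close>

lemma
  assumes \<phi>: "test_fun (- {z}) \<phi>"
  shows dipole_weak_gradient:
      "(\<integral>x. dipole_field k z a x * of_real (pderiv3 i \<phi> x) \<partial>lborel) = - (\<integral>x. dipole_grad k z a i x * of_real (\<phi> x) \<partial>lborel)"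
    and dipole_weak_helmholtz:
      "(\<integral>x. (\<Sum>i\<in>UNIV. dipole_grad k z a i x * of_real (pderiv3 i \<phi> x))
           - (of_real k)\<^sup>2 * dipole_field k z a x * of_real (\<phi> x) \<partial>lborel) = 0"
    and integrable_dipole_test:
      "integrable lborel (\<lambda>x. dipole_field k z a x * of_real (\<phi> x))"
      "integrable lborel (\<lambda>x. dipole_field k z a x * of_real (pderiv3 i \<phi> x))"
      "integrable lborel (\<lambda>x. dipole_grad k z a i x * of_real (\<phi> x))"
      "integrable lborel (\<lambda>x. dipole_grad k z a i x * of_real (pderiv3 i \<phi> x))"
proof -
  have op: "open (- {z})" by auto
  have ax: "v \<bullet> axis i 1 = v $ i" "axis i 1 \<bullet> v = v $ i" for v :: R3 and i by (simp_all add: inner_axis inner_axis')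
  have cA: "continuous_on (- {z}) (\<lambda>x. fA k (norm (x - z)))" using kern_shift_continuous_on[OF kern_fA, of 0 z "- {z}" k] by simp
  have cB: "continuous_on (- {z}) (\<lambda>x. fB k (norm (x - z)))" using kern_shift_continuous_on[OF kern_fB, of 0 z "- {z}" k] by simp
  have cC: "continuous_on (- {z}) (\<lambda>x. fC k (norm (x - z)))" using kern_shift_continuous_on[OF kern_fC, of 0 z "- {z}" k] by simp
  show int: "integrable lborel (\<lambda>x. dipole_field k z a x * of_real (\<phi> x))"
      "integrable lborel (\<lambda>x. dipole_field k z a x * of_real (pderiv3 i \<phi> x))"
      "integrable lborel (\<lambda>x. dipole_grad k z a i x * of_real (\<phi> x))"
      "integrable lborel (\<lambda>x. dipole_grad k z a i x * of_real (pderiv3 i \<phi> x))" for i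
    by (intro integrable_mult_test[OF _ op \<phi>] dipole_field_continuous_on dipole_grad_continuous_on)+
  have "(\<integral>x. dipole_field k z a x * of_real (pderiv3 i \<phi> x) \<partial>lborel)
    = - (\<integral>x. ((of_real ((x - z) \<bullet> a) * (of_real ((x - z) \<bullet> axis i 1) * fB k (norm (x - z)))
     + of_real (axis i 1 \<bullet> a) * fA k (norm (x - z))) / of_real (4 * pi)) * of_real (\<phi> x) \<partial>lborel)"
  proof (rule integral_by_parts_test[OF op \<phi> dipole_field_has_derivative])
    show "continuous_on (- {z}) (\<lambda>x. (of_real ((x - z) \<bullet> a) * (of_real ((x - z) \<bullet> axis i 1) * fB k (norm (x - z)))
     + of_real (axis i 1 \<bullet> a) * fA k (norm (x - z))) / of_real (4 * pi))"
      by (intro continuous_intros cA cB) simp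
  qed simp
  then show "(\<integral>x. dipole_field k z a x * of_real (pderiv3 i \<phi> x) \<partial>lborel) = - (\<integral>x. dipole_grad k z a i x * of_real (\<phi> x) \<partial>lborel)"
    unfolding dipole_grad_def ax .
  \<comment> \<open>The second derivative of the dipole field in direction i, taken twice; their sum
    is evaluated by \<open>fA_laplace\<close>.\<close>
  define Q where "Q i x = (of_real ((x - z) \<bullet> a) * (of_real ((x - z) $ i) * (of_real ((x - z) $ i) * fC k (norm (x - z))) + fB k (norm (x - z)))
      + of_real (a $ i) * (of_real ((x - z) $ i) * fB k (norm (x - z)))
      + of_real (a $ i) * (of_real ((x - z) $ i) * fB k (norm (x - z)))) / complex_of_real (4 * pi)" for i x
  have cQ: "continuous_on (- {z}) (Q i)" for i unfolding Q_def by (intro continuous_intros cB cC) simp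
  have parts: "(\<integral>x. dipole_grad k z a i x * of_real (pderiv3 i \<phi> x) \<partial>lborel) = - (\<integral>x. Q i x * of_real (\<phi> x) \<partial>lborel)" for i
  proof -
    have eq: "(of_real ((x - z) \<bullet> a) * (of_real ((x - z) $ i) * (of_real ((x - z) \<bullet> axis i 1) * fC k (norm (x - z))) + of_real (axis i 1 $ i) * fB k (norm (x - z)))
      + of_real (axis i 1 \<bullet> a) * (of_real ((x - z) $ i) * fB k (norm (x - z)))
      + of_real (a $ i) * (of_real ((x - z) \<bullet> axis i 1) * fB k (norm (x - z)))) / of_real (4 * pi) = Q i x" for x
      unfolding Q_def ax by (simp add: axis_def)
    show ?thesis unfolding eq[symmetric]
      by (rule integral_by_parts_test[OF op \<phi> dipole_grad_has_derivative]) (use cQ in \<open>simp_all only: eq Compl_iff singleton_iff simp_thms\<close>)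
  qed
  have iQ: "integrable lborel (\<lambda>x. Q i x * of_real (\<phi> x))" for i
    by (rule integrable_mult_test(1)[OF cQ op \<phi>])
  have sumQ: "(\<Sum>i\<in>UNIV. Q i x) = - (of_real k)\<^sup>2 * dipole_field k z a x" if "x \<noteq> z" for x
  proof -
    define r where "r = norm (x - z)"
    have r: "r \<noteq> 0" using that by (simp add: r_def)
    define c where "c = complex_of_real ((x - z) \<bullet> a)"
    have "(\<Sum>i\<in>UNIV. (x - z) $ i * a $ i) = (x - z) \<bullet> a" by (simp add: inner_vec_def)
    then have T: "(\<Sum>i\<in>UNIV. of_real ((x - z) $ i * a $ i)) = c" unfolding c_def by (simp only: of_real_sum[symmetric])
    have "(\<Sum>i\<in>UNIV. Q i x) = (\<Sum>i\<in>UNIV. c * (of_real (((x - z) $ i)\<^sup>2) * fC k r + fB k r) + of_real ((x - z) $ i * a $ i) * (2 * fB k r)) / of_real (4 * pi)"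
      unfolding Q_def r_def[symmetric] c_def[symmetric] sum_divide_distrib[symmetric]
      by (intro arg_cong2[where f = "(/)"] sum.cong refl) (simp add: power2_eq_square algebra_simps)
    also have "(\<Sum>i\<in>UNIV. c * (of_real (((x - z) $ i)\<^sup>2) * fC k r + fB k r) + of_real ((x - z) $ i * a $ i) * (2 * fB k r))
      = c * ((\<Sum>i\<in>UNIV. of_real (((x - z) $ i)\<^sup>2)) * fC k r + 3 * fB k r) + (\<Sum>i\<in>UNIV. of_real ((x - z) $ i * a $ i)) * (2 * fB k r)"
      by (simp only: sum.distrib sum_distrib_left[symmetric] sum_distrib_right[symmetric]) (simp add: sum.distrib)
    also have "\<dots> = c * (5 * fB k r + of_real r ^ 2 * fC k r)" unfolding sum_component_squares T r_def[symmetric] by (simp add: algebra_simps)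
    also have "\<dots> = c * (- (of_real k)\<^sup>2 * fA k r)" by (simp only: fA_laplace[OF r])
    finally show ?thesis unfolding dipole_field_def r_def[symmetric] c_def[symmetric] by simp
  qed
  have "(\<integral>x. (\<Sum>i\<in>UNIV. dipole_grad k z a i x * of_real (pderiv3 i \<phi> x))
           - (of_real k)\<^sup>2 * dipole_field k z a x * of_real (\<phi> x) \<partial>lborel)
    = (\<Sum>i\<in>UNIV. \<integral>x. dipole_grad k z a i x * of_real (pderiv3 i \<phi> x) \<partial>lborel)
      - (of_real k)\<^sup>2 * (\<integral>x. dipole_field k z a x * of_real (\<phi> x) \<partial>lborel)"
    using int by (simp add: mult.assoc)
  also have "\<dots> = - (\<integral>x. (\<Sum>i\<in>UNIV. Q i x * of_real (\<phi> x)) \<partial>lborel)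
      - (of_real k)\<^sup>2 * (\<integral>x. dipole_field k z a x * of_real (\<phi> x) \<partial>lborel)"
    unfolding parts using iQ by (simp add: sum_negf)
  also have "(\<integral>x. (\<Sum>i\<in>UNIV. Q i x * of_real (\<phi> x)) \<partial>lborel) = (\<integral>x. - (of_real k)\<^sup>2 * (dipole_field k z a x * of_real (\<phi> x)) \<partial>lborel)"
  proof (rule integral_cong_AE)
    have "AE x in lborel. x \<noteq> z" using AE_lborel_singleton[of z] by simp
    then show "AE x in lborel. (\<Sum>i\<in>UNIV. Q i x * of_real (\<phi> x)) = - (of_real k)\<^sup>2 * (dipole_field k z a x * of_real (\<phi> x))"
      by eventually_elim (simp add: sum_distrib_right[symmetric] sumQ)
    show "(\<lambda>x. \<Sum>i\<in>UNIV. Q i x * of_real (\<phi> x)) \<in> borel_measurable lborel"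
      using borel_measurable_integrable[OF iQ] by (intro borel_measurable_sum)
    show "(\<lambda>x. - (of_real k)\<^sup>2 * (dipole_field k z a x * of_real (\<phi> x))) \<in> borel_measurable lborel"
      by (intro borel_measurable_times borel_measurable_const borel_measurable_integrable[OF int(1)])
  qed
  finally show "(\<integral>x. (\<Sum>i\<in>UNIV. dipole_grad k z a i x * of_real (pderiv3 i \<phi> x))
           - (of_real k)\<^sup>2 * dipole_field k z a x * of_real (\<phi> x) \<partial>lborel) = 0"
    by simp
qed

section \<open>Size of dipole fields and their norms\<close>

lemma norm_dipole_field:
  assumes "k \<ge> 0" "x \<noteq> z"
  shows "norm (dipole_field k z a x) = \<bar>(x - z) \<bullet> a\<bar> * norm (fA k (norm (x - z))) / (4 * pi)"
  unfolding dipole_field_def by (simp add: norm_mult norm_divide)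

lemma norm_fA_antimono:
  assumes "0 < s" "s \<le> t" shows "norm (fA k t) \<le> norm (fA k s)"
proof -
  have "k\<^sup>2 / t\<^sup>2 + 1 / t ^ 4 \<le> k\<^sup>2 / s\<^sup>2 + 1 / s ^ 4"
    using assms by (intro add_mono divide_left_mono power_mono) auto
  then have "sqrt (k\<^sup>2 / t\<^sup>2 + 1 / t ^ 4) / t \<le> sqrt (k\<^sup>2 / s\<^sup>2 + 1 / s ^ 4) / s"
    using assms by (intro frac_le) auto
  then show ?thesis using assms by (simp add: norm_fA_eq)
qed

text \<open>Replacing t by t / 3 enlarges the radicand by at most 3^4, hence the root by 9, and the
  factor 1 / t by 3. The ratio 3 is that of the largest to the smallest relevant distance from a far
  source to D.\<close>

lemma norm_fA_scale:
  assumes "0 < t" shows "norm (fA k (t / 3)) \<le> 27 * norm (fA k t)"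
proof -
  have "k\<^sup>2 / (t / 3)\<^sup>2 + 1 / (t / 3) ^ 4 \<le> 81 * (k\<^sup>2 / t\<^sup>2 + 1 / t ^ 4)"
    by (simp add: power_divide distrib_left divide_right_mono)
  then have "sqrt (k\<^sup>2 / (t / 3)\<^sup>2 + 1 / (t / 3) ^ 4) \<le> sqrt (81 * (k\<^sup>2 / t\<^sup>2 + 1 / t ^ 4))" by simp
  also have "\<dots> = 9 * sqrt (k\<^sup>2 / t\<^sup>2 + 1 / t ^ 4)"
  proof -
    have "sqrt 81 = 9" by (rule real_sqrt_unique) auto
    then show ?thesis by (simp only: real_sqrt_mult)
  qed
  finally show ?thesis using assms by (simp add: norm_fA_eq field_simps)
qed

lemma norm_fA_pos: "0 < t \<Longrightarrow> 0 < norm (fA k t)"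
  by (simp add: norm_fA_eq add_nonneg_pos)

lemma Lp_on_bounded:
  assumes D: "D \<in> lmeasurable" and m: "f \<in> borel_measurable (lebesgue_on D)" and B: "\<And>x. x \<in> D \<Longrightarrow> norm (f x) \<le> B" and p: "p > 0"
  shows "Lp_on p D f"
  unfolding Lp_on_def
proof (intro conjI m)
  have fin: "integrable (lebesgue_on D) (\<lambda>x. \<bar>B\<bar> powr p)"
    using D by (auto simp: integrable_restrict_space fmeasurable_def)
  show "integrable (lebesgue_on D) (\<lambda>x. norm (f x) powr p)"
  proof (rule Bochner_Integration.integrable_bound[OF fin])
    show "(\<lambda>x. norm (f x) powr p) \<in> borel_measurable (lebesgue_on D)" using m by measurable
    show "AE x in lebesgue_on D. norm (norm (f x) powr p) \<le> norm (\<bar>B\<bar> powr p)"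
    proof (rule AE_I2)
      fix x assume "x \<in> space (lebesgue_on D)"
      then have "norm (f x) \<le> \<bar>B\<bar>" using B[of x] by simp
      then show "norm (norm (f x) powr p) \<le> norm (\<bar>B\<bar> powr p)" using p by (simp add: powr_mono2)
    qed
  qed
qed

lemma Lp_norm_ge_on_ball:
  assumes f: "Lp_on p D f" and p: "p > 0" and b: "ball c r \<subseteq> D" "r > 0" and m: "m \<ge> 0" "\<And>x. x \<in> ball c r \<Longrightarrow> m \<le> norm (f x)"
    and D: "open D"
  shows "m * (measure lebesgue (ball c r)) powr (1 / p) \<le> Lp_norm p D f"
proof -
  have Dm: "D \<in> sets lebesgue" using D by simp
  have bm: "ball c r \<in> sets (lebesgue_on D)" using b(1) Dm by (simp add: sets_restrict_space_iff)
  have ms: "measure (lebesgue_on D) (ball c r) = measure lebesgue (ball c r)"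
    using b(1) Dm by (intro measure_restrict_space) auto
  have "m powr p * measure lebesgue (ball c r) = (\<integral>x. m powr p * indicator (ball c r) x \<partial>lebesgue_on D)"
    using bm b(1) by (simp add: ms Int_absorb2)
  also have "\<dots> \<le> (\<integral>x. norm (f x) powr p \<partial>lebesgue_on D)"
  proof (rule integral_mono)
    have "emeasure (lebesgue_on D) (ball c r) < \<infinity>"
      using b(1) Dm emeasure_bounded_finite[of "ball c r"] by (subst emeasure_restrict_space) auto
    then show "integrable (lebesgue_on D) (\<lambda>x. m powr p * indicator (ball c r) x)"
      using bm by simp
    show "integrable (lebesgue_on D) (\<lambda>x. norm (f x) powr p)" using f by (simp add: Lp_on_def)
    show "m powr p * indicator (ball c r) x \<le> norm (f x) powr p" for x
      using m p by (auto simp: indicator_def intro: powr_mono2)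
  qed
  finally have "(m powr p * measure lebesgue (ball c r)) powr (1 / p) \<le> Lp_norm p D f"
    unfolding Lp_norm_def using p by (intro powr_mono2) auto
  then show ?thesis using m p by (simp add: powr_mult powr_powr)
qed

lemma dipole_inc_measurable:
  assumes "z \<notin> D" "D \<in> sets lebesgue"
  shows "dipole_inc k z a \<in> borel_measurable (lebesgue_on D)"
proof -
  have "dipole_field k z a \<in> borel_measurable (lebesgue_on D)"
    by (intro measurable_restrict_space1 measurable_completion) simp
  moreover have "dipole_field k z a x = dipole_inc k z a x" if "x \<in> space (lebesgue_on D)" for x
    using that assms by (intro dipole_inc_eq[symmetric]) auto
  ultimately show ?thesis using measurable_cong[of "lebesgue_on D" "dipole_field k z a" "dipole_inc k z a" borel] by blast
qed

lemma dipole_field_bounded: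
  assumes "z \<notin> closure D" "bounded D"
  shows "\<exists>B\<ge>0. \<forall>x\<in>D. norm (dipole_field k z a x) \<le> B"
proof -
  have "continuous_on (closure D) (dipole_field k z a)"
    by (rule continuous_on_subset[OF dipole_field_continuous_on]) (use assms(1) in blast)
  then have "compact (dipole_field k z a ` closure D)"
    using assms(2) by (intro compact_continuous_image) (auto simp: compact_closure)
  then obtain B where B: "\<forall>x\<in>dipole_field k z a ` closure D. norm x \<le> B" using compact_imp_bounded bounded_iff by blast
  then have "\<forall>x\<in>D. norm (dipole_field k z a x) \<le> max B 0" using closure_subset by (force simp: le_max_iff_disj)
  then show ?thesis by (intro exI[of _ "max B 0"]) auto
qed

text \<open>A reverse Hoelder inequality, uniform in the position of the source: on a small ball inside
  \<open>D\<close>, chosen according to the direction of the dipole moment, the field is bounded below by its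
  size elsewhere in \<open>D\<close>, up to the singular factor.\<close>

lemma dipole_le_Lp_norm:
  assumes D: "open D" "bounded D" "D \<noteq> {}" and k: "k \<ge> 0" and p: "p > 0"
  shows "\<exists>C>0. \<forall>z a y. z \<notin> closure D \<longrightarrow> y \<in> D \<longrightarrow>
    norm (dipole_field k z a y) \<le> C * Lp_norm p D (dipole_inc k z a) * (1 + norm (y - z) powr - 2)"
proof -
  obtain c \<rho> where c: "c \<in> D" "\<rho> > 0" "ball c \<rho> \<subseteq> D" using D(1,3) open_contains_ball by blast
  obtain R0 where R0: "\<And>y. y \<in> D \<Longrightarrow> dist c y \<le> R0" using D(2) bounded_any_center[of D c] by blast
  define R where "R = max R0 (max \<rho> 1)"
  have R: "R \<ge> 1" "R \<ge> \<rho>" "\<And>y. y \<in> D \<Longrightarrow> norm (y - c) \<le> R"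
    using R0 unfolding R_def by (auto simp: dist_norm norm_minus_commute le_max_iff_disj)
  \<comment> \<open>The weight that lets one lower bound cover both summands of t below: 1 for |(c -
    z) . a| and \<rho> / 4 for |a|.\<close>
  define \<kappa> where "\<kappa> = min 1 (\<rho> / 4)"
  have kap: "\<kappa> > 0" "\<kappa> \<le> 1" "\<kappa> \<le> \<rho> / 4" using c unfolding \<kappa>_def by auto
  define V where "V = (measure lebesgue (ball (0::R3) (\<rho> / 4))) powr (1 / p)"
  have V: "V > 0" unfolding V_def using c by simp
  define h where "h t = norm (fA k t)" for t
  have h3: "h (3 * R) > 0" unfolding h_def using R by (intro norm_fA_pos) simp
  \<comment> \<open>One summand for sources within 2R of c, one for sources farther away.\<close>
  define C where "C = (k + 1) / (\<kappa> * h (3 * R) * V) + 27 * R / (\<kappa> * V)"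
  have Cp: "C > 0" unfolding C_def
  proof (rule add_pos_pos)
    show "0 < (k + 1) / (\<kappa> * h (3 * R) * V)"
      by (rule divide_pos_pos[OF add_nonneg_pos[OF k zero_less_one]]) (use kap h3 V in simp)
    show "0 < 27 * R / (\<kappa> * V)" using kap V R by simp
  qed
  show ?thesis
  proof (intro exI conjI allI impI)
    show "C > 0" by (rule Cp)
    fix z a y assume z: "z \<notin> closure D" and y: "y \<in> D"
    have zD: "x \<noteq> z" if "x \<in> D" for x using that z closure_subset by blast
    define N where "N = Lp_norm p D (dipole_inc k z a)"
    \<comment> \<open>The effective size of the moment as seen from c. Over D the numerator |(x - z)
      . a| is at most R t, and on the small ball chosen next it is at least \<kappa> t, whatever the
      angle between a and c - z.\<close>
    define t where "t = norm a + \<bar>(c - z) \<bullet> a\<bar>"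
    have t0: "t \<ge> 0" unfolding t_def by simp
    define \<sigma> where "\<sigma> = (if (c - z) \<bullet> a \<ge> 0 then 1 else - 1 :: real)"
    \<comment> \<open>Shifting by \<rho> / 2 along a, with the sign of (c - z) . a, adds \<rho> / 2
      |a| without cancellation; moving within the ball of radius \<rho> / 4 loses at most half of
      this gain.\<close>
    define c' where "c' = c + (\<sigma> * (\<rho> / 2)) *\<^sub>R sgn a"
    have sgn1: "norm (sgn a) \<le> 1" by (simp add: norm_sgn)
    have c'c: "norm (c' - c) \<le> \<rho> / 2" unfolding c'_def using c(2) sgn1 by (simp add: \<sigma>_def abs_mult mult_left_le)
    have sub: "ball c' (\<rho> / 4) \<subseteq> ball c \<rho>"
    proof
      fix x assume "x \<in> ball c' (\<rho> / 4)"
      then have "norm (x - c') < \<rho> / 4" by (simp add: dist_norm norm_minus_commute)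
      moreover have "norm (x - c) \<le> norm (x - c') + norm (c' - c)" using norm_triangle_ineq[of "x - c'" "c' - c"] by simp
      ultimately show "x \<in> ball c \<rho>" using c'c c(2) by (simp add: dist_norm norm_minus_commute)
    qed
    have low: "\<kappa> * t \<le> \<bar>(x - z) \<bullet> a\<bar>" if "x \<in> ball c' (\<rho> / 4)" for x
    proof -
      have xc: "norm (x - c') \<le> \<rho> / 4" using that by (simp add: dist_norm norm_minus_commute)
      have sa: "sgn a \<bullet> a = norm a" by (cases "a = 0") (simp_all add: sgn_div_norm dot_square_norm power2_eq_square)
      have "(x - z) \<bullet> a = (c - z) \<bullet> a + \<sigma> * (\<rho> / 2) * norm a + (x - c') \<bullet> a"
        unfolding c'_def by (simp add: inner_diff_left inner_add_left sa algebra_simps)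
      then have "\<sigma> * ((x - z) \<bullet> a) = \<bar>(c - z) \<bullet> a\<bar> + \<rho> / 2 * norm a + \<sigma> * ((x - c') \<bullet> a)"
        unfolding \<sigma>_def by (auto simp: algebra_simps split: if_splits)
      moreover have "\<bar>\<sigma> * ((x - c') \<bullet> a)\<bar> \<le> \<rho> / 4 * norm a"
      proof -
        have "\<bar>(x - c') \<bullet> a\<bar> \<le> norm (x - c') * norm a" by (rule Cauchy_Schwarz_ineq2)
        also have "\<dots> \<le> \<rho> / 4 * norm a" using xc by (intro mult_right_mono) auto
        finally show ?thesis by (simp add: \<sigma>_def)
      qed
      ultimately have "\<sigma> * ((x - z) \<bullet> a) \<ge> \<bar>(c - z) \<bullet> a\<bar> + \<rho> / 4 * norm a" by linarith
      moreover have "\<sigma> * ((x - z) \<bullet> a) \<le> \<bar>(x - z) \<bullet> a\<bar>" by (auto simp: \<sigma>_def)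
      moreover have "\<kappa> * t \<le> 1 * \<bar>(c - z) \<bullet> a\<bar> + \<rho> / 4 * norm a"
        unfolding t_def distrib_left using kap by (subst add.commute) (intro add_mono mult_right_mono, auto)
      ultimately show ?thesis by linarith
    qed
    have Lp: "Lp_on p D (dipole_inc k z a)"
    proof -
      obtain B where B: "\<forall>x\<in>D. norm (dipole_field k z a x) \<le> B" using dipole_field_bounded[OF z D(2)] by blast
      show ?thesis
        by (rule Lp_on_bounded[OF lmeasurable_open[OF D(2,1)] dipole_inc_measurable]) (use B zD dipole_inc_eq D p in auto)
    qed
    have lower: "\<kappa> * t * h s / (4 * pi) * V \<le> N" if s: "\<And>x. x \<in> ball c' (\<rho> / 4) \<Longrightarrow> norm (x - z) \<le> s" for s
    proof -
      have "\<kappa> * t * h s / (4 * pi) * (measure lebesgue (ball c' (\<rho> / 4))) powr (1 / p) \<le> N"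
        unfolding N_def
      proof (rule Lp_norm_ge_on_ball[OF Lp p _ _ _ _ D(1)])
        show "ball c' (\<rho> / 4) \<subseteq> D" using sub c(3) by blast
        show "\<kappa> * t * h s / (4 * pi) \<le> norm (dipole_inc k z a x)" if x: "x \<in> ball c' (\<rho> / 4)" for x
        proof -
          have xD: "x \<in> D" using x sub c(3) by blast
          have pos: "norm (x - z) > 0" using zD[OF xD] by simp
          have "\<kappa> * t * h s \<le> \<bar>(x - z) \<bullet> a\<bar> * h (norm (x - z))"
            using low[OF x] norm_fA_antimono[OF pos s[OF x], of k] kap t0 unfolding h_def by (intro mult_mono) auto
          then show ?thesis
            unfolding dipole_inc_eq[OF zD[OF xD]] norm_dipole_field[OF k zD[OF xD]] h_def
            by (rule divide_right_mono) simp
        qed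
        show "0 \<le> \<kappa> * t * h s / (4 * pi)" using kap t0 unfolding h_def by simp
      qed (use c in simp)
      moreover have "measure lebesgue (ball c' (\<rho> / 4)) = measure lebesgue (ball (0::R3) (\<rho> / 4))"
        using c by (simp add: content_ball)
      ultimately show ?thesis by (simp only: V_def)
    qed
    have near: "norm (x - z) \<le> norm (c - z) + R" if "x \<in> ball c' (\<rho> / 4)" for x
    proof -
      have "x \<in> D" using that sub c(3) by blast
      then show ?thesis using R(3) norm_triangle_ineq[of "x - c" "c - z"] by fastforce
    qed
    define r where "r = norm (y - z)"
    have r: "r > 0" using zD[OF y] by (simp add: r_def)
    have r2: "norm (y - z) powr - 2 = 1 / r\<^sup>2" unfolding r_def by (rule norm_powr_minus_2)
    have N0: "N \<ge> 0" unfolding N_def Lp_norm_def by simp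
    have fld: "norm (dipole_field k z a y) = \<bar>(y - z) \<bullet> a\<bar> * h r / (4 * pi)"
      unfolding norm_dipole_field[OF k zD[OF y]] h_def r_def ..
    show "norm (dipole_field k z a y) \<le> C * Lp_norm p D (dipole_inc k z a) * (1 + norm (y - z) powr - 2)"
    proof (cases "norm (c - z) \<le> 2 * R")
      case True
      \<comment> \<open>Near source: all distances from the small ball to z are at most 3R, so
        \<open>h\<close> has a fixed positive lower bound there. The size of the field at y is paid
        for by the singular factor, as 1 / r \<le> 1 + 1 / r^2.\<close>
      have "\<kappa> * t * h (3 * R) / (4 * pi) * V \<le> N"
        by (rule lower) (use near True in fastforce)
      moreover have "\<kappa> * norm a * h (3 * R) / (4 * pi) * V \<le> \<kappa> * t * h (3 * R) / (4 * pi) * V"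
        using kap h3 V by (intro mult_right_mono divide_right_mono mult_left_mono) (auto simp: t_def)
      ultimately have "\<kappa> * norm a * h (3 * R) / (4 * pi) * V \<le> N" by linarith
      then have a: "norm a / (4 * pi) \<le> N / (\<kappa> * h (3 * R) * V)"
        using kap h3 V by (simp add: pos_le_divide_eq mult_ac)
      have "\<bar>(y - z) \<bullet> a\<bar> * h r \<le> (r * norm a) * h r"
        using Cauchy_Schwarz_ineq2[of "y - z" a] by (intro mult_right_mono) (auto simp: r_def h_def)
      also have "\<dots> = norm a * (r * h r)" by simp
      also have "r * h r \<le> k * (1 / r) + 1 / r\<^sup>2"
        using norm_fA_le[of "y - z" k 0] r k unfolding rho_0 norm_powr_minus_1 norm_powr_minus_2 h_def r_def by auto
      also have "k * (1 / r) + 1 / r\<^sup>2 \<le> (k + 1) * (1 + 1 / r\<^sup>2)"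
      proof -
        have "2 * (1 / r) \<le> 1 + (1 / r)\<^sup>2" using sum_squares_bound[of 1 "1 / r"] by simp
        moreover have "1 / r > 0" using r by simp
        ultimately have "1 / r \<le> 1 + 1 / r\<^sup>2" unfolding power_one_over[symmetric] by linarith
        then have "k * (1 / r) \<le> k * (1 + 1 / r\<^sup>2)" using k by (rule mult_left_mono)
        then show ?thesis by (simp add: distrib_right)
      qed
      finally have "\<bar>(y - z) \<bullet> a\<bar> * h r / (4 * pi) \<le> norm a * ((k + 1) * (1 + 1 / r\<^sup>2)) / (4 * pi)"
        by (simp add: mult_left_mono divide_right_mono)
      also have "\<dots> = norm a / (4 * pi) * ((k + 1) * (1 + 1 / r\<^sup>2))" by simp
      also have "\<dots> \<le> N / (\<kappa> * h (3 * R) * V) * ((k + 1) * (1 + 1 / r\<^sup>2))"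
        using a k by (intro mult_right_mono) auto
      also have "\<dots> = (k + 1) / (\<kappa> * h (3 * R) * V) * N * (1 + 1 / r\<^sup>2)" by simp
      also have "\<dots> \<le> C * N * (1 + 1 / r\<^sup>2)"
        unfolding C_def using kap V R N0 by (intro mult_right_mono) auto
      finally show ?thesis unfolding fld r2 N_def .
    next
      case False
      define d where "d = norm (c - z)"
      have d: "d > 2 * R" using False by (simp add: d_def)
      have d0: "d > 0" using d R by simp
      \<comment> \<open>Far source: d > 2R puts every relevant distance to z between d / 2 and 3d /
        2, so the values of \<open>h\<close> are comparable and the field is already bounded without
        the singular factor.\<close>
      have "\<kappa> * t * h (3 / 2 * d) / (4 * pi) * V \<le> N"
        by (rule lower) (use near d in \<open>fastforce simp: d_def\<close>)
      then have b: "t * h (3 / 2 * d) / (4 * pi) \<le> N / (\<kappa> * V)"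
        using kap V by (simp add: pos_le_divide_eq mult_ac)
      have "norm (c - z) \<le> norm (y - z) + norm (y - c)"
        using norm_triangle_ineq4[of "y - z" "y - c"] by simp
      then have rd: "r \<ge> d / 2" using R(3)[OF y] d by (simp add: r_def d_def)
      have "h r \<le> h (d / 2)" unfolding h_def using d0 rd by (intro norm_fA_antimono) auto
      also have "d / 2 = (3 / 2 * d) / 3" by simp
      also have "h ((3 / 2 * d) / 3) \<le> 27 * h (3 / 2 * d)" unfolding h_def using d0 by (intro norm_fA_scale) simp
      finally have hr: "h r \<le> 27 * h (3 / 2 * d)" .
      have "\<bar>(y - z) \<bullet> a\<bar> \<le> R * t"
      proof -
        have "(y - z) \<bullet> a = (c - z) \<bullet> a + (y - c) \<bullet> a" by (simp add: inner_diff_left)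
        moreover have "\<bar>(y - c) \<bullet> a\<bar> \<le> R * norm a"
          using Cauchy_Schwarz_ineq2[of "y - c" a] R(3)[OF y] mult_right_mono[OF R(3)[OF y] norm_ge_zero[of a]] by linarith
        moreover have "\<bar>(c - z) \<bullet> a\<bar> \<le> R * \<bar>(c - z) \<bullet> a\<bar>" using R(1) by (simp add: mult_le_cancel_right1)
        ultimately show ?thesis unfolding t_def distrib_left by linarith
      qed
      then have "\<bar>(y - z) \<bullet> a\<bar> * h r / (4 * pi) \<le> R * t * (27 * h (3 / 2 * d)) / (4 * pi)"
        using hr R t0 by (intro divide_right_mono mult_mono) (auto simp: h_def)
      also have "\<dots> = 27 * R * (t * h (3 / 2 * d) / (4 * pi))" by simp
      also have "\<dots> \<le> 27 * R * (N / (\<kappa> * V))" using b R by (intro mult_left_mono) auto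
      also have "\<dots> = 27 * R / (\<kappa> * V) * N" by simp
      also have "\<dots> \<le> C * N" unfolding C_def using k kap h3 V N0 by (intro mult_right_mono) auto
      also have "\<dots> \<le> C * N * (1 + 1 / r\<^sup>2)" using Cp N0 by (simp add: distrib_left)
      finally show ?thesis unfolding fld r2 N_def .
    qed
  qed
qed

section \<open>Uniqueness of weak gradients\<close>

text \<open>For m = 0 the classical smooth function that is flat at 0; the powers t^-m close the
  family under differentiation.\<close>

definition flat_exp :: "nat \<Rightarrow> real \<Rightarrow> real" where
  "flat_exp m t = (if t > 0 then exp (- (1 / t)) / t ^ m else 0)"

lemma flat_exp_tendsto_0: "(flat_exp m \<longlongrightarrow> 0) (at 0)"
proof (rule filterlim_split_at)
  have "((\<lambda>t. (inverse t) ^ m / exp (inverse t)) \<longlongrightarrow> 0) (at_right (0::real))"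
    by (rule filterlim_compose[OF tendsto_power_div_exp_0 filterlim_inverse_at_top_right])
  moreover have "\<forall>\<^sub>F t in at_right 0. (inverse t) ^ m / exp (inverse t) = flat_exp m t"
    unfolding flat_exp_def eventually_at_right_field
    by (intro exI[of _ 1]) (auto simp: exp_minus field_simps power_inverse)
  ultimately show "(flat_exp m \<longlongrightarrow> 0) (at_right 0)" by (rule Lim_transform_eventually)
  have "\<forall>\<^sub>F t in at_left 0. 0 = flat_exp m t"
    unfolding flat_exp_def eventually_at_left_field by (intro exI[of _ "-1"]) auto
  from Lim_transform_eventually[OF tendsto_const this] show "(flat_exp m \<longlongrightarrow> 0) (at_left 0)" .
qed

lemma flat_exp_deriv:
  "(flat_exp m has_real_derivative flat_exp (m + 2) t - real m * flat_exp (m + 1) t) (at t)"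
proof -
  consider "t > 0" | "t < 0" | "t = 0" by linarith
  then show ?thesis
  proof cases
    case 1
    have "((\<lambda>t. exp (- (1 / t)) / t ^ m) has_real_derivative flat_exp (m + 2) t - real m * flat_exp (m + 1) t) (at t)"
    proof (cases m)
      case 0
      then show ?thesis using 1 by (auto intro!: derivative_eq_intros simp: flat_exp_def field_simps power2_eq_square)
    next
      case (Suc l)
      then have tm: "t ^ m = t * t ^ (m - Suc 0)" by simp
      show ?thesis using 1
        by (auto intro!: derivative_eq_intros simp: flat_exp_def tm field_simps power2_eq_square)
    qed
    then show ?thesis
      by (rule has_field_derivative_transform_within_open[of _ _ _ "{0<..}"]) (use 1 in \<open>auto simp: flat_exp_def\<close>)
  next
    case 2
    have "((\<lambda>t. 0) has_real_derivative flat_exp (m + 2) t - real m * flat_exp (m + 1) t) (at t)"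
      using 2 by (simp add: flat_exp_def)
    then show ?thesis
      by (rule has_field_derivative_transform_within_open[of _ _ _ "{..<0}"]) (use 2 in \<open>auto simp: flat_exp_def\<close>)
  next
    case 3
    \<comment> \<open>The difference quotient at 0 is the next member of the family, which tends to
      0.\<close>
    have "((\<lambda>h. (flat_exp m (0 + h) - flat_exp m 0) / h) \<longlongrightarrow> 0) (at 0)"
    proof (rule Lim_transform_eventually[OF flat_exp_tendsto_0[of "m + 1"]])
      show "\<forall>\<^sub>F h in at 0. flat_exp (m + 1) h = (flat_exp m (0 + h) - flat_exp m 0) / h"
        by (rule always_eventually) (auto simp: flat_exp_def)
    qed
    then show ?thesis using 3 by (simp add: DERIV_def flat_exp_def)
  qed
qed

text \<open>Chosen to contain the bump functions below and all their derivatives, so that smoothness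
  follows from one closure lemma, as for \<open>kern\<close>.\<close>

inductive bump_class :: "R3 \<Rightarrow> R3 \<Rightarrow> (R3 \<Rightarrow> real) \<Rightarrow> bool" for a b where
  "bump_class a b (\<lambda>x. c)"
| "bump_class a b (\<lambda>x. x $ i)"
| "bump_class a b (\<lambda>x. flat_exp m ((x $ i - a $ i) * (b $ i - x $ i)))"
| "bump_class a b F \<Longrightarrow> bump_class a b G \<Longrightarrow> bump_class a b (\<lambda>x. F x + G x)"
| "bump_class a b F \<Longrightarrow> bump_class a b G \<Longrightarrow> bump_class a b (\<lambda>x. F x * G x)"
| "bump_class a b F \<Longrightarrow> bump_class a b (\<lambda>x. exp (F x))"

lemma bump_class_derivative:
  assumes "bump_class a b F"
  shows "\<exists>F'. (\<forall>x. (F has_derivative F' x) (at x)) \<and> (\<forall>v. bump_class a b (\<lambda>x. F' x v))"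
  using assms
proof induction
  case (1 c)
  then show ?case by (intro exI[of _ "\<lambda>x v. 0"]) (auto intro: bump_class.intros)
next
  case (2 i)
  then show ?case
    by (intro exI[of _ "\<lambda>x v. v $ i"])
       (auto intro: bump_class.intros bounded_linear_imp_has_derivative bounded_linear_vec_nth)
next
  case (3 m i)
  define q where "q x = (x $ i - a $ i) * (b $ i - x $ i)" for x :: R3
  define q' where "q' x v = (a $ i + b $ i + (- 2) * x $ i) * v $ i" for x v :: R3
  have comp: "((\<lambda>x::R3. x $ i) has_derivative (\<lambda>v. v $ i)) (at x)" for x
    by (intro bounded_linear_imp_has_derivative bounded_linear_vec_nth)
  have q: "(q has_derivative q' x) (at x)" for x
    unfolding q_def[abs_def] q'_def[abs_def]
    by (rule has_derivative_eq_rhs)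
       (auto intro!: derivative_eq_intros comp simp: algebra_simps fun_eq_iff)
  have d: "((\<lambda>x. flat_exp m (q x)) has_derivative (\<lambda>v. (flat_exp (m + 2) (q x) + (- real m) * flat_exp (m + 1) (q x)) * q' x v)) (at x)" for x
    using has_derivative_compose[OF q has_field_derivative_imp_has_derivative[OF flat_exp_deriv[of m "q x"]]] by simp
  have "bump_class a b (\<lambda>x. (flat_exp (m + 2) (q x) + (- real m) * flat_exp (m + 1) (q x)) * q' x v)" for v
    unfolding q_def q'_def by (intro bump_class.intros)
  with d show ?case unfolding q_def by (intro exI[of _ "\<lambda>x v. (flat_exp (m + 2) (q x) + (- real m) * flat_exp (m + 1) (q x)) * q' x v"]) (simp add: q_def)
next
  case (4 F G)
  then obtain F' G' where "\<forall>x. (F has_derivative F' x) (at x)" "\<forall>v. bump_class a b (\<lambda>x. F' x v)"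
    "\<forall>x. (G has_derivative G' x) (at x)" "\<forall>v. bump_class a b (\<lambda>x. G' x v)" by blast
  then show ?case
    by (intro exI[of _ "\<lambda>x v. F' x v + G' x v"]) (auto intro: bump_class.intros has_derivative_add)
next
  case (5 F G)
  then obtain F' G' where *: "\<forall>x. (F has_derivative F' x) (at x)" "\<forall>v. bump_class a b (\<lambda>x. F' x v)"
    "\<forall>x. (G has_derivative G' x) (at x)" "\<forall>v. bump_class a b (\<lambda>x. G' x v)" by blast
  show ?case
    by (intro exI[of _ "\<lambda>x v. F x * G' x v + F' x v * G x"])
       (use * 5 in \<open>auto intro!: bump_class.intros(4,5) has_derivative_mult\<close>)
next
  case (6 F)
  then obtain F' where *: "\<forall>x. (F has_derivative F' x) (at x)" "\<forall>v. bump_class a b (\<lambda>x. F' x v)" by blast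
  have "((\<lambda>x. exp (F x)) has_derivative (\<lambda>v. exp (F x) * F' x v)) (at x)" for x
    using * by (auto intro!: derivative_eq_intros)
  then show ?case
    by (intro exI[of _ "\<lambda>x v. exp (F x) * F' x v"])
       (use * 6 in \<open>auto intro!: bump_class.intros(5,6)\<close>)
qed

text \<open>The product is positive exactly on the open box, when that is nonempty. Hence 1 - exp(-j
  ...) stays in [0, 1] and tends to the indicator of the box as j grows: test functions approximate
  indicators without mollification.\<close>

definition box_bump :: "R3 \<Rightarrow> R3 \<Rightarrow> nat \<Rightarrow> R3 \<Rightarrow> real" where
  "box_bump a b j x = 1 - exp (- real j * (\<Prod>i\<in>UNIV. flat_exp 0 ((x $ i - a $ i) * (b $ i - x $ i))))"

lemma bump_class_prod: "finite I \<Longrightarrow> bump_class a b (\<lambda>x. \<Prod>i\<in>I. flat_exp 0 ((x $ i - a $ i) * (b $ i - x $ i)))"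
  by (induction I rule: finite_induct) (auto intro: bump_class.intros)

text \<open>Nonemptiness fixes the order of the endpoints; with \<open>b $ i < a $ i\<close> the
  product would be positive between them although the box is empty.\<close>

lemma mem_box_iff_bump:
  fixes a b x :: R3
  assumes "box a b \<noteq> {}"
  shows "x \<in> box a b \<longleftrightarrow> (\<forall>i. (x $ i - a $ i) * (b $ i - x $ i) > 0)"
proof -
  have ab: "a $ i < b $ i" for i using assms by (simp add: interval_ne_empty_cart)
  have "(a $ i < x $ i \<and> x $ i < b $ i) \<longleftrightarrow> (x $ i - a $ i) * (b $ i - x $ i) > 0" for i
    using ab[of i] by (auto simp: zero_less_mult_iff)
  then show ?thesis by (simp add: mem_box_cart)
qed

lemma
  fixes a b :: R3
  assumes ne: "box a b \<noteq> {}"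
  shows box_bump_outside: "x \<notin> box a b \<Longrightarrow> box_bump a b j x = 0"
    and box_bump_range: "0 \<le> box_bump a b j x \<and> box_bump a b j x \<le> 1"
    and box_bump_tendsto: "(\<lambda>j. box_bump a b j x) \<longlonglongrightarrow> indicator (box a b) x"
    and test_fun_box_bump: "cbox a b \<subseteq> \<Omega> \<Longrightarrow> test_fun \<Omega> (box_bump a b j)"
proof -
  define \<beta> where "\<beta> x = (\<Prod>i\<in>UNIV. flat_exp 0 ((x $ i - a $ i) * (b $ i - x $ i)))" for x :: R3
  have b0: "\<beta> x \<ge> 0" for x unfolding \<beta>_def by (intro prod_nonneg) (simp add: flat_exp_def)
  have bout: "\<beta> x = 0" if "x \<notin> box a b" for x
  proof -
    obtain i where "\<not> (x $ i - a $ i) * (b $ i - x $ i) > 0" using \<open>x \<notin> box a b\<close> mem_box_iff_bump[OF ne] by blast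
    then have "flat_exp 0 ((x $ i - a $ i) * (b $ i - x $ i)) = 0" by (simp add: flat_exp_def)
    then show ?thesis unfolding \<beta>_def by (intro prod_zero) auto
  qed
  have bin: "\<beta> x > 0" if "x \<in> box a b" for x
    unfolding \<beta>_def using that mem_box_iff_bump[OF ne] by (intro prod_pos) (auto simp: flat_exp_def)
  have eq: "box_bump a b j x = 1 - exp (- real j * \<beta> x)" for j x by (simp add: box_bump_def \<beta>_def)
  show out: "box_bump a b j x = 0" if "x \<notin> box a b" for j x using bout[OF that] by (simp add: eq)
  show "0 \<le> box_bump a b j x \<and> box_bump a b j x \<le> 1" using b0[of x] by (simp add: eq)
  show "(\<lambda>j. box_bump a b j x) \<longlonglongrightarrow> indicator (box a b) x"
  proof (cases "x \<in> box a b")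
    case True
    have "exp (- \<beta> x) < 1" using bin[OF True] by simp
    then have "(\<lambda>j. exp (- \<beta> x) ^ j) \<longlonglongrightarrow> 0" by (intro LIMSEQ_realpow_zero) auto
    then have "(\<lambda>j. 1 - exp (- \<beta> x) ^ j) \<longlonglongrightarrow> 1 - 0" by (rule tendsto_diff[OF tendsto_const])
    moreover have "box_bump a b j x = 1 - exp (- \<beta> x) ^ j" for j
      by (simp add: eq exp_of_nat_mult[symmetric])
    ultimately show ?thesis using True by simp
  qed (simp add: out)
  show "test_fun \<Omega> (box_bump a b j)" if sub: "cbox a b \<subseteq> \<Omega>"
    unfolding test_fun_def
  proof (intro conjI)
    have "bump_class a b (\<lambda>x. 1 + (- 1) * exp (- real j * (\<Prod>i\<in>UNIV. flat_exp 0 ((x $ i - a $ i) * (b $ i - x $ i)))))"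
      by (intro bump_class.intros bump_class_prod) simp
    then have cls: "bump_class a b (box_bump a b j)" by (simp add: box_bump_def[abs_def])
    show "smooth_on UNIV (box_bump a b j)"
      unfolding smooth_on_def
      by (rule allI, rule Ck_on_closed_class[where P = "bump_class a b", OF _ cls]) (use bump_class_derivative in blast)
    have "{x. box_bump a b j x \<noteq> 0} \<subseteq> cbox a b" using out box_subset_cbox by blast
    then have cl: "closure {x. box_bump a b j x \<noteq> 0} \<subseteq> cbox a b" by (intro closure_minimal) (auto simp: closed_cbox)
    then show "closure {x. box_bump a b j x \<noteq> 0} \<subseteq> \<Omega>" using sub by blast
    show "compact (closure {x. box_bump a b j x \<noteq> 0})"
      using cl by (metis bounded_cbox bounded_subset closed_closure compact_eq_bounded_closed)
  qed
qed

text \<open>The positive and negative parts of g are densities of measures that agree on boxes.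
  Boxes are stable under intersection and generate the Borel sets, so the measures agree, and then
  the densities agree almost everywhere.\<close>

lemma AE_zero_of_box_integrals:
  fixes g :: "R3 \<Rightarrow> real"
  assumes g: "integrable lebesgue g" and z: "\<And>a b. (\<integral>x. indicator (box a b) x * g x \<partial>lebesgue) = 0"
  shows "AE x in lebesgue. g x = 0"
proof -
  \<comment> \<open>The uniqueness theorem for measures lives on the Borel sets, so the Lebesgue
    measurable g is replaced by a Borel version.\<close>
  obtain g' where g'[measurable]: "g' \<in> borel_measurable lborel" and gg: "AE x in lborel. g x = g' x"
    using completion_ex_borel_measurable_real[of g lborel] borel_measurable_integrable[OF g] by blast
  have gg': "AE x in lebesgue. g x = g' x" using gg by (rule AE_completion)
  have g'b: "g' \<in> borel_measurable borel" using g' by simp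
  have "integrable lebesgue g'"
    using g gg' borel_measurable_integrable[OF g] measurable_completion[OF g']
    by (subst integrable_cong_AE[of _ _ g]) auto
  then have ig': "integrable lborel g'" using integrable_completion[OF g'] by simp
  have z': "(\<integral>x. indicator (box a b) x * g' x \<partial>lborel) = 0" for a b
  proof -
    have "(\<integral>x. indicator (box a b) x * g' x \<partial>lborel) = (\<integral>x. indicator (box a b) x * g' x \<partial>lebesgue)"
      by (rule integral_completion[symmetric]) measurable
    also have "\<dots> = (\<integral>x. indicator (box a b) x * g x \<partial>lebesgue)"
    proof (rule integral_cong_AE)
      show "(\<lambda>x. indicator (box a b) x * g' x) \<in> borel_measurable lebesgue"
        by (intro measurable_completion) measurable
      show "(\<lambda>x. indicator (box a b) x * g x) \<in> borel_measurable lebesgue"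
        using borel_measurable_integrable[OF g] by (intro borel_measurable_times borel_measurable_indicator) auto
      show "AE x in lebesgue. indicator (box a b) x * g' x = indicator (box a b) x * g x"
        using gg' by eventually_elim simp
    qed
    finally show ?thesis using z by simp
  qed
  define p where "p x = ennreal (max 0 (g' x))" for x
  define q where "q x = ennreal (max 0 (- g' x))" for x
  have [measurable]: "p \<in> borel_measurable lborel" "q \<in> borel_measurable lborel"
    unfolding p_def q_def by measurable
  have ip: "integrable lborel (\<lambda>x. max 0 (g' x))" "integrable lborel (\<lambda>x. max 0 (- g' x))"
    using ig' by (auto intro!: integrable_max)
  have nnp: "(\<integral>\<^sup>+x. p x * indicator A x \<partial>lborel) = ennreal (\<integral>x. indicator A x * max 0 (g' x) \<partial>lborel)"
    and nnq: "(\<integral>\<^sup>+x. q x * indicator A x \<partial>lborel) = ennreal (\<integral>x. indicator A x * max 0 (- g' x) \<partial>lborel)"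
    if A[measurable]: "A \<in> sets borel" for A
  proof -
    have i: "integrable lborel (\<lambda>x. indicator A x * max 0 (g' x))" "integrable lborel (\<lambda>x. indicator A x * max 0 (- g' x))"
      using integrable_mult_indicator[of A lborel, OF _ ip(1)] integrable_mult_indicator[of A lborel, OF _ ip(2)] A by simp_all
    show "(\<integral>\<^sup>+x. p x * indicator A x \<partial>lborel) = ennreal (\<integral>x. indicator A x * max 0 (g' x) \<partial>lborel)"
      unfolding p_def by (subst nn_integral_eq_integral[OF i(1), symmetric]) (auto intro!: nn_integral_cong simp: indicator_def)
    show "(\<integral>\<^sup>+x. q x * indicator A x \<partial>lborel) = ennreal (\<integral>x. indicator A x * max 0 (- g' x) \<partial>lborel)"
      unfolding q_def by (subst nn_integral_eq_integral[OF i(2), symmetric]) (auto intro!: nn_integral_cong simp: indicator_def)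
  qed
  have "density lborel p = density lborel q"
  proof (rule measure_eqI_generator_eq[where E = "range (\<lambda>(a, b). box a b :: R3 set)" and \<Omega> = UNIV
        and A = "\<lambda>i. box (- (real i *\<^sub>R One)) (real i *\<^sub>R One)"])
    show "Int_stable (range (\<lambda>(a, b). box a b :: R3 set))"
      by (auto simp: Int_stable_def box_Int_box)
    show "emeasure (density lborel p) X = emeasure (density lborel q) X" if X: "X \<in> range (\<lambda>(a, b). box a b)" for X
    proof -
      obtain a b where X': "X = box a b" using X by auto
      have i: "integrable lborel (\<lambda>x. indicator X x * max 0 (g' x))" "integrable lborel (\<lambda>x. indicator X x * max 0 (- g' x))"
        using integrable_mult_indicator[of X lborel, OF _ ip(1)] integrable_mult_indicator[of X lborel, OF _ ip(2)] by (simp_all add: X')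
      have "(\<integral>x. indicator X x * max 0 (g' x) \<partial>lborel) - (\<integral>x. indicator X x * max 0 (- g' x) \<partial>lborel)
        = (\<integral>x. indicator X x * max 0 (g' x) - indicator X x * max 0 (- g' x) \<partial>lborel)"
        using i by simp
      also have "\<dots> = (\<integral>x. indicator X x * g' x \<partial>lborel)"
        by (intro Bochner_Integration.integral_cong refl) (auto simp: max_def)
      also have "\<dots> = 0" using z' by (simp add: X')
      finally show ?thesis using nnp[of X] nnq[of X] by (simp add: emeasure_density X')
    qed
    show "sets (density lborel p) = sigma_sets UNIV (range (\<lambda>(a, b). box a b))"
      "sets (density lborel q) = sigma_sets UNIV (range (\<lambda>(a, b). box a b))"
      by (simp_all add: borel_eq_box)
    show "(\<Union>i::nat. box (- (real i *\<^sub>R One)) (real i *\<^sub>R One)) = (UNIV :: R3 set)"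
      by (rule UN_box_eq_UNIV)
    show "emeasure (density lborel p) (box (- (real i *\<^sub>R One)) (real i *\<^sub>R One)) \<noteq> \<infinity>" for i :: nat
      using nnp[of "box (- (real i *\<^sub>R One)) (real i *\<^sub>R One)"] by (simp add: emeasure_density)
  qed auto
  then have "AE x in lborel. p x = q x" by (intro sigma_finite_measure.density_unique[OF sigma_finite_lborel]) auto
  then have "AE x in lborel. g' x = 0"
    by eventually_elim (auto simp: p_def q_def max_def split: if_splits)
  then have "AE x in lebesgue. g' x = 0" by (rule AE_completion)
  with gg' show ?thesis by eventually_elim simp
qed

lemma set_integrable_loc_test:
  assumes h: "loc_integrable D h" and D: "open D" and p: "p \<in> borel_measurable borel" "\<And>x. \<bar>p x\<bar> \<le> B"
    "\<And>x. x \<notin> K \<Longrightarrow> p x = 0" "compact K" "K \<subseteq> D"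
  shows "set_integrable lebesgue D (\<lambda>x. h x * complex_of_real (p x))"
proof -
  have "set_integrable lebesgue K h" using h p(4,5) unfolding loc_integrable_def by blast
  then have i: "integrable lebesgue (\<lambda>x. indicator K x *\<^sub>R h x)" unfolding set_integrable_def .
  have eq: "indicator D x *\<^sub>R (h x * complex_of_real (p x)) = (indicator K x *\<^sub>R h x) * complex_of_real (p x)" for x
    using p(3)[of x] p(5) by (cases "x \<in> K") (auto simp: indicator_def)
  have pm: "(\<lambda>x. complex_of_real (p x)) \<in> borel_measurable lebesgue"
    using p(1) by (intro measurable_completion) measurable
  show ?thesis unfolding set_integrable_def eq
  proof (rule Bochner_Integration.integrable_bound[OF integrable_mult_right[OF i, of "complex_of_real B"]])
    show "(\<lambda>x. indicator K x *\<^sub>R h x * complex_of_real (p x)) \<in> borel_measurable lebesgue"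
      by (intro borel_measurable_times pm borel_measurable_integrable[OF i])
    show "AE x in lebesgue. norm (indicator K x *\<^sub>R h x * complex_of_real (p x)) \<le> norm (complex_of_real B * indicator K x *\<^sub>R h x)"
    proof (rule AE_I2)
      fix x
      have "\<bar>p x\<bar> \<le> \<bar>B\<bar>" using p(2)[of x] by linarith
      then show "norm (indicator K x *\<^sub>R h x * complex_of_real (p x)) \<le> norm (complex_of_real B * indicator K x *\<^sub>R h x)"
        by (cases "x \<in> K") (simp_all add: norm_mult mult.commute[of _ "\<bar>p x\<bar>"] mult_right_mono)
    qed
  qed
qed

text \<open>Testing with \<open>box_bump\<close> and letting j grow shows that the integral of h
  over every open box with closure in D vanishes. Restricting h to one such box makes it integrable,
  and intersections with other boxes are boxes again.\<close>

lemma du_Bois_Reymond: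
  assumes h: "loc_integrable D h" and D: "open D"
    and z: "\<And>\<phi>. test_fun D \<phi> \<Longrightarrow> (LINT x:D|lebesgue. h x * of_real (\<phi> x)) = 0"
  shows "AE x in lebesgue. x \<in> D \<longrightarrow> h x = 0"
proof -
  have cz: "AE x in lebesgue. x \<in> box c d \<longrightarrow> h x = 0" if cd: "cbox c d \<subseteq> D" for c d
  proof -
    have "set_integrable lebesgue (cbox c d) h" using h cd compact_cbox unfolding loc_integrable_def by blast
    then have ih: "integrable lebesgue (\<lambda>x. indicator (cbox c d) x *\<^sub>R h x)" unfolding set_integrable_def .
    define H where "H x = indicator (box c d) x *\<^sub>R h x" for x
    have iH: "integrable lebesgue H"
    proof -
      have "H = (\<lambda>x. indicator (box c d) x *\<^sub>R (indicator (cbox c d) x *\<^sub>R h x))"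
        using box_subset_cbox[of c d] by (auto simp: H_def fun_eq_iff indicator_def)
      then show ?thesis using integrable_mult_indicator[OF _ ih, of "box c d"] by simp
    qed
    have zero: "(\<integral>x. indicator (box a b) x *\<^sub>R H x \<partial>lebesgue) = 0" for a b
    proof -
      obtain a' b' where int: "box a b \<inter> box c d = box a' b'" using box_Int_box by blast
      have eqH: "indicator (box a b) x *\<^sub>R H x = indicator (box a' b') x *\<^sub>R h x" for x
        unfolding int[symmetric] by (simp add: H_def indicator_inter_arith)
      show ?thesis
      proof (cases "box a' b' = {}")
        case False
        have "cbox a' b' = closure (box a' b')" using False by (simp add: closure_box)
        also have "\<dots> \<subseteq> closure (box c d)" unfolding int[symmetric] by (intro closure_mono) auto
        also have "\<dots> \<subseteq> cbox c d" by (intro closure_minimal box_subset_cbox closed_cbox)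
        finally have sub: "cbox a' b' \<subseteq> cbox c d" .
        have sub': "box a' b' \<subseteq> box c d" using int by blast
        have "(\<lambda>j. \<integral>x. indicator D x *\<^sub>R (h x * of_real (box_bump a' b' j x)) \<partial>lebesgue)
          \<longlonglongrightarrow> (\<integral>x. indicator (box a' b') x *\<^sub>R h x \<partial>lebesgue)"
        proof (rule integral_dominated_convergence[where w = "\<lambda>x. norm (indicator (cbox c d) x *\<^sub>R h x)"])
          have tf: "test_fun D (box_bump a' b' j)" for j by (rule test_fun_box_bump[OF False]) (use sub cd in blast)
          show "(\<lambda>x. indicator D x *\<^sub>R (h x * of_real (box_bump a' b' j x))) \<in> borel_measurable lebesgue" for j
          proof -
            obtain B K where "compact K" "K \<subseteq> D" "\<And>x. x \<notin> K \<Longrightarrow> box_bump a' b' j x = 0" "\<And>x. \<bar>box_bump a' b' j x\<bar> \<le> B"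
              using test_fun_bounds[OF tf] by metis
            from set_integrable_loc_test[OF h D test_fun_measurable(1)[OF tf] this(4,3,1,2)] show ?thesis
              unfolding set_integrable_def by (rule borel_measurable_integrable)
          qed
          show "(\<lambda>x. indicator (box a' b') x *\<^sub>R h x) \<in> borel_measurable lebesgue"
          proof -
            have "(\<lambda>x. indicator (box a' b') x *\<^sub>R h x) = (\<lambda>x. indicator (box a' b') x *\<^sub>R H x)"
              using sub' by (auto simp: H_def fun_eq_iff indicator_def)
            then show ?thesis using borel_measurable_integrable[OF integrable_mult_indicator[OF _ iH, of "box a' b'"]] by simp
          qed
          show "integrable lebesgue (\<lambda>x. norm (indicator (cbox c d) x *\<^sub>R h x))" using ih by (rule integrable_norm)
          show "AE x in lebesgue. (\<lambda>j. indicator D x *\<^sub>R (h x * of_real (box_bump a' b' j x))) \<longlonglongrightarrow> indicator (box a' b') x *\<^sub>R h x"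
          proof (rule AE_I2)
            fix x
            have "(\<lambda>j. indicator D x *\<^sub>R (h x * of_real (box_bump a' b' j x))) \<longlonglongrightarrow> indicator D x *\<^sub>R (h x * of_real (indicator (box a' b') x))"
              by (intro tendsto_intros box_bump_tendsto[OF False])
            moreover have "indicator D x *\<^sub>R (h x * of_real (indicator (box a' b') x)) = indicator (box a' b') x *\<^sub>R h x"
              using sub sub' cd box_subset_cbox[of a' b'] by (auto simp: indicator_def)
            ultimately show "(\<lambda>j. indicator D x *\<^sub>R (h x * of_real (box_bump a' b' j x))) \<longlonglongrightarrow> indicator (box a' b') x *\<^sub>R h x" by simp
          qed
          show "AE x in lebesgue. norm (indicator D x *\<^sub>R (h x * of_real (box_bump a' b' j x))) \<le> norm (indicator (cbox c d) x *\<^sub>R h x)" for j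
          proof (rule AE_I2)
            fix x
            show "norm (indicator D x *\<^sub>R (h x * of_real (box_bump a' b' j x))) \<le> norm (indicator (cbox c d) x *\<^sub>R h x)"
            proof (cases "x \<in> box a' b'")
              case True
              then have "x \<in> D" "x \<in> cbox c d" using sub cd box_subset_cbox[of a' b'] by blast+
              then show ?thesis using box_bump_range[OF False, of j x] by (simp add: norm_mult mult_left_le)
            qed (simp add: box_bump_outside[OF False])
          qed
        qed
        moreover have "(\<integral>x. indicator D x *\<^sub>R (h x * of_real (box_bump a' b' j x)) \<partial>lebesgue) = 0" for j
        proof -
          have "test_fun D (box_bump a' b' j)" by (rule test_fun_box_bump[OF False]) (use sub cd in blast)
          from z[OF this] show ?thesis unfolding set_lebesgue_integral_def .
        qed
        ultimately have "(\<lambda>j::nat. 0) \<longlonglongrightarrow> (\<integral>x. indicator (box a' b') x *\<^sub>R h x \<partial>lebesgue)" by simp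
        then show ?thesis unfolding eqH using LIMSEQ_unique tendsto_const by blast
      qed (simp add: eqH)
    qed
    have iab: "integrable lebesgue (\<lambda>x. indicator (box a b) x *\<^sub>R H x)" for a b
      by (rule integrable_mult_indicator[OF _ iH]) simp
    have "AE x in lebesgue. Re (H x) = 0"
    proof (rule AE_zero_of_box_integrals)
      show "integrable lebesgue (\<lambda>x. Re (H x))" using iH by simp
      show "(\<integral>x. indicator (box a b) x * Re (H x) \<partial>lebesgue) = 0" for a b
        using integral_Re[OF iab, of a b] zero[of a b] by simp
    qed
    moreover have "AE x in lebesgue. Im (H x) = 0"
    proof (rule AE_zero_of_box_integrals)
      show "integrable lebesgue (\<lambda>x. Im (H x))" using iH by simp
      show "(\<integral>x. indicator (box a b) x * Im (H x) \<partial>lebesgue) = 0" for a b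
        using integral_Im[OF iab, of a b] zero[of a b] by simp
    qed
    ultimately show ?thesis by eventually_elim (auto simp: H_def complex_eq_iff)
  qed
  \<comment> \<open>D is a countable union of closed boxes, whose faces are null sets, so the
    statements on open boxes combine to one on D.\<close>
  obtain \<D> where \<D>: "countable \<D>" "\<And>X. X \<in> \<D> \<Longrightarrow> X \<subseteq> D \<and> (\<exists>a b. X = cbox a b)" "\<Union>\<D> = D"
  proof -
    obtain \<D>' where "countable \<D>'" "\<D>' \<subseteq> Pow D" "\<And>X. X \<in> \<D>' \<Longrightarrow> \<exists>a b. X = cbox a b" "\<Union>\<D>' = D"
      using open_countable_Union_open_cbox[OF D] by blast
    then show ?thesis by (intro that[of \<D>']) auto
  qed
  have "AE x in lebesgue. \<forall>X\<in>\<D>. x \<in> X \<longrightarrow> h x = 0"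
  proof (rule AE_ball_countable'[OF _ \<D>(1)])
    fix X assume "X \<in> \<D>"
    then obtain a b where X: "X = cbox a b" "cbox a b \<subseteq> D" using \<D>(2) by blast
    have "cbox a b - box a b \<in> null_sets lebesgue"
      using negligible_frontier_interval[of a b] negligible_iff_null_sets by blast
    then have "AE x in lebesgue. x \<notin> cbox a b - box a b" by (rule AE_not_in)
    with cz[OF X(2)] show "AE x in lebesgue. x \<in> X \<longrightarrow> h x = 0" by eventually_elim (auto simp: X)
  qed
  then show ?thesis by eventually_elim (use \<D>(3) in blast)
qed

lemma loc_integrable_diff:
  "loc_integrable D f \<Longrightarrow> loc_integrable D g \<Longrightarrow> loc_integrable D (\<lambda>x. f x - g x)"
  unfolding loc_integrable_def by (auto intro: set_integral_diff)

text \<open>Subtracting the two defining identities leaves a locally integrable function that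
  annihilates all test functions. This pins down the gradient chosen inside
  \<open>H1_norm\<close>.\<close>

lemma weak_grad_unique:
  assumes f: "weak_grad D f g" and f': "weak_grad D f' g'" and D: "open D"
    and eq: "AE x in lebesgue. x \<in> D \<longrightarrow> f x = f' x"
  shows "AE x in lebesgue. x \<in> D \<longrightarrow> g i x = g' i x"
proof -
  have lf: "loc_integrable D f" "loc_integrable D f'" "loc_integrable D (g i)" "loc_integrable D (g' i)"
    using f f' unfolding weak_grad_def by auto
  have "AE x in lebesgue. x \<in> D \<longrightarrow> g i x - g' i x = 0"
  proof (rule du_Bois_Reymond[OF loc_integrable_diff[OF lf(3,4)] D])
    fix \<phi> assume \<phi>: "test_fun D \<phi>"
    obtain B K where BK: "compact K" "K \<subseteq> D" "\<And>x. x \<notin> K \<Longrightarrow> \<phi> x = 0" "\<And>i x. x \<notin> K \<Longrightarrow> pderiv3 i \<phi> x = 0"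
      "\<And>x. \<bar>\<phi> x\<bar> \<le> B" "\<And>i x. \<bar>pderiv3 i \<phi> x\<bar> \<le> B" using test_fun_bounds[OF \<phi>] by metis
    note m = test_fun_measurable[OF \<phi>]
    have i1: "set_integrable lebesgue D (\<lambda>x. u x * of_real (\<phi> x))" if "loc_integrable D u" for u
      by (rule set_integrable_loc_test[OF that D m(1) BK(5,3,1,2)])
    have i2: "set_integrable lebesgue D (\<lambda>x. u x * of_real (pderiv3 i \<phi> x))" if "loc_integrable D u" for u
      by (rule set_integrable_loc_test[OF that D m(2) BK(6,4,1,2)])
    have "(LINT x:D|lebesgue. f x * of_real (pderiv3 i \<phi> x)) = (LINT x:D|lebesgue. f' x * of_real (pderiv3 i \<phi> x))"
      unfolding set_lebesgue_integral_def
    proof (rule integral_cong_AE)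
      show "AE x in lebesgue. indicator D x *\<^sub>R (f x * of_real (pderiv3 i \<phi> x)) = indicator D x *\<^sub>R (f' x * of_real (pderiv3 i \<phi> x))"
        using eq by eventually_elim (auto simp: indicator_def)
    qed (use i2[OF lf(1)] i2[OF lf(2)] in \<open>auto simp: set_integrable_def dest: borel_measurable_integrable\<close>)
    moreover have "(LINT x:D|lebesgue. f x * of_real (pderiv3 i \<phi> x)) = - (LINT x:D|lebesgue. g i x * of_real (\<phi> x))"
      "(LINT x:D|lebesgue. f' x * of_real (pderiv3 i \<phi> x)) = - (LINT x:D|lebesgue. g' i x * of_real (\<phi> x))"
      using f f' \<phi> unfolding weak_grad_def by blast+
    moreover have "(LINT x:D|lebesgue. (g i x - g' i x) * of_real (\<phi> x))
      = (LINT x:D|lebesgue. g i x * of_real (\<phi> x)) - (LINT x:D|lebesgue. g' i x * of_real (\<phi> x))"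
      unfolding left_diff_distrib by (rule set_integral_diff(2)[OF i1[OF lf(3)] i1[OF lf(4)]])
    ultimately show "(LINT x:D|lebesgue. (g i x - g' i x) * of_real (\<phi> x)) = 0" by simp
  qed
  then show ?thesis by eventually_elim simp
qed

section \<open>Estimates for Riesz potentials\<close>

text \<open>Only the case \<open>q < 3/2\<close> of the mapping property below is covered by Young's inequality; for the
  dipole weights \<open>1 + |y - z|\<^sup>-\<^sup>2\<close>, which lie in \<open>L\<^sup>q\<close> for all such \<open>q\<close>, this suffices even at the
  endpoint exponent \<open>6/5\<close>.\<close>

definition dipole_weight :: "R3 \<Rightarrow> R3 \<Rightarrow> ennreal" where
  "dipole_weight z y = ennreal (1 + norm (y - z) powr - 2)"

text \<open>Values in \<open>ennreal\<close> let Fubini and Cauchy-Schwarz work from measurability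
  alone, with finiteness settled at the end.\<close>

definition riesz_op :: "R3 set \<Rightarrow> (R3 \<Rightarrow> ennreal) \<Rightarrow> R3 \<Rightarrow> ennreal" where
  "riesz_op D f x = (\<integral>\<^sup>+y. ennreal (norm (x - y) powr - 2) * f y * indicator D y \<partial>lborel)"

lemma dipole_weight_measurable [measurable]: "dipole_weight z \<in> borel_measurable borel"
  unfolding dipole_weight_def[abs_def] by measurable

lemma riesz_op_measurable [measurable]:
  assumes [measurable]: "f \<in> borel_measurable borel" "D \<in> sets borel"
  shows "riesz_op D f \<in> borel_measurable borel"
proof -
  have "(\<lambda>x. \<integral>\<^sup>+y. ennreal (norm (x - y) powr - 2) * f y * indicator D y \<partial>lborel) \<in> borel_measurable borel"
    by measurable
  then show ?thesis by (simp add: riesz_op_def[abs_def])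
qed

lemma riesz_op_add:
  assumes [measurable]: "f \<in> borel_measurable borel" "g \<in> borel_measurable borel" "D \<in> sets borel"
  shows "riesz_op D (\<lambda>y. f y + g y) x = riesz_op D f x + riesz_op D g x"
  unfolding riesz_op_def by (subst nn_integral_add[symmetric]) (auto simp: distrib_left distrib_right)

lemma riesz_op_cmult:
  assumes [measurable]: "f \<in> borel_measurable borel" "D \<in> sets borel"
  shows "riesz_op D (\<lambda>y. c * f y) x = c * riesz_op D f x"
  unfolding riesz_op_def by (subst nn_integral_cmult[symmetric]) (auto simp: mult_ac)

lemma riesz_op_mono: "(\<And>y. y \<in> D \<Longrightarrow> f y \<le> g y) \<Longrightarrow> riesz_op D f x \<le> riesz_op D g x"
  unfolding riesz_op_def by (intro nn_integral_mono) (auto simp: indicator_def intro: mult_left_mono)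

lemma nn_integral_iterated_const:
  fixes h :: "R3 \<Rightarrow> R3 \<Rightarrow> ennreal"
  assumes h[measurable]: "(\<lambda>p. h (fst p) (snd p)) \<in> borel_measurable (lborel \<Otimes>\<^sub>M lborel)" and [measurable]: "D \<in> sets borel"
  shows "(\<integral>\<^sup>+x. c * (\<integral>\<^sup>+y. h x y * indicator D y \<partial>lborel) * indicator D x \<partial>lborel)
    = c * (\<integral>\<^sup>+x. \<integral>\<^sup>+y. h x y * indicator D y * indicator D x \<partial>lborel \<partial>lborel)"
proof -
  have h': "(\<lambda>(x, y). h x y) \<in> borel_measurable (lborel \<Otimes>\<^sub>M lborel)" using h by (simp add: case_prod_beta')
  have hx: "h x \<in> borel_measurable lborel" for x
    using measurable_compose[OF measurable_Pair1' h, of x] by simp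
  have "(\<integral>\<^sup>+x. c * (\<integral>\<^sup>+y. h x y * indicator D y \<partial>lborel) * indicator D x \<partial>lborel)
    = (\<integral>\<^sup>+x. c * (\<integral>\<^sup>+y. h x y * indicator D y * indicator D x \<partial>lborel) \<partial>lborel)"
  proof (rule nn_integral_cong)
    fix x
    note [measurable] = hx
    have "(\<integral>\<^sup>+y. h x y * indicator D y * indicator D x \<partial>lborel) = (\<integral>\<^sup>+y. h x y * indicator D y \<partial>lborel) * indicator D x"
      by (rule nn_integral_multc) measurable
    then show "c * (\<integral>\<^sup>+y. h x y * indicator D y \<partial>lborel) * indicator D x = c * (\<integral>\<^sup>+y. h x y * indicator D y * indicator D x \<partial>lborel)"
      by (simp only: mult.assoc)
  qed
  also have "\<dots> = c * (\<integral>\<^sup>+x. \<integral>\<^sup>+y. h x y * indicator D y * indicator D x \<partial>lborel \<partial>lborel)"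
  proof (rule nn_integral_cmult)
    have "(\<lambda>(x, y). h x y * indicator D y * indicator D x) \<in> borel_measurable (lborel \<Otimes>\<^sub>M lborel)"
      using h' by measurable
    then show "(\<lambda>x. \<integral>\<^sup>+y. h x y * indicator D y * indicator D x \<partial>lborel) \<in> borel_measurable lborel"
      by (rule lborel.borel_measurable_nn_integral)
  qed
  finally show ?thesis .
qed

lemma powr_square:
  fixes a r :: real
  shows "(a powr r)\<^sup>2 = a powr (2 * r)"
  by (simp add: power2_eq_square powr_add[symmetric])

text \<open>Schur's test: with K = H^2, Cauchy-Schwarz for H times H f gives the factor C and an
  integral of K f^2; exchanging the order of integration gives C a second time, by symmetry of the
  kernel.\<close>

lemma riesz_op_schur:
  assumes [measurable]: "f \<in> borel_measurable borel" and D[measurable]: "D \<in> sets borel"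
    and C: "\<And>x::R3. (\<integral>\<^sup>+y\<in>D. ennreal (norm (x - y) powr - 2) \<partial>lborel) \<le> ennreal C"
  shows "(\<integral>\<^sup>+x\<in>D. (riesz_op D f x)\<^sup>2 \<partial>lborel) \<le> (ennreal C)\<^sup>2 * (\<integral>\<^sup>+y\<in>D. (f y)\<^sup>2 \<partial>lborel)"
proof -
  define K where "K x y = ennreal (norm (x - y) powr - 2)" for x y :: R3
  define H where "H x y = ennreal (norm (x - y) powr - 1)" for x y :: R3
  have HK: "(H x y)\<^sup>2 = K x y" for x y
    unfolding H_def K_def norm_powr_minus_1 norm_powr_minus_2 by (simp add: ennreal_power power_divide)
  have [measurable]: "(\<lambda>y. H x y) \<in> borel_measurable borel" "(\<lambda>y. K x y) \<in> borel_measurable borel"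
    "(\<lambda>x. K x y) \<in> borel_measurable borel" "(\<lambda>(x, y). K x y) \<in> borel_measurable (borel \<Otimes>\<^sub>M borel)" for x y
    unfolding H_def K_def by measurable
  have K2: "(\<lambda>p. K (fst p) (snd p)) \<in> borel_measurable (lborel \<Otimes>\<^sub>M lborel)"
    unfolding K_def by measurable
  have pt: "(riesz_op D f x)\<^sup>2 \<le> ennreal C * (\<integral>\<^sup>+y. K x y * (f y)\<^sup>2 * indicator D y \<partial>lborel)" for x
  proof -
    have "riesz_op D f x = (\<integral>\<^sup>+y. (H x y * indicator D y) * (H x y * f y * indicator D y) \<partial>lborel)"
      unfolding riesz_op_def K_def[symmetric] HK[symmetric]
      by (intro nn_integral_cong) (auto simp: indicator_def power2_eq_square mult_ac)
    then have "(riesz_op D f x)\<^sup>2 \<le> (\<integral>\<^sup>+y. (H x y * indicator D y)\<^sup>2 \<partial>lborel) * (\<integral>\<^sup>+y. (H x y * f y * indicator D y)\<^sup>2 \<partial>lborel)"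
      by (simp only:) (rule Cauchy_Schwarz_nn_integral; measurable)
    also have "(\<integral>\<^sup>+y. (H x y * indicator D y)\<^sup>2 \<partial>lborel) = (\<integral>\<^sup>+y\<in>D. ennreal (norm (x - y) powr - 2) \<partial>lborel)"
      unfolding K_def[symmetric] HK[symmetric] by (intro nn_integral_cong) (auto simp: indicator_def)
    also have "(\<integral>\<^sup>+y. (H x y * f y * indicator D y)\<^sup>2 \<partial>lborel) = (\<integral>\<^sup>+y. K x y * (f y)\<^sup>2 * indicator D y \<partial>lborel)"
      unfolding HK[symmetric] by (intro nn_integral_cong) (auto simp: indicator_def power_mult_distrib)
    finally show ?thesis using C[of x] by (meson mult_right_mono order_trans zero_le)
  qed
  have "(\<integral>\<^sup>+x\<in>D. (riesz_op D f x)\<^sup>2 \<partial>lborel) \<le> (\<integral>\<^sup>+x. ennreal C * (\<integral>\<^sup>+y. K x y * (f y)\<^sup>2 * indicator D y \<partial>lborel) * indicator D x \<partial>lborel)"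
    by (intro nn_integral_mono mult_right_mono pt) auto
  also have "\<dots> = ennreal C * (\<integral>\<^sup>+x. \<integral>\<^sup>+y. K x y * (f y)\<^sup>2 * indicator D y * indicator D x \<partial>lborel \<partial>lborel)"
    unfolding K_def by (rule nn_integral_iterated_const[where h = "\<lambda>x y. ennreal (norm (x - y) powr - 2) * (f y)\<^sup>2"]) measurable
  also have "(\<integral>\<^sup>+x. \<integral>\<^sup>+y. K x y * (f y)\<^sup>2 * indicator D y * indicator D x \<partial>lborel \<partial>lborel)
    = (\<integral>\<^sup>+y. \<integral>\<^sup>+x. K x y * (f y)\<^sup>2 * indicator D y * indicator D x \<partial>lborel \<partial>lborel)"
    unfolding K_def by (rule lborel_pair.Fubini'[symmetric]) measurable
  also have "\<dots> \<le> (\<integral>\<^sup>+y. ennreal C * ((f y)\<^sup>2 * indicator D y) \<partial>lborel)"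
  proof (rule nn_integral_mono)
    fix y
    have "(\<integral>\<^sup>+x. K x y * (f y)\<^sup>2 * indicator D y * indicator D x \<partial>lborel)
      = (\<integral>\<^sup>+x. (K x y * indicator D x) * ((f y)\<^sup>2 * indicator D y) \<partial>lborel)"
      by (intro nn_integral_cong) (simp add: mult_ac)
    also have "\<dots> = (\<integral>\<^sup>+x. K x y * indicator D x \<partial>lborel) * ((f y)\<^sup>2 * indicator D y)"
      by (rule nn_integral_multc) measurable
    also have "\<dots> \<le> ennreal C * ((f y)\<^sup>2 * indicator D y)"
      using C[of y] by (intro mult_right_mono) (simp_all add: K_def norm_minus_commute)
    finally show "(\<integral>\<^sup>+x. K x y * (f y)\<^sup>2 * indicator D y * indicator D x \<partial>lborel) \<le> ennreal C * ((f y)\<^sup>2 * indicator D y)" .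
  qed
  also have "\<dots> = ennreal C * (\<integral>\<^sup>+y\<in>D. (f y)\<^sup>2 \<partial>lborel)"
    by (rule nn_integral_cmult) measurable
  finally show ?thesis by (simp add: power2_eq_square mult.assoc mult_left_mono)
qed

lemma powr_sum_le_two_powr:
  fixes a b p :: real
  assumes "a \<ge> 0" "b \<ge> 0" "p > 0"
  shows "(a + b) powr p \<le> 2 powr p * (a powr p + b powr p)"
proof -
  have "(a + b) powr p \<le> (2 * max a b) powr p" using assms by (intro powr_mono2) auto
  also have "\<dots> = 2 powr p * (max a b) powr p" using assms by (simp add: powr_mult)
  also have "(max a b) powr p \<le> a powr p + b powr p" by (simp add: max_def)
  finally show ?thesis by simp
qed

text \<open>Young's inequality from L^(4/3) * L^(4/3) into L^2, proved by hand. Kernel and weight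
  have the same singularity |.|^-2, whose 4/3 power |.|^(-8/3) is integrable on D, uniformly in the
  location of the singularity.\<close>

lemma riesz_op_dipole_weight:
  assumes D[measurable]: "D \<in> sets borel" and bD: "bounded D"
  shows "\<exists>C>0. \<forall>z. (\<integral>\<^sup>+x\<in>D. (riesz_op D (dipole_weight z) x)\<^sup>2 \<partial>lborel) \<le> ennreal C"
proof -
  obtain C1 where C1: "C1 > 0" "\<And>x::R3. (\<integral>\<^sup>+y\<in>D. ennreal (norm (x - y) powr - (8/3)) \<partial>lborel) \<le> ennreal C1"
    using riesz_kernel_uniform_bound[of "8/3" D] D bD by auto
  define V where "V = measure lborel D"
  have V: "emeasure lborel D = ennreal V" using emeasure_bounded_finite[OF bD] by (simp add: V_def emeasure_eq_ennreal_measure)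
  have V0: "V \<ge> 0" by (simp add: V_def)
  define g where "g z y = 1 + norm (y - z) powr - 2" for z y :: R3
  have g1: "g z y \<ge> 1" for z y unfolding g_def by simp
  define t where "t = 2 powr (4/3 :: real)"
  have g43: "g z y powr (4/3) \<le> t * (1 + norm (y - z) powr - (8/3))" for z y
    using powr_sum_le_two_powr[of 1 "norm (y - z) powr - 2" "4/3"] by (simp add: g_def t_def powr_powr)
  define C2 where "C2 = t * (V + C1)"
  have t0: "t > 0" by (simp add: t_def)
  have [measurable]: "g z \<in> borel_measurable borel" for z unfolding g_def[abs_def] by measurable
  have C2: "(\<integral>\<^sup>+y\<in>D. ennreal (g z y powr (4/3)) \<partial>lborel) \<le> ennreal C2" for z
  proof -
    have "(\<integral>\<^sup>+y\<in>D. ennreal (g z y powr (4/3)) \<partial>lborel) \<le> (\<integral>\<^sup>+y. ennreal t * (indicator D y + ennreal (norm (z - y) powr - (8/3)) * indicator D y) \<partial>lborel)"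
    proof (rule nn_integral_mono)
      fix y
      have "ennreal (g z y powr (4/3)) \<le> ennreal (t * (1 + norm (z - y) powr - (8/3)))"
        using g43[of z y] by (intro ennreal_leI) (simp add: norm_minus_commute)
      also have "\<dots> = ennreal t * (1 + ennreal (norm (z - y) powr - (8/3)))"
        using t0 ennreal_plus[of 1 "norm (z - y) powr - (8/3)"] by (simp add: ennreal_mult')
      finally show "ennreal (g z y powr (4/3)) * indicator D y \<le> ennreal t * (indicator D y + ennreal (norm (z - y) powr - (8/3)) * indicator D y)"
        by (cases "y \<in> D") auto
    qed
    also have "\<dots> = ennreal t * (emeasure lborel D + (\<integral>\<^sup>+y\<in>D. ennreal (norm (z - y) powr - (8/3)) \<partial>lborel))"
      by (subst nn_integral_cmult; (measurable)?; subst nn_integral_add) auto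
    also have "\<dots> \<le> ennreal t * (ennreal V + ennreal C1)"
      unfolding V by (intro mult_left_mono add_mono C1) auto
    also have "\<dots> = ennreal C2" unfolding C2_def using t0 V0 C1 by (simp add: ennreal_mult' ennreal_plus)
    finally show ?thesis .
  qed
  have C2p: "C2 > 0" unfolding C2_def using t0 V0 C1 by (intro mult_pos_pos add_nonneg_pos) auto
  define k where "k x y = norm (x - y) powr - 2" for x y :: R3
  have k43: "k x y powr (4/3) = norm (x - y) powr - (8/3)" for x y unfolding k_def by (simp add: powr_powr)
  have k0: "k x y \<ge> 0" for x y unfolding k_def by simp
  have [measurable]: "k x \<in> borel_measurable borel" "(\<lambda>x. k x y) \<in> borel_measurable borel" for x y unfolding k_def[abs_def] by measurable
  have pt: "(riesz_op D (dipole_weight z) x)\<^sup>2 \<le> ennreal (C1 + C2) * (\<integral>\<^sup>+y. ennreal (k x y powr (4/3)) * ennreal (g z y powr (4/3)) * indicator D y \<partial>lborel)" for z x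
  proof -
    \<comment> \<open>The splitting kg = (kg)^(1/3) (kg)^(2/3). The square of the first factor is at
      most k^(4/3) + g^(4/3) and integrates to a constant; the square of the second is k^(4/3)
      g^(4/3), for which the x-integration only meets k.\<close>
    have eq: "riesz_op D (dipole_weight z) x = (\<integral>\<^sup>+y. (ennreal ((k x y * g z y) powr (1/3)) * indicator D y) * (ennreal ((k x y * g z y) powr (2/3)) * indicator D y) \<partial>lborel)"
      unfolding riesz_op_def dipole_weight_def g_def[symmetric] unfolding k_def[symmetric]
    proof (rule nn_integral_cong)
      fix y
      have "k x y * g z y = (k x y * g z y) powr (1/3) * (k x y * g z y) powr (2/3)"
        using k0[of x y] g1[of z y] by (simp add: powr_add[symmetric])
      then have "ennreal (k x y) * ennreal (g z y) = ennreal ((k x y * g z y) powr (1/3)) * ennreal ((k x y * g z y) powr (2/3))"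
        using k0[of x y] g1[of z y] by (simp add: ennreal_mult'[symmetric])
      then show "ennreal (k x y) * ennreal (g z y) * indicator D y = (ennreal ((k x y * g z y) powr (1/3)) * indicator D y) * (ennreal ((k x y * g z y) powr (2/3)) * indicator D y)"
        by (cases "y \<in> D") auto
    qed
    have "(riesz_op D (dipole_weight z) x)\<^sup>2 \<le> (\<integral>\<^sup>+y. (ennreal ((k x y * g z y) powr (1/3)) * indicator D y)\<^sup>2 \<partial>lborel) * (\<integral>\<^sup>+y. (ennreal ((k x y * g z y) powr (2/3)) * indicator D y)\<^sup>2 \<partial>lborel)"
      unfolding eq by (rule Cauchy_Schwarz_nn_integral; measurable)
    also have "\<dots> \<le> ennreal (C1 + C2) * (\<integral>\<^sup>+y. ennreal (k x y powr (4/3)) * ennreal (g z y powr (4/3)) * indicator D y \<partial>lborel)"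
    proof (rule mult_mono)
      have "(\<integral>\<^sup>+y. (ennreal ((k x y * g z y) powr (1/3)) * indicator D y)\<^sup>2 \<partial>lborel)
        \<le> (\<integral>\<^sup>+y. ennreal (norm (x - y) powr - (8/3)) * indicator D y + ennreal (g z y powr (4/3)) * indicator D y \<partial>lborel)"
      proof (rule nn_integral_mono)
        fix y
        have "((k x y * g z y) powr (1/3))\<^sup>2 = k x y powr (2/3) * g z y powr (2/3)"
          using k0[of x y] g1[of z y] by (simp add: powr_mult power_mult_distrib powr_square)
        also have "\<dots> \<le> (k x y powr (2/3))\<^sup>2 + (g z y powr (2/3))\<^sup>2"
          by (rule mult_le_sum_squares) auto
        also have "\<dots> = norm (x - y) powr - (8/3) + g z y powr (4/3)"
          unfolding k43[symmetric] by (simp add: power2_eq_square powr_add[symmetric])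
        finally have "(ennreal ((k x y * g z y) powr (1/3)))\<^sup>2 \<le> ennreal (norm (x - y) powr - (8/3)) + ennreal (g z y powr (4/3))"
          by (simp add: ennreal_power ennreal_plus[symmetric] ennreal_leI del: ennreal_plus)
        then show "(ennreal ((k x y * g z y) powr (1/3)) * indicator D y)\<^sup>2 \<le> ennreal (norm (x - y) powr - (8/3)) * indicator D y + ennreal (g z y powr (4/3)) * indicator D y"
          by (cases "y \<in> D") auto
      qed
      also have "\<dots> = (\<integral>\<^sup>+y\<in>D. ennreal (norm (x - y) powr - (8/3)) \<partial>lborel) + (\<integral>\<^sup>+y\<in>D. ennreal (g z y powr (4/3)) \<partial>lborel)"
        by (rule nn_integral_add) measurable
      also have "\<dots> \<le> ennreal C1 + ennreal C2" by (intro add_mono C1 C2)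
      also have "\<dots> = ennreal (C1 + C2)" using C1 C2p by (simp add: ennreal_plus)
      finally show "(\<integral>\<^sup>+y. (ennreal ((k x y * g z y) powr (1/3)) * indicator D y)\<^sup>2 \<partial>lborel) \<le> ennreal (C1 + C2)" .
      show "(\<integral>\<^sup>+y. (ennreal ((k x y * g z y) powr (2/3)) * indicator D y)\<^sup>2 \<partial>lborel) \<le> (\<integral>\<^sup>+y. ennreal (k x y powr (4/3)) * ennreal (g z y powr (4/3)) * indicator D y \<partial>lborel)"
      proof (rule nn_integral_mono)
        fix y
        have "((k x y * g z y) powr (2/3))\<^sup>2 = k x y powr (4/3) * g z y powr (4/3)"
          using k0[of x y] g1[of z y] by (simp add: powr_mult power_mult_distrib powr_square)
        then have "(ennreal ((k x y * g z y) powr (2/3)))\<^sup>2 = ennreal (k x y powr (4/3)) * ennreal (g z y powr (4/3))"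
          by (simp add: ennreal_power ennreal_mult'[symmetric])
        then show "(ennreal ((k x y * g z y) powr (2/3)) * indicator D y)\<^sup>2 \<le> ennreal (k x y powr (4/3)) * ennreal (g z y powr (4/3)) * indicator D y"
          by (cases "y \<in> D") auto
      qed
    qed auto
    finally show ?thesis .
  qed
  have main: "(\<integral>\<^sup>+x\<in>D. (riesz_op D (dipole_weight z) x)\<^sup>2 \<partial>lborel) \<le> ennreal ((C1 + C2) * (C1 * C2))" for z
  proof -
    have "(\<integral>\<^sup>+x\<in>D. (riesz_op D (dipole_weight z) x)\<^sup>2 \<partial>lborel)
      \<le> (\<integral>\<^sup>+x. ennreal (C1 + C2) * (\<integral>\<^sup>+y. ennreal (k x y powr (4/3)) * ennreal (g z y powr (4/3)) * indicator D y \<partial>lborel) * indicator D x \<partial>lborel)"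
      by (intro nn_integral_mono mult_right_mono pt) auto
    also have "\<dots> = ennreal (C1 + C2) * (\<integral>\<^sup>+x. \<integral>\<^sup>+y. ennreal (k x y powr (4/3)) * ennreal (g z y powr (4/3)) * indicator D y * indicator D x \<partial>lborel \<partial>lborel)"
      unfolding k_def
      by (rule nn_integral_iterated_const[where h = "\<lambda>x y. ennreal ((norm (x - y) powr - 2) powr (4/3)) * ennreal (g z y powr (4/3))"]) measurable
    also have "(\<integral>\<^sup>+x. \<integral>\<^sup>+y. ennreal (k x y powr (4/3)) * ennreal (g z y powr (4/3)) * indicator D y * indicator D x \<partial>lborel \<partial>lborel)
      = (\<integral>\<^sup>+y. \<integral>\<^sup>+x. ennreal (k x y powr (4/3)) * ennreal (g z y powr (4/3)) * indicator D y * indicator D x \<partial>lborel \<partial>lborel)"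
      unfolding k_def by (rule lborel_pair.Fubini'[symmetric]) measurable
    also have "\<dots> \<le> (\<integral>\<^sup>+y. ennreal C1 * (ennreal (g z y powr (4/3)) * indicator D y) \<partial>lborel)"
    proof (rule nn_integral_mono)
      fix y
      have "(\<integral>\<^sup>+x. ennreal (k x y powr (4/3)) * ennreal (g z y powr (4/3)) * indicator D y * indicator D x \<partial>lborel)
        = (\<integral>\<^sup>+x. (ennreal (norm (y - x) powr - (8/3)) * indicator D x) * (ennreal (g z y powr (4/3)) * indicator D y) \<partial>lborel)"
        unfolding k43 by (intro nn_integral_cong) (simp add: mult_ac norm_minus_commute)
      also have "\<dots> = (\<integral>\<^sup>+x. ennreal (norm (y - x) powr - (8/3)) * indicator D x \<partial>lborel) * (ennreal (g z y powr (4/3)) * indicator D y)"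
        by (rule nn_integral_multc) measurable
      also have "\<dots> \<le> ennreal C1 * (ennreal (g z y powr (4/3)) * indicator D y)"
        by (intro mult_right_mono C1) simp
      finally show "(\<integral>\<^sup>+x. ennreal (k x y powr (4/3)) * ennreal (g z y powr (4/3)) * indicator D y * indicator D x \<partial>lborel) \<le> ennreal C1 * (ennreal (g z y powr (4/3)) * indicator D y)" .
    qed
    also have "\<dots> = ennreal C1 * (\<integral>\<^sup>+y\<in>D. ennreal (g z y powr (4/3)) \<partial>lborel)"
      by (rule nn_integral_cmult) measurable
    also have "ennreal (C1 + C2) * (ennreal C1 * (\<integral>\<^sup>+y\<in>D. ennreal (g z y powr (4/3)) \<partial>lborel)) \<le> ennreal (C1 + C2) * (ennreal C1 * ennreal C2)"
      by (intro mult_left_mono C2) auto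
    also have "\<dots> = ennreal ((C1 + C2) * (C1 * C2))" using C1 C2p by (simp add: ennreal_mult')
    finally show ?thesis by (simp add: mult_left_mono)
  qed
  moreover have "(C1 + C2) * (C1 * C2) > 0" using C1 C2p by simp
  ultimately show ?thesis by blast
qed

section \<open>The Lippmann--Schwinger operator\<close>

text \<open>q stands for the contrast k^2 (n - 1) / \<open>kappa\<close>, in a Borel version bounded
  everywhere. Dividing by \<open>kappa\<close> matches a kernel e^(ikr) / r without normalising
  factor.\<close>

locale scatterer =
  fixes D :: "R3 set" and k Q :: real and q :: "R3 \<Rightarrow> complex"
  assumes D_open: "open D" and D_bounded: "bounded D" and D_nonempty: "D \<noteq> {}"
    and k_pos: "k > 0"
    and q_meas [measurable]: "q \<in> borel_measurable borel"
    and q_bound: "\<And>x. norm (q x) \<le> Q"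
    and q_supp: "\<And>x. x \<notin> D \<Longrightarrow> q x = 0"
begin

definition T :: "(R3 \<Rightarrow> complex) \<Rightarrow> R3 \<Rightarrow> complex" where
  "T g = potential (kerE k) (\<lambda>y. q y * g y)"

lemma D_borel [measurable]: "D \<in> sets borel"
  using D_open by simp

lemma Q_nonneg: "Q \<ge> 0"
  using q_bound[of 0] norm_ge_zero order_trans by blast

lemma bounded_density_mult:
  assumes "g \<in> borel_measurable borel" "\<And>y. y \<in> D \<Longrightarrow> norm (g y) \<le> B"
  shows "bounded_density (\<lambda>y. q y * g y) D (Q * B)"
proof
  have B: "B \<ge> 0" using assms(2) D_nonempty norm_ge_zero order_trans by blast
  show "(\<lambda>y. q y * g y) \<in> borel_measurable borel" using assms(1) by measurable
  show "norm (q y * g y) \<le> Q * B" for y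
  proof (cases "y \<in> D")
    case True
    then show ?thesis unfolding norm_mult using assms(2) Q_nonneg by (intro mult_mono q_bound) auto
  qed (use B Q_nonneg q_supp in auto)
qed (use q_supp D_bounded in auto)

lemma T_cong_AE:
  assumes "g \<in> borel_measurable borel" "h \<in> borel_measurable borel" "AE y in lborel. y \<in> D \<longrightarrow> g y = h y"
  shows "T g x = T h x"
  unfolding T_def potential_def
proof (rule integral_cong_AE)
  show "AE y in lborel. kerE k (x - y) * (q y * g y) = kerE k (x - y) * (q y * h y)"
    using assms(3) by eventually_elim (use q_supp in auto)
qed (use assms(1,2) in measurable)

lemma T_measurable:
  assumes "g \<in> borel_measurable borel" "\<And>y. y \<in> D \<Longrightarrow> norm (g y) \<le> B"
  shows "T g \<in> borel_measurable borel"
proof -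
  interpret bounded_density "\<lambda>y. q y * g y" D "Q * B" by (rule bounded_density_mult[OF assms])
  show ?thesis unfolding T_def by (rule potential_measurable[OF weakly_singular_kerE])
qed

lemma T_add:
  assumes "g \<in> borel_measurable borel" "\<And>y. y \<in> D \<Longrightarrow> norm (g y) \<le> B"
    and "h \<in> borel_measurable borel" "\<And>y. y \<in> D \<Longrightarrow> norm (h y) \<le> B'"
  shows "T (\<lambda>y. g y + h y) x = T g x + T h x"
proof -
  interpret g: bounded_density "\<lambda>y. q y * g y" D "Q * B" by (rule bounded_density_mult[OF assms(1,2)])
  interpret h: bounded_density "\<lambda>y. q y * h y" D "Q * B'" by (rule bounded_density_mult[OF assms(3,4)])
  show ?thesis unfolding T_def potential_def
    using g.integrable_potential[OF weakly_singular_kerE] h.integrable_potential[OF weakly_singular_kerE]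
    by (subst Bochner_Integration.integral_add[symmetric]) (auto simp: distrib_left)
qed

lemma T_scaleR: "T (\<lambda>y. r *\<^sub>R g y) x = r *\<^sub>R T g x"
proof -
  have "T (\<lambda>y. r *\<^sub>R g y) x = (\<integral>y. r *\<^sub>R (kerE k (x - y) * (q y * g y)) \<partial>lborel)"
    unfolding T_def potential_def by (intro Bochner_Integration.integral_cong refl) simp
  also have "\<dots> = r *\<^sub>R T g x" unfolding T_def potential_def by (rule integral_scaleR_right)
  finally show ?thesis .
qed

text \<open>The second estimate integrates \<open>kerE_lipschitz\<close> over D. A Lipschitz
  constant depending only on the sup bound of g is what supplies equicontinuity later.\<close>

lemma T_bounds:
  obtains C where "C > 0"
    "\<And>(g :: R3 \<Rightarrow> complex) B x. g \<in> borel_measurable borel \<Longrightarrow> (\<And>y. y \<in> D \<Longrightarrow> norm (g y) \<le> B) \<Longrightarrow> norm (T g x) \<le> C * B"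
    "\<And>(g :: R3 \<Rightarrow> complex) B x x'. g \<in> borel_measurable borel \<Longrightarrow> (\<And>y. y \<in> D \<Longrightarrow> norm (g y) \<le> B) \<Longrightarrow>
       norm (T g x - T g x') \<le> C * B * norm (x - x')"
proof -
  obtain C0 where C0: "C0 > 0" "\<And>x. (\<integral>\<^sup>+y\<in>D. ennreal (norm (kerE k (x - y))) \<partial>lborel) \<le> ennreal C0"
    using weakly_singular_nn_bound[OF weakly_singular_kerE D_borel D_bounded] by metis
  obtain C1 where C1: "C1 > 0" "\<And>x::R3. (\<integral>\<^sup>+y\<in>D. ennreal (norm (x - y) powr - 1) \<partial>lborel) \<le> ennreal C1"
    using riesz_kernel_uniform_bound[of 1 D] D_borel D_bounded by auto
  obtain C2 where C2: "C2 > 0" "\<And>x::R3. (\<integral>\<^sup>+y\<in>D. ennreal (norm (x - y) powr - 2) \<partial>lborel) \<le> ennreal C2"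
    using riesz_kernel_uniform_bound[of 2 D] D_borel D_bounded by auto
  define L where "L = k * C1 + C2 + C2"
  have L: "L > 0" unfolding L_def using k_pos C1 C2 by (simp add: add_pos_pos)
  define C where "C = Q * C0 + Q * L + 1"
  show ?thesis
  proof (rule that)
    show "C > 0" unfolding C_def using Q_nonneg C0 L by (simp add: add_nonneg_pos)
    fix g :: "R3 \<Rightarrow> complex" and B and x x' :: R3 assume g: "g \<in> borel_measurable borel" "\<And>y. y \<in> D \<Longrightarrow> norm (g y) \<le> B"
    have B: "B \<ge> 0" using g(2) D_nonempty norm_ge_zero order_trans by blast
    interpret bounded_density "\<lambda>y. q y * g y" D "Q * B" by (rule bounded_density_mult[OF g])
    have "norm (T g x) \<le> Q * B * C0" unfolding T_def
      by (rule norm_potential_le[OF C0(2) _ weakly_singular_kerE]) (use C0 in simp)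
    also have "\<dots> = Q * C0 * B" by simp
    also have "\<dots> \<le> C * B" unfolding C_def using Q_nonneg L B by (intro mult_right_mono) auto
    finally show "norm (T g x) \<le> C * B" .
    let ?h = "\<lambda>y. (kerE k (x - y) - kerE k (x' - y)) * (q y * g y)"
    have i: "integrable lborel (\<lambda>y. kerE k (x - y) * (q y * g y))" "integrable lborel (\<lambda>y. kerE k (x' - y) * (q y * g y))"
      by (rule integrable_potential[OF weakly_singular_kerE])+
    have ih: "integrable lborel ?h" using Bochner_Integration.integrable_diff[OF i] by (simp add: left_diff_distrib)
    have "T g x - T g x' = (\<integral>y. ?h y \<partial>lborel)" unfolding T_def potential_def using i by (simp add: left_diff_distrib)
    then have "ennreal (norm (T g x - T g x')) \<le> (\<integral>\<^sup>+y. ennreal (norm (?h y)) \<partial>lborel)"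
      using integral_norm_bound_ennreal[OF ih] by simp
    also have "\<dots> \<le> (\<integral>\<^sup>+y. ennreal (norm (x - x') * (Q * B)) * (ennreal k * (ennreal (norm (x - y) powr - 1) * indicator D y)
        + ennreal (norm (x - y) powr - 2) * indicator D y + ennreal (norm (x' - y) powr - 2) * indicator D y) \<partial>lborel)"
    proof (rule nn_integral_mono_AE)
      have "AE y in lborel. y \<noteq> x" "AE y in lborel. y \<noteq> x'" using AE_lborel_singleton[of x] AE_lborel_singleton[of x'] by auto
      then show "AE y in lborel. ennreal (norm (?h y)) \<le> ennreal (norm (x - x') * (Q * B)) * (ennreal k * (ennreal (norm (x - y) powr - 1) * indicator D y)
        + ennreal (norm (x - y) powr - 2) * indicator D y + ennreal (norm (x' - y) powr - 2) * indicator D y)"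
      proof eventually_elim
        case (elim y)
        show ?case
        proof (cases "y \<in> D")
          case True
          define u v w where "u = norm (x - y) powr - 1" and "v = norm (x - y) powr - 2" and "w = norm (x' - y) powr - 2"
          have uvw: "u \<ge> 0" "v \<ge> 0" "w \<ge> 0" unfolding u_def v_def w_def by auto
          have "norm (?h y) \<le> (norm ((x - y) - (x' - y)) * (k * u + v + w)) * (Q * B)"
            unfolding norm_mult[of "kerE k (x - y) - kerE k (x' - y)"] u_def v_def w_def
            using elim k_pos f_bound[of y] M_nonneg by (intro mult_mono kerE_lipschitz) auto
          also have "\<dots> = norm (x - x') * (Q * B) * (k * u + v + w)" by simp
          finally have "ennreal (norm (?h y)) \<le> ennreal (norm (x - x') * (Q * B) * (k * u + v + w))" by (rule ennreal_leI)
          also have "\<dots> = ennreal (norm (x - x') * (Q * B)) * (ennreal k * ennreal u + ennreal v + ennreal w)"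
            using uvw k_pos M_nonneg by (simp add: ennreal_mult' ennreal_plus)
          finally show ?thesis using True unfolding u_def v_def w_def by (simp only: indicator_simps mult_1_right)
        qed (simp add: q_supp)
      qed
    qed
    also have "\<dots> = ennreal (norm (x - x') * (Q * B)) * (ennreal k * (\<integral>\<^sup>+y\<in>D. ennreal (norm (x - y) powr - 1) \<partial>lborel)
        + (\<integral>\<^sup>+y\<in>D. ennreal (norm (x - y) powr - 2) \<partial>lborel) + (\<integral>\<^sup>+y\<in>D. ennreal (norm (x' - y) powr - 2) \<partial>lborel))"
      by (simp add: nn_integral_cmult nn_integral_add del: norm_powr_minus_1)
    also have "\<dots> \<le> ennreal (norm (x - x') * (Q * B)) * (ennreal k * ennreal C1 + ennreal C2 + ennreal C2)"
      by (intro mult_left_mono add_mono C1 C2) auto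
    also have "\<dots> = ennreal (norm (x - x') * (Q * B) * L)"
    proof -
      have *: "ennreal k * ennreal a + ennreal b + ennreal c = ennreal (k * a + b + c)" if "a \<ge> 0" "b \<ge> 0" "c \<ge> 0" for a b c
        using that k_pos by (simp add: ennreal_mult' ennreal_plus)
      have "ennreal k * ennreal C1 + ennreal C2 + ennreal C2 = ennreal L"
        unfolding L_def by (rule *) (use C1(1) C2(1) in auto)
      then show ?thesis using M_nonneg L by (simp add: ennreal_mult'[symmetric])
    qed
    finally have "norm (T g x - T g x') \<le> norm (x - x') * (Q * B) * L"
      using L M_nonneg by (simp add: ennreal_le_iff)
    also have "\<dots> = Q * L * (B * norm (x - x'))" by simp
    also have "\<dots> \<le> C * (B * norm (x - x'))" unfolding C_def using Q_nonneg C0 B by (intro mult_right_mono) auto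
    finally show "norm (T g x - T g x') \<le> C * B * norm (x - x')" by (simp add: mult.assoc)
  qed
qed

lemma T_continuous:
  assumes "g \<in> borel_measurable borel" "\<And>y. y \<in> D \<Longrightarrow> norm (g y) \<le> B"
  shows "continuous_on UNIV (T g)"
proof -
  obtain C where C: "\<And>x x'. norm (T g x - T g x') \<le> C * B * norm (x - x')"
    using T_bounds assms by metis
  have "norm (T g x - T g x') \<le> \<bar>C * B\<bar> * norm (x - x')" for x x'
    by (rule order_trans[OF C mult_right_mono]) auto
  then have "\<bar>C * B\<bar>-lipschitz_on UNIV (T g)" by (intro lipschitz_onI) (auto simp: dist_norm)
  then show ?thesis by (rule lipschitz_on_continuous_on)
qed

text \<open>Composing with the metric projection onto a ball containing \<open>D\<close> does not change the values
  on \<open>D\<close>, and makes the operator compact on the bounded continuous functions.\<close>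

definition radius :: real where
  "radius = (SOME R. R > 0 \<and> D \<subseteq> cball 0 R)"

lemma radius: "radius > 0" "D \<subseteq> cball 0 radius"
proof -
  have "\<exists>R. R > 0 \<and> D \<subseteq> cball (0::R3) R"
    using D_bounded unfolding bounded_pos by (auto simp: subset_iff)
  from someI_ex[OF this] show "radius > 0" "D \<subseteq> cball 0 radius" unfolding radius_def by auto
qed

definition proj :: "R3 \<Rightarrow> R3" where
  "proj = closest_point (cball 0 radius)"

lemma proj_in: "proj x \<in> cball 0 radius"
  unfolding proj_def using radius by (intro closest_point_in_set) auto

lemma proj_id: "x \<in> D \<Longrightarrow> proj x = x"
  unfolding proj_def using radius by (intro closest_point_self) auto

lemma proj_continuous: "continuous_on S proj"
  unfolding proj_def using radius by (intro continuous_on_closest_point) auto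

section \<open>Compactness and invertibility on bounded continuous functions\<close>

lemma comp_proj_bcontfun:
  assumes "g \<in> borel_measurable borel" "\<And>y. y \<in> D \<Longrightarrow> norm (g y) \<le> B"
  shows "(\<lambda>x. T g (proj x)) \<in> bcontfun"
  unfolding bcontfun_def
proof (intro CollectI conjI)
  show "continuous_on UNIV (\<lambda>x. T g (proj x))"
    by (rule continuous_on_compose2[OF T_continuous[OF assms] proj_continuous]) auto
  obtain C where "\<And>x. norm (T g x) \<le> C * B" using T_bounds assms by metis
  then show "bounded (range (\<lambda>x. T g (proj x)))" by (intro boundedI[of _ "C * B"]) auto
qed

definition Kop :: "(R3 \<Rightarrow>\<^sub>C complex) \<Rightarrow> (R3 \<Rightarrow>\<^sub>C complex)" where
  "Kop \<phi> = Bcontfun (\<lambda>x. T (apply_bcontfun \<phi>) (proj x))"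

lemma bcontfun_borel [measurable]: "apply_bcontfun (\<phi> :: R3 \<Rightarrow>\<^sub>C complex) \<in> borel_measurable borel"
  by (rule borel_measurable_continuous_onI) simp

lemma Kop_apply: "apply_bcontfun (Kop \<phi>) x = T (apply_bcontfun \<phi>) (proj x)"
  unfolding Kop_def
  by (subst Bcontfun_inverse[OF comp_proj_bcontfun[OF bcontfun_borel norm_bounded]]) simp

lemma norm_bcontfun_le:
  fixes \<phi> :: "R3 \<Rightarrow>\<^sub>C complex"
  assumes "\<And>x. norm (apply_bcontfun \<phi> x) \<le> b" shows "norm \<phi> \<le> b"
  using norm_bound[of \<phi> b] assms by blast

lemma Kop_bounded_linear: "bounded_linear Kop"
proof -
  obtain C where C: "\<And>g B x. g \<in> borel_measurable borel \<Longrightarrow> (\<And>y. y \<in> D \<Longrightarrow> norm (g y) \<le> B) \<Longrightarrow> norm (T g x) \<le> C * B"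
    using T_bounds by metis
  show ?thesis
  proof (rule bounded_linear_intro[of _ C])
    fix \<phi> \<psi> :: "R3 \<Rightarrow>\<^sub>C complex"
    show "Kop (\<phi> + \<psi>) = Kop \<phi> + Kop \<psi>"
    proof (rule bcontfun_eqI)
      fix x
      have "apply_bcontfun (\<phi> + \<psi>) = (\<lambda>y. apply_bcontfun \<phi> y + apply_bcontfun \<psi> y)" by (simp add: fun_eq_iff)
      then show "apply_bcontfun (Kop (\<phi> + \<psi>)) x = apply_bcontfun (Kop \<phi> + Kop \<psi>) x"
        using T_add[OF bcontfun_borel norm_bounded bcontfun_borel norm_bounded] by (simp add: Kop_apply)
    qed
  next
    fix \<phi> :: "R3 \<Rightarrow>\<^sub>C complex" and r :: real
    show "Kop (r *\<^sub>R \<phi>) = r *\<^sub>R Kop \<phi>"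
    proof (rule bcontfun_eqI)
      fix x
      have "apply_bcontfun (r *\<^sub>R \<phi>) = (\<lambda>y. r *\<^sub>R apply_bcontfun \<phi> y)" by (simp add: fun_eq_iff)
      then show "apply_bcontfun (Kop (r *\<^sub>R \<phi>)) x = apply_bcontfun (r *\<^sub>R Kop \<phi>) x"
        by (simp add: Kop_apply T_scaleR)
    qed
  next
    fix \<phi> :: "R3 \<Rightarrow>\<^sub>C complex"
    show "norm (Kop \<phi>) \<le> norm \<phi> * C"
      using C[OF bcontfun_borel norm_bounded] by (intro norm_bcontfun_le) (simp add: Kop_apply mult.commute)
  qed
qed

text \<open>Images of a bounded sequence are uniformly bounded and uniformly Lipschitz, so
  Arzela-Ascoli applies on the closed ball. Since \<open>Kop\<close> only sees values at projected
  points, uniform convergence on the ball is convergence in the sup norm over the whole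
  space.\<close>

lemma Kop_compact: "sequentially_compact_op Kop"
  unfolding sequentially_compact_op_def
proof (intro allI impI)
  fix X :: "nat \<Rightarrow> R3 \<Rightarrow>\<^sub>C complex" assume "bounded (range X)"
  then obtain b where b: "b > 0" "\<And>n. norm (X n) \<le> b" unfolding bounded_pos by auto
  obtain C where C: "C > 0"
    "\<And>(g :: R3 \<Rightarrow> complex) B x. g \<in> borel_measurable borel \<Longrightarrow> (\<And>y. y \<in> D \<Longrightarrow> norm (g y) \<le> B) \<Longrightarrow> norm (T g x) \<le> C * B"
    "\<And>(g :: R3 \<Rightarrow> complex) B x x'. g \<in> borel_measurable borel \<Longrightarrow> (\<And>y. y \<in> D \<Longrightarrow> norm (g y) \<le> B) \<Longrightarrow> norm (T g x - T g x') \<le> C * B * norm (x - x')"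
    using T_bounds by metis
  define F where "F n x = T (apply_bcontfun (X n)) x" for n x
  have Xb: "norm (apply_bcontfun (X n) y) \<le> b" for n y using norm_bounded b(2) order_trans by blast
  have Fb: "norm (F n x) \<le> C * b" for n x unfolding F_def by (rule C(2)[OF bcontfun_borel Xb])
  have Fl: "norm (F n x - F n x') \<le> C * b * norm (x - x')" for n x x' unfolding F_def by (rule C(3)[OF bcontfun_borel Xb])
  obtain g r where g: "continuous_on (cball 0 radius) g" "strict_mono (r :: nat \<Rightarrow> nat)"
    "\<And>e. 0 < e \<Longrightarrow> \<exists>N. \<forall>n x. n \<ge> N \<and> x \<in> cball 0 radius \<longrightarrow> norm (F (r n) x - g x) < e"
  proof (rule Arzela_Ascoli[of "cball 0 radius" F "C * b"])
    fix x :: R3 and e :: real assume "e > 0"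
    show "\<exists>d>0. \<forall>n y. y \<in> cball 0 radius \<and> norm (x - y) < d \<longrightarrow> norm (F n x - F n y) < e"
    proof (intro exI conjI allI impI)
      show "e / (C * b) > 0" using \<open>e > 0\<close> C b by simp
      fix n y assume "y \<in> cball 0 radius \<and> norm (x - y) < e / (C * b)"
      then have "C * b * norm (x - y) < e" using C b by (simp add: pos_less_divide_eq mult.commute)
      then show "norm (F n x - F n y) < e" using Fl[of n x y] by linarith
    qed
  qed (use Fb in auto)
  have gb: "norm (g x) \<le> C * b + 1" if x: "x \<in> cball 0 radius" for x
  proof -
    obtain N where "norm (F (r N) x - g x) < 1" using g(3)[of 1] x by auto
    then show ?thesis using Fb[of "r N" x] norm_triangle_sub[of "g x" "F (r N) x"] by (simp add: norm_minus_commute)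
  qed
  have "(\<lambda>x. g (proj x)) \<in> bcontfun" unfolding bcontfun_def
  proof (intro CollectI conjI)
    show "continuous_on UNIV (\<lambda>x. g (proj x))"
      by (rule continuous_on_compose2[OF g(1) proj_continuous]) (use proj_in in auto)
    show "bounded (range (\<lambda>x. g (proj x)))" using gb[OF proj_in] by (intro boundedI[of _ "C * b + 1"]) auto
  qed
  then obtain l where l: "(\<lambda>x. g (proj x)) = apply_bcontfun l" by (rule bcontfunE)
  have "(\<lambda>n. Kop (X (r n))) \<longlonglongrightarrow> l"
  proof (rule metric_LIMSEQ_I)
    fix e :: real assume e: "e > 0"
    then obtain N where N: "\<And>n x. n \<ge> N \<Longrightarrow> x \<in> cball 0 radius \<Longrightarrow> norm (F (r n) x - g x) < e / 2"
      using g(3)[of "e / 2"] by auto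
    have "dist (Kop (X (r n))) l < e" if n: "n \<ge> N" for n
    proof -
      have "dist (Kop (X (r n))) l \<le> e / 2"
      proof (rule dist_bound)
        fix x
        have "apply_bcontfun l x = g (proj x)" using l by metis
        then show "dist (apply_bcontfun (Kop (X (r n))) x) (apply_bcontfun l x) \<le> e / 2"
          using N[OF n proj_in, of x] by (simp add: Kop_apply F_def dist_norm)
      qed
      then show ?thesis using e by linarith
    qed
    then show "\<exists>N. \<forall>n\<ge>N. dist (Kop (X (r n))) l < e" by blast
  qed
  then show "\<exists>r l. strict_mono r \<and> (\<lambda>n. Kop (X (r n))) \<longlonglongrightarrow> l" using g(2) by blast
qed

text \<open>Injectivity is asked only almost everywhere on D, which is what uniqueness of the
  transmission problem can deliver. It suffices: a fixed point that vanishes a.e. on D has zero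
  density, hence zero potential, and so vanishes at every point.\<close>

lemma Kop_solvable:
  assumes inj: "\<And>\<phi> :: R3 \<Rightarrow>\<^sub>C complex. (\<And>y. y \<in> D \<Longrightarrow> T (apply_bcontfun \<phi>) y = apply_bcontfun \<phi> y) \<Longrightarrow>
      AE y in lborel. y \<in> D \<longrightarrow> apply_bcontfun \<phi> y = 0"
  shows "\<exists>C>0. \<forall>b. \<exists>w. w - Kop w = b \<and> norm w \<le> C * norm b"
proof -
  have inj0: "\<phi> = 0" if \<phi>: "\<phi> = Kop \<phi>" for \<phi>
  proof -
    have "T (apply_bcontfun \<phi>) y = apply_bcontfun \<phi> y" if "y \<in> D" for y
      using \<phi> Kop_apply[of \<phi> y] proj_id[OF that] by simp
    from inj[OF this] have ae: "AE y in lborel. y \<in> D \<longrightarrow> apply_bcontfun \<phi> y = 0" .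
    have "apply_bcontfun \<phi> x = 0" for x
    proof -
      have "apply_bcontfun \<phi> x = T (apply_bcontfun \<phi>) (proj x)" using \<phi> Kop_apply by metis
      also have "\<dots> = T (\<lambda>y. 0) (proj x)" by (rule T_cong_AE[OF _ _ ae]) auto
      also have "\<dots> = 0" by (simp add: T_def potential_def)
      finally show ?thesis .
    qed
    then show ?thesis by (intro bcontfun_eqI) simp
  qed
  obtain c where c: "c > 0" "\<And>x. c * norm x \<le> norm (x - Kop x)"
    using compact_perturbation_bounded_below[OF Kop_bounded_linear Kop_compact inj0] by blast
  show ?thesis
  proof (rule exI[of _ "inverse c"], rule conjI, goal_cases)
    case 1 show ?case using c by simp
  next
    case 2 show ?case
    proof
      fix b
      obtain w where w: "w - Kop w = b"
        using compact_perturbation_surj[OF Kop_bounded_linear Kop_compact inj0] by blast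
      have "norm w \<le> inverse c * norm b" using c(2)[of w] c(1) unfolding w by (simp add: field_simps)
      with w show "\<exists>w. w - Kop w = b \<and> norm w \<le> inverse c * norm b" by blast
    qed
  qed
qed

end

section \<open>From the integral equation to the transmission problem\<close>

lemma test_fun_mono: "test_fun \<Omega> \<phi> \<Longrightarrow> \<Omega> \<subseteq> \<Omega>' \<Longrightarrow> test_fun \<Omega>' \<phi>"
  unfolding test_fun_def by blast

lemma borel_imp_lebesgue_on:
  assumes "h \<in> borel_measurable borel"
  shows "h \<in> borel_measurable (lebesgue_on K)"
  using assms by (intro measurable_restrict_space1 measurable_completion) simp

lemma
  fixes h u :: "R3 \<Rightarrow> complex"
  assumes h: "h \<in> borel_measurable borel" and K: "K \<in> lmeasurable"
    and B: "\<And>x. x \<in> K \<Longrightarrow> norm (h x) \<le> B" and eq: "\<And>x. x \<in> K \<Longrightarrow> u x = h x"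
  shows set_integrable_bounded: "set_integrable lebesgue K u"
    and Lp_on_bounded_borel: "p > 0 \<Longrightarrow> Lp_on p K u"
proof -
  have "integrable lebesgue (\<lambda>x. indicator K x *\<^sub>R h x)"
  proof (rule Bochner_Integration.integrable_bound)
    show "integrable lebesgue (\<lambda>x. \<bar>B\<bar> * indicator K x)"
      using fmeasurableD[OF K] fmeasurableD2[OF K] by (simp add: top.not_eq_extremum)
    show "(\<lambda>x. indicator K x *\<^sub>R h x) \<in> borel_measurable lebesgue"
    proof (intro borel_measurable_scaleR borel_measurable_indicator)
      show "K \<in> sets lebesgue" using K by (rule fmeasurableD)
      show "h \<in> borel_measurable lebesgue" using h by (intro measurable_completion) simp
    qed
    show "AE x in lebesgue. norm (indicator K x *\<^sub>R h x) \<le> norm (\<bar>B\<bar> * indicator K x)"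
    proof (rule AE_I2)
      fix x show "norm (indicator K x *\<^sub>R h x) \<le> norm (\<bar>B\<bar> * indicator K x)"
        using B[of x] by (cases "x \<in> K") auto
    qed
  qed
  moreover have "(\<lambda>x. indicator K x *\<^sub>R h x) = (\<lambda>x. indicator K x *\<^sub>R u x)"
    using eq by (auto simp: fun_eq_iff indicator_def)
  ultimately show "set_integrable lebesgue K u" unfolding set_integrable_def by simp
  have "u \<in> borel_measurable (lebesgue_on K)"
    using borel_imp_lebesgue_on[OF h, of K] measurable_cong[of "lebesgue_on K" h u borel] eq by auto
  then show "p > 0 \<Longrightarrow> Lp_on p K u"
    using B eq by (intro Lp_on_bounded[OF K, of _ B]) auto
qed

text \<open>The definitions integrate over Lebesgue measure, the potential theory over
  \<open>lborel\<close>. Agreement almost everywhere is allowed because \<open>dipole_inc\<close> is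
  unspecified at z; measurability of u then comes from completeness.\<close>

lemma LINT_eq_borel:
  fixes h u :: "R3 \<Rightarrow> complex"
  assumes h: "h \<in> borel_measurable borel" and ae: "AE x in lebesgue. indicator \<Omega> x *\<^sub>R u x = h x"
  shows "(LINT x:\<Omega>|lebesgue. u x) = (\<integral>x. h x \<partial>lborel)"
proof -
  have hm: "h \<in> borel_measurable lebesgue" using h by (intro measurable_completion) simp
  have ae': "AE x in lebesgue. h x = indicator \<Omega> x *\<^sub>R u x" using ae by eventually_elim simp
  have "(\<integral>x. indicator \<Omega> x *\<^sub>R u x \<partial>lebesgue) = (\<integral>x. h x \<partial>lebesgue)"
    by (rule integral_cong_AE[OF borel_measurable_AE[OF hm ae'] hm ae])
  also have "\<dots> = (\<integral>x. h x \<partial>lborel)" using h by (intro integral_completion) simp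
  finally show ?thesis unfolding set_lebesgue_integral_def .
qed

lemma AE_lebesgue_neq: "AE x in lebesgue. x \<noteq> (z :: R3)"
  using AE_lborel_singleton[of z] by (intro AE_completion) simp

lemma continuous_on_compact_norm_bound:
  assumes "continuous_on S h" "compact K" "K \<subseteq> S"
  obtains B where "\<And>x. x \<in> K \<Longrightarrow> norm (h x) \<le> B"
proof -
  have "bounded (h ` K)" using assms compact_continuous_image compact_imp_bounded continuous_on_subset by metis
  then show ?thesis using that unfolding bounded_iff by blast
qed

context bounded_density
begin

lemma potential_bounded:
  assumes "weakly_singular H"
  obtains B where "\<And>x. norm (potential H f x) \<le> B"
proof -
  obtain C where C: "C > 0" "\<And>x. (\<integral>\<^sup>+y\<in>S. ennreal (norm (H (x - y))) \<partial>lborel) \<le> ennreal C"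
    using weakly_singular_nn_bound[OF assms S_meas S_bounded] by metis
  show ?thesis by (rule that[OF norm_potential_le[OF C(2) less_imp_le[OF C(1)] assms]])
qed

lemma potential_locally_bounded:
  assumes "weakly_singular H" "compact K"
  shows "set_integrable lebesgue K (potential H f)" "p > 0 \<Longrightarrow> Lp_on p K (potential H f)"
proof -
  obtain B where "\<And>x. norm (potential H f x) \<le> B" using potential_bounded[OF assms(1)] by blast
  then show "set_integrable lebesgue K (potential H f)" "p > 0 \<Longrightarrow> Lp_on p K (potential H f)"
    using potential_measurable[OF assms(1)] lmeasurable_compact[OF assms(2)]
    by (auto intro: set_integrable_bounded Lp_on_bounded_borel)
qed

lemma potential_weak_grad:
  assumes k: "k \<ge> 0"
  shows "weak_grad \<Omega> (potential (kerE k) f) (\<lambda>i. potential (kerG k i) f)"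
  unfolding weak_grad_def loc_integrable_def
proof (intro conjI allI impI)
  note E = weakly_singular_kerE[of k] and G = weakly_singular_kerG[OF k]
  show "set_integrable lebesgue K (potential (kerE k) f)" if "compact K \<and> K \<subseteq> \<Omega>" for K
    using potential_locally_bounded(1)[OF E] that by blast
  show "set_integrable lebesgue K (potential (kerG k i) f)" if "compact K \<and> K \<subseteq> \<Omega>" for K i
    using potential_locally_bounded(1)[OF G] that by blast
  fix i \<phi> assume \<phi>: "test_fun \<Omega> \<phi>"
  note T = test_funD[OF \<phi>] and \<phi>U = test_fun_mono[OF \<phi> subset_UNIV] and m = test_fun_measurable[OF \<phi>]
  have z: "\<phi> x = 0" "pderiv3 i \<phi> x = 0" if "x \<notin> \<Omega>" for x i using that T(5) T(6)[of x] T(7)[of x i] by blast+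
  have "(LINT x:\<Omega>|lebesgue. potential (kerE k) f x * of_real (pderiv3 i \<phi> x)) = (\<integral>x. potential (kerE k) f x * of_real (pderiv3 i \<phi> x) \<partial>lborel)"
  proof (rule LINT_eq_borel)
    show "(\<lambda>x. potential (kerE k) f x * of_real (pderiv3 i \<phi> x)) \<in> borel_measurable borel"
      using borel_measurable_integrable[OF integrable_potential_test(2)[OF k \<phi>U E]] by simp
  qed (auto simp: indicator_def z)
  also have "\<dots> = - (\<integral>x. potential (kerG k i) f x * of_real (\<phi> x) \<partial>lborel)"
    by (rule potential_weak_gradient[OF k \<phi>U])
  also have "(\<integral>x. potential (kerG k i) f x * of_real (\<phi> x) \<partial>lborel) = (LINT x:\<Omega>|lebesgue. potential (kerG k i) f x * of_real (\<phi> x))"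
  proof (rule LINT_eq_borel[symmetric])
    show "(\<lambda>x. potential (kerG k i) f x * of_real (\<phi> x)) \<in> borel_measurable borel"
      using borel_measurable_integrable[OF integrable_potential_test(1)[OF k \<phi>U G]] by simp
  qed (auto simp: indicator_def z)
  finally show "(LINT x:\<Omega>|lebesgue. potential (kerE k) f x * of_real (pderiv3 i \<phi> x)) = - (LINT x:\<Omega>|lebesgue. potential (kerG k i) f x * of_real (\<phi> x))" .
qed

end

context scatterer
begin

lemma dipole_density:
  assumes z: "z \<notin> closure D" and w: "w \<in> borel_measurable borel" "\<And>y. y \<in> D \<Longrightarrow> norm (w y) \<le> B"
  obtains M where "bounded_density (\<lambda>y. q y * (dipole_field k z a y + w y)) D M"
proof -
  obtain Bd where Bd: "\<And>x. x \<in> D \<Longrightarrow> norm (dipole_field k z a x) \<le> Bd"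
    using dipole_field_bounded[OF z D_bounded, of k a] by auto
  have "bounded_density (\<lambda>y. q y * (dipole_field k z a y + w y)) D (Q * (Bd + B))"
  proof (rule bounded_density_mult)
    show "(\<lambda>y. dipole_field k z a y + w y) \<in> borel_measurable borel" using w(1) by measurable
    show "norm (dipole_field k z a y + w y) \<le> Bd + B" if "y \<in> D" for y
      by (rule norm_triangle_mono[OF Bd[OF that] w(2)[OF that]])
  qed
  then show ?thesis by (rule that)
qed

text \<open>Incident field and potential are each weak solutions off z, with right-hand sides 0 and
  \<open>kappa\<close> f. On D the integral equation turns \<open>kappa\<close> f into k^2 (n - 1)
  times the total field, which is the change of refractive index. The transmission conditions hold
  because one formula describes the field on both sides of the boundary.\<close>

lemma transmission_of_lippmann_schwinger:
  assumes z: "z \<notin> closure D" and w: "w \<in> borel_measurable borel" "\<And>y. y \<in> D \<Longrightarrow> norm (w y) \<le> B"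
    and LS: "\<And>y. y \<in> D \<Longrightarrow> T (\<lambda>y. dipole_field k z a y + w y) y = w y"
    and n: "AE x in lebesgue. x \<in> D \<longrightarrow> of_real kappa * q x = (of_real k)\<^sup>2 * (n x - 1)"
  shows "transmission_solution D n k z (dipole_inc k z a) (T (\<lambda>y. dipole_field k z a y + w y))
    (\<lambda>x. dipole_inc k z a x + T (\<lambda>y. dipole_field k z a y + w y) x)"
proof -
  have k: "k \<ge> 0" using k_pos by simp
  define f where "f y = q y * (dipole_field k z a y + w y)" for y
  obtain M where "bounded_density f D M" unfolding f_def using dipole_density[OF z w] by blast
  then interpret F: bounded_density f D M .
  define W where "W = T (\<lambda>y. dipole_field k z a y + w y)"
  have WP: "W = potential (kerE k) f" unfolding W_def T_def f_def ..
  define G where "G i = potential (kerG k i) f" for i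
  note wE = weakly_singular_kerE[of k] and wG = weakly_singular_kerG[OF k]
  have Wm[measurable]: "W \<in> borel_measurable borel" unfolding WP by (rule F.potential_measurable[OF wE])
  have Gm[measurable]: "G i \<in> borel_measurable borel" for i unfolding G_def by (rule F.potential_measurable[OF wG])
  define U where "U x = dipole_field k z a x + W x" for x
  define gU where "gU i x = dipole_grad k z a i x + G i x" for i x
  have Um[measurable]: "U \<in> borel_measurable borel" unfolding U_def[abs_def] by measurable
  have gUm[measurable]: "gU i \<in> borel_measurable borel" for i unfolding gU_def[abs_def] by measurable
  have Uglue: "(if x \<in> D then dipole_inc k z a x + W x else dipole_inc k z a x + W x) = U x" if "x \<noteq> z" for x
    using dipole_inc_eq[OF that] by (simp add: U_def)
  \<comment> \<open>Both branches coincide; the conditional keeps the shape of the glued field in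
    \<open>transmission_solution\<close>. V and U can differ only at z.\<close>
  define V where "V = (\<lambda>x. if x \<in> D then dipole_inc k z a x + W x else dipole_inc k z a x + W x)"
  have VU: "V x = U x" if "x \<noteq> z" for x using Uglue[OF that] by (simp add: V_def)
  obtain BW where BW: "\<And>x. norm (W x) \<le> BW" unfolding WP using F.potential_bounded[OF wE] by blast
  have "\<exists>B. \<forall>x. norm (G i x) \<le> B" for i unfolding G_def using F.potential_bounded[OF wG] by blast
  then obtain BG where BG: "\<And>i x. norm (G i x) \<le> BG i" by metis
  have loc: "set_integrable lebesgue K V \<and> Lp_on 2 K V" "\<And>i. set_integrable lebesgue K (gU i) \<and> Lp_on 2 K (gU i)"
    if K: "compact K" "K \<subseteq> - {z}" for K
  proof -
    obtain B1 where B1: "\<And>x. x \<in> K \<Longrightarrow> norm (dipole_field k z a x) \<le> B1"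
      using continuous_on_compact_norm_bound[OF dipole_field_continuous_on K] by blast
    have b: "norm (U x) \<le> B1 + BW" if "x \<in> K" for x
      unfolding U_def by (rule norm_triangle_mono[OF B1[OF that] BW])
    have e: "V x = U x" if "x \<in> K" for x using VU that K(2) by blast
    show "set_integrable lebesgue K V \<and> Lp_on 2 K V"
      using set_integrable_bounded[OF Um lmeasurable_compact[OF K(1)] b e] Lp_on_bounded_borel[OF Um lmeasurable_compact[OF K(1)] b e, of 2] by simp
    fix i
    obtain B2 where B2: "\<And>x. x \<in> K \<Longrightarrow> norm (dipole_grad k z a i x) \<le> B2"
      using continuous_on_compact_norm_bound[OF dipole_grad_continuous_on K] by blast
    have b: "norm (gU i x) \<le> B2 + BG i" if "x \<in> K" for x
      unfolding gU_def by (rule norm_triangle_mono[OF B2[OF that] BG])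
    show "set_integrable lebesgue K (gU i) \<and> Lp_on 2 K (gU i)"
      using set_integrable_bounded[OF gUm lmeasurable_compact[OF K(1)] b refl] Lp_on_bounded_borel[OF gUm lmeasurable_compact[OF K(1)] b refl, of 2] by simp
  qed
  have neq: "AE x in lebesgue. x \<noteq> z" by (rule AE_lebesgue_neq)
  have grad: "weak_grad (- {z}) V gU"
    unfolding weak_grad_def loc_integrable_def
  proof (intro conjI allI impI)
    fix i \<phi> assume \<phi>: "test_fun (- {z}) \<phi>"
    note \<phi>U = test_fun_mono[OF \<phi> subset_UNIV] and [measurable] = test_fun_measurable[OF \<phi>]
    have "(LINT x:- {z}|lebesgue. V x * of_real (pderiv3 i \<phi> x)) = (\<integral>x. U x * of_real (pderiv3 i \<phi> x) \<partial>lborel)"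
      by (rule LINT_eq_borel, measurable) (use neq in \<open>eventually_elim, simp add: VU\<close>)
    also have "\<dots> = (\<integral>x. dipole_field k z a x * of_real (pderiv3 i \<phi> x) \<partial>lborel) + (\<integral>x. W x * of_real (pderiv3 i \<phi> x) \<partial>lborel)"
      unfolding U_def distrib_right WP
      by (intro Bochner_Integration.integral_add integrable_dipole_test(2)[OF \<phi>] F.integrable_potential_test(2)[OF k \<phi>U wE])
    also have "\<dots> = - ((\<integral>x. dipole_grad k z a i x * of_real (\<phi> x) \<partial>lborel) + (\<integral>x. G i x * of_real (\<phi> x) \<partial>lborel))"
      unfolding dipole_weak_gradient[OF \<phi>] WP G_def F.potential_weak_gradient[OF k \<phi>U] by simp
    also have "(\<integral>x. dipole_grad k z a i x * of_real (\<phi> x) \<partial>lborel) + (\<integral>x. G i x * of_real (\<phi> x) \<partial>lborel) = (\<integral>x. gU i x * of_real (\<phi> x) \<partial>lborel)"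
      unfolding gU_def distrib_right G_def
      by (intro Bochner_Integration.integral_add[symmetric] integrable_dipole_test(3)[OF \<phi>] F.integrable_potential_test(1)[OF k \<phi>U wG])
    also have "(\<integral>x. gU i x * of_real (\<phi> x) \<partial>lborel) = (LINT x:- {z}|lebesgue. gU i x * of_real (\<phi> x))"
      by (rule LINT_eq_borel[symmetric], measurable) (use neq in \<open>eventually_elim, simp\<close>)
    finally show "(LINT x:- {z}|lebesgue. V x * of_real (pderiv3 i \<phi> x)) = - (LINT x:- {z}|lebesgue. gU i x * of_real (\<phi> x))" .
  qed (use loc in blast)+
  have eqn: "(LINT x|lebesgue. (\<Sum>i\<in>UNIV. gU i x * of_real (pderiv3 i \<phi> x)) - (of_real k)\<^sup>2 * (if x \<in> D then n x else 1) * V x * of_real (\<phi> x)) = 0"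
    if \<phi>: "test_fun (- {z}) \<phi>" for \<phi>
  proof -
    note \<phi>U = test_fun_mono[OF \<phi> subset_UNIV] and [measurable] = test_fun_measurable[OF \<phi>]
    \<comment> \<open>J1 is the weak form for the incident field, J2 that for the potential, J3 the
      contrast term. Their combination J1 + J2 - J3 equals the required integrand a.e., and its
      integral is 0 + \<open>kappa\<close> (f, \<phi>) - \<open>kappa\<close> (f, \<phi>).\<close>
    define J1 where "J1 x = (\<Sum>i\<in>UNIV. dipole_grad k z a i x * of_real (pderiv3 i \<phi> x)) - (of_real k)\<^sup>2 * dipole_field k z a x * of_real (\<phi> x)" for x
    define J2 where "J2 x = (\<Sum>i\<in>UNIV. G i x * of_real (pderiv3 i \<phi> x)) - (of_real k)\<^sup>2 * W x * of_real (\<phi> x)" for x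
    define J3 where "J3 x = of_real kappa * (f x * of_real (\<phi> x))" for x
    have iJ1: "integrable lborel J1" unfolding J1_def
      using integrable_dipole_test[OF \<phi>, of k a] by (intro Bochner_Integration.integrable_diff Bochner_Integration.integrable_sum) (auto simp: mult.assoc)
    have iJ2: "integrable lborel J2" unfolding J2_def G_def WP
      using F.integrable_potential_test[OF k \<phi>U] wE wG by (intro Bochner_Integration.integrable_diff Bochner_Integration.integrable_sum) (auto simp: mult.assoc)
    have iJ3: "integrable lborel J3"
    proof -
      obtain Bd where Bd: "\<And>x. \<bar>\<phi> x\<bar> \<le> Bd" using test_fun_bounds[OF \<phi>] by metis
      have "integrable lborel (\<lambda>x. of_real (\<phi> x) * f x)"
        by (rule F.integrable_density_mult[of _ Bd]) (use Bd in auto)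
      then show ?thesis unfolding J3_def by (simp add: mult.commute)
    qed
    have 0: "(\<integral>x. J1 x + J2 x - J3 x \<partial>lborel) = 0"
    proof -
      have "(\<integral>x. J1 x \<partial>lborel) = 0" unfolding J1_def by (rule dipole_weak_helmholtz[OF \<phi>])
      moreover have "(\<integral>x. J2 x \<partial>lborel) = of_real kappa * (\<integral>y. f y * of_real (\<phi> y) \<partial>lborel)"
        unfolding J2_def G_def WP by (rule F.potential_weak_helmholtz[OF k \<phi>U])
      moreover have "(\<integral>x. J3 x \<partial>lborel) = of_real kappa * (\<integral>y. f y * of_real (\<phi> y) \<partial>lborel)" unfolding J3_def by simp
      ultimately show ?thesis using iJ1 iJ2 iJ3 by simp
    qed
    have Jm: "(\<lambda>x. J1 x + J2 x - J3 x) \<in> borel_measurable borel"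
      using borel_measurable_integrable[OF iJ1] borel_measurable_integrable[OF iJ2] borel_measurable_integrable[OF iJ3] by simp
    have ae: "AE x in lebesgue. indicator UNIV x *\<^sub>R ((\<Sum>i\<in>UNIV. gU i x * of_real (pderiv3 i \<phi> x)) - (of_real k)\<^sup>2 * (if x \<in> D then n x else 1) * V x * of_real (\<phi> x))
       = J1 x + J2 x - J3 x"
      using neq n
    proof eventually_elim
      case (elim x)
      have S: "(\<Sum>i\<in>UNIV. gU i x * of_real (pderiv3 i \<phi> x)) = (\<Sum>i\<in>UNIV. dipole_grad k z a i x * of_real (pderiv3 i \<phi> x)) + (\<Sum>i\<in>UNIV. G i x * of_real (pderiv3 i \<phi> x))"
        by (simp add: gU_def distrib_right sum.distrib)
      have "(of_real k)\<^sup>2 * (if x \<in> D then n x else 1) * U x = (of_real k)\<^sup>2 * U x + of_real kappa * f x"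
      proof (cases "x \<in> D")
        case True
        then have "f x = q x * U x" using LS[OF True] by (simp add: f_def U_def W_def)
        then have "of_real kappa * f x = (of_real kappa * q x) * U x" by simp
        also have "of_real kappa * q x = (of_real k)\<^sup>2 * (n x - 1)" using elim True by blast
        finally show ?thesis using True by (simp add: algebra_simps)
      qed (simp add: f_def q_supp)
      then have "(of_real k)\<^sup>2 * (if x \<in> D then n x else 1) * V x * of_real (\<phi> x)
        = (of_real k)\<^sup>2 * dipole_field k z a x * of_real (\<phi> x) + (of_real k)\<^sup>2 * W x * of_real (\<phi> x) + of_real kappa * (f x * of_real (\<phi> x))"
        unfolding VU[OF elim(1)] by (simp only:) (simp add: U_def algebra_simps)
      then show ?case unfolding J1_def J2_def J3_def S by (simp only:) simp
    qed
    show ?thesis using LINT_eq_borel[OF Jm ae] 0 by (simp add: set_lebesgue_integral_def)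
  qed
  have "kern k 0 (kerE k)" using kern_fE[of k 0] by simp
  then have C2: "Ck_on 2 (- closure D) W" unfolding WP by (rule F.potential_Ck_on)
  show ?thesis
    unfolding transmission_solution_def W_def[symmetric] Let_def V_def[symmetric] H1loc_grad_def
  proof (intro conjI ballI)
    show "Ck_on 2 (- closure D) W" by (rule C2)
    show "laplacian3 W x + (of_real k)\<^sup>2 * W x = 0" if "x \<in> - closure D" for x
      unfolding WP using F.potential_helmholtz_outside that by simp
    show "radiating k W" unfolding WP by (rule F.potential_radiating[OF k])
    show "\<exists>g. (weak_grad (- {z}) V g \<and> (\<forall>K. compact K \<and> K \<subseteq> - {z} \<longrightarrow> Lp_on 2 K V \<and> (\<forall>i. Lp_on 2 K (g i)))) \<and>
      (\<forall>\<phi>. test_fun (- {z}) \<phi> \<longrightarrow> (LINT x|lebesgue. (\<Sum>i\<in>UNIV. g i x * of_real (pderiv3 i \<phi> x)) - (of_real k)\<^sup>2 * (if x \<in> D then n x else 1) * V x * of_real (\<phi> x)) = 0)"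
      by (rule exI[of _ gU]) (use grad loc eqn in blast)
  qed
qed

end

section \<open>Bounds for the solution\<close>

lemma ennreal_square_add_le:
  fixes a b :: ennreal
  shows "(a + b)\<^sup>2 \<le> 2 * a\<^sup>2 + 2 * b\<^sup>2"
proof -
  have "(a + b)\<^sup>2 = a\<^sup>2 + b\<^sup>2 + 2 * a * b" by (rule power2_sum)
  also have "\<dots> \<le> a\<^sup>2 + b\<^sup>2 + (a\<^sup>2 + b\<^sup>2)" by (intro add_left_mono sum_of_squares_ge_ennreal)
  also have "\<dots> = 2 * a\<^sup>2 + 2 * b\<^sup>2" by (simp add: mult_2 ac_simps)
  finally show ?thesis .
qed

context scatterer
begin

lemma dist_le_radius: "x \<in> D \<Longrightarrow> y \<in> D \<Longrightarrow> norm (x - y) \<le> 2 * radius"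
proof -
  assume "x \<in> D" "y \<in> D"
  then have "norm x \<le> radius" "norm y \<le> radius" using radius(2) by auto
  then show ?thesis using norm_triangle_ineq4[of x y] by linarith
qed

text \<open>For points of D one has |x - y|^-1 \<le> 2 \<open>radius\<close> |x - y|^-2. The terms
  cover, in this order, \<open>kerE\<close>, the milder part of \<open>kerG\<close> and its leading
  part, so that a single kernel |x - y|^-2 dominates everything.\<close>

definition kernel_const :: real where
  "kernel_const = 2 * radius + k * (2 * radius) + 1"

lemma kernel_const_pos: "kernel_const > 0"
  unfolding kernel_const_def using radius(1) k_pos by (simp add: add_pos_pos)

lemma kernel_le:
  assumes "x \<in> D" "y \<in> D" "x \<noteq> y"
  shows "norm (kerE k (x - y)) \<le> kernel_const * norm (x - y) powr - 2"
    and "norm (kerG k i (x - y)) \<le> kernel_const * norm (x - y) powr - 2"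
proof -
  have nz: "x - y \<noteq> 0" using assms by simp
  define r where "r = norm (x - y)"
  have r: "r > 0" "r \<le> 2 * radius" using assms dist_le_radius by (auto simp: r_def)
  have p: "norm (x - y) powr - 2 = 1 / r\<^sup>2" "norm (x - y) powr - 1 = 1 / r"
    unfolding r_def by (rule norm_powr_minus_2, rule norm_powr_minus_1)
  have "1 / r = r * (1 / r\<^sup>2)" using r by (simp add: power2_eq_square)
  also have "\<dots> \<le> 2 * radius * (1 / r\<^sup>2)" using r by (intro mult_right_mono) auto
  finally have r1: "1 / r \<le> 2 * radius * (1 / r\<^sup>2)" .
  have r2: "0 \<le> 1 / r\<^sup>2" by simp
  have kr: "0 \<le> k * (2 * radius) * (1 / r\<^sup>2)" "0 \<le> 2 * radius * (1 / r\<^sup>2)" using k_pos radius(1) by auto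
  have c: "kernel_const * (1 / r\<^sup>2) = 2 * radius * (1 / r\<^sup>2) + k * (2 * radius) * (1 / r\<^sup>2) + 1 / r\<^sup>2"
    by (simp add: kernel_const_def add_divide_distrib)
  have "norm (kerE k (x - y)) \<le> 1 / r" using norm_fE_le[OF nz, of k 0] unfolding p by simp
  then show "norm (kerE k (x - y)) \<le> kernel_const * norm (x - y) powr - 2"
    unfolding p c using r1 r2 kr by linarith
  have "norm (kerG k i (x - y)) \<le> k * (1 / r) + 1 / r\<^sup>2"
    using norm_component_fA_le[OF nz, of k i 0] k_pos unfolding p rho_0 by simp
  moreover have "k * (1 / r) \<le> k * (2 * radius) * (1 / r\<^sup>2)"
    using mult_left_mono[OF r1, of k] k_pos by simp
  ultimately show "norm (kerG k i (x - y)) \<le> kernel_const * norm (x - y) powr - 2"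
    unfolding p c using kr by linarith
qed

lemma potential_le_riesz_op:
  assumes g: "g \<in> borel_measurable borel" "\<And>y. y \<in> D \<Longrightarrow> norm (g y) \<le> B"
    and H: "weakly_singular H" and le: "\<And>y. y \<in> D \<Longrightarrow> x \<noteq> y \<Longrightarrow> norm (H (x - y)) \<le> c * norm (x - y) powr - 2" and c: "c \<ge> 0"
  shows "ennreal (norm (potential H (\<lambda>y. q y * g y) x)) \<le> ennreal (c * Q) * riesz_op D (\<lambda>y. ennreal (norm (g y))) x"
proof -
  interpret bounded_density "\<lambda>y. q y * g y" D "Q * B" by (rule bounded_density_mult[OF g])
  have [measurable]: "g \<in> borel_measurable borel" by (rule g(1))
  have "ennreal (norm (potential H (\<lambda>y. q y * g y) x)) \<le> (\<integral>\<^sup>+y. ennreal (norm (H (x - y) * (q y * g y))) \<partial>lborel)"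
    unfolding potential_def by (rule integral_norm_bound_ennreal[OF integrable_potential[OF H]])
  also have "\<dots> \<le> (\<integral>\<^sup>+y. ennreal (c * Q) * (ennreal (norm (x - y) powr - 2) * ennreal (norm (g y)) * indicator D y) \<partial>lborel)"
  proof (rule nn_integral_mono_AE)
    have "AE y in lborel. y \<noteq> x" using AE_lborel_singleton[of x] by simp
    then show "AE y in lborel. ennreal (norm (H (x - y) * (q y * g y))) \<le> ennreal (c * Q) * (ennreal (norm (x - y) powr - 2) * ennreal (norm (g y)) * indicator D y)"
    proof eventually_elim
      case (elim y)
      show ?case
      proof (cases "y \<in> D")
        case True
        have "norm (H (x - y) * (q y * g y)) \<le> (c * norm (x - y) powr - 2) * (Q * norm (g y))"
          unfolding norm_mult using elim c Q_nonneg by (intro mult_mono le[OF True] q_bound) auto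
        also have "\<dots> = (c * Q) * (norm (x - y) powr - 2 * norm (g y))" by simp
        finally have "ennreal (norm (H (x - y) * (q y * g y))) \<le> ennreal ((c * Q) * (norm (x - y) powr - 2 * norm (g y)))" by (rule ennreal_leI)
        also have "\<dots> = ennreal (c * Q) * (ennreal (norm (x - y) powr - 2) * ennreal (norm (g y)))"
          using c Q_nonneg by (subst ennreal_mult', simp, subst ennreal_mult', simp_all only: powr_ge_zero)
        finally show ?thesis using True by simp
      qed (simp add: q_supp)
    qed
  qed
  also have "\<dots> = ennreal (c * Q) * riesz_op D (\<lambda>y. ennreal (norm (g y))) x"
    unfolding riesz_op_def by (rule nn_integral_cmult) measurable
  finally show ?thesis .
qed

text \<open>Cauchy-Schwarz in additive form: |x - y|^-1 |g| \<le> S |x - y|^-2 + |g|^2 / S. Taking S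
  to be the scale of g makes the bound linear in S.\<close>

lemma T_le_weighted_L2:
  fixes S :: real
  assumes g: "g \<in> borel_measurable borel" "\<And>y. y \<in> D \<Longrightarrow> norm (g y) \<le> B" and S: "S > 0"
    and C2: "(\<integral>\<^sup>+y\<in>D. ennreal (norm (x - y) powr - 2) \<partial>lborel) \<le> ennreal C2" "C2 \<ge> 0"
    and L: "(\<integral>\<^sup>+y\<in>D. (ennreal (norm (g y)))\<^sup>2 \<partial>lborel) \<le> ennreal (A * S\<^sup>2)" "A \<ge> 0"
  shows "norm (T g x) \<le> Q * (C2 + A) * S"
proof -
  interpret bounded_density "\<lambda>y. q y * g y" D "Q * B" by (rule bounded_density_mult[OF g])
  have [measurable]: "g \<in> borel_measurable borel" by (rule g(1))
  have "ennreal (norm (T g x)) \<le> (\<integral>\<^sup>+y. ennreal (norm (kerE k (x - y) * (q y * g y))) \<partial>lborel)"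
    unfolding T_def potential_def by (rule integral_norm_bound_ennreal[OF integrable_potential[OF weakly_singular_kerE]])
  also have "\<dots> \<le> (\<integral>\<^sup>+y. ennreal Q * (ennreal S * (ennreal (norm (x - y) powr - 2) * indicator D y) + ennreal (1 / S) * ((ennreal (norm (g y)))\<^sup>2 * indicator D y)) \<partial>lborel)"
  proof (rule nn_integral_mono_AE)
    have "AE y in lborel. y \<noteq> x" using AE_lborel_singleton[of x] by simp
    then show "AE y in lborel. ennreal (norm (kerE k (x - y) * (q y * g y))) \<le> ennreal Q * (ennreal S * (ennreal (norm (x - y) powr - 2) * indicator D y) + ennreal (1 / S) * ((ennreal (norm (g y)))\<^sup>2 * indicator D y))"
    proof eventually_elim
      case (elim y)
      show ?case
      proof (cases "y \<in> D")
        case True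
        define u where "u = norm (x - y) powr - 1"
        define v where "v = norm (g y)"
        have uv: "u \<ge> 0" "v \<ge> 0" unfolding u_def v_def by auto
        have u2: "norm (x - y) powr - 2 = u\<^sup>2" unfolding u_def powr_square by simp
        have "norm (kerE k (x - y)) \<le> u" using norm_fE_le[of "x - y" k 0] elim unfolding u_def rho_0 by simp
        then have "norm (kerE k (x - y) * (q y * g y)) \<le> u * (Q * v)"
          unfolding norm_mult v_def using uv Q_nonneg by (intro mult_mono q_bound) auto
        also have "\<dots> = Q * ((sqrt S * u) * (v / sqrt S))" using S by simp
        also have "\<dots> \<le> Q * ((sqrt S * u)\<^sup>2 + (v / sqrt S)\<^sup>2)"
          using uv S Q_nonneg by (intro mult_left_mono mult_le_sum_squares) auto
        also have "\<dots> = Q * (S * u\<^sup>2 + 1 / S * v\<^sup>2)" using S by (simp add: power_mult_distrib power_divide)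
        finally have "ennreal (norm (kerE k (x - y) * (q y * g y))) \<le> ennreal (Q * (S * u\<^sup>2 + 1 / S * v\<^sup>2))" by (rule ennreal_leI)
        also have "\<dots> = ennreal Q * (ennreal S * ennreal (u\<^sup>2) + ennreal (1 / S) * (ennreal v)\<^sup>2)"
        proof -
          have "ennreal (S * u\<^sup>2 + 1 / S * v\<^sup>2) = ennreal (S * u\<^sup>2) + ennreal (1 / S * v\<^sup>2)"
            using S by (intro ennreal_plus) auto
          moreover have "ennreal (S * u\<^sup>2) = ennreal S * ennreal (u\<^sup>2)" using S by (intro ennreal_mult) auto
          moreover have "ennreal (1 / S * v\<^sup>2) = ennreal (1 / S) * ennreal (v\<^sup>2)" using S by (intro ennreal_mult) auto
          moreover have "ennreal (v\<^sup>2) = (ennreal v)\<^sup>2" using uv by (simp add: ennreal_power)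
          moreover have "ennreal (Q * (S * u\<^sup>2 + 1 / S * v\<^sup>2)) = ennreal Q * ennreal (S * u\<^sup>2 + 1 / S * v\<^sup>2)"
            using Q_nonneg S by (intro ennreal_mult) auto
          ultimately show ?thesis by simp
        qed
        finally show ?thesis using True unfolding u2 v_def by simp
      qed (simp add: q_supp)
    qed
  qed
  also have "\<dots> = ennreal Q * (ennreal S * (\<integral>\<^sup>+y\<in>D. ennreal (norm (x - y) powr - 2) \<partial>lborel) + ennreal (1 / S) * (\<integral>\<^sup>+y\<in>D. (ennreal (norm (g y)))\<^sup>2 \<partial>lborel))"
    by (simp add: nn_integral_cmult nn_integral_add)
  also have "\<dots> \<le> ennreal Q * (ennreal S * ennreal C2 + ennreal (1 / S) * ennreal (A * S\<^sup>2))"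
    by (intro mult_left_mono add_mono C2 L) auto
  also have "\<dots> = ennreal (Q * (S * C2 + 1 / S * (A * S\<^sup>2)))"
    using Q_nonneg S C2(2) L(2) by (simp only: ennreal_mult[symmetric] ennreal_plus[symmetric] mult_nonneg_nonneg add_nonneg_nonneg divide_nonneg_nonneg zero_le_one less_imp_le zero_le_power2)
  also have "Q * (S * C2 + 1 / S * (A * S\<^sup>2)) = Q * (C2 + A) * S" using S by (simp add: power2_eq_square algebra_simps)
  finally show ?thesis using Q_nonneg S C2(2) L(2) by (simp add: ennreal_le_iff)
qed

text \<open>S is the amplitude in front of the dipole weight, and every constant is fixed before z,
  a and S. The sup bounds of u and w may depend on z; they only justify linearity and measurability
  and do not enter C.\<close>

lemma lippmann_schwinger_estimate:
  assumes inj: "\<And>\<phi> :: R3 \<Rightarrow>\<^sub>C complex. (\<And>y. y \<in> D \<Longrightarrow> T (apply_bcontfun \<phi>) y = apply_bcontfun \<phi> y) \<Longrightarrow>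
      AE y in lborel. y \<in> D \<longrightarrow> apply_bcontfun \<phi> y = 0"
  shows "\<exists>C>0. \<forall>z a S. z \<notin> closure D \<longrightarrow> S > 0 \<longrightarrow> (\<forall>y\<in>D. norm (dipole_field k z a y) \<le> S * (1 + norm (y - z) powr - 2)) \<longrightarrow>
    (\<exists>w B. w \<in> borel_measurable borel \<and> (\<forall>y\<in>D. norm (w y) \<le> B) \<and>
       (\<forall>y\<in>D. T (\<lambda>y. dipole_field k z a y + w y) y = w y) \<and>
       (\<integral>\<^sup>+x\<in>D. (ennreal (norm (T (\<lambda>y. dipole_field k z a y + w y) x)))\<^sup>2 \<partial>lborel) \<le> ennreal (C * S\<^sup>2) \<and>
       (\<forall>i. (\<integral>\<^sup>+x\<in>D. (ennreal (norm (potential (kerG k i) (\<lambda>y. q y * (dipole_field k z a y + w y)) x)))\<^sup>2 \<partial>lborel) \<le> ennreal (C * S\<^sup>2)))"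
proof -
  obtain Ck where Ck: "Ck > 0" "\<And>b. \<exists>w. w - Kop w = b \<and> norm w \<le> Ck * norm b" using Kop_solvable[OF inj] by blast
  obtain Cy where Cy: "Cy > 0" "\<And>z. (\<integral>\<^sup>+x\<in>D. (riesz_op D (dipole_weight z) x)\<^sup>2 \<partial>lborel) \<le> ennreal Cy"
    using riesz_op_dipole_weight[OF D_borel D_bounded] by blast
  obtain C2 where C2: "C2 > 0" "\<And>x::R3. (\<integral>\<^sup>+y\<in>D. ennreal (norm (x - y) powr - 2) \<partial>lborel) \<le> ennreal C2"
    using riesz_kernel_uniform_bound[of 2 D] D_borel D_bounded by auto
  obtain CT where CT: "\<And>g B x. g \<in> borel_measurable borel \<Longrightarrow> (\<And>y. y \<in> D \<Longrightarrow> norm (g y) \<le> B) \<Longrightarrow> norm (T g x) \<le> CT * B"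
    using T_bounds by metis
  define V where "V = measure lborel D"
  have V: "emeasure lborel D = ennreal V" "V \<ge> 0"
    using emeasure_bounded_finite[OF D_bounded] by (auto simp: V_def emeasure_eq_ennreal_measure)
  define c where "c = kernel_const * Q"
  have c0: "c \<ge> 0" unfolding c_def using kernel_const_pos Q_nonneg by simp
  define A1 where "A1 = c\<^sup>2 * Cy"
  have A10: "A1 \<ge> 0" unfolding A1_def using Cy by simp
  define c2 where "c2 = Ck * (Q * (C2 + A1))"
  have c20: "c2 \<ge> 0" unfolding c2_def using Ck Q_nonneg C2 A10 by simp
  \<comment> \<open>Squares of sums are bounded by twice the sum of squares; the sup bound c2 S
    contributes its square times the volume V, and CG is formed in the same way.\<close>
  define CW where "CW = 2 * A1 + 2 * c2\<^sup>2 * V"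
  define CG where "CG = c\<^sup>2 * (2 * (1 + c2)\<^sup>2 * Cy + 2 * (C2\<^sup>2 * A1))"
  have CW0: "CW \<ge> 0" unfolding CW_def using A10 V by simp
  have CG0: "CG \<ge> 0" unfolding CG_def using A10 Cy by simp
  show ?thesis
  proof (rule exI[of _ "CW + CG + 1"], rule conjI, goal_cases)
    case 1 show ?case using CW0 CG0 by simp
  next
    case 2 show ?case
    proof (intro allI impI)
      fix z a S assume z: "z \<notin> closure D" and S: "S > 0"
        and dip: "\<forall>y\<in>D. norm (dipole_field k z a y) \<le> S * (1 + norm (y - z) powr - 2)"
      define u where "u = dipole_field k z a"
      have um[measurable]: "u \<in> borel_measurable borel" unfolding u_def by simp
      obtain Bu where Bu: "\<And>y. y \<in> D \<Longrightarrow> norm (u y) \<le> Bu"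
        using dipole_field_bounded[OF z D_bounded, of k a] unfolding u_def by auto
      have uw: "ennreal (norm (u y)) \<le> ennreal S * dipole_weight z y" if "y \<in> D" for y
      proof -
        have "ennreal (norm (u y)) \<le> ennreal (S * (1 + norm (y - z) powr - 2))" using dip that unfolding u_def by (intro ennreal_leI) blast
        also have "\<dots> = ennreal S * dipole_weight z y" unfolding dipole_weight_def using S by (intro ennreal_mult) auto
        finally show ?thesis .
      qed
      \<comment> \<open>The first iterate. Its sup bound depends on z through Bu, so only the L^2
        bound, from Young's inequality for the dipole weight, is carried further.\<close>
      define w1 where "w1 = T u"
      have w1m[measurable]: "w1 \<in> borel_measurable borel" unfolding w1_def by (rule T_measurable[OF um Bu])
      have w1B: "norm (w1 y) \<le> CT * Bu" for y unfolding w1_def by (rule CT[OF um Bu])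
      have w1L: "(\<integral>\<^sup>+x\<in>D. (ennreal (norm (w1 x)))\<^sup>2 \<partial>lborel) \<le> ennreal (A1 * S\<^sup>2)"
      proof -
        have "(\<integral>\<^sup>+x\<in>D. (ennreal (norm (w1 x)))\<^sup>2 \<partial>lborel) \<le> (\<integral>\<^sup>+x. ennreal ((c * S)\<^sup>2) * ((riesz_op D (dipole_weight z) x)\<^sup>2 * indicator D x) \<partial>lborel)"
        proof (rule nn_integral_mono)
          fix x
          show "(ennreal (norm (w1 x)))\<^sup>2 * indicator D x \<le> ennreal ((c * S)\<^sup>2) * ((riesz_op D (dipole_weight z) x)\<^sup>2 * indicator D x)"
          proof (cases "x \<in> D")
            case True
            have "ennreal (norm (w1 x)) \<le> ennreal c * riesz_op D (\<lambda>y. ennreal (norm (u y))) x"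
              unfolding w1_def T_def c_def
              using kernel_le(1)[OF True] kernel_const_pos by (intro potential_le_riesz_op[OF um Bu weakly_singular_kerE]) auto
            also have "\<dots> \<le> ennreal c * riesz_op D (\<lambda>y. ennreal S * dipole_weight z y) x"
              by (intro mult_left_mono riesz_op_mono uw) auto
            also have "\<dots> = ennreal (c * S) * riesz_op D (dipole_weight z) x"
              using c0 S by (simp add: riesz_op_cmult ennreal_mult mult.assoc)
            finally have "(ennreal (norm (w1 x)))\<^sup>2 \<le> (ennreal (c * S) * riesz_op D (dipole_weight z) x)\<^sup>2" by (rule power_mono) simp
            then show ?thesis using True c0 S by (simp add: power_mult_distrib ennreal_power)
          qed simp
        qed
        also have "\<dots> = ennreal ((c * S)\<^sup>2) * (\<integral>\<^sup>+x\<in>D. (riesz_op D (dipole_weight z) x)\<^sup>2 \<partial>lborel)"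
          by (rule nn_integral_cmult) measurable
        also have "\<dots> \<le> ennreal ((c * S)\<^sup>2) * ennreal Cy" by (intro mult_left_mono Cy) simp
        also have "\<dots> = ennreal (A1 * S\<^sup>2)" unfolding A1_def using Cy(1) by (simp add: ennreal_mult[symmetric] power_mult_distrib mult_ac)
        finally show ?thesis .
      qed
      have bmem: "(\<lambda>x. T w1 (proj x)) \<in> bcontfun" by (rule comp_proj_bcontfun[OF w1m w1B])
      define b where "b = Bcontfun (\<lambda>x. T w1 (proj x))"
      have bap: "apply_bcontfun b x = T w1 (proj x)" for x unfolding b_def using Bcontfun_inverse[OF bmem] by simp
      have bn: "norm b \<le> Q * (C2 + A1) * S"
        by (intro norm_bcontfun_le) (simp only: bap, rule T_le_weighted_L2[OF w1m w1B S C2(2) less_imp_le[OF C2(1)] w1L A10])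
      \<comment> \<open>With w2 - T w2 = T w1 on D, the sum w1 + w2 satisfies T (u + w1 + w2) = w1 +
        w2 there. The right-hand side T w1 is bounded uniformly by the L^2 norm of w1, so w2 has a
        sup bound of order S.\<close>
      obtain w2 where w2: "w2 - Kop w2 = b" "norm w2 \<le> Ck * norm b" using Ck(2) by blast
      have w2B: "norm (apply_bcontfun w2 y) \<le> c2 * S" for y
      proof -
        have "norm (apply_bcontfun w2 y) \<le> norm w2" by (rule norm_bounded)
        also have "\<dots> \<le> Ck * (Q * (C2 + A1) * S)" using w2(2) mult_left_mono[OF bn, of Ck] Ck(1) by linarith
        finally show ?thesis unfolding c2_def by (simp add: mult.assoc)
      qed
      define w where "w y = w1 y + apply_bcontfun w2 y" for y
      have wm[measurable]: "w \<in> borel_measurable borel" unfolding w_def[abs_def] by measurable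
      have wB: "norm (w y) \<le> CT * Bu + c2 * S" for y unfolding w_def by (rule norm_triangle_mono[OF w1B w2B])
      define g where "g y = u y + w y" for y
      have gm[measurable]: "g \<in> borel_measurable borel" unfolding g_def[abs_def] by measurable
      have gB: "norm (g y) \<le> Bu + (CT * Bu + c2 * S)" if "y \<in> D" for y
        unfolding g_def by (rule norm_triangle_mono[OF Bu[OF that] wB])
      have LS: "T g y = w y" if y: "y \<in> D" for y
      proof -
        have "T g y = T u y + T w y" unfolding g_def by (rule T_add[OF um Bu wm wB])
        also have "T w y = T w1 y + T (apply_bcontfun w2) y" unfolding w_def by (rule T_add[OF w1m w1B bcontfun_borel w2B])
        also have "apply_bcontfun w2 y - T (apply_bcontfun w2) y = T w1 y"
        proof -
          have "apply_bcontfun (w2 - Kop w2) y = apply_bcontfun b y" using w2(1) by simp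
          then show ?thesis using Kop_apply[of w2 y] bap[of y] proj_id[OF y] by simp
        qed
        then have "T w1 y + T (apply_bcontfun w2) y = apply_bcontfun w2 y" by (simp add: algebra_simps)
        finally show ?thesis by (simp add: w_def w1_def)
      qed
      have wle: "ennreal (norm (w y)) \<le> ennreal (norm (w1 y)) + ennreal (c2 * S)" for y
      proof -
        have "norm (w y) \<le> norm (w1 y) + c2 * S" unfolding w_def by (rule norm_triangle_mono[OF order_refl w2B])
        then have "ennreal (norm (w y)) \<le> ennreal (norm (w1 y) + c2 * S)" by (rule ennreal_leI)
        then show ?thesis using c20 S by (simp add: ennreal_plus)
      qed
      have TL: "(\<integral>\<^sup>+x\<in>D. (ennreal (norm (T g x)))\<^sup>2 \<partial>lborel) \<le> ennreal (CW * S\<^sup>2)"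
      proof -
        have "(\<integral>\<^sup>+x\<in>D. (ennreal (norm (T g x)))\<^sup>2 \<partial>lborel)
          \<le> (\<integral>\<^sup>+x. 2 * ((ennreal (norm (w1 x)))\<^sup>2 * indicator D x) + 2 * (ennreal ((c2 * S)\<^sup>2) * indicator D x) \<partial>lborel)"
        proof (rule nn_integral_mono)
          fix x
          show "(ennreal (norm (T g x)))\<^sup>2 * indicator D x \<le> 2 * ((ennreal (norm (w1 x)))\<^sup>2 * indicator D x) + 2 * (ennreal ((c2 * S)\<^sup>2) * indicator D x)"
          proof (cases "x \<in> D")
            case True
            have "(ennreal (norm (T g x)))\<^sup>2 \<le> (ennreal (norm (w1 x)) + ennreal (c2 * S))\<^sup>2"
              unfolding LS[OF True] by (intro power_mono wle) simp
            also have "\<dots> \<le> 2 * (ennreal (norm (w1 x)))\<^sup>2 + 2 * (ennreal (c2 * S))\<^sup>2" by (rule ennreal_square_add_le)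
            also have "(ennreal (c2 * S))\<^sup>2 = ennreal ((c2 * S)\<^sup>2)" using c20 S by (intro ennreal_power) auto
            finally show ?thesis using True by simp
          qed simp
        qed
        also have "\<dots> = 2 * (\<integral>\<^sup>+x\<in>D. (ennreal (norm (w1 x)))\<^sup>2 \<partial>lborel) + 2 * (ennreal ((c2 * S)\<^sup>2) * emeasure lborel D)"
          by (simp add: nn_integral_add nn_integral_cmult)
        also have "\<dots> \<le> 2 * ennreal (A1 * S\<^sup>2) + 2 * (ennreal ((c2 * S)\<^sup>2) * ennreal V)"
          unfolding V by (intro add_mono mult_left_mono w1L) auto
        also have "\<dots> = ennreal (2 * (A1 * S\<^sup>2) + 2 * ((c2 * S)\<^sup>2 * V))"
          using A10 V(2) by (simp add: ennreal_plus ennreal_mult)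
        also have "2 * (A1 * S\<^sup>2) + 2 * ((c2 * S)\<^sup>2 * V) = CW * S\<^sup>2" unfolding CW_def by (simp add: algebra_simps power_mult_distrib)
        finally show ?thesis .
      qed
      have gle: "ennreal (norm (g y)) \<le> ennreal ((1 + c2) * S) * dipole_weight z y + ennreal (norm (w1 y))" if y: "y \<in> D" for y
      proof -
        have "norm (g y) \<le> norm (u y) + norm (w y)" unfolding g_def by (rule norm_triangle_ineq)
        then have "ennreal (norm (g y)) \<le> ennreal (norm (u y)) + ennreal (norm (w y))"
          by (simp add: ennreal_plus[symmetric] ennreal_leI del: ennreal_plus)
        also have "\<dots> \<le> ennreal S * dipole_weight z y + (ennreal (norm (w1 y)) + ennreal (c2 * S) * dipole_weight z y)"
        proof (rule add_mono[OF uw[OF y] order_trans[OF wle]])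
          \<comment> \<open>The summand 1 in the weight absorbs the constant bound for w2, so the
            density consists of a multiple of the weight and of w1.\<close>
          have "1 \<le> dipole_weight z y" unfolding dipole_weight_def by (simp add: ennreal_leI flip: ennreal_1)
          then have "ennreal (c2 * S) * 1 \<le> ennreal (c2 * S) * dipole_weight z y" by (intro mult_left_mono) auto
          then show "ennreal (norm (w1 y)) + ennreal (c2 * S) \<le> ennreal (norm (w1 y)) + ennreal (c2 * S) * dipole_weight z y"
            by (intro add_left_mono) simp
        qed
        also have "\<dots> = (ennreal S + ennreal (c2 * S)) * dipole_weight z y + ennreal (norm (w1 y))" by (simp add: algebra_simps)
        also have "ennreal S + ennreal (c2 * S) = ennreal ((1 + c2) * S)" using S c20 by (simp add: distrib_right ennreal_plus)
        finally show ?thesis .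
      qed
      have GL: "(\<integral>\<^sup>+x\<in>D. (ennreal (norm (potential (kerG k i) (\<lambda>y. q y * g y) x)))\<^sup>2 \<partial>lborel) \<le> ennreal (CG * S\<^sup>2)" for i
      proof -
        \<comment> \<open>The gradient splits accordingly: I1 is handled by the Young estimate for
          the weight, I2 by Schur's test and the L^2 bound for w1.\<close>
        define I1 where "I1 = riesz_op D (dipole_weight z)"
        define I2 where "I2 = riesz_op D (\<lambda>y. ennreal (norm (w1 y)))"
        have [measurable]: "I1 \<in> borel_measurable borel" "I2 \<in> borel_measurable borel" unfolding I1_def I2_def by measurable
        define s where "s = (1 + c2) * S"
        have s0: "s \<ge> 0" unfolding s_def using c20 S by simp
        have "(\<integral>\<^sup>+x\<in>D. (ennreal (norm (potential (kerG k i) (\<lambda>y. q y * g y) x)))\<^sup>2 \<partial>lborel)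
          \<le> (\<integral>\<^sup>+x. ennreal (c\<^sup>2) * (2 * (ennreal (s\<^sup>2) * ((I1 x)\<^sup>2 * indicator D x)) + 2 * ((I2 x)\<^sup>2 * indicator D x)) \<partial>lborel)"
        proof (rule nn_integral_mono)
          fix x
          show "(ennreal (norm (potential (kerG k i) (\<lambda>y. q y * g y) x)))\<^sup>2 * indicator D x
            \<le> ennreal (c\<^sup>2) * (2 * (ennreal (s\<^sup>2) * ((I1 x)\<^sup>2 * indicator D x)) + 2 * ((I2 x)\<^sup>2 * indicator D x))"
          proof (cases "x \<in> D")
            case True
            have "ennreal (norm (potential (kerG k i) (\<lambda>y. q y * g y) x)) \<le> ennreal c * riesz_op D (\<lambda>y. ennreal (norm (g y))) x"
              unfolding c_def using kernel_le(2)[OF True] kernel_const_pos k_pos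
              by (intro potential_le_riesz_op[OF gm gB weakly_singular_kerG]) auto
            also have "\<dots> \<le> ennreal c * riesz_op D (\<lambda>y. ennreal s * dipole_weight z y + ennreal (norm (w1 y))) x"
              unfolding s_def by (intro mult_left_mono riesz_op_mono gle) auto
            also have "riesz_op D (\<lambda>y. ennreal s * dipole_weight z y + ennreal (norm (w1 y))) x = ennreal s * I1 x + I2 x"
              unfolding I1_def I2_def by (simp add: riesz_op_add riesz_op_cmult)
            finally have "(ennreal (norm (potential (kerG k i) (\<lambda>y. q y * g y) x)))\<^sup>2 \<le> (ennreal c * (ennreal s * I1 x + I2 x))\<^sup>2"
              by (rule power_mono) simp
            also have "\<dots> = ennreal (c\<^sup>2) * (ennreal s * I1 x + I2 x)\<^sup>2" using c0 by (simp add: power_mult_distrib ennreal_power)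
            also have "\<dots> \<le> ennreal (c\<^sup>2) * (2 * (ennreal s * I1 x)\<^sup>2 + 2 * (I2 x)\<^sup>2)"
              by (intro mult_left_mono ennreal_square_add_le) simp
            also have "(ennreal s * I1 x)\<^sup>2 = ennreal (s\<^sup>2) * (I1 x)\<^sup>2" using s0 by (simp add: power_mult_distrib ennreal_power)
            finally show ?thesis using True by simp
          qed simp
        qed
        also have "\<dots> = ennreal (c\<^sup>2) * (2 * (ennreal (s\<^sup>2) * (\<integral>\<^sup>+x\<in>D. (I1 x)\<^sup>2 \<partial>lborel)) + 2 * (\<integral>\<^sup>+x\<in>D. (I2 x)\<^sup>2 \<partial>lborel))"
          by (simp add: nn_integral_add nn_integral_cmult)
        also have "\<dots> \<le> ennreal (c\<^sup>2) * (2 * (ennreal (s\<^sup>2) * ennreal Cy) + 2 * ((ennreal C2)\<^sup>2 * ennreal (A1 * S\<^sup>2)))"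
        proof (intro mult_left_mono add_mono)
          show "(\<integral>\<^sup>+x\<in>D. (I1 x)\<^sup>2 \<partial>lborel) \<le> ennreal Cy" unfolding I1_def by (rule Cy(2))
          have "(\<integral>\<^sup>+x\<in>D. (I2 x)\<^sup>2 \<partial>lborel) \<le> (ennreal C2)\<^sup>2 * (\<integral>\<^sup>+y\<in>D. (ennreal (norm (w1 y)))\<^sup>2 \<partial>lborel)"
            unfolding I2_def by (rule riesz_op_schur[OF _ D_borel C2(2)]) measurable
          also have "\<dots> \<le> (ennreal C2)\<^sup>2 * ennreal (A1 * S\<^sup>2)" by (intro mult_left_mono w1L) simp
          finally show "(\<integral>\<^sup>+x\<in>D. (I2 x)\<^sup>2 \<partial>lborel) \<le> (ennreal C2)\<^sup>2 * ennreal (A1 * S\<^sup>2)" .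
        qed auto
        also have "\<dots> = ennreal (c\<^sup>2 * (2 * (s\<^sup>2 * Cy) + 2 * (C2\<^sup>2 * (A1 * S\<^sup>2))))"
          using Cy(1) C2(1) A10 by (simp add: ennreal_plus ennreal_mult ennreal_power)
        also have "c\<^sup>2 * (2 * (s\<^sup>2 * Cy) + 2 * (C2\<^sup>2 * (A1 * S\<^sup>2))) = CG * S\<^sup>2"
          unfolding CG_def s_def power_mult_distrib by (simp add: algebra_simps)
        finally show ?thesis .
      qed
      have le: "ennreal (CW * S\<^sup>2) \<le> ennreal ((CW + CG + 1) * S\<^sup>2)" "ennreal (CG * S\<^sup>2) \<le> ennreal ((CW + CG + 1) * S\<^sup>2)"
        using CW0 CG0 by (auto intro!: ennreal_leI mult_right_mono)
      show "\<exists>w B. w \<in> borel_measurable borel \<and> (\<forall>y\<in>D. norm (w y) \<le> B) \<and>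
       (\<forall>y\<in>D. T (\<lambda>y. dipole_field k z a y + w y) y = w y) \<and>
       (\<integral>\<^sup>+x\<in>D. (ennreal (norm (T (\<lambda>y. dipole_field k z a y + w y) x)))\<^sup>2 \<partial>lborel) \<le> ennreal ((CW + CG + 1) * S\<^sup>2) \<and>
       (\<forall>i. (\<integral>\<^sup>+x\<in>D. (ennreal (norm (potential (kerG k i) (\<lambda>y. q y * (dipole_field k z a y + w y)) x)))\<^sup>2 \<partial>lborel) \<le> ennreal ((CW + CG + 1) * S\<^sup>2))"
      proof (rule exI[of _ w], rule exI[of _ "CT * Bu + c2 * S"], intro conjI ballI allI)
        have geq: "(\<lambda>y. dipole_field k z a y + w y) = g" by (simp add: g_def[abs_def] u_def)
        have geq': "(\<lambda>y. q y * (dipole_field k z a y + w y)) = (\<lambda>y. q y * g y)" by (simp add: g_def u_def)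
        show "w \<in> borel_measurable borel" by (rule wm)
        show "norm (w y) \<le> CT * Bu + c2 * S" for y by (rule wB)
        show "T (\<lambda>y. dipole_field k z a y + w y) y = w y" if "y \<in> D" for y unfolding geq by (rule LS[OF that])
        show "(\<integral>\<^sup>+x\<in>D. (ennreal (norm (T (\<lambda>y. dipole_field k z a y + w y) x)))\<^sup>2 \<partial>lborel) \<le> ennreal ((CW + CG + 1) * S\<^sup>2)"
          unfolding geq by (rule order_trans[OF TL le(1)])
        show "(\<integral>\<^sup>+x\<in>D. (ennreal (norm (potential (kerG k i) (\<lambda>y. q y * (dipole_field k z a y + w y)) x)))\<^sup>2 \<partial>lborel) \<le> ennreal ((CW + CG + 1) * S\<^sup>2)" for i
          unfolding geq' by (rule order_trans[OF GL le(2)])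
      qed
    qed
  qed
qed

end

section \<open>From Borel estimates to norms over Lebesgue measure\<close>

lemma integral_lebesgue_cong_AE:
  fixes f g :: "R3 \<Rightarrow> complex"
  assumes "f \<in> borel_measurable lebesgue" "AE x in lebesgue. f x = g x"
  shows "integrable lebesgue f \<longleftrightarrow> integrable lebesgue g" "(\<integral>x. f x \<partial>lebesgue) = (\<integral>x. g x \<partial>lebesgue)"
  by (rule integrable_cong_AE[OF assms(1) borel_measurable_AE[OF assms] assms(2)],
      rule integral_cong_AE[OF assms(1) borel_measurable_AE[OF assms] assms(2)])

text \<open>The given v is known only up to a null set through the uniqueness hypothesis. Its
  measurability is inherited from u by completeness of Lebesgue measure, after extension by
  0.\<close>

lemma Lp_cong_AE:
  assumes u: "Lp_on p D u" and D: "D \<in> sets lebesgue" and ae: "AE x in lebesgue. x \<in> D \<longrightarrow> u x = v x"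
  shows "Lp_on p D v" "Lp_norm p D v = Lp_norm p D u"
proof -
  have um: "u \<in> borel_measurable (lebesgue_on D)" using u unfolding Lp_on_def by blast
  then have "(\<lambda>x. if x \<in> D then u x else 0) \<in> borel_measurable lebesgue" using borel_measurable_if[OF D] by blast
  moreover have "AE x in lebesgue. (if x \<in> D then u x else 0) = (if x \<in> D then v x else 0)" using ae by eventually_elim simp
  ultimately have "(\<lambda>x. if x \<in> D then v x else 0) \<in> borel_measurable lebesgue" by (rule borel_measurable_AE)
  then have vm: "v \<in> borel_measurable (lebesgue_on D)" using borel_measurable_if[OF D] by blast
  have ae': "AE x in lebesgue_on D. norm (v x) powr p = norm (u x) powr p"
    using ae D by (subst AE_restrict_space_iff) (auto elim: eventually_mono)
  have m: "(\<lambda>x. norm (v x) powr p) \<in> borel_measurable (lebesgue_on D)" "(\<lambda>x. norm (u x) powr p) \<in> borel_measurable (lebesgue_on D)"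
    using um vm by measurable
  show "Lp_on p D v" unfolding Lp_on_def using vm u integrable_cong_AE[OF m ae'] unfolding Lp_on_def by blast
  show "Lp_norm p D v = Lp_norm p D u" unfolding Lp_norm_def using integral_cong_AE[OF m ae'] by simp
qed

lemma Lp2_of_nn_integral:
  assumes h: "h \<in> borel_measurable borel" and D: "D \<in> sets lebesgue" and A: "A \<ge> 0"
    and le: "(\<integral>\<^sup>+x\<in>D. (ennreal (norm (h x)))\<^sup>2 \<partial>lborel) \<le> ennreal A"
  shows "Lp_on 2 D h" "(\<integral>x. norm (h x) powr 2 \<partial>lebesgue_on D) \<le> A" "Lp_norm 2 D h \<le> sqrt A"
proof -
  have hm: "h \<in> borel_measurable (lebesgue_on D)" by (rule borel_imp_lebesgue_on[OF h])
  have sq: "ennreal (norm (h x) powr 2) = (ennreal (norm (h x)))\<^sup>2" for x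
    by (cases "h x = 0") (simp_all add: ennreal_power)
  have nn: "(\<integral>\<^sup>+x. ennreal (norm (h x) powr 2) \<partial>lebesgue_on D) \<le> ennreal A"
  proof -
    have "(\<integral>\<^sup>+x. ennreal (norm (h x) powr 2) \<partial>lebesgue_on D) = (\<integral>\<^sup>+x\<in>D. (ennreal (norm (h x)))\<^sup>2 \<partial>lebesgue)"
      unfolding sq by (rule nn_integral_restrict_space) (use D in simp)
    then show ?thesis using le by (simp only: nn_integral_completion)
  qed
  have i: "integrable (lebesgue_on D) (\<lambda>x. norm (h x) powr 2)"
  proof (rule integrableI_bounded)
    show "(\<lambda>x. norm (h x) powr 2) \<in> borel_measurable (lebesgue_on D)" using hm by measurable
    show "(\<integral>\<^sup>+x. ennreal (norm (norm (h x) powr 2)) \<partial>lebesgue_on D) < \<infinity>"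
      using le_less_trans[OF nn ennreal_less_top] by simp
  qed
  then show "Lp_on 2 D h" unfolding Lp_on_def using hm by blast
  have "ennreal (\<integral>x. norm (h x) powr 2 \<partial>lebesgue_on D) \<le> ennreal A"
    using nn nn_integral_eq_integral[OF i] by simp
  then show le': "(\<integral>x. norm (h x) powr 2 \<partial>lebesgue_on D) \<le> A" using A by (simp add: ennreal_le_iff)
  have "Lp_norm 2 D h = sqrt (\<integral>x. norm (h x) powr 2 \<partial>lebesgue_on D)"
    unfolding Lp_norm_def by (rule powr_half_sqrt) simp
  then show "Lp_norm 2 D h \<le> sqrt A" using le' by simp
qed

lemma powr_le_one_plus_square:
  fixes t :: real
  assumes "t \<ge> 0" "0 < p" "p \<le> 2"
  shows "t powr p \<le> 1 + t powr 2"
proof (cases "t \<le> 1")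
  case True
  then have "t powr p \<le> 1 powr p" using assms by (intro powr_mono2) auto
  also have "\<dots> \<le> 1 + t powr 2" by simp
  finally show ?thesis .
next
  case False
  then have "t powr p \<le> t powr 2" using assms by (intro powr_mono) auto
  then show ?thesis by simp
qed

text \<open>Scaling by S replaces both Minkowski and Hoelder: |W|^p \<le> S^p (1 + |W / S|^2), so a
  quadratic bound of order S^2 turns into an L^p bound of order S on a set of finite
  measure.\<close>

lemma Lp_norm_add_le:
  assumes D: "D \<in> lmeasurable" and p: "0 < p" "p \<le> 2" and S: "S > 0" and A: "A \<ge> 0"
    and d: "Lp_on p D d" "Lp_norm p D d \<le> S"
    and W: "Lp_on 2 D W" "(\<integral>x. norm (W x) powr 2 \<partial>lebesgue_on D) \<le> A * S\<^sup>2"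
  shows "Lp_on p D (\<lambda>x. d x + W x)"
    and "Lp_norm p D (\<lambda>x. d x + W x) \<le> 2 * (1 + measure lebesgue D + A) powr (1 / p) * S"
proof -
  have Ds: "D \<in> sets lebesgue" using D by (rule fmeasurableD)
  have dm: "d \<in> borel_measurable (lebesgue_on D)" and di: "integrable (lebesgue_on D) (\<lambda>x. norm (d x) powr p)"
    using d(1) unfolding Lp_on_def by auto
  have Wm: "W \<in> borel_measurable (lebesgue_on D)" and Wi: "integrable (lebesgue_on D) (\<lambda>x. norm (W x) powr 2)"
    using W(1) unfolding Lp_on_def by auto
  have m: "(\<lambda>x. d x + W x) \<in> borel_measurable (lebesgue_on D)" using dm Wm by measurable
  have c: "integrable (lebesgue_on D) (\<lambda>x. 1 :: real)" "(\<integral>x. 1 \<partial>lebesgue_on D) = measure lebesgue D"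
  proof -
    show "integrable (lebesgue_on D) (\<lambda>x. 1 :: real)"
      using finite_measure_lebesgue_on[OF D] by (rule finite_measure.integrable_const)
    show "(\<integral>x. 1 \<partial>lebesgue_on D) = measure lebesgue D" using Ds by (simp add: measure_restrict_space)
  qed
  \<comment> \<open>An integrable majorant whose integral is at most (2S)^p (1 + |D| + A); the p-th
    root gives the claimed constant.\<close>
  define h where "h x = 2 powr p * (norm (d x) powr p + S powr p * (1 + norm (W x) powr 2 / S\<^sup>2))" for x
  have hi: "integrable (lebesgue_on D) h" unfolding h_def
    using di Wi c(1) by (intro integrable_mult_right Bochner_Integration.integrable_add integrable_divide) auto
  have le: "norm (d x + W x) powr p \<le> h x" for x
  proof -
    have "norm (d x + W x) powr p \<le> (norm (d x) + norm (W x)) powr p"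
      using p by (intro powr_mono2 norm_triangle_ineq) auto
    also have "\<dots> \<le> 2 powr p * (norm (d x) powr p + norm (W x) powr p)" using p by (intro powr_sum_le_two_powr) auto
    also have "norm (W x) powr p = S powr p * (norm (W x) / S) powr p" using S by (simp add: powr_mult[symmetric])
    also have "(norm (W x) / S) powr p \<le> 1 + (norm (W x) / S) powr 2" using p S by (intro powr_le_one_plus_square) auto
    also have "(norm (W x) / S) powr 2 = norm (W x) powr 2 / S\<^sup>2" using S by (simp add: powr_divide)
    finally show ?thesis unfolding h_def using S by (simp add: mult_left_mono)
  qed
  have i: "integrable (lebesgue_on D) (\<lambda>x. norm (d x + W x) powr p)"
  proof (rule Bochner_Integration.integrable_bound[OF hi])
    show "(\<lambda>x. norm (d x + W x) powr p) \<in> borel_measurable (lebesgue_on D)" using m by measurable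
    show "AE x in lebesgue_on D. norm (norm (d x + W x) powr p) \<le> norm (h x)"
      using le by (intro AE_I2) (smt (verit) powr_ge_zero real_norm_def)
  qed
  then show "Lp_on p D (\<lambda>x. d x + W x)" unfolding Lp_on_def using m by blast
  have "(\<integral>x. norm (d x + W x) powr p \<partial>lebesgue_on D) \<le> (\<integral>x. h x \<partial>lebesgue_on D)"
    by (rule integral_mono[OF i hi le])
  also have "\<dots> = 2 powr p * ((\<integral>x. norm (d x) powr p \<partial>lebesgue_on D) + S powr p * (measure lebesgue D + (\<integral>x. norm (W x) powr 2 \<partial>lebesgue_on D) / S\<^sup>2))"
    unfolding h_def using di Wi c by simp
  also have "\<dots> \<le> 2 powr p * (S powr p + S powr p * (measure lebesgue D + A))"
  proof (intro mult_left_mono add_mono order_refl)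
    have "(Lp_norm p D d) powr p \<le> S powr p" using d(2) p by (intro powr_mono2) (auto simp: Lp_norm_def)
    moreover have "(Lp_norm p D d) powr p = (\<integral>x. norm (d x) powr p \<partial>lebesgue_on D)"
      unfolding Lp_norm_def using p by (simp add: powr_powr)
    ultimately show "(\<integral>x. norm (d x) powr p \<partial>lebesgue_on D) \<le> S powr p" by simp
    show "(\<integral>x. norm (W x) powr 2 \<partial>lebesgue_on D) / S\<^sup>2 \<le> A" using W(2) S by (simp add: pos_divide_le_eq)
  qed auto
  also have "\<dots> = (2 * S) powr p * (1 + measure lebesgue D + A)" using S by (simp add: powr_mult algebra_simps)
  finally have "Lp_norm p D (\<lambda>x. d x + W x) \<le> ((2 * S) powr p * (1 + measure lebesgue D + A)) powr (1 / p)"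
    unfolding Lp_norm_def using p by (intro powr_mono2) auto
  also have "\<dots> = 2 * (1 + measure lebesgue D + A) powr (1 / p) * S"
    using p S A by (simp add: powr_mult powr_powr)
  finally show "Lp_norm p D (\<lambda>x. d x + W x) \<le> 2 * (1 + measure lebesgue D + A) powr (1 / p) * S" .
qed

lemma weak_grad_cong_AE:
  assumes W: "weak_grad D W G" and D: "open D" and ae: "AE x in lebesgue. x \<in> D \<longrightarrow> W x = f x"
  shows "weak_grad D f G"
  unfolding weak_grad_def loc_integrable_def
proof (intro conjI allI impI)
  have lW: "loc_integrable D W" using W unfolding weak_grad_def by blast
  show "set_integrable lebesgue K f" if K: "compact K \<and> K \<subseteq> D" for K
  proof -
    have i: "integrable lebesgue (\<lambda>x. indicator K x *\<^sub>R W x)" using lW K unfolding loc_integrable_def set_integrable_def by blast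
    have "AE x in lebesgue. indicator K x *\<^sub>R W x = indicator K x *\<^sub>R f x"
      using ae by eventually_elim (use K in \<open>auto simp: indicator_def\<close>)
    from integral_lebesgue_cong_AE(1)[OF borel_measurable_integrable[OF i] this] i show ?thesis unfolding set_integrable_def by blast
  qed
  show "set_integrable lebesgue K (G i)" if "compact K \<and> K \<subseteq> D" for K i
    using W that unfolding weak_grad_def loc_integrable_def by blast
  fix i \<phi> assume \<phi>: "test_fun D \<phi>"
  obtain B K where BK: "compact K" "K \<subseteq> D" "\<And>i x. x \<notin> K \<Longrightarrow> pderiv3 i \<phi> x = 0" "\<And>i x. \<bar>pderiv3 i \<phi> x\<bar> \<le> B"
    using test_fun_bounds[OF \<phi>] by metis
  have "set_integrable lebesgue D (\<lambda>x. W x * complex_of_real (pderiv3 i \<phi> x))"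
    by (rule set_integrable_loc_test[OF lW D test_fun_measurable(2)[OF \<phi>] BK(4,3,1,2)])
  then have m: "(\<lambda>x. indicator D x *\<^sub>R (W x * complex_of_real (pderiv3 i \<phi> x))) \<in> borel_measurable lebesgue"
    unfolding set_integrable_def by (rule borel_measurable_integrable)
  have "AE x in lebesgue. indicator D x *\<^sub>R (W x * complex_of_real (pderiv3 i \<phi> x)) = indicator D x *\<^sub>R (f x * complex_of_real (pderiv3 i \<phi> x))"
    using ae by eventually_elim (auto simp: indicator_def)
  from integral_lebesgue_cong_AE(2)[OF m this]
  have "(LINT x:D|lebesgue. f x * of_real (pderiv3 i \<phi> x)) = (LINT x:D|lebesgue. W x * of_real (pderiv3 i \<phi> x))"
    unfolding set_lebesgue_integral_def by simp
  also have "\<dots> = - (LINT x:D|lebesgue. G i x * of_real (\<phi> x))" using W \<phi> unfolding weak_grad_def by blast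
  finally show "(LINT x:D|lebesgue. f x * of_real (pderiv3 i \<phi> x)) = - (LINT x:D|lebesgue. G i x * of_real (\<phi> x))" .
qed

text \<open>The function and its three derivatives each contribute at most s^2, and the square root
  of 4 s^2 is 2 s.\<close>

lemma H1_of_weak_grad:
  assumes D: "open D" and ae: "AE x in lebesgue. x \<in> D \<longrightarrow> W x = f x" and wg: "weak_grad D W G"
    and W: "Lp_on 2 D W" "Lp_norm 2 D W \<le> s" and G: "\<And>i. Lp_on 2 D (G i)" "\<And>i. Lp_norm 2 D (G i) \<le> s"
  shows "H1_on D f" "H1_norm D f \<le> 2 * s"
proof -
  have Ds: "D \<in> sets lebesgue" using D by simp
  have fL: "Lp_on 2 D f" "Lp_norm 2 D f = Lp_norm 2 D W" using Lp_cong_AE[OF W(1) Ds ae] by auto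
  have fG: "weak_grad D f G" by (rule weak_grad_cong_AE[OF wg D ae])
  show "H1_on D f" unfolding H1_on_def using fL fG G by blast
  \<comment> \<open>The gradient selected inside \<open>H1_norm\<close>. By uniqueness it agrees
    a.e. with G, so the bounds for G apply to it.\<close>
  define g where "g = (SOME g. weak_grad D f g \<and> (\<forall>i. Lp_on 2 D (g i)))"
  have g: "weak_grad D f g \<and> (\<forall>i. Lp_on 2 D (g i))" unfolding g_def by (rule someI[of _ G]) (use fG G in blast)
  have gG: "Lp_norm 2 D (g i) = Lp_norm 2 D (G i)" for i
  proof -
    have "AE x in lebesgue. x \<in> D \<longrightarrow> G i x = g i x"
      by (rule weak_grad_unique[OF fG _ D]) (use g in auto)
    then show ?thesis by (rule Lp_cong_AE(2)[OF G(1) Ds])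
  qed
  have nn: "Lp_norm 2 D h \<ge> 0" for h unfolding Lp_norm_def by simp
  have s: "s \<ge> 0" using nn[of W] W(2) by linarith
  have sq: "(Lp_norm 2 D h)\<^sup>2 \<le> s\<^sup>2" if "Lp_norm 2 D h \<le> s" for h using nn that by (intro power_mono)
  have "H1_norm D f = sqrt ((Lp_norm 2 D W)\<^sup>2 + (\<Sum>i\<in>UNIV. (Lp_norm 2 D (G i))\<^sup>2))"
    unfolding H1_norm_def Let_def g_def[symmetric] gG fL(2) ..
  also have "\<dots> \<le> sqrt (s\<^sup>2 + (\<Sum>i\<in>(UNIV :: 3 set). s\<^sup>2))"
    by (intro real_sqrt_le_mono add_mono sum_mono sq W G)
  also have "s\<^sup>2 + (\<Sum>i\<in>(UNIV :: 3 set). s\<^sup>2) = (2 * s)\<^sup>2" by (simp add: power_mult_distrib)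
  also have "sqrt ((2 * s)\<^sup>2) = 2 * s" using s unfolding real_sqrt_abs by simp
  finally show "H1_norm D f \<le> 2 * s" .
qed

text \<open>n is only Lebesgue measurable and essentially bounded, while the operator theory wants a
  density that is Borel and bounded at every point. Borel versions of real and imaginary part
  followed by truncation change the contrast on a null set only.\<close>

lemma contrast_borel_version:
  assumes D: "open D" and n: "Linfty_on D n" and c: "c > (0::real)"
  obtains q Q where "q \<in> borel_measurable borel" "\<And>x. norm (q x) \<le> Q" "\<And>x. x \<notin> D \<Longrightarrow> q x = 0"
    "AE x in lebesgue. x \<in> D \<longrightarrow> of_real c * q x = (of_real k)\<^sup>2 * (n x - 1)"
proof -
  have Ds: "D \<in> sets lebesgue" using D by simp
  obtain M where nm: "n \<in> borel_measurable (lebesgue_on D)" and M: "AE x in lebesgue_on D. norm (n x) \<le> M"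
    using n unfolding Linfty_on_def by blast
  define q0 where "q0 x = (if x \<in> D then (of_real k)\<^sup>2 * (n x - 1) / of_real c else 0)" for x
  have "(\<lambda>x. (of_real k)\<^sup>2 * (n x - 1) / of_real c) \<in> borel_measurable (lebesgue_on D)" using nm by measurable
  then have q0m: "q0 \<in> borel_measurable lebesgue" unfolding q0_def by (rule iffD2[OF borel_measurable_if[OF Ds]])
  have m: "(\<lambda>x. Re (q0 x)) \<in> borel_measurable lebesgue" "(\<lambda>x. Im (q0 x)) \<in> borel_measurable lebesgue" using q0m by measurable
  obtain r where r: "r \<in> borel_measurable lborel" "AE x in lborel. Re (q0 x) = r x"
    using completion_ex_borel_measurable_real[OF m(1)] by blast
  obtain s where s: "s \<in> borel_measurable lborel" "AE x in lborel. Im (q0 x) = s x"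
    using completion_ex_borel_measurable_real[OF m(2)] by blast
  note rs = r(1) s(1) and ae = r(2) s(2)
  define Q where "Q = k\<^sup>2 * (\<bar>M\<bar> + 1) / c"
  have Q0: "Q \<ge> 0" unfolding Q_def using c by simp
  \<comment> \<open>Truncation at Q turns the essential bound into a pointwise one; it is inactive
    almost everywhere, because |n - 1| \<le> |M| + 1 there.\<close>
  define q where "q x = (if x \<in> D \<and> norm (Complex (r x) (s x)) \<le> Q then Complex (r x) (s x) else 0)" for x
  have [measurable]: "D \<in> sets borel" using D by simp
  have Cm: "(\<lambda>x. Complex (r x) (s x)) \<in> borel_measurable borel"
    using rs unfolding Complex_eq by measurable
  show ?thesis
  proof (rule that)
    have "Measurable.pred borel (\<lambda>x. x \<in> D \<and> norm (Complex (r x) (s x)) \<le> Q)" using Cm by measurable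
    then show "q \<in> borel_measurable borel" unfolding q_def using Cm by measurable
    show "norm (q x) \<le> Q" for x unfolding q_def using Q0 by simp
    show "q x = 0" if "x \<notin> D" for x unfolding q_def using that by simp
    have M': "AE x in lebesgue. x \<in> D \<longrightarrow> norm (n x) \<le> M" using M Ds by (simp add: AE_restrict_space_iff)
    show "AE x in lebesgue. x \<in> D \<longrightarrow> of_real c * q x = (of_real k)\<^sup>2 * (n x - 1)"
      using M' AE_completion[OF ae(1)] AE_completion[OF ae(2)]
    proof eventually_elim
      case (elim x)
      show ?case
      proof
        assume x: "x \<in> D"
        have eq: "Complex (r x) (s x) = q0 x" using elim by (simp add: complex_eq_iff)
        have "norm (n x - 1) \<le> \<bar>M\<bar> + 1" using elim x norm_triangle_ineq4[of "n x" 1] by simp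
        then have "norm (q0 x) \<le> Q" unfolding q0_def Q_def using x c
          by (simp add: norm_mult norm_divide norm_power divide_right_mono mult_left_mono)
        then have "q x = q0 x" unfolding q_def eq using x by simp
        then show "of_real c * q x = (of_real k)\<^sup>2 * (n x - 1)" unfolding q0_def using x c by simp
      qed
    qed
  qed
qed

theorem theoremA3:
  fixes D :: "R3 set" and n :: "R3 \<Rightarrow> complex" and k :: real
  assumes dom: "bounded_C2_domain D"
    and k: "k > 0"
    and n_Linf: "Linfty_on D n"
    and n_re: "AE x in lebesgue_on D. Re (n x) > 0"
    and n_im: "AE x in lebesgue_on D. Im (n x) \<ge> 0"
    and unique: "\<And>z a us1 v1 us2 v2. z \<notin> closure D \<Longrightarrow>
        transmission_solution D n k z (dipole_inc k z a) us1 v1 \<Longrightarrow>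
        transmission_solution D n k z (dipole_inc k z a) us2 v2 \<Longrightarrow>
        (\<forall>x \<in> - closure D. us1 x = us2 x) \<and> (AE x in lebesgue_on D. v1 x = v2 x)"
  shows "\<forall>p. 6/5 \<le> p \<and> p < 2 \<longrightarrow>
           (\<exists>C>0. \<forall>z a us v. z \<notin> closure D \<longrightarrow>
               transmission_solution D n k z (dipole_inc k z a) us v \<longrightarrow>
               Lp_on p D v \<and> H1_on D (\<lambda>x. v x - dipole_inc k z a x) \<and>
               Lp_norm p D v + H1_norm D (\<lambda>x. v x - dipole_inc k z a x)
                 \<le> C * Lp_norm p D (dipole_inc k z a))"

proof (intro allI impI)
  fix p :: real assume "6/5 \<le> p \<and> p < 2"
  then have p: "0 < p" "p \<le> 2" by auto
  have D: "open D" "bounded D" "D \<noteq> {}" using dom unfolding bounded_C2_domain_def by auto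
  have Dm: "D \<in> lmeasurable" by (rule lmeasurable_open[OF D(2,1)])
  then have Ds: "D \<in> sets lebesgue" by (rule fmeasurableD)
  have k0: "k \<ge> 0" using k by simp
  \<comment> \<open>\<open>kappa\<close> is divided out here, so the numerical value of the mass of
    the fundamental solution never enters.\<close>
  obtain q Q where q: "q \<in> borel_measurable borel" "\<And>x. norm (q x) \<le> Q" "\<And>x. x \<notin> D \<Longrightarrow> q x = 0"
    and qn: "AE x in lebesgue. x \<in> D \<longrightarrow> of_real kappa * q x = (of_real k)\<^sup>2 * (n x - 1)"
    by (rule contrast_borel_version[OF D(1) n_Linf kappa_pos, of k]) (rule that)
  interpret scatterer D k Q q by unfold_locales (use D k q in auto)
  have AE_on: "(AE x in lebesgue_on D. P x) \<longleftrightarrow> (AE x in lebesgue. x \<in> D \<longrightarrow> P x)" for P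
    using Ds by (simp add: AE_restrict_space_iff)
  have zD: "x \<noteq> z" if "z \<notin> closure D" "x \<in> D" for x z using that closure_subset by blast
  have inj: "AE y in lborel. y \<in> D \<longrightarrow> apply_bcontfun \<phi> y = 0"
    if fp: "\<And>y. y \<in> D \<Longrightarrow> T (apply_bcontfun \<phi>) y = apply_bcontfun \<phi> y" for \<phi> :: "R3 \<Rightarrow>\<^sub>C complex"
  proof -
    have "closure D \<noteq> UNIV" using D(2) bounded_closure not_bounded_UNIV by metis
    \<comment> \<open>Any source point outside the closure serves: with zero moment the incident
      field vanishes off z, so both T \<phi> and 0 solve the same problem, and \<open>unique\<close>
      forces \<phi> = T \<phi> to vanish a.e. on D.\<close>
    then obtain z where z: "z \<notin> closure D" by blast
    have d0: "dipole_field k z 0 = (\<lambda>y. 0)" by (simp add: dipole_field_def[abs_def])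
    have t1: "transmission_solution D n k z (dipole_inc k z 0) (T (apply_bcontfun \<phi>)) (\<lambda>x. dipole_inc k z 0 x + T (apply_bcontfun \<phi>) x)"
      using transmission_of_lippmann_schwinger[OF z bcontfun_borel norm_bounded _ qn, of 0 \<phi>] fp by (simp add: d0)
    have T0: "T (\<lambda>y. 0) = (\<lambda>x. 0)" by (simp add: T_def potential_def fun_eq_iff)
    have t2: "transmission_solution D n k z (dipole_inc k z 0) (\<lambda>x. 0) (\<lambda>x. dipole_inc k z 0 x + 0)"
      using transmission_of_lippmann_schwinger[OF z, of "\<lambda>y. 0" 0 0 n] qn by (simp add: d0 T0)
    have "AE x in lebesgue_on D. dipole_inc k z 0 x + T (apply_bcontfun \<phi>) x = dipole_inc k z 0 x + 0"
      using unique[OF z t1 t2] by blast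
    then have "AE x in lebesgue. x \<in> D \<longrightarrow> apply_bcontfun \<phi> x = 0"
      unfolding AE_on by eventually_elim (use fp in auto)
    then show ?thesis by (simp add: AE_completion_iff)
  qed
  obtain C where C: "C > 0" and est: "\<And>z a S. z \<notin> closure D \<Longrightarrow> S > 0 \<Longrightarrow>
      (\<forall>y\<in>D. norm (dipole_field k z a y) \<le> S * (1 + norm (y - z) powr - 2)) \<Longrightarrow>
    \<exists>w B. w \<in> borel_measurable borel \<and> (\<forall>y\<in>D. norm (w y) \<le> B) \<and>
       (\<forall>y\<in>D. T (\<lambda>y. dipole_field k z a y + w y) y = w y) \<and>
       (\<integral>\<^sup>+x\<in>D. (ennreal (norm (T (\<lambda>y. dipole_field k z a y + w y) x)))\<^sup>2 \<partial>lborel) \<le> ennreal (C * S\<^sup>2) \<and>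
       (\<forall>i. (\<integral>\<^sup>+x\<in>D. (ennreal (norm (potential (kerG k i) (\<lambda>y. q y * (dipole_field k z a y + w y)) x)))\<^sup>2 \<partial>lborel) \<le> ennreal (C * S\<^sup>2))"
    using lippmann_schwinger_estimate[OF inj] by blast
  obtain C0 where C0: "C0 > 0" and rev: "\<And>z a y. z \<notin> closure D \<Longrightarrow> y \<in> D \<Longrightarrow>
    norm (dipole_field k z a y) \<le> C0 * Lp_norm p D (dipole_inc k z a) * (1 + norm (y - z) powr - 2)"
    using dipole_le_Lp_norm[OF D k0 p(1)] by blast
  \<comment> \<open>The first summand bounds the L^p norm of v per unit of S, the second the H^1
    norm of v - u^i.\<close>
  define c where "c = 2 * (1 + measure lebesgue D + C) powr (1 / p) + 2 * sqrt C"
  have c: "c \<ge> 0" unfolding c_def using C by simp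
  \<comment> \<open>S is any positive number above both the L^p norm of the incident field and the
    amplitude in the pointwise dipole bound. The solution built from the integral equation is
    identified with the given v by \<open>unique\<close>.\<close>
  have main: "Lp_on p D v \<and> H1_on D (\<lambda>x. v x - dipole_inc k z a x) \<and>
      Lp_norm p D v + H1_norm D (\<lambda>x. v x - dipole_inc k z a x) \<le> c * S"
    if z: "z \<notin> closure D" and sol: "transmission_solution D n k z (dipole_inc k z a) us v"
      and S: "S > 0" "Lp_norm p D (dipole_inc k z a) \<le> S" "C0 * Lp_norm p D (dipole_inc k z a) \<le> S" for z a us v S
  proof -
    let ?d = "dipole_field k z a"
    have "\<forall>y\<in>D. norm (?d y) \<le> S * (1 + norm (y - z) powr - 2)"
      using rev[OF z] S(3) by (meson add_nonneg_nonneg mult_right_mono order_trans powr_ge_zero zero_le_one)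
    from est[OF z S(1) this] obtain w B where w: "w \<in> borel_measurable borel" "\<And>y. y \<in> D \<Longrightarrow> norm (w y) \<le> B"
      and LS: "\<And>y. y \<in> D \<Longrightarrow> T (\<lambda>y. ?d y + w y) y = w y"
      and WL: "(\<integral>\<^sup>+x\<in>D. (ennreal (norm (T (\<lambda>y. ?d y + w y) x)))\<^sup>2 \<partial>lborel) \<le> ennreal (C * S\<^sup>2)"
      and GL: "\<And>i. (\<integral>\<^sup>+x\<in>D. (ennreal (norm (potential (kerG k i) (\<lambda>y. q y * (?d y + w y)) x)))\<^sup>2 \<partial>lborel) \<le> ennreal (C * S\<^sup>2)"
      by blast
    define f where "f y = q y * (?d y + w y)" for y
    obtain M where "bounded_density f D M" unfolding f_def using dipole_density[OF z w] by blast
    then interpret F: bounded_density f D M .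
    define W where "W = T (\<lambda>y. ?d y + w y)"
    define G where "G i = potential (kerG k i) f" for i
    have WP: "W = potential (kerE k) f" unfolding W_def T_def f_def ..
    have CS: "C * S\<^sup>2 \<ge> 0" "sqrt (C * S\<^sup>2) = sqrt C * S" using C S(1) by (auto simp: real_sqrt_mult)
    have Wm: "W \<in> borel_measurable borel" unfolding WP by (rule F.potential_measurable[OF weakly_singular_kerE])
    have Gm: "G i \<in> borel_measurable borel" for i unfolding G_def by (rule F.potential_measurable[OF weakly_singular_kerG[OF k0]])
    note W2 = Lp2_of_nn_integral[OF Wm Ds CS(1) WL[folded W_def], unfolded CS(2)]
    note G2 = Lp2_of_nn_integral[OF Gm Ds CS(1) GL[folded f_def, folded G_def], unfolded CS(2)]
    have wg: "weak_grad D W G" unfolding WP G_def by (rule F.potential_weak_grad[OF k0])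
    have "transmission_solution D n k z (dipole_inc k z a) W (\<lambda>x. dipole_inc k z a x + W x)"
      unfolding W_def by (rule transmission_of_lippmann_schwinger[OF z w LS qn])
    from unique[OF z sol this] have vW: "AE x in lebesgue. x \<in> D \<longrightarrow> v x = dipole_inc k z a x + W x"
      unfolding AE_on by blast
    have "AE x in lebesgue. x \<in> D \<longrightarrow> W x = v x - dipole_inc k z a x" using vW by eventually_elim auto
    note H = H1_of_weak_grad[OF D(1) this wg W2(1,3) G2(1,3)]
    obtain Bd where Bd: "\<And>x. x \<in> D \<Longrightarrow> norm (?d x) \<le> Bd" using dipole_field_bounded[OF z D(2)] by blast
    have dL: "Lp_on p D (dipole_inc k z a)"
      by (rule Lp_on_bounded_borel[OF dipole_field_measurable Dm Bd dipole_inc_eq p(1)]) (use zD[OF z] in auto)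
    note L = Lp_norm_add_le[OF Dm p S(1) less_imp_le[OF C] dL S(2) W2(1,2)]
    have "AE x in lebesgue. x \<in> D \<longrightarrow> dipole_inc k z a x + W x = v x" using vW by eventually_elim auto
    note V = Lp_cong_AE[OF L(1) Ds this]
    have "Lp_norm p D v + H1_norm D (\<lambda>x. v x - dipole_inc k z a x) \<le> c * S"
      unfolding V(2) c_def distrib_right using add_mono[OF L(2) H(2)] by (simp add: mult.assoc)
    with V(1) H(1) show ?thesis by blast
  qed
  show "\<exists>C>0. \<forall>z a us v. z \<notin> closure D \<longrightarrow>
      transmission_solution D n k z (dipole_inc k z a) us v \<longrightarrow>
      Lp_on p D v \<and> H1_on D (\<lambda>x. v x - dipole_inc k z a x) \<and>
      Lp_norm p D v + H1_norm D (\<lambda>x. v x - dipole_inc k z a x) \<le> C * Lp_norm p D (dipole_inc k z a)"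
  proof (rule exI[of _ "c * (C0 + 1) + 1"], rule conjI, goal_cases)
    case 1 show ?case using c C0 by (simp add: add_nonneg_pos)
  next
    case 2 show ?case
    proof (intro allI impI)
      fix z a us v assume z: "z \<notin> closure D" and sol: "transmission_solution D n k z (dipole_inc k z a) us v"
      define N where "N = Lp_norm p D (dipole_inc k z a)"
      have N: "N \<ge> 0" unfolding N_def Lp_norm_def by simp
      \<comment> \<open>The norm N may be 0, for instance when a = 0, whereas S must be positive;
        hence N + e, with e removed at the end.\<close>
      have S: "(C0 + 1) * (N + e) > 0" "N \<le> (C0 + 1) * (N + e)" "C0 * N \<le> (C0 + 1) * (N + e)" if "e > 0" for e
        using that N C0 by (auto simp: algebra_simps add_pos_nonneg add_nonneg_pos)
      have le: "Lp_norm p D v + H1_norm D (\<lambda>x. v x - dipole_inc k z a x) \<le> c * ((C0 + 1) * (N + e))" if "e > 0" for e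
        using main[OF z sol S(1)[OF that]] S(2,3)[OF that] unfolding N_def by blast
      have "Lp_norm p D v + H1_norm D (\<lambda>x. v x - dipole_inc k z a x) \<le> c * ((C0 + 1) * N)"
      proof (rule field_le_epsilon)
        fix e :: real assume e: "e > 0"
        \<comment> \<open>The summand 1 keeps the denominator positive even if c (C0 + 1) were 0,
          and makes the resulting error at most e.\<close>
        define e' where "e' = e / (c * (C0 + 1) + 1)"
        have pos: "c * (C0 + 1) + 1 > 0" using c C0 by (simp add: add_nonneg_pos)
        have e': "e' > 0" unfolding e'_def using e pos by simp
        have "c * (C0 + 1) * e' \<le> (c * (C0 + 1) + 1) * e'" using e' by (intro mult_right_mono) auto
        also have "\<dots> = e" unfolding e'_def using pos by simp
        finally show "Lp_norm p D v + H1_norm D (\<lambda>x. v x - dipole_inc k z a x) \<le> c * ((C0 + 1) * N) + e"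
          using le[OF e'] by (simp add: algebra_simps)
      qed
      also have "\<dots> \<le> (c * (C0 + 1) + 1) * N" using N by (simp add: algebra_simps)
      finally show "Lp_on p D v \<and> H1_on D (\<lambda>x. v x - dipole_inc k z a x) \<and>
        Lp_norm p D v + H1_norm D (\<lambda>x. v x - dipole_inc k z a x) \<le> (c * (C0 + 1) + 1) * Lp_norm p D (dipole_inc k z a)"
        using main[OF z sol S(1)[of 1]] S(2,3)[of 1] unfolding N_def by simp
    qed
  qed
qed

end
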